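(* Let $A$ be a finite dimensional algebra over a field $k$, let $M$ be a finite dimensional $A$-module, and let $R$ be a finite dimensional unital algebra in the monoidal category $\mathrm{Mod}(A^e)$ of $A$-bimodules (with tensor product $\otimes_A$ and unit object $A$). Then: (i) $\mathrm{HH}^*(A)$ maps to the graded center of $\mathrm{Ext}_A^*(M,M)$. Moreover, if $A$ satisfies condition (fg), then $\mathrm{Ext}_A^*(M,M)$ is noetherian and a finite module over its graded center. (ii) $\mathrm{HH}^*(A)$ maps to the graded center of $\mathrm{HH}^*(A,R)$. Moreover, if $A$ satisfies condition (fg), then $\mathrm{HH}^*(A,R)$ is noetherian and a finite module over its graded center.
   Context: $A^e=A\otimes_kA^{op}$. For an $A$-bimodule $N$, $\mathrm{HH}^*(A,N)=\bigoplus_{n\ge0}\mathrm{Ext}^n_{A^e}(A,N)$, and $\mathrm{HH}^*(A)=\mathrm{HH}^*(A,A)$. Condition (fg): for every finitely generated $A$-bimodule $N$, $\mathrm{HH}^*(A,N)$ is a noetherian module over $\mathrm{HH}^*(A)$. A unital algebra $R$ in $\mathrm{Mod}(A^e)$ is an $A$-bimodule with associative bimodule multiplication $R\otimes_AR\to R$ and unit bimodule map $A\to R$ (equivalently, an algebra $R$ with an algebra map $A\to R$); $\mathrm{HH}^*(A,R)$ is then a graded algebra under cup product combined with the multiplication of $R$. The map $\mathrm{HH}^*(A)\to\mathrm{Ext}_A^*(M,M)$ is the graded ring homomorphism $-\otimes_AM$, and $\mathrm{HH}^*(A)\to\mathrm{HH}^*(A,R)$ is induced by the unit $A\to R$. The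 graded center of a graded ring $E$ is spanned by the homogeneous $z$ with $zx=(-1)^{|z||x|}xz$ for all homogeneous $x\in E$. *)

theory Defs
  imports "HOL-Algebra.Algebra"
begin

section \<open>Modules over a possibly noncommutative ring\<close>

locale left_module = R?: ring R + M?: abelian_group M
  for R :: "('s, 'z) ring_scheme" (structure) and M :: "('s, 'm) module" (structure) +
  assumes smult_closed:
      "\<lbrakk> a \<in> carrier R; x \<in> carrier M \<rbrakk> \<Longrightarrow> a \<odot>\<^bsub>M\<^esub> x \<in> carrier M"
    and smult_l_distr:
      "\<lbrakk> a \<in> carrier R; b \<in> carrier R; x \<in> carrier M \<rbrakk>
        \<Longrightarrow> (a \<oplus>\<^bsub>R\<^esub> b) \<odot>\<^bsub>M\<^esub> x = a \<odot>\<^bsub>M\<^esub> x \<oplus>\<^bsub>M\<^esub> b \<odot>\<^bsub>M\<^esub> x"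
    and smult_r_distr:
      "\<lbrakk> a \<in> carrier R; x \<in> carrier M; y \<in> carrier M \<rbrakk>
        \<Longrightarrow> a \<odot>\<^bsub>M\<^esub> (x \<oplus>\<^bsub>M\<^esub> y) = a \<odot>\<^bsub>M\<^esub> x \<oplus>\<^bsub>M\<^esub> a \<odot>\<^bsub>M\<^esub> y"
    and smult_assoc1:
      "\<lbrakk> a \<in> carrier R; b \<in> carrier R; x \<in> carrier M \<rbrakk>
        \<Longrightarrow> (a \<otimes>\<^bsub>R\<^esub> b) \<odot>\<^bsub>M\<^esub> x = a \<odot>\<^bsub>M\<^esub> (b \<odot>\<^bsub>M\<^esub> x)"
    and smult_one: "x \<in> carrier M \<Longrightarrow> \<one>\<^bsub>R\<^esub> \<odot>\<^bsub>M\<^esub> x = x"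

text \<open>Homomorphisms are extensional, so that pointwise operations on them form a group.\<close>

definition module_hom ::
  "('s, 'z) ring_scheme \<Rightarrow> ('s, 'm) module \<Rightarrow> ('s, 'n) module \<Rightarrow> ('m \<Rightarrow> 'n) set" where
  "module_hom S V Y = {f \<in> carrier V \<rightarrow>\<^sub>E carrier Y.
     (\<forall>x\<in>carrier V. \<forall>y\<in>carrier V. f (x \<oplus>\<^bsub>V\<^esub> y) = f x \<oplus>\<^bsub>Y\<^esub> f y) \<and>
     (\<forall>s\<in>carrier S. \<forall>x\<in>carrier V. f (s \<odot>\<^bsub>V\<^esub> x) = s \<odot>\<^bsub>Y\<^esub> f x)}"

definition free_module :: "('s, 'z) ring_scheme \<Rightarrow> 'x set \<Rightarrow> ('s, 'x \<Rightarrow> 's) module" where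
  "free_module S B =
     \<lparr>carrier = {c \<in> B \<rightarrow>\<^sub>E carrier S. finite {b \<in> B. c b \<noteq> \<zero>\<^bsub>S\<^esub>}},
      monoid.mult = undefined, monoid.one = undefined,
      ring.zero = (\<lambda>b\<in>B. \<zero>\<^bsub>S\<^esub>),
      ring.add = (\<lambda>c c'. \<lambda>b\<in>B. c b \<oplus>\<^bsub>S\<^esub> c' b),
      smult = (\<lambda>s c. \<lambda>b\<in>B. s \<otimes>\<^bsub>S\<^esub> c b)\<rparr>"

text \<open>A projective module is a direct summand of a free one.  Basis elements may be taken from
  the type of the module itself, since every module is a quotient of the free module on its own
  carrier.\<close>

definition projective_module :: "('s, 'z) ring_scheme \<Rightarrow> ('s, 'p) module \<Rightarrow> bool" where
  "projective_module S P \<longleftrightarrow> left_module S P \<and>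
     (\<exists>(B :: 'p set) i q. i \<in> module_hom S P (free_module S B) \<and>
        q \<in> module_hom S (free_module S B) P \<and> (\<forall>x\<in>carrier P. q (i x) = x))"

text \<open>Here \<open>d n\<close> is the differential from degree \<open>Suc n\<close> to degree \<open>n\<close>, and \<open>\<epsilon>\<close> the augmentation.\<close>

definition projective_resolution ::
  "('s, 'z) ring_scheme \<Rightarrow> (nat \<Rightarrow> ('s, 'p) module) \<Rightarrow> (nat \<Rightarrow> 'p \<Rightarrow> 'p) \<Rightarrow> ('p \<Rightarrow> 'x)
     \<Rightarrow> ('s, 'x) module \<Rightarrow> bool" where
  "projective_resolution S P d \<epsilon> V \<longleftrightarrow>
     (\<forall>n. projective_module S (P n)) \<and>
     (\<forall>n. d n \<in> module_hom S (P (Suc n)) (P n)) \<and>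
     \<epsilon> \<in> module_hom S (P 0) V \<and>
     \<epsilon> ` carrier (P 0) = carrier V \<and>
     d 0 ` carrier (P (Suc 0)) = {x \<in> carrier (P 0). \<epsilon> x = \<zero>\<^bsub>V\<^esub>} \<and>
     (\<forall>n. d (Suc n) ` carrier (P (Suc (Suc n)))
            = {x \<in> carrier (P (Suc n)). d n x = \<zero>\<^bsub>P n\<^esub>})"


section \<open>Finiteness conditions\<close>

text \<open>The scalars act on an abelian group \<open>G\<close> (given as a monoid record); the action may come from a
  left or from a right module structure.\<close>

definition stable_subgroup ::
  "'s set \<Rightarrow> ('s \<Rightarrow> 'g \<Rightarrow> 'g) \<Rightarrow> ('g, 'z) monoid_scheme \<Rightarrow> 'g set \<Rightarrow> bool" where
  "stable_subgroup S act G N \<longleftrightarrow> subgroup N G \<and> (\<forall>s\<in>S. \<forall>x\<in>N. act s x \<in> N)"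

definition fin_generated ::
  "'s set \<Rightarrow> ('s \<Rightarrow> 'g \<Rightarrow> 'g) \<Rightarrow> ('g, 'z) monoid_scheme \<Rightarrow> 'g set \<Rightarrow> bool" where
  "fin_generated S act G N \<longleftrightarrow>
     (\<exists>F. finite F \<and> F \<subseteq> N \<and> (\<forall>L. stable_subgroup S act G L \<and> F \<subseteq> L \<longrightarrow> N \<subseteq> L))"

definition noetherian_action ::
  "'s set \<Rightarrow> ('s \<Rightarrow> 'g \<Rightarrow> 'g) \<Rightarrow> ('g, 'z) monoid_scheme \<Rightarrow> bool" where
  "noetherian_action S act G \<longleftrightarrow>
     (\<forall>N. stable_subgroup S act G N \<longrightarrow> fin_generated S act G N)"

definition lr_noetherian_ring :: "('e, 'z) ring_scheme \<Rightarrow> bool" where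
  "lr_noetherian_ring E \<longleftrightarrow> ring E \<and>
     noetherian_action (carrier E) (\<lambda>e x. e \<otimes>\<^bsub>E\<^esub> x) (add_monoid E) \<and>
     noetherian_action (carrier E) (\<lambda>e x. x \<otimes>\<^bsub>E\<^esub> e) (add_monoid E)"


section \<open>Graded rings\<close>

definition graded_prod ::
  "(nat \<Rightarrow> ('c, 'z) monoid_scheme) \<Rightarrow> (nat \<Rightarrow> nat \<Rightarrow> 'c \<Rightarrow> 'b \<Rightarrow> 'c) \<Rightarrow> (nat \<Rightarrow> 'c) \<Rightarrow> (nat \<Rightarrow> 'b)
     \<Rightarrow> nat \<Rightarrow> 'c" where
  "graded_prod H p x y = (\<lambda>n. finprod (H n) (\<lambda>i. p i (n - i) (x i) (y (n - i))) {..n})"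

text \<open>The direct sum of the groups \<open>H n\<close>, with the product whose homogeneous components are
  \<open>p m n\<close>, from \<open>H m\<close> and \<open>H n\<close> to \<open>H (m + n)\<close>, and with unit \<open>u\<close> in degree 0.\<close>

definition graded_ring ::
  "(nat \<Rightarrow> ('c, 'z) monoid_scheme) \<Rightarrow> (nat \<Rightarrow> nat \<Rightarrow> 'c \<Rightarrow> 'c \<Rightarrow> 'c) \<Rightarrow> 'c \<Rightarrow> (nat \<Rightarrow> 'c) ring" where
  "graded_ring H p u =
     \<lparr>carrier = carrier (sum_group UNIV H),
      monoid.mult = graded_prod H p,
      monoid.one = (\<lambda>n. if n = 0 then u else \<one>\<^bsub>H n\<^esub>),
      ring.zero = \<one>\<^bsub>sum_group UNIV H\<^esub>,
      ring.add = (\<otimes>\<^bsub>sum_group UNIV H\<^esub>)\<rparr>"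

definition homogeneous :: "(nat \<Rightarrow> 'c, 'z) ring_scheme \<Rightarrow> nat \<Rightarrow> (nat \<Rightarrow> 'c) set" where
  "homogeneous E n = {x \<in> carrier E. \<forall>i. i \<noteq> n \<longrightarrow> x i = \<zero>\<^bsub>E\<^esub> i}"

text \<open>The scalars from the ground field are graded central of degree 0, so the additive span and the
  linear span agree.\<close>

definition graded_center :: "(nat \<Rightarrow> 'c, 'z) ring_scheme \<Rightarrow> (nat \<Rightarrow> 'c) set" where
  "graded_center E = generate (add_monoid E)
     {z. \<exists>m. z \<in> homogeneous E m \<and>
        (\<forall>n. \<forall>x\<in>homogeneous E n.
           z \<otimes>\<^bsub>E\<^esub> x = (if even (m * n) then x \<otimes>\<^bsub>E\<^esub> z else \<ominus>\<^bsub>E\<^esub> (x \<otimes>\<^bsub>E\<^esub> z)))}"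

definition finite_over_graded_center :: "(nat \<Rightarrow> 'c, 'z) ring_scheme \<Rightarrow> bool" where
  "finite_over_graded_center E \<longleftrightarrow>
     fin_generated (graded_center E) (\<lambda>z x. z \<otimes>\<^bsub>E\<^esub> x) (add_monoid E) (carrier E)"


section \<open>Ext and the Yoneda product\<close>

definition cochain_group ::
  "('s, 'z) ring_scheme \<Rightarrow> (nat \<Rightarrow> ('s, 'p) module) \<Rightarrow> ('s, 'y) module \<Rightarrow> nat \<Rightarrow> ('p \<Rightarrow> 'y) monoid" where
  "cochain_group S P Y n =
     \<lparr>carrier = module_hom S (P n) Y,
      monoid.mult = (\<lambda>f g. \<lambda>x\<in>carrier (P n). f x \<oplus>\<^bsub>Y\<^esub> g x),
      monoid.one = (\<lambda>x\<in>carrier (P n). \<zero>\<^bsub>Y\<^esub>)\<rparr>"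

definition coboundary_map ::
  "(nat \<Rightarrow> ('s, 'p) module) \<Rightarrow> (nat \<Rightarrow> 'p \<Rightarrow> 'p) \<Rightarrow> nat \<Rightarrow> ('p \<Rightarrow> 'y) \<Rightarrow> 'p \<Rightarrow> 'y" where
  "coboundary_map P d n f = compose (carrier (P (Suc n))) f (d n)"

definition cocycles ::
  "('s, 'z) ring_scheme \<Rightarrow> (nat \<Rightarrow> ('s, 'p) module) \<Rightarrow> (nat \<Rightarrow> 'p \<Rightarrow> 'p) \<Rightarrow> ('s, 'y) module \<Rightarrow> nat
     \<Rightarrow> ('p \<Rightarrow> 'y) set" where
  "cocycles S P d Y n =
     {f \<in> module_hom S (P n) Y. coboundary_map P d n f = \<one>\<^bsub>cochain_group S P Y (Suc n)\<^esub>}"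

definition coboundaries ::
  "('s, 'z) ring_scheme \<Rightarrow> (nat \<Rightarrow> ('s, 'p) module) \<Rightarrow> (nat \<Rightarrow> 'p \<Rightarrow> 'p) \<Rightarrow> ('s, 'y) module \<Rightarrow> nat
     \<Rightarrow> ('p \<Rightarrow> 'y) set" where
  "coboundaries S P d Y n =
     (case n of 0 \<Rightarrow> {\<one>\<^bsub>cochain_group S P Y 0\<^esub>}
      | Suc m \<Rightarrow> coboundary_map P d m ` module_hom S (P m) Y)"

text \<open>The degree \<open>n\<close> part of the Ext of \<open>V\<close> and \<open>Y\<close>, where \<open>P\<close>, \<open>d\<close> is a projective resolution
  of \<open>V\<close>.\<close>

definition Ext_group ::
  "('s, 'z) ring_scheme \<Rightarrow> (nat \<Rightarrow> ('s, 'p) module) \<Rightarrow> (nat \<Rightarrow> 'p \<Rightarrow> 'p) \<Rightarrow> ('s, 'y) module \<Rightarrow> nat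
     \<Rightarrow> ('p \<Rightarrow> 'y) set monoid" where
  "Ext_group S P d Y n =
     (cochain_group S P Y n)\<lparr>carrier := cocycles S P d Y n\<rparr> Mod coboundaries S P d Y n"

definition Ext_class ::
  "('s, 'z) ring_scheme \<Rightarrow> (nat \<Rightarrow> ('s, 'p) module) \<Rightarrow> (nat \<Rightarrow> 'p \<Rightarrow> 'p) \<Rightarrow> ('s, 'y) module \<Rightarrow> nat
     \<Rightarrow> ('p \<Rightarrow> 'y) \<Rightarrow> ('p \<Rightarrow> 'y) set" where
  "Ext_class S P d Y n f = coboundaries S P d Y n #>\<^bsub>cochain_group S P Y n\<^esub> f"

text \<open>Lifts of a cocycle \<open>g\<close> from \<open>P n\<close> to \<open>V\<close> along a complex \<open>C\<close>, \<open>c\<close> with augmentation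
  \<open>\<eta>\<close> to \<open>V\<close>.\<close>

definition chain_lifts ::
  "('s, 'z) ring_scheme \<Rightarrow> (nat \<Rightarrow> ('s, 'p) module) \<Rightarrow> (nat \<Rightarrow> 'p \<Rightarrow> 'p) \<Rightarrow>
   (nat \<Rightarrow> ('s, 'c) module) \<Rightarrow> (nat \<Rightarrow> 'c \<Rightarrow> 'c) \<Rightarrow> ('c \<Rightarrow> 'x) \<Rightarrow> nat \<Rightarrow> ('p \<Rightarrow> 'x)
     \<Rightarrow> (nat \<Rightarrow> 'p \<Rightarrow> 'c) set" where
  "chain_lifts S P d C c \<eta> n g =
     {h. (\<forall>i. h i \<in> module_hom S (P (n + i)) (C i)) \<and>
         (\<forall>x\<in>carrier (P n). \<eta> (h 0 x) = g x) \<and>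
         (\<forall>i. \<forall>x\<in>carrier (P (Suc (n + i))). c i (h (Suc i) x) = h i (d (n + i) x))}"

text \<open>The Yoneda product of a class of degree \<open>m\<close> in the Ext of \<open>V\<close> and \<open>Y\<close> with a class of degree
  \<open>n\<close> in the Ext of \<open>V\<close> and \<open>V\<close>: compose a representative of the first with the \<open>m\<close>-th component of
  a lift of a representative of the second.  The result does not depend on the
  choices; as for the product of cosets in a factor group, it is written as the union
  over all of them.  Lifts are taken without signs; the other usual convention multiplies
  all products below by \<open>(-1)\<close> to the power \<open>m * n\<close>, which changes the graded rings only up to
  isomorphism and does not change their graded centers.\<close>

definition yoneda ::
  "('s, 'z) ring_scheme \<Rightarrow> (nat \<Rightarrow> ('s, 'p) module) \<Rightarrow> (nat \<Rightarrow> 'p \<Rightarrow> 'p) \<Rightarrow> ('p \<Rightarrow> 'x)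
     \<Rightarrow> ('s, 'y) module \<Rightarrow> nat \<Rightarrow> nat \<Rightarrow> ('p \<Rightarrow> 'y) set \<Rightarrow> ('p \<Rightarrow> 'x) set \<Rightarrow> ('p \<Rightarrow> 'y) set" where
  "yoneda S P d \<epsilon> Y m n \<alpha> \<beta> =
     (\<Union>f\<in>\<alpha>. \<Union>g\<in>\<beta>. \<Union>h\<in>chain_lifts S P d P d \<epsilon> n g.
        Ext_class S P d Y (m + n) (compose (carrier (P (m + n))) f (h m)))"

definition Ext_ring ::
  "('s, 'z) ring_scheme \<Rightarrow> (nat \<Rightarrow> ('s, 'p) module) \<Rightarrow> (nat \<Rightarrow> 'p \<Rightarrow> 'p) \<Rightarrow> ('p \<Rightarrow> 'x)
     \<Rightarrow> ('s, 'x) module \<Rightarrow> (nat \<Rightarrow> ('p \<Rightarrow> 'x) set) ring" where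
  "Ext_ring S P d \<epsilon> V =
     graded_ring (Ext_group S P d V) (yoneda S P d \<epsilon> V) (Ext_class S P d V 0 \<epsilon>)"


section \<open>Tensor products\<close>

type_synonym ('x, 'y) tensor = "('x \<times> 'y \<Rightarrow>\<^sub>0 int) set"

definition tensor_relations ::
  "'s set \<Rightarrow> ('x, 'z1) ring_scheme \<Rightarrow> ('x \<Rightarrow> 's \<Rightarrow> 'x) \<Rightarrow> ('y, 'z2) ring_scheme \<Rightarrow> ('s \<Rightarrow> 'y \<Rightarrow> 'y)
     \<Rightarrow> ('x \<times> 'y \<Rightarrow>\<^sub>0 int) set" where
  "tensor_relations S V r Y l =
     {frag_of (x \<oplus>\<^bsub>V\<^esub> x', y) - frag_of (x, y) - frag_of (x', y) | x x' y.
        x \<in> carrier V \<and> x' \<in> carrier V \<and> y \<in> carrier Y} \<union>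
     {frag_of (x, y \<oplus>\<^bsub>Y\<^esub> y') - frag_of (x, y) - frag_of (x, y') | x y y'.
        x \<in> carrier V \<and> y \<in> carrier Y \<and> y' \<in> carrier Y} \<union>
     {frag_of (r x s, y) - frag_of (x, l s y) | x s y.
        x \<in> carrier V \<and> s \<in> S \<and> y \<in> carrier Y}"

text \<open>The tensor product, over the ring with elements \<open>S\<close>, of \<open>V\<close> with right action \<open>r\<close> and \<open>Y\<close> with
  left action \<open>l\<close>, as an abelian group.\<close>

definition tensor_group ::
  "'s set \<Rightarrow> ('x, 'z1) ring_scheme \<Rightarrow> ('x \<Rightarrow> 's \<Rightarrow> 'x) \<Rightarrow> ('y, 'z2) ring_scheme \<Rightarrow> ('s \<Rightarrow> 'y \<Rightarrow> 'y)
     \<Rightarrow> ('x, 'y) tensor monoid" where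
  "tensor_group S V r Y l =
     (let F = free_Abelian_group (carrier V \<times> carrier Y)
      in F Mod generate F (tensor_relations S V r Y l))"

text \<open>The subgroup of relations is the neutral element of the factor group.\<close>

definition pure_tensor :: "('x, 'y) tensor monoid \<Rightarrow> 'x \<Rightarrow> 'y \<Rightarrow> ('x, 'y) tensor" where
  "pure_tensor T x y = \<one>\<^bsub>T\<^esub> #>\<^bsub>free_Abelian_group UNIV\<^esub> frag_of (x, y)"

text \<open>The additive map into \<open>G\<close> induced by a balanced map \<open>b\<close>, evaluated on the representatives.\<close>

definition tensor_lift ::
  "('g, 'z) monoid_scheme \<Rightarrow> ('x \<Rightarrow> 'y \<Rightarrow> 'g) \<Rightarrow> ('x, 'y) tensor \<Rightarrow> 'g" where
  "tensor_lift G b t =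
     the_elem ((\<lambda>w. finprod G (\<lambda>(x, y). b x y [^]\<^bsub>G\<^esub> Poly_Mapping.lookup w (x, y))
       (Poly_Mapping.keys w)) ` t)"

definition tensor_map ::
  "('x', 'y') tensor monoid \<Rightarrow> ('x \<Rightarrow> 'x') \<Rightarrow> ('y \<Rightarrow> 'y') \<Rightarrow> ('x, 'y) tensor \<Rightarrow> ('x', 'y') tensor" where
  "tensor_map T f g = tensor_lift T (\<lambda>x y. pure_tensor T (f x) (g y))"


section \<open>Algebras and bimodules\<close>

locale fd_algebra = module K A + A?: ring A for K (structure) and A :: "('k, 'a) module" (structure) +
  assumes field: "field K"
    and smult_mult_left:
      "\<lbrakk> c \<in> carrier K; x \<in> carrier A; y \<in> carrier A \<rbrakk>
        \<Longrightarrow> (c \<odot>\<^bsub>A\<^esub> x) \<otimes>\<^bsub>A\<^esub> y = c \<odot>\<^bsub>A\<^esub> (x \<otimes>\<^bsub>A\<^esub> y)"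
    and smult_mult_right:
      "\<lbrakk> c \<in> carrier K; x \<in> carrier A; y \<in> carrier A \<rbrakk>
        \<Longrightarrow> x \<otimes>\<^bsub>A\<^esub> (c \<odot>\<^bsub>A\<^esub> y) = c \<odot>\<^bsub>A\<^esub> (x \<otimes>\<^bsub>A\<^esub> y)"
    and finite_dimensional:
      "fin_generated (carrier K) (\<lambda>c x. c \<odot>\<^bsub>A\<^esub> x) (add_monoid A) (carrier A)"

text \<open>The ground field acts on an \<open>A\<close>-module through the unit of \<open>A\<close>.\<close>

definition fd_module ::
  "('k, 'z) ring_scheme \<Rightarrow> ('k, 'a) module \<Rightarrow> ('a, 'm) module \<Rightarrow> bool" where
  "fd_module K A M \<longleftrightarrow> left_module A M \<and>
     fin_generated (carrier K) (\<lambda>c m. (c \<odot>\<^bsub>A\<^esub> \<one>\<^bsub>A\<^esub>) \<odot>\<^bsub>M\<^esub> m) (add_monoid M) (carrier M)"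

definition env_group :: "('k, 'z) ring_scheme \<Rightarrow> ('k, 'a) module \<Rightarrow> ('a, 'a) tensor monoid" where
  "env_group K A =
     tensor_group (carrier K) A (\<lambda>x c. c \<odot>\<^bsub>A\<^esub> x) A (\<lambda>c x. c \<odot>\<^bsub>A\<^esub> x)"

text \<open>The enveloping algebra, in which the product of \<open>a \<otimes> b\<close> and \<open>a' \<otimes> b'\<close> is
  \<open>a a' \<otimes> b' b\<close>.\<close>

definition env :: "('k, 'z) ring_scheme \<Rightarrow> ('k, 'a) module \<Rightarrow> ('a, 'a) tensor ring" where
  "env K A = (let T = env_group K A in
     \<lparr>carrier = carrier T,
      monoid.mult = (\<lambda>s t. tensor_lift T (\<lambda>a b. tensor_lift T (\<lambda>a' b'.
          pure_tensor T (a \<otimes>\<^bsub>A\<^esub> a') (b' \<otimes>\<^bsub>A\<^esub> b)) t) s),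
      monoid.one = pure_tensor T \<one>\<^bsub>A\<^esub> \<one>\<^bsub>A\<^esub>,
      ring.zero = \<one>\<^bsub>T\<^esub>,
      ring.add = (\<otimes>\<^bsub>T\<^esub>)\<rparr>)"

text \<open>Bimodules over \<open>A\<close> are left modules over the enveloping algebra; these are the underlying left and
  right actions of \<open>A\<close>.\<close>

definition lact ::
  "('k, 'z) ring_scheme \<Rightarrow> ('k, 'a) module \<Rightarrow> (('a, 'a) tensor, 'n) module \<Rightarrow> 'a \<Rightarrow> 'n \<Rightarrow> 'n" where
  "lact K A N a x = pure_tensor (env_group K A) a \<one>\<^bsub>A\<^esub> \<odot>\<^bsub>N\<^esub> x"

definition ract ::
  "('k, 'z) ring_scheme \<Rightarrow> ('k, 'a) module \<Rightarrow> (('a, 'a) tensor, 'n) module \<Rightarrow> 'n \<Rightarrow> 'a \<Rightarrow> 'n" where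
  "ract K A N x a = pure_tensor (env_group K A) \<one>\<^bsub>A\<^esub> a \<odot>\<^bsub>N\<^esub> x"

definition regular_bimodule :: "('k, 'a) module \<Rightarrow> (('a, 'a) tensor, 'a) module" where
  "regular_bimodule A =
     \<lparr>carrier = carrier A, monoid.mult = (\<otimes>\<^bsub>A\<^esub>), monoid.one = \<one>\<^bsub>A\<^esub>,
      ring.zero = \<zero>\<^bsub>A\<^esub>, ring.add = (\<oplus>\<^bsub>A\<^esub>),
      smult = (\<lambda>s x. tensor_lift (add_monoid A) (\<lambda>a b. a \<otimes>\<^bsub>A\<^esub> x \<otimes>\<^bsub>A\<^esub> b) s)\<rparr>"

definition fd_bimodule ::
  "('k, 'z) ring_scheme \<Rightarrow> ('k, 'a) module \<Rightarrow> (('a, 'a) tensor, 'n) module \<Rightarrow> bool" where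
  "fd_bimodule K A N \<longleftrightarrow> left_module (env K A) N \<and>
     fin_generated (carrier K) (\<lambda>c x. lact K A N (c \<odot>\<^bsub>A\<^esub> \<one>\<^bsub>A\<^esub>) x) (add_monoid N) (carrier N)"

text \<open>Tensor products over \<open>A\<close>: a bimodule with a left module, and two bimodules.\<close>

definition mtensor_group ::
  "('k, 'z) ring_scheme \<Rightarrow> ('k, 'a) module \<Rightarrow> (('a, 'a) tensor, 'n) module \<Rightarrow> ('a, 'm) module
     \<Rightarrow> ('n, 'm) tensor monoid" where
  "mtensor_group K A N M = tensor_group (carrier A) N (ract K A N) M (\<lambda>a m. a \<odot>\<^bsub>M\<^esub> m)"

definition mtensor ::
  "('k, 'z) ring_scheme \<Rightarrow> ('k, 'a) module \<Rightarrow> (('a, 'a) tensor, 'n) module \<Rightarrow> ('a, 'm) module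
     \<Rightarrow> ('a, ('n, 'm) tensor) module" where
  "mtensor K A N M = (let T = mtensor_group K A N M in
     \<lparr>carrier = carrier T, monoid.mult = undefined, monoid.one = undefined,
      ring.zero = \<one>\<^bsub>T\<^esub>, ring.add = (\<otimes>\<^bsub>T\<^esub>),
      smult = (\<lambda>a. tensor_map T (lact K A N a) (\<lambda>m. m))\<rparr>)"

definition btensor_group ::
  "('k, 'z) ring_scheme \<Rightarrow> ('k, 'a) module \<Rightarrow> (('a, 'a) tensor, 'n) module
     \<Rightarrow> (('a, 'a) tensor, 'm) module \<Rightarrow> ('n, 'm) tensor monoid" where
  "btensor_group K A N M = tensor_group (carrier A) N (ract K A N) M (lact K A M)"

definition btensor ::
  "('k, 'z) ring_scheme \<Rightarrow> ('k, 'a) module \<Rightarrow> (('a, 'a) tensor, 'n) module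
     \<Rightarrow> (('a, 'a) tensor, 'm) module \<Rightarrow> (('a, 'a) tensor, ('n, 'm) tensor) module" where
  "btensor K A N M = (let T = btensor_group K A N M in
     \<lparr>carrier = carrier T, monoid.mult = undefined, monoid.one = undefined,
      ring.zero = \<one>\<^bsub>T\<^esub>, ring.add = (\<otimes>\<^bsub>T\<^esub>),
      smult = (\<lambda>s t. tensor_lift T
        (\<lambda>a b. tensor_map T (lact K A N a) (\<lambda>y. ract K A M y b) t) s)\<rparr>)"

text \<open>Unital algebras in the monoidal category of \<open>A\<close>-bimodules.\<close>

definition bimodule_algebra ::
  "('k, 'z) ring_scheme \<Rightarrow> ('k, 'a) module \<Rightarrow> (('a, 'a) tensor, 'r) module
     \<Rightarrow> (('r, 'r) tensor \<Rightarrow> 'r) \<Rightarrow> ('a \<Rightarrow> 'r) \<Rightarrow> bool" where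
  "bimodule_algebra K A R \<mu> \<eta> \<longleftrightarrow> (let m = (\<lambda>x y. \<mu> (pure_tensor (btensor_group K A R R) x y)) in
     left_module (env K A) R \<and>
     \<mu> \<in> module_hom (env K A) (btensor K A R R) R \<and>
     \<eta> \<in> module_hom (env K A) (regular_bimodule A) R \<and>
     (\<forall>x\<in>carrier R. \<forall>y\<in>carrier R. \<forall>z\<in>carrier R. m (m x y) z = m x (m y z)) \<and>
     (\<forall>a\<in>carrier A. \<forall>x\<in>carrier R. m (\<eta> a) x = lact K A R a x \<and> m x (\<eta> a) = ract K A R x a))"


section \<open>Hochschild cohomology\<close>

text \<open>From here on \<open>P\<close>, \<open>d\<close>, \<open>\<epsilon>\<close> is a projective resolution of the bimodule \<open>A\<close>, and \<open>Q\<close>, \<open>e\<close>,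
  \<open>\<pi>\<close> one of the \<open>A\<close>-module \<open>M\<close>.\<close>

definition HH_ring ::
  "('k, 'z) ring_scheme \<Rightarrow> ('k, 'a) module \<Rightarrow> (nat \<Rightarrow> (('a, 'a) tensor, 'p) module)
     \<Rightarrow> (nat \<Rightarrow> 'p \<Rightarrow> 'p) \<Rightarrow> ('p \<Rightarrow> 'a) \<Rightarrow> (nat \<Rightarrow> ('p \<Rightarrow> 'a) set) ring" where
  "HH_ring K A P d \<epsilon> = Ext_ring (env K A) P d \<epsilon> (regular_bimodule A)"

text \<open>Condition (fg).  The ring acts on the right by the Yoneda product; twisting by signs turns
  submodules for this action into submodules for the corresponding left action.  A finitely generated
  bimodule over a finite dimensional algebra is finite dimensional, hence isomorphic to one whose
  elements are the vectors of type \<open>nat \<Rightarrow> 'k\<close> vanishing from some index on; so bimodules with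
  elements in this type represent all finitely generated ones.\<close>

definition condition_fg ::
  "('k, 'z) ring_scheme \<Rightarrow> ('k, 'a) module \<Rightarrow> (nat \<Rightarrow> (('a, 'a) tensor, 'p) module)
     \<Rightarrow> (nat \<Rightarrow> 'p \<Rightarrow> 'p) \<Rightarrow> ('p \<Rightarrow> 'a) \<Rightarrow> bool" where
  "condition_fg K A P d \<epsilon> \<longleftrightarrow>
     (\<forall>N :: (('a, 'a) tensor, nat \<Rightarrow> 'k) module.
        left_module (env K A) N \<and>
        fin_generated (carrier (env K A)) (\<lambda>s x. s \<odot>\<^bsub>N\<^esub> x) (add_monoid N) (carrier N) \<longrightarrow>
        noetherian_action (carrier (HH_ring K A P d \<epsilon>))
          (\<lambda>z x. graded_prod (Ext_group (env K A) P d N) (yoneda (env K A) P d \<epsilon> N) x z)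
          (sum_group UNIV (Ext_group (env K A) P d N)))"

text \<open>The map \<open>- \<otimes>\<^sub>A M\<close>: a cocycle \<open>f\<close> from \<open>P n\<close> to \<open>A\<close> gives a cocycle on \<open>P n \<otimes>\<^sub>A M\<close> with values
  in \<open>A \<otimes>\<^sub>A M = M\<close>, which is pulled back along a comparison map from \<open>Q\<close> to the resolution
  \<open>P \<otimes>\<^sub>A M\<close> of \<open>M\<close> over the identity of \<open>M\<close>.\<close>

definition comparison_maps ::
  "('k, 'z) ring_scheme \<Rightarrow> ('k, 'a) module \<Rightarrow>
   (nat \<Rightarrow> (('a, 'a) tensor, 'p) module) \<Rightarrow> (nat \<Rightarrow> 'p \<Rightarrow> 'p) \<Rightarrow> ('p \<Rightarrow> 'a) \<Rightarrow> ('a, 'm) module \<Rightarrow>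
   (nat \<Rightarrow> ('a, 'q) module) \<Rightarrow> (nat \<Rightarrow> 'q \<Rightarrow> 'q) \<Rightarrow> ('q \<Rightarrow> 'm) \<Rightarrow> (nat \<Rightarrow> 'q \<Rightarrow> ('p, 'm) tensor) set" where
  "comparison_maps K A P d \<epsilon> M Q e \<pi> =
     chain_lifts A Q e
       (\<lambda>i. mtensor K A (P i) M)
       (\<lambda>i. tensor_map (mtensor_group K A (P i) M) (d i) (\<lambda>m. m))
       (tensor_lift (add_monoid M) (\<lambda>p m. \<epsilon> p \<odot>\<^bsub>M\<^esub> m))
       0 \<pi>"

definition tensor_functor_map ::
  "('k, 'z) ring_scheme \<Rightarrow> ('k, 'a) module \<Rightarrow>
   (nat \<Rightarrow> (('a, 'a) tensor, 'p) module) \<Rightarrow> (nat \<Rightarrow> 'p \<Rightarrow> 'p) \<Rightarrow> ('p \<Rightarrow> 'a) \<Rightarrow> ('a, 'm) module \<Rightarrow>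
   (nat \<Rightarrow> ('a, 'q) module) \<Rightarrow> (nat \<Rightarrow> 'q \<Rightarrow> 'q) \<Rightarrow> ('q \<Rightarrow> 'm)
     \<Rightarrow> (nat \<Rightarrow> ('p \<Rightarrow> 'a) set) \<Rightarrow> nat \<Rightarrow> ('q \<Rightarrow> 'm) set" where
  "tensor_functor_map K A P d \<epsilon> M Q e \<pi> x = (\<lambda>n.
     \<Union>f\<in>x n. \<Union>u\<in>comparison_maps K A P d \<epsilon> M Q e \<pi>.
       Ext_class A Q e M n
         (\<lambda>y\<in>carrier (Q n). tensor_lift (add_monoid M) (\<lambda>p m. f p \<odot>\<^bsub>M\<^esub> m) (u n y)))"

text \<open>The components \<open>D i j\<close>, from \<open>P (i + j)\<close> to \<open>P i \<otimes>\<^sub>A P j\<close>, of the chain maps from \<open>P\<close> to the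
  total complex of \<open>P \<otimes>\<^sub>A P\<close> over the isomorphism of \<open>A\<close> and \<open>A \<otimes>\<^sub>A A\<close>.\<close>

definition diagonal_maps ::
  "('k, 'z) ring_scheme \<Rightarrow> ('k, 'a) module \<Rightarrow>
   (nat \<Rightarrow> (('a, 'a) tensor, 'p) module) \<Rightarrow> (nat \<Rightarrow> 'p \<Rightarrow> 'p) \<Rightarrow> ('p \<Rightarrow> 'a)
     \<Rightarrow> (nat \<Rightarrow> nat \<Rightarrow> 'p \<Rightarrow> ('p, 'p) tensor) set" where
  "diagonal_maps K A P d \<epsilon> =
     {D. (\<forall>i j. D i j \<in> module_hom (env K A) (P (i + j)) (btensor K A (P i) (P j))) \<and>
         (\<forall>x\<in>carrier (P 0).
            tensor_lift (add_monoid A) (\<lambda>p q. \<epsilon> p \<otimes>\<^bsub>A\<^esub> \<epsilon> q) (D 0 0 x) = \<epsilon> x) \<and>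
         (\<forall>i j. \<forall>x\<in>carrier (P (Suc (i + j))).
            let T = btensor_group K A (P i) (P j);
                s = tensor_map T (d i) (\<lambda>q. q) (D (Suc i) j x);
                t = tensor_map T (\<lambda>p. p) (d j) (D i (Suc j) x)
            in D i j (d (i + j) x) = s \<otimes>\<^bsub>T\<^esub> (if even i then t else inv\<^bsub>T\<^esub> t))}"

definition cup ::
  "('k, 'z) ring_scheme \<Rightarrow> ('k, 'a) module \<Rightarrow>
   (nat \<Rightarrow> (('a, 'a) tensor, 'p) module) \<Rightarrow> (nat \<Rightarrow> 'p \<Rightarrow> 'p) \<Rightarrow> ('p \<Rightarrow> 'a) \<Rightarrow>
   (('a, 'a) tensor, 'r) module \<Rightarrow> (('r, 'r) tensor \<Rightarrow> 'r) \<Rightarrow> nat \<Rightarrow> nat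
     \<Rightarrow> ('p \<Rightarrow> 'r) set \<Rightarrow> ('p \<Rightarrow> 'r) set \<Rightarrow> ('p \<Rightarrow> 'r) set" where
  "cup K A P d \<epsilon> R \<mu> m n \<alpha> \<beta> =
     (\<Union>f\<in>\<alpha>. \<Union>g\<in>\<beta>. \<Union>D\<in>diagonal_maps K A P d \<epsilon>.
        Ext_class (env K A) P d R (m + n)
          (\<lambda>x\<in>carrier (P (m + n)). \<mu> (tensor_map (btensor_group K A R R) f g (D m n x))))"

definition HH_algebra ::
  "('k, 'z) ring_scheme \<Rightarrow> ('k, 'a) module \<Rightarrow>
   (nat \<Rightarrow> (('a, 'a) tensor, 'p) module) \<Rightarrow> (nat \<Rightarrow> 'p \<Rightarrow> 'p) \<Rightarrow> ('p \<Rightarrow> 'a) \<Rightarrow>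
   (('a, 'a) tensor, 'r) module \<Rightarrow> (('r, 'r) tensor \<Rightarrow> 'r) \<Rightarrow> ('a \<Rightarrow> 'r)
     \<Rightarrow> (nat \<Rightarrow> ('p \<Rightarrow> 'r) set) ring" where
  "HH_algebra K A P d \<epsilon> R \<mu> \<eta> =
     graded_ring (Ext_group (env K A) P d R) (cup K A P d \<epsilon> R \<mu>)
       (Ext_class (env K A) P d R 0 (compose (carrier (P 0)) \<eta> \<epsilon>))"

definition unit_map ::
  "('k, 'z) ring_scheme \<Rightarrow> ('k, 'a) module \<Rightarrow>
   (nat \<Rightarrow> (('a, 'a) tensor, 'p) module) \<Rightarrow> (nat \<Rightarrow> 'p \<Rightarrow> 'p) \<Rightarrow>
   (('a, 'a) tensor, 'r) module \<Rightarrow> ('a \<Rightarrow> 'r)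
     \<Rightarrow> (nat \<Rightarrow> ('p \<Rightarrow> 'a) set) \<Rightarrow> nat \<Rightarrow> ('p \<Rightarrow> 'r) set" where
  "unit_map K A P d R \<eta> x = (\<lambda>n.
     \<Union>f\<in>x n. Ext_class (env K A) P d R n (compose (carrier (P n)) \<eta> f))"

end

theory Submission
 imports Defs
begin

section \<open>Linear maps and projective modules\<close>

definition lin ::
 "('s, 'z) ring_scheme \<Rightarrow> ('s, 'v) module \<Rightarrow> ('s, 'y) module \<Rightarrow> ('v \<Rightarrow> 'y) set" where
 "lin S V Y = {f \<in> carrier V \<rightarrow> carrier Y.
  (\<forall>x\<in>carrier V. \<forall>y\<in>carrier V. f (x \<oplus>\<^bsub>V\<^esub> y) = f x \<oplus>\<^bsub>Y\<^esub> f y) \<and>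
  (\<forall>s\<in>carrier S. \<forall>x\<in>carrier V. f (s \<odot>\<^bsub>V\<^esub> x) = s \<odot>\<^bsub>Y\<^esub> f x)}"

lemma linI:
 assumes "!!x. x \<in> carrier V ==> f x \<in> carrier Y"
  and "!!x y. x \<in> carrier V ==> y \<in> carrier V ==> f (x \<oplus>\<^bsub>V\<^esub> y) = f x \<oplus>\<^bsub>Y\<^esub> f y"
  and "!!s x. s \<in> carrier S ==> x \<in> carrier V ==> f (s \<odot>\<^bsub>V\<^esub> x) = s \<odot>\<^bsub>Y\<^esub> f x"
 shows "f \<in> lin S V Y"
 using assms by (auto simp: lin_def)

lemma lin_closed: "f \<in> lin S V Y ==> x \<in> carrier V ==> f x \<in> carrier Y"
 by (auto simp: lin_def)

lemma lin_add:
 "f \<in> lin S V Y ==> x \<in> carrier V ==> y \<in> carrier V ==> f (x \<oplus>\<^bsub>V\<^esub> y) = f x \<oplus>\<^bsub>Y\<^esub> f y"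
 by (auto simp: lin_def)

lemma lin_smult:
 "f \<in> lin S V Y ==> s \<in> carrier S ==> x \<in> carrier V ==> f (s \<odot>\<^bsub>V\<^esub> x) = s \<odot>\<^bsub>Y\<^esub> f x"
 by (auto simp: lin_def)

lemma module_hom_iff: "f \<in> module_hom S V Y \<longleftrightarrow> f \<in> lin S V Y \<and> f \<in> extensional (carrier V)"
 by (auto simp: module_hom_def lin_def PiE_def)

lemma module_hom_lin: "f \<in> module_hom S V Y ==> f \<in> lin S V Y"
 by (simp add: module_hom_iff)

lemma lin_cong:
 assumes "left_module S V" "f \<in> lin S V Y" "!!x. x \<in> carrier V ==> g x = f x"
 shows "g \<in> lin S V Y"
proof -
 interpret V: left_module S V by fact
 show ?thesis using assms(2,3) by (auto simp: lin_def V.smult_closed Pi_iff)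
qed

lemma lin_restrict:
 assumes "left_module S V" "f \<in> lin S V Y"
 shows "(\<lambda>x\<in>carrier V. f x) \<in> module_hom S V Y"
 unfolding module_hom_iff using lin_cong[OF assms] by auto

lemma left_module_abelian_group: "left_module S V ==> abelian_group V"
 by (simp add: left_module_def)

lemma additive_hom:
 assumes "abelian_group V" "abelian_group Y" "!!x. x \<in> carrier V ==> f x \<in> carrier Y"
  "!!x y. x \<in> carrier V ==> y \<in> carrier V ==> f (x \<oplus>\<^bsub>V\<^esub> y) = f x \<oplus>\<^bsub>Y\<^esub> f y"
 shows "f \<zero>\<^bsub>V\<^esub> = \<zero>\<^bsub>Y\<^esub>" "x \<in> carrier V ==> f (\<ominus>\<^bsub>V\<^esub> x) = \<ominus>\<^bsub>Y\<^esub> f x"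
  "x \<in> carrier V ==> y \<in> carrier V ==> f (x \<ominus>\<^bsub>V\<^esub> y) = f x \<ominus>\<^bsub>Y\<^esub> f y"
proof -
 interpret V: abelian_group V by fact
 interpret Y: abelian_group Y by fact
 have "f \<zero>\<^bsub>V\<^esub> \<oplus>\<^bsub>Y\<^esub> f \<zero>\<^bsub>V\<^esub> = f \<zero>\<^bsub>V\<^esub>"
  using assms(4)[of "\<zero>\<^bsub>V\<^esub>" "\<zero>\<^bsub>V\<^esub>"] by simp
 then show z: "f \<zero>\<^bsub>V\<^esub> = \<zero>\<^bsub>Y\<^esub>"
  using assms(3)[of "\<zero>\<^bsub>V\<^esub>"] by (metis V.zero_closed Y.add.r_cancel_one')
 have n: "f (\<ominus>\<^bsub>V\<^esub> x) = \<ominus>\<^bsub>Y\<^esub> f x" if "x \<in> carrier V" for x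
  using assms(4)[of "\<ominus>\<^bsub>V\<^esub> x" x] that assms(3) z
  by (metis V.a_inv_closed V.l_neg Y.minus_equality)
 then show "x \<in> carrier V ==> f (\<ominus>\<^bsub>V\<^esub> x) = \<ominus>\<^bsub>Y\<^esub> f x" .
 show "x \<in> carrier V ==> y \<in> carrier V ==> f (x \<ominus>\<^bsub>V\<^esub> y) = f x \<ominus>\<^bsub>Y\<^esub> f y"
  by (simp add: a_minus_def assms(4) n)
qed

lemma (in abelian_group) add_minus_cancel:
 assumes "x \<in> carrier G" "y \<in> carrier G"
 shows "y \<oplus> (x \<ominus> y) = x" "(x \<oplus> y) \<ominus> y = x" "(y \<oplus> x) \<ominus> y = x" "(x \<ominus> y) \<oplus> y = x"
proof -
 show "y \<oplus> (x \<ominus> y) = x" using assms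
  by (simp add: a_minus_def a_comm[of x] flip: a_assoc) (simp add: r_neg)
 then show "(x \<ominus> y) \<oplus> y = x" using assms by (simp add: a_comm)
 show "(x \<oplus> y) \<ominus> y = x" using assms by (simp add: a_minus_def a_assoc r_neg)
 then show "(y \<oplus> x) \<ominus> y = x" using assms by (simp add: a_comm)
qed

lemma lin_zero: "left_module S V ==> left_module S Y ==> f \<in> lin S V Y ==> f \<zero>\<^bsub>V\<^esub> = \<zero>\<^bsub>Y\<^esub>"
 using additive_hom(1)[of V Y f] by (auto simp: left_module_abelian_group lin_def)

lemma lin_uminus:
 "left_module S V ==> left_module S Y ==> f \<in> lin S V Y ==> x \<in> carrier V ==>
  f (\<ominus>\<^bsub>V\<^esub> x) = \<ominus>\<^bsub>Y\<^esub> f x"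
 using additive_hom(2)[of V Y f] by (auto simp: left_module_abelian_group lin_def)

lemma lin_minus:
 "left_module S V ==> left_module S Y ==> f \<in> lin S V Y ==> x \<in> carrier V ==> y \<in> carrier V ==>
  f (x \<ominus>\<^bsub>V\<^esub> y) = f x \<ominus>\<^bsub>Y\<^esub> f y"
 using additive_hom(3)[of V Y f] by (auto simp: left_module_abelian_group lin_def)

lemma lin_comp: "f \<in> lin S V Y ==> g \<in> lin S Y Z ==> (%x. g (f x)) \<in> lin S V Z"
 by (auto simp: lin_def Pi_iff)

lemma lin_id: "(%x. x) \<in> lin S V V"
 by (auto simp: lin_def)

context left_module
begin

lemma smult_zero: "s \<in> carrier R ==> s \<odot>\<^bsub>M\<^esub> \<zero>\<^bsub>M\<^esub> = \<zero>\<^bsub>M\<^esub>"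
 using additive_hom(1)[of M M "%x. s \<odot>\<^bsub>M\<^esub> x"] smult_r_distr smult_closed
 by (simp add: M.abelian_group_axioms)

lemma smult_uminus: "s \<in> carrier R ==> x \<in> carrier M ==> s \<odot>\<^bsub>M\<^esub> (\<ominus>\<^bsub>M\<^esub> x) = \<ominus>\<^bsub>M\<^esub> (s \<odot>\<^bsub>M\<^esub> x)"
 using additive_hom(2)[of M M "%x. s \<odot>\<^bsub>M\<^esub> x"] smult_r_distr smult_closed
 by (simp add: M.abelian_group_axioms)

lemma zero_smult: "x \<in> carrier M ==> \<zero>\<^bsub>R\<^esub> \<odot>\<^bsub>M\<^esub> x = \<zero>\<^bsub>M\<^esub>"
 using additive_hom(1)[of R M "%s. s \<odot>\<^bsub>M\<^esub> x"] smult_l_distr smult_closed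
 by (simp add: M.abelian_group_axioms R.is_abelian_group)

lemma smult_finsum:
 assumes "s \<in> carrier R" "f \<in> I \<rightarrow> carrier M"
 shows "s \<odot>\<^bsub>M\<^esub> finsum M f I = finsum M (%i. s \<odot>\<^bsub>M\<^esub> f i) I"
 using assms(2)
proof (induction I rule: infinite_finite_induct)
 case (insert i I)
 then show ?case using assms(1)
  by (subst M.finsum_insert M.finsum_insert; auto simp: smult_r_distr smult_closed Pi_iff)+
qed (use assms(1) in \<open>auto simp: smult_zero M.finsum_infinite\<close>)

end

lemma lin_plus:
 assumes "left_module S V" "left_module S Y" "f \<in> lin S V Y" "g \<in> lin S V Y"
 shows "(%x. f x \<oplus>\<^bsub>Y\<^esub> g x) \<in> lin S V Y"
proof -
 interpret V: left_module S V by fact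
 interpret Y: left_module S Y by fact
 show ?thesis using assms(3,4)
  by (intro linI) (auto simp: lin_closed lin_add lin_smult V.smult_closed Y.smult_r_distr Y.M.a_ac)
qed

lemma lin_neg:
 assumes "left_module S V" "left_module S Y" "f \<in> lin S V Y"
 shows "(%x. \<ominus>\<^bsub>Y\<^esub> f x) \<in> lin S V Y"
proof -
 interpret V: left_module S V by fact
 interpret Y: left_module S Y by fact
 show ?thesis using assms(3)
  by (intro linI) (auto simp: lin_closed lin_add lin_smult V.smult_closed Y.smult_uminus Y.M.minus_add)
qed

lemma lin_diff:
 assumes "left_module S V" "left_module S Y" "f \<in> lin S V Y" "g \<in> lin S V Y"
 shows "(%x. f x \<ominus>\<^bsub>Y\<^esub> g x) \<in> lin S V Y"
 unfolding a_minus_def by (rule lin_plus lin_neg assms)+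

lemma lin_null:
 assumes "left_module S V" "left_module S Y"
 shows "(%x. \<zero>\<^bsub>Y\<^esub>) \<in> lin S V Y"
proof -
 interpret Y: left_module S Y by fact
 show ?thesis by (intro linI) (auto simp: Y.smult_zero)
qed

definition free_unit :: "('s, 'z) ring_scheme \<Rightarrow> 'x set \<Rightarrow> 'x \<Rightarrow> 'x \<Rightarrow> 's" where
 "free_unit S B b = (\<lambda>b'\<in>B. if b' = b then \<one>\<^bsub>S\<^esub> else \<zero>\<^bsub>S\<^esub>)"

lemma free_module_carrierI:
 "c \<in> B \<rightarrow>\<^sub>E carrier S ==> finite {b \<in> B. c b \<noteq> \<zero>\<^bsub>S\<^esub>} ==> c \<in> carrier (free_module S B)"
 by (simp add: free_module_def)

lemma free_module_ops:
 "c \<oplus>\<^bsub>free_module S B\<^esub> c' = (\<lambda>b\<in>B. c b \<oplus>\<^bsub>S\<^esub> c' b)"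
 "s \<odot>\<^bsub>free_module S B\<^esub> c = (\<lambda>b\<in>B. s \<otimes>\<^bsub>S\<^esub> c b)"
 by (simp_all add: free_module_def)

lemma free_unit_closed:
 assumes "ring S" "b \<in> B"
 shows "free_unit S B b \<in> carrier (free_module S B)"
proof -
 interpret ring S by fact
 have "finite {b' \<in> B. free_unit S B b b' \<noteq> \<zero>\<^bsub>S\<^esub>}"
  by (rule finite_subset[of _ "{b}"]) (auto simp: free_unit_def)
 then show ?thesis by (intro free_module_carrierI) (auto simp: free_unit_def)
qed

lemma free_module_extension:
 assumes W: "left_module S W" and x: "!!b. b \<in> B ==> x b \<in> carrier W"
 shows "\<exists>ext. ext \<in> lin S (free_module S B) W \<and> (\<forall>b\<in>B. ext (free_unit S B b) = x b)"
proof -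
 interpret W: left_module S W by fact
 define ext where "ext = (%c. finsum W (%b. c b \<odot>\<^bsub>W\<^esub> x b) {b \<in> B. c b \<noteq> \<zero>\<^bsub>S\<^esub>})"
 have car: "c b \<in> carrier S" if "c \<in> carrier (free_module S B)" "b \<in> B" for c b
  using that by (auto simp: free_module_def)
 have fin: "finite {b \<in> B. c b \<noteq> \<zero>\<^bsub>S\<^esub>}" if "c \<in> carrier (free_module S B)" for c
  using that by (auto simp: free_module_def)
 have sup: "ext c = finsum W (%b. c b \<odot>\<^bsub>W\<^esub> x b) I"
  if "c \<in> B \<rightarrow> carrier S" "finite I" "I \<subseteq> B" "{b \<in> B. c b \<noteq> \<zero>\<^bsub>S\<^esub>} \<subseteq> I" for c I
  unfolding ext_def
  by (rule W.M.add.finprod_mono_neutral_cong_left)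
   (use that x in \<open>auto simp: W.zero_smult W.smult_closed Pi_iff subset_iff\<close>)
 have closed: "ext c \<in> carrier W" if "c \<in> carrier (free_module S B)" for c
  unfolding ext_def using x car[OF that] by (intro W.M.finsum_closed) (auto simp: W.smult_closed)
 have add: "ext (c \<oplus>\<^bsub>free_module S B\<^esub> c') = ext c \<oplus>\<^bsub>W\<^esub> ext c'"
  if c: "c \<in> carrier (free_module S B)" "c' \<in> carrier (free_module S B)" for c c'
 proof -
  let ?I = "{b \<in> B. c b \<noteq> \<zero>\<^bsub>S\<^esub>} \<union> {b \<in> B. c' b \<noteq> \<zero>\<^bsub>S\<^esub>}"
  let ?s = "\<lambda>b\<in>B. c b \<oplus>\<^bsub>S\<^esub> c' b"
  have "ext ?s = finsum W (%b. ?s b \<odot>\<^bsub>W\<^esub> x b) ?I"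
   by (rule sup) (use fin c car in auto)
  also have "\<dots> = finsum W (%b. c b \<odot>\<^bsub>W\<^esub> x b \<oplus>\<^bsub>W\<^esub> c' b \<odot>\<^bsub>W\<^esub> x b) ?I"
   by (rule W.M.finsum_cong') (use x c car in \<open>auto simp: W.smult_l_distr W.smult_closed\<close>)
  also have "\<dots> = finsum W (%b. c b \<odot>\<^bsub>W\<^esub> x b) ?I \<oplus>\<^bsub>W\<^esub> finsum W (%b. c' b \<odot>\<^bsub>W\<^esub> x b) ?I"
   by (rule W.M.finsum_addf) (use x c car in \<open>auto simp: W.smult_closed\<close>)
  also have "finsum W (%b. c b \<odot>\<^bsub>W\<^esub> x b) ?I = ext c"
   by (rule sup[symmetric]) (use fin c car in auto)
  also have "finsum W (%b. c' b \<odot>\<^bsub>W\<^esub> x b) ?I = ext c'"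
   by (rule sup[symmetric]) (use fin c car in auto)
  finally show ?thesis unfolding free_module_ops .
 qed
 have smult: "ext (s \<odot>\<^bsub>free_module S B\<^esub> c) = s \<odot>\<^bsub>W\<^esub> ext c"
  if c: "c \<in> carrier (free_module S B)" and s: "s \<in> carrier S" for c s
 proof -
  let ?I = "{b \<in> B. c b \<noteq> \<zero>\<^bsub>S\<^esub>}"
  let ?s = "\<lambda>b\<in>B. s \<otimes>\<^bsub>S\<^esub> c b"
  have "ext ?s = finsum W (%b. ?s b \<odot>\<^bsub>W\<^esub> x b) ?I"
   by (rule sup) (use fin c car s in auto)
  also have "\<dots> = finsum W (%b. s \<odot>\<^bsub>W\<^esub> (c b \<odot>\<^bsub>W\<^esub> x b)) ?I"
   by (rule W.M.finsum_cong') (use x c car s in \<open>auto simp: W.smult_assoc1 W.smult_closed\<close>)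
  also have "\<dots> = s \<odot>\<^bsub>W\<^esub> ext c"
   unfolding ext_def by (rule W.smult_finsum[symmetric]) (use x c car s in \<open>auto simp: W.smult_closed\<close>)
  finally show ?thesis unfolding free_module_ops .
 qed
 have unit: "ext (free_unit S B b) = x b" if "b \<in> B" for b
 proof -
  have "ext (free_unit S B b) = finsum W (%b'. free_unit S B b b' \<odot>\<^bsub>W\<^esub> x b') {b}"
   by (rule sup) (use that in \<open>auto simp: free_unit_def\<close>)
  then show ?thesis using that x by (simp add: free_unit_def W.smult_one)
 qed
 show ?thesis
  by (intro exI[of _ ext] conjI ballI linI) (simp_all add: closed add smult unit)
qed

lemma free_module_lin_unique:
 assumes Y: "left_module S Y" and f: "f \<in> lin S (free_module S B) Y" and g: "g \<in> lin S (free_module S B) Y"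
  and eq: "!!b. b \<in> B ==> f (free_unit S B b) = g (free_unit S B b)"
  and c: "c \<in> carrier (free_module S B)"
 shows "f c = g c"
proof -
 interpret Y: left_module S Y by fact
 let ?F = "free_module S B"
 have "c \<in> carrier ?F ==> card {b \<in> B. c b \<noteq> \<zero>\<^bsub>S\<^esub>} = n ==> f c = g c" for n c
 proof (induction n arbitrary: c)
  case 0
  then have "c = \<zero>\<^bsub>S\<^esub> \<odot>\<^bsub>?F\<^esub> c"
   by (intro ext) (auto simp: free_module_def PiE_def Pi_def extensional_def)
  then show ?case using lin_smult[OF f, of "\<zero>\<^bsub>S\<^esub>" c] lin_smult[OF g, of "\<zero>\<^bsub>S\<^esub>" c] 0
    lin_closed[OF f] lin_closed[OF g]
   by (metis Y.R.zero_closed Y.zero_smult)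
 next
  case (Suc n)
  from Suc.prems(2) have "{b \<in> B. c b \<noteq> \<zero>\<^bsub>S\<^esub>} \<noteq> {}" by (metis card.empty nat.distinct(1))
  then obtain b where b: "b \<in> B" "c b \<noteq> \<zero>\<^bsub>S\<^esub>" by blast
  let ?c = "c(b := \<zero>\<^bsub>S\<^esub>)"
  have fin: "finite {b \<in> B. c b \<noteq> \<zero>\<^bsub>S\<^esub>}" and car: "c \<in> B \<rightarrow>\<^sub>E carrier S"
   using Suc.prems by (auto simp: free_module_def)
  have supp: "{b' \<in> B. ?c b' \<noteq> \<zero>\<^bsub>S\<^esub>} = {b \<in> B. c b \<noteq> \<zero>\<^bsub>S\<^esub>} - {b}" by auto
  have "finite {b' \<in> B. ?c b' \<noteq> \<zero>\<^bsub>S\<^esub>}" unfolding supp using fin by simp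
  moreover have "?c \<in> B \<rightarrow>\<^sub>E carrier S" using car b by (auto simp: PiE_def extensional_def)
  ultimately have c': "?c \<in> carrier ?F" by (intro free_module_carrierI)
  have fg: "f ?c = g ?c" by (rule Suc.IH[OF c']) (use Suc.prems fin b in \<open>simp only: supp card_Diff_singleton; simp\<close>)
  have u: "free_unit S B b \<in> carrier ?F" by (rule free_unit_closed[OF Y.R.ring_axioms b(1)])
  have cb: "c b \<in> carrier S" using car b by auto
  have su: "c b \<odot>\<^bsub>?F\<^esub> free_unit S B b \<in> carrier ?F"
   by (simp add: free_module_def free_unit_def)
    (use b cb in \<open>auto intro!: finite_subset[of _ "{b}"]\<close>)
  have ceq: "c = ?c \<oplus>\<^bsub>?F\<^esub> (c b \<odot>\<^bsub>?F\<^esub> free_unit S B b)"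
  proof
   fix b' show "c b' = (?c \<oplus>\<^bsub>?F\<^esub> (c b \<odot>\<^bsub>?F\<^esub> free_unit S B b)) b'"
    using car cb b by (cases "b' \<in> B") (auto simp: free_module_def free_unit_def PiE_def Pi_def extensional_def)
  qed
  have "h c = h ?c \<oplus>\<^bsub>Y\<^esub> c b \<odot>\<^bsub>Y\<^esub> h (free_unit S B b)" if h: "h \<in> lin S ?F Y" for h
   using arg_cong[OF ceq, of h] by (simp only: lin_add[OF h c' su] lin_smult[OF h cb u])
  from this[OF f] this[OF g] show ?case by (simp only: fg eq[OF b(1)])
 qed
 then show ?thesis using c by blast
qed

lemma projective_lift:
 fixes P :: "('s, 'p) module"
 assumes P: "projective_module S P" and W: "left_module S W" and Y: "left_module S Y"
  and dl: "dl \<in> lin S W Y" and f: "f \<in> lin S P Y" and im: "f ` carrier P \<subseteq> dl ` carrier W"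
 shows "\<exists>g\<in>module_hom S P W. \<forall>x\<in>carrier P. dl (g x) = f x"
proof -
 have PM: "left_module S P" using P unfolding projective_module_def by (rule conjunct1)
 obtain B :: "'p set" and i q where *: "i \<in> module_hom S P (free_module S B) \<and>
   q \<in> module_hom S (free_module S B) P \<and> (\<forall>x\<in>carrier P. q (i x) = x)"
  using P unfolding projective_module_def by (elim conjE exE) (rule that, intro conjI)
 then have i: "i \<in> lin S P (free_module S B)" and q: "q \<in> lin S (free_module S B) P"
  and qi: "!!x. x \<in> carrier P ==> q (i x) = x"
  by (simp_all add: module_hom_iff)
 interpret P: left_module S P by fact
 have "\<exists>z. z \<in> carrier W \<and> dl z = f (q (free_unit S B b))" if "b \<in> B" for b
 proof -
  have "q (free_unit S B b) \<in> carrier P"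
   by (rule lin_closed[OF q free_unit_closed[OF P.R.ring_axioms that]])
  then have "f (q (free_unit S B b)) \<in> dl ` carrier W" by (rule subsetD[OF im imageI])
  then show ?thesis by (metis imageE)
 qed
 then obtain z where z: "!!b. b \<in> B ==> z b \<in> carrier W" "!!b. b \<in> B ==> dl (z b) = f (q (free_unit S B b))"
  by metis
 obtain ext where ext: "ext \<in> lin S (free_module S B) W" "!!b. b \<in> B ==> ext (free_unit S B b) = z b"
  using free_module_extension[OF W, of B z] z(1) by auto
 have eq: "dl (ext c) = f (q c)" if "c \<in> carrier (free_module S B)" for c
  by (rule free_module_lin_unique[OF Y lin_comp[OF ext(1) dl] lin_comp[OF q f] _ that]) (simp add: ext(2) z(2))
 show ?thesis
 proof (rule bexI[of _ "\<lambda>x\<in>carrier P. ext (i x)"], rule ballI)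
  show "(\<lambda>x\<in>carrier P. ext (i x)) \<in> module_hom S P W" by (rule lin_restrict[OF PM lin_comp[OF i ext(1)]])
  show "dl ((\<lambda>x\<in>carrier P. ext (i x)) x) = f x" if "x \<in> carrier P" for x
   by (simp only: restrict_apply' that eq[OF lin_closed[OF i that]] qi[OF that])
 qed
qed

section \<open>Cochains, cocycles and Ext groups\<close>

locale mod_complex =
 fixes S :: "('s, 'z) ring_scheme" and P :: "nat \<Rightarrow> ('s, 'p) module" and d :: "nat \<Rightarrow> 'p \<Rightarrow> 'p"
 assumes P_mod: "left_module S (P n)"
  and d_lin: "d n \<in> lin S (P (Suc n)) (P n)"
  and dd: "x \<in> carrier (P (Suc (Suc n))) ==> d n (d (Suc n) x) = \<zero>\<^bsub>P n\<^esub>"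
begin

abbreviation "onP n f \<equiv> restrict f (carrier (P n))"
abbreviation "ZC \<equiv> cocycles S P d"
abbreviation "BC \<equiv> coboundaries S P d"
abbreviation "cls \<equiv> Ext_class S P d"
abbreviation "ExtG \<equiv> Ext_group S P d"

lemma d_closed: "x \<in> carrier (P (Suc n)) ==> d n x \<in> carrier (P n)"
 by (rule lin_closed[OF d_lin])

lemma cochain_simps:
 "carrier (cochain_group S P Y n) = module_hom S (P n) Y"
 "f \<otimes>\<^bsub>cochain_group S P Y n\<^esub> g = (onP n (%x. f x \<oplus>\<^bsub>Y\<^esub> g x))"
 "\<one>\<^bsub>cochain_group S P Y n\<^esub> = (onP n (%x. \<zero>\<^bsub>Y\<^esub>))"
 by (simp_all add: cochain_group_def)

lemma hom_closed: "f \<in> module_hom S V Y ==> x \<in> carrier V ==> f x \<in> carrier Y"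
 by (rule lin_closed[OF module_hom_lin])

lemma cochain_comm_group:
 assumes Y: "left_module S Y"
 shows "comm_group (cochain_group S P Y n)"
proof -
 interpret Y: left_module S Y by fact
 show ?thesis
 proof (rule comm_groupI; unfold cochain_simps)
  fix f g h
  assume f: "f \<in> module_hom S (P n) Y" and g: "g \<in> module_hom S (P n) Y" and h: "h \<in> module_hom S (P n) Y"
  show "(onP n (%x. f x \<oplus>\<^bsub>Y\<^esub> g x)) \<in> module_hom S (P n) Y"
   by (rule lin_restrict[OF P_mod lin_plus[OF P_mod Y]]) (use f g in \<open>simp_all add: module_hom_lin\<close>)
  show "(onP n (%x. (onP n (%x. f x \<oplus>\<^bsub>Y\<^esub> g x)) x \<oplus>\<^bsub>Y\<^esub> h x)) =
   (onP n (%x. f x \<oplus>\<^bsub>Y\<^esub> (onP n (%x. g x \<oplus>\<^bsub>Y\<^esub> h x)) x))"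
   by (rule restrict_ext) (use f g h in \<open>simp add: hom_closed Y.M.a_assoc\<close>)
  show "(onP n (%x. f x \<oplus>\<^bsub>Y\<^esub> g x)) = (onP n (%x. g x \<oplus>\<^bsub>Y\<^esub> f x))"
   by (rule restrict_ext) (use f g in \<open>simp add: hom_closed Y.M.a_comm\<close>)
  show "(onP n (%x. (onP n (%x. \<zero>\<^bsub>Y\<^esub>)) x \<oplus>\<^bsub>Y\<^esub> f x)) = f"
   by (rule extensionalityI[where A = "carrier (P n)"]) (use f in \<open>simp_all add: hom_closed\<close>, simp add: module_hom_iff)
  show "\<exists>g\<in>module_hom S (P n) Y. (onP n (%x. g x \<oplus>\<^bsub>Y\<^esub> f x)) = (onP n (%x. \<zero>\<^bsub>Y\<^esub>))"
  proof (rule bexI)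
   show "(onP n (%x. \<ominus>\<^bsub>Y\<^esub> f x)) \<in> module_hom S (P n) Y"
    by (rule lin_restrict[OF P_mod lin_neg[OF P_mod Y]]) (use f in \<open>simp_all add: module_hom_lin\<close>)
   show "(onP n (%x. (onP n (%x. \<ominus>\<^bsub>Y\<^esub> f x)) x \<oplus>\<^bsub>Y\<^esub> f x)) = (onP n (%x. \<zero>\<^bsub>Y\<^esub>))"
    by (rule restrict_ext) (use f in \<open>simp add: hom_closed Y.M.l_neg\<close>)
  qed
 next
  show "(onP n (%x. \<zero>\<^bsub>Y\<^esub>)) \<in> module_hom S (P n) Y"
   by (rule lin_restrict[OF P_mod lin_null[OF P_mod Y]])
 qed
qed

lemma cochain_inv:
 assumes Y: "left_module S Y" and f: "f \<in> module_hom S (P n) Y"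
 shows "inv\<^bsub>cochain_group S P Y n\<^esub> f = (onP n (%x. \<ominus>\<^bsub>Y\<^esub> f x))"
proof -
 interpret Y: left_module S Y by fact
 interpret C: comm_group "cochain_group S P Y n" by (rule cochain_comm_group[OF Y])
 show ?thesis
 proof (rule C.inv_equality; unfold cochain_simps)
  show "(onP n (%x. \<ominus>\<^bsub>Y\<^esub> f x)) \<in> module_hom S (P n) Y"
   by (rule lin_restrict[OF P_mod lin_neg[OF P_mod Y]]) (use f in \<open>simp_all add: module_hom_lin\<close>)
  show "(onP n (%x. (onP n (%x. \<ominus>\<^bsub>Y\<^esub> f x)) x \<oplus>\<^bsub>Y\<^esub> f x)) = (onP n (%x. \<zero>\<^bsub>Y\<^esub>))"
   by (rule restrict_ext) (use f in \<open>simp add: hom_closed Y.M.l_neg\<close>)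
 qed (rule f)
qed

lemma cocycles_iff:
 "f \<in> ZC Y n \<longleftrightarrow>
  f \<in> module_hom S (P n) Y \<and> (\<forall>x\<in>carrier (P (Suc n)). f (d n x) = \<zero>\<^bsub>Y\<^esub>)"
 unfolding cocycles_def coboundary_map_def cochain_simps compose_def
 by (auto simp: fun_eq_iff restrict_def)

lemma cocycleI:
 assumes "f \<in> lin S (P n) Y" "!!x. x \<in> carrier (P (Suc n)) ==> f (d n x) = \<zero>\<^bsub>Y\<^esub>"
 shows "(onP n (%x. f x)) \<in> ZC Y n"
 unfolding cocycles_iff using lin_restrict[OF P_mod assms(1)] assms(2) by (simp add: d_closed)

lemma cocycle_hom: "f \<in> ZC Y n ==> f \<in> module_hom S (P n) Y"
 by (simp add: cocycles_iff)

lemma cocycle_lin: "f \<in> ZC Y n ==> f \<in> lin S (P n) Y"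
 by (simp add: cocycles_iff module_hom_iff)

lemma cocycle_d: "f \<in> ZC Y n ==> x \<in> carrier (P (Suc n)) ==> f (d n x) = \<zero>\<^bsub>Y\<^esub>"
 by (simp add: cocycles_iff)

lemma coboundaries_iff:
 "b \<in> BC Y n \<longleftrightarrow>
  (n = 0 \<and> b = (onP 0 (%x. \<zero>\<^bsub>Y\<^esub>))) \<or>
  (\<exists>m \<gamma>. n = Suc m \<and> \<gamma> \<in> module_hom S (P m) Y \<and> b = (onP n (%x. \<gamma> (d m x))))"
 unfolding coboundaries_def coboundary_map_def cochain_simps compose_def
 by (cases n) auto

lemma coboundaryI:
 assumes "g \<in> lin S (P m) Y"
 shows "(onP (Suc m) (%x. g (d m x))) \<in> BC Y (Suc m)"
 unfolding coboundaries_iff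
 by (intro disjI2 exI[of _ m] exI[of _ "\<lambda>x\<in>carrier (P m). g x"])
  (use lin_restrict[OF P_mod assms] in \<open>auto simp: d_closed intro!: restrict_ext\<close>)

lemma coboundary_zero:
 assumes "left_module S Y"
 shows "(onP n (%x. \<zero>\<^bsub>Y\<^esub>)) \<in> BC Y n"
proof (cases n)
 case (Suc m) then show ?thesis using coboundaryI[OF lin_null[OF P_mod[of m] assms]] by simp
qed (simp add: coboundaries_iff)

lemma coboundary_hom:
 assumes Y: "left_module S Y" and b: "b \<in> BC Y n"
 shows "b \<in> module_hom S (P n) Y"
 using b unfolding coboundaries_iff
proof (elim disjE exE conjE)
 show "b = (onP 0 (%x. \<zero>\<^bsub>Y\<^esub>)) ==> n = 0 ==> ?thesis"
  using lin_restrict[OF P_mod lin_null[OF P_mod[of 0] Y]] by simp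
 show "?thesis" if "n = Suc m" "\<gamma> \<in> module_hom S (P m) Y" "b = (onP n (%x. \<gamma> (d m x)))" for m \<gamma>
  using lin_restrict[OF P_mod lin_comp[OF d_lin module_hom_lin[OF that(2)]]] that by simp
qed

lemma coboundary_cocycle:
 assumes Y: "left_module S Y" and b: "b \<in> BC Y n"
 shows "b \<in> ZC Y n"
 unfolding cocycles_iff
proof (intro conjI ballI coboundary_hom[OF assms])
 fix x assume x: "x \<in> carrier (P (Suc n))"
 show "b (d n x) = \<zero>\<^bsub>Y\<^esub>" using b unfolding coboundaries_iff
 proof (elim disjE exE conjE)
  show "?thesis" if "n = Suc m" "\<gamma> \<in> module_hom S (P m) Y" "b = (onP n (%x. \<gamma> (d m x)))" for m \<gamma>
   using that x dd[of x m] d_closed[OF x] lin_zero[OF P_mod Y module_hom_lin[OF that(2)]] by simp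
 qed (use d_closed[OF x] in simp)
qed

lemma coboundary_image:
 assumes Y: "left_module S Y" and Z: "left_module S Z" and g: "g \<in> lin S Y Z" and b: "b \<in> BC Y n"
 shows "(onP n (%x. g (b x))) \<in> BC Z n"
 using b unfolding coboundaries_iff[of b]
proof (elim disjE exE conjE)
 assume "n = 0" "b = (onP 0 (%x. \<zero>\<^bsub>Y\<^esub>))"
 then have "(onP n (%x. g (b x))) = (onP n (%x. \<zero>\<^bsub>Z\<^esub>))"
  using lin_zero[OF Y Z g] by (auto intro!: restrict_ext)
 then show ?thesis using coboundary_zero[OF Z] by simp
next
 fix m \<gamma> assume h: "n = Suc m" "\<gamma> \<in> module_hom S (P m) Y" "b = (onP n (%x. \<gamma> (d m x)))"
 have "(onP n (%x. g (b x))) = (onP (Suc m) (%x. g (\<gamma> (d m x))))"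
  using h by (auto intro!: restrict_ext)
 then show ?thesis using coboundaryI[OF lin_comp[OF module_hom_lin[OF h(2)] g]] h(1) by simp
qed

lemma cocycles_subgroup:
 assumes Y: "left_module S Y"
 shows "subgroup (ZC Y n) (cochain_group S P Y n)"
proof -
 interpret Y: left_module S Y by fact
 interpret C: comm_group "cochain_group S P Y n" by (rule cochain_comm_group[OF Y])
 show ?thesis
 proof (rule C.subgroupI)
  show "ZC Y n \<subseteq> carrier (cochain_group S P Y n)" by (auto simp: cochain_simps cocycle_hom)
  show "ZC Y n \<noteq> {}" using coboundary_cocycle[OF Y coboundary_zero[OF Y]] by auto
  show "inv\<^bsub>cochain_group S P Y n\<^esub> a \<in> ZC Y n" if "a \<in> ZC Y n" for a
   unfolding cochain_inv[OF Y cocycle_hom[OF that]]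
   by (rule cocycleI) (use that in \<open>auto simp: cocycle_d intro: lin_neg[OF P_mod Y cocycle_lin]\<close>)
  show "a \<otimes>\<^bsub>cochain_group S P Y n\<^esub> b \<in> ZC Y n"
   if "a \<in> ZC Y n" "b \<in> ZC Y n" for a b
   unfolding cochain_simps
   by (rule cocycleI) (use that in \<open>auto simp: cocycle_d intro: lin_plus[OF P_mod Y cocycle_lin cocycle_lin]\<close>)
 qed
qed

lemma coboundaries_subgroup:
 assumes Y: "left_module S Y"
 shows "subgroup (BC Y n) (cochain_group S P Y n)"
proof -
 interpret Y: left_module S Y by fact
 interpret C: comm_group "cochain_group S P Y n" by (rule cochain_comm_group[OF Y])
 show ?thesis
 proof (rule C.subgroupI)
  show "BC Y n \<subseteq> carrier (cochain_group S P Y n)" by (auto simp: cochain_simps coboundary_hom[OF Y])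
  show "BC Y n \<noteq> {}" using coboundary_zero[OF Y] by auto
  show "inv\<^bsub>cochain_group S P Y n\<^esub> a \<in> BC Y n" if "a \<in> BC Y n" for a
   unfolding cochain_inv[OF Y coboundary_hom[OF Y that]]
   by (rule coboundary_image[OF Y Y _ that]) (rule lin_neg[OF Y Y lin_id])
  show "a \<otimes>\<^bsub>cochain_group S P Y n\<^esub> b \<in> BC Y n"
   if a: "a \<in> BC Y n" and b: "b \<in> BC Y n" for a b
  proof (cases n)
   case 0
   then have "a \<otimes>\<^bsub>cochain_group S P Y n\<^esub> b = (onP n (%x. \<zero>\<^bsub>Y\<^esub>))"
    unfolding cochain_simps using a b by (auto simp: coboundaries_iff intro!: restrict_ext)
   then show ?thesis using coboundary_zero[OF Y] by simp
  next
   case (Suc m)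
   then obtain \<gamma> \<gamma>' where h: "\<gamma> \<in> module_hom S (P m) Y" "a = (onP n (%x. \<gamma> (d m x)))"
     "\<gamma>' \<in> module_hom S (P m) Y" "b = (onP n (%x. \<gamma>' (d m x)))"
    using a b by (auto simp: coboundaries_iff)
   have "a \<otimes>\<^bsub>cochain_group S P Y n\<^esub> b = (onP (Suc m) (%x. \<gamma> (d m x) \<oplus>\<^bsub>Y\<^esub> \<gamma>' (d m x)))"
    unfolding cochain_simps using h Suc by (auto intro!: restrict_ext)
   then show ?thesis
    using coboundaryI[OF lin_plus[OF P_mod Y module_hom_lin[OF h(1)] module_hom_lin[OF h(3)]]] Suc by simp
  qed
 qed
qed


lemma Ext_comm_group:
 assumes Y: "left_module S Y"
 shows "comm_group (ExtG Y n)"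
proof -
 interpret C: comm_group "cochain_group S P Y n" by (rule cochain_comm_group[OF Y])
 interpret Z: comm_group "(cochain_group S P Y n)\<lparr>carrier := ZC Y n\<rparr>"
  by (rule group.group_comm_groupI[OF C.subgroup_imp_group[OF cocycles_subgroup[OF Y]]])
   (use subgroup.subset[OF cocycles_subgroup[OF Y]] in \<open>simp add: C.m_comm subset_iff\<close>)
 have "subgroup (BC Y n) ((cochain_group S P Y n)\<lparr>carrier := ZC Y n\<rparr>)"
  by (rule C.subgroup_incl[OF coboundaries_subgroup[OF Y] cocycles_subgroup[OF Y]])
   (use coboundary_cocycle[OF Y] in blast)
 then show ?thesis unfolding Ext_group_def by (rule Z.abelian_FactGroup)
qed

lemma Ext_carrier: "carrier (ExtG Y n) = cls Y n ` ZC Y n"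
 by (simp add: Ext_group_def carrier_FactGroup Ext_class_def r_coset_def)

lemma Ext_class_closed: "f \<in> ZC Y n ==> cls Y n f \<in> carrier (ExtG Y n)"
 by (simp add: Ext_carrier)

lemma Ext_class_mult:
 assumes Y: "left_module S Y" and f: "f \<in> ZC Y n" and g: "g \<in> ZC Y n"
 shows "cls Y n f \<otimes>\<^bsub>ExtG Y n\<^esub> cls Y n g =
  cls Y n (onP n (%x. f x \<oplus>\<^bsub>Y\<^esub> g x))"
proof -
 interpret C: comm_group "cochain_group S P Y n" by (rule cochain_comm_group[OF Y])
 interpret B: normal "BC Y n" "cochain_group S P Y n"
  by (rule C.subgroup_imp_normal[OF coboundaries_subgroup[OF Y]])
 have "cls Y n f <#>\<^bsub>cochain_group S P Y n\<^esub> cls Y n g =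
   BC Y n #>\<^bsub>cochain_group S P Y n\<^esub> (f \<otimes>\<^bsub>cochain_group S P Y n\<^esub> g)"
  unfolding Ext_class_def by (rule B.rcos_sum) (use f g in \<open>simp_all add: cochain_simps cocycle_hom\<close>)
 then show ?thesis by (simp add: Ext_group_def Ext_class_def cochain_simps set_mult_def)
qed

lemma Ext_class_mem_iff:
 "f' \<in> cls Y n f \<longleftrightarrow>
  (\<exists>b\<in>BC Y n. f' = (onP n (%x. b x \<oplus>\<^bsub>Y\<^esub> f x)))"
 by (simp add: Ext_class_def r_coset_def cochain_simps)

lemma Ext_class_self:
 assumes Y: "left_module S Y" and f: "f \<in> ZC Y n"
 shows "f \<in> cls Y n f"
proof -
 interpret C: comm_group "cochain_group S P Y n" by (rule cochain_comm_group[OF Y])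
 show ?thesis unfolding Ext_class_def
  by (rule C.rcos_self[OF _ coboundaries_subgroup[OF Y]]) (use f in \<open>simp add: cochain_simps cocycle_hom\<close>)
qed

lemma Ext_class_eqI:
 assumes Y: "left_module S Y" and f: "f \<in> module_hom S (P n) Y" and g: "g \<in> module_hom S (P n) Y"
  and b: "b \<in> BC Y n" and eq: "!!x. x \<in> carrier (P n) ==> f x = b x \<oplus>\<^bsub>Y\<^esub> g x"
 shows "cls Y n f = cls Y n g"
proof -
 interpret C: comm_group "cochain_group S P Y n" by (rule cochain_comm_group[OF Y])
 have "f \<in> cls Y n g" unfolding Ext_class_mem_iff
  by (rule bexI[OF _ b]) (use f eq in \<open>auto simp: module_hom_iff restrict_def extensional_def\<close>)
 then show ?thesis unfolding Ext_class_def
  by (intro C.repr_independence[symmetric] coboundaries_subgroup[OF Y]) (use g in \<open>simp_all add: cochain_simps\<close>)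
qed

lemma Ext_class_eqD:
 assumes Y: "left_module S Y" and f: "f \<in> ZC Y n"
  and eq: "cls Y n f = cls Y n g"
 shows "\<exists>b\<in>BC Y n. \<forall>x\<in>carrier (P n). f x = b x \<oplus>\<^bsub>Y\<^esub> g x"
proof -
 have "f \<in> cls Y n g" using Ext_class_self[OF Y f] eq by simp
 then show ?thesis unfolding Ext_class_mem_iff by (auto intro!: bexI)
qed

lemma Ext_class_memD:
 assumes Y: "left_module S Y" and f: "f \<in> ZC Y n" and f': "f' \<in> cls Y n f"
 shows "f' \<in> ZC Y n" "cls Y n f' = cls Y n f"
proof -
 obtain b where b: "b \<in> BC Y n" "f' = (onP n (%x. b x \<oplus>\<^bsub>Y\<^esub> f x))"
  using f' unfolding Ext_class_mem_iff by auto
 have "b \<otimes>\<^bsub>cochain_group S P Y n\<^esub> f \<in> ZC Y n"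
  by (rule subgroup.m_closed[OF cocycles_subgroup[OF Y] coboundary_cocycle[OF Y b(1)] f])
 then show 1: "f' \<in> ZC Y n" by (simp add: b(2) cochain_simps)
 show "cls Y n f' = cls Y n f"
  by (rule Ext_class_eqI[OF Y cocycle_hom[OF 1] cocycle_hom[OF f] b(1)]) (simp add: b(2))
qed

lemma Ext_one:
 assumes Y: "left_module S Y"
 shows "\<one>\<^bsub>ExtG Y n\<^esub> = cls Y n (onP n (%x. \<zero>\<^bsub>Y\<^esub>))"
proof -
 interpret C: comm_group "cochain_group S P Y n" by (rule cochain_comm_group[OF Y])
 have "cls Y n (\<one>\<^bsub>cochain_group S P Y n\<^esub>) = BC Y n"
  unfolding Ext_class_def by (rule C.coset_mult_one) (use coboundary_hom[OF Y] in \<open>auto simp: cochain_simps\<close>)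
 then show ?thesis by (simp add: Ext_group_def cochain_simps)
qed

lemma Ext_class_inv:
 assumes Y: "left_module S Y" and f: "f \<in> ZC Y n"
 shows "inv\<^bsub>ExtG Y n\<^esub> cls Y n f = cls Y n (onP n (%x. \<ominus>\<^bsub>Y\<^esub> f x))"
proof -
 interpret Y: left_module S Y by fact
 interpret E: comm_group "ExtG Y n" by (rule Ext_comm_group[OF Y])
 have n: "(onP n (%x. \<ominus>\<^bsub>Y\<^esub> f x)) \<in> ZC Y n"
  by (rule cocycleI) (use f in \<open>auto simp: cocycle_d intro: lin_neg[OF P_mod Y cocycle_lin]\<close>)
 show ?thesis
 proof (rule E.inv_equality)
  have "(onP n (%x. (onP n (%x. \<ominus>\<^bsub>Y\<^esub> f x)) x \<oplus>\<^bsub>Y\<^esub> f x)) = (onP n (%x. \<zero>\<^bsub>Y\<^esub>))"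
   by (rule restrict_ext) (use hom_closed[OF cocycle_hom[OF f]] in \<open>simp add: Y.M.l_neg\<close>)
  then show "cls Y n (onP n (%x. \<ominus>\<^bsub>Y\<^esub> f x)) \<otimes>\<^bsub>ExtG Y n\<^esub> cls Y n f =
    \<one>\<^bsub>ExtG Y n\<^esub>"
   by (simp only: Ext_class_mult[OF Y n f] Ext_one[OF Y])
 qed (use n f in \<open>simp_all add: Ext_class_closed\<close>)
qed

end

section \<open>Lifting cocycles to chain maps\<close>

definition aug_exact ::
 "('s, 'z) ring_scheme \<Rightarrow> (nat \<Rightarrow> ('s, 'c) module) \<Rightarrow> (nat \<Rightarrow> 'c \<Rightarrow> 'c) \<Rightarrow> ('c \<Rightarrow> 'x)
  \<Rightarrow> ('s, 'x) module \<Rightarrow> bool" where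
 "aug_exact S C c \<eta> V \<longleftrightarrow> left_module S V \<and> (\<forall>n. left_module S (C n)) \<and>
  (\<forall>n. c n \<in> lin S (C (Suc n)) (C n)) \<and> \<eta> \<in> lin S (C 0) V \<and>
  \<eta> ` carrier (C 0) = carrier V \<and>
  c 0 ` carrier (C (Suc 0)) = {x \<in> carrier (C 0). \<eta> x = \<zero>\<^bsub>V\<^esub>} \<and>
  (\<forall>n. c (Suc n) ` carrier (C (Suc (Suc n))) = {x \<in> carrier (C (Suc n)). c n x = \<zero>\<^bsub>C n\<^esub>})"

lemma aug_exactD:
 assumes "aug_exact S C c \<eta> V"
 shows "left_module S V" "left_module S (C n)" "c n \<in> lin S (C (Suc n)) (C n)" "\<eta> \<in> lin S (C 0) V"
  "\<eta> ` carrier (C 0) = carrier V" "c 0 ` carrier (C (Suc 0)) = {x \<in> carrier (C 0). \<eta> x = \<zero>\<^bsub>V\<^esub>}"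
  "c (Suc n) ` carrier (C (Suc (Suc n))) = {x \<in> carrier (C (Suc n)). c n x = \<zero>\<^bsub>C n\<^esub>}"
 using assms unfolding aug_exact_def by simp_all

lemma aug_exact_dd:
 assumes "aug_exact S C c \<eta> V" "x \<in> carrier (C (Suc (Suc n)))"
 shows "c n (c (Suc n) x) = \<zero>\<^bsub>C n\<^esub>"
 using imageI[OF assms(2), of "c (Suc n)"] unfolding aug_exactD(7)[OF assms(1)] by simp

lemma aug_exact_eps:
 assumes "aug_exact S C c \<eta> V" "x \<in> carrier (C (Suc 0))"
 shows "\<eta> (c 0 x) = \<zero>\<^bsub>V\<^esub>"
 using imageI[OF assms(2), of "c 0"] unfolding aug_exactD(6)[OF assms(1)] by simp

lemma projective_resolution_aug_exact:
 assumes "projective_resolution S P d \<epsilon> V" "left_module S V"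
 shows "aug_exact S P d \<epsilon> V"
 using assms unfolding projective_resolution_def aug_exact_def
 by (simp add: module_hom_lin projective_module_def)

lemma chain_liftsD:
 assumes "h \<in> chain_lifts S P d C c \<eta> n g"
 shows "h i \<in> module_hom S (P (n + i)) (C i)" "x \<in> carrier (P n) ==> \<eta> (h 0 x) = g x"
  "x \<in> carrier (P (Suc (n + i))) ==> c i (h (Suc i) x) = h i (d (n + i) x)"
 using assms by (auto simp: chain_lifts_def)

locale proj_complex = mod_complex +
 assumes P_proj: "projective_module S (P n)"
begin

lemma lift_exists:
 assumes C: "aug_exact S C c \<eta> V" and g: "g \<in> lin S (P n) V"
  and gd: "!!x. x \<in> carrier (P (Suc n)) ==> g (d n x) = \<zero>\<^bsub>V\<^esub>"
 shows "\<exists>h. h \<in> chain_lifts S P d C c \<eta> n g"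
proof -
 note CD = aug_exactD[OF C]
 define good where "good = (%i h. h \<in> module_hom S (P (n + i)) (C i) \<and>
  (i = 0 \<longrightarrow> (\<forall>x\<in>carrier (P n). \<eta> (h x) = g x)) \<and>
  (\<forall>j. i = Suc j \<longrightarrow> (\<forall>x\<in>carrier (P (Suc (n + i))). c j (h (d (n + i) x)) = \<zero>\<^bsub>C j\<^esub>)))"
 have "\<exists>h. \<forall>i. good i (h i) \<and> (\<forall>x\<in>carrier (P (Suc (n + i))). c i (h (Suc i) x) = h i (d (n + i) x))"
 proof (rule dependent_nat_choice)
  have im: "g ` carrier (P n) \<subseteq> \<eta> ` carrier (C 0)" using lin_closed[OF g] CD(5) by auto
  obtain h where "h \<in> module_hom S (P n) (C 0)" "!!x. x \<in> carrier (P n) ==> \<eta> (h x) = g x"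
   using projective_lift[OF P_proj CD(2) CD(1) CD(4) g im] by auto
  then show "\<exists>h. good 0 h" unfolding good_def by auto
 next
  fix h i assume h: "good i h"
  then have hh: "h \<in> module_hom S (P (n + i)) (C i)" by (simp add: good_def)
  let ?f = "%x. h (d (n + i) x)"
  have f: "?f \<in> lin S (P (Suc (n + i))) (C i)" by (rule lin_comp[OF d_lin module_hom_lin[OF hh]])
  have im: "?f ` carrier (P (Suc (n + i))) \<subseteq> c i ` carrier (C (Suc i))"
  proof (rule image_subsetI)
   fix x assume x: "x \<in> carrier (P (Suc (n + i)))"
   show "?f x \<in> c i ` carrier (C (Suc i))"
   proof (cases i)
    case 0
    then show ?thesis using x h lin_closed[OF f x] gd[of x] d_closed[of x n] by (simp add: CD(6) good_def)
   next
    case (Suc j)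
    then show ?thesis using x h lin_closed[OF f x] unfolding Suc CD(7) by (simp add: good_def Suc)
   qed
  qed
  obtain h' where h': "h' \<in> module_hom S (P (Suc (n + i))) (C (Suc i))"
    "!!x. x \<in> carrier (P (Suc (n + i))) ==> c i (h' x) = ?f x"
   using projective_lift[OF P_proj CD(2) CD(2) CD(3) f im] by auto
  have "c i (h' (d (n + Suc i) x)) = \<zero>\<^bsub>C i\<^esub>" if "x \<in> carrier (P (Suc (n + Suc i)))" for x
   using that h'(2)[of "d (Suc (n + i)) x"] d_closed[of x "Suc (n + i)"] dd[of x "n + i"]
    lin_zero[OF P_mod CD(2) module_hom_lin[OF hh]] by simp
  then have "good (Suc i) h'" using h'(1) by (simp add: good_def)
  then show "\<exists>h'. good (Suc i) h' \<and> (\<forall>x\<in>carrier (P (Suc (n + i))). c i (h' x) = ?f x)"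
   using h'(2) by blast
 qed
 then obtain h where "!!i. good i (h i)"
   "!!i x. x \<in> carrier (P (Suc (n + i))) ==> c i (h (Suc i) x) = h i (d (n + i) x)" by blast
 then have "h \<in> chain_lifts S P d C c \<eta> n g"
  unfolding chain_lifts_def good_def by auto
 then show ?thesis by (rule exI[of _ h])
qed

lemma null_lift:
 assumes C: "aug_exact S C c \<eta> V" and k: "k \<in> chain_lifts S P d C c \<eta> n \<beta>"
  and \<beta>: "\<beta> \<in> BC V n"
 shows "\<exists>t\<in>BC (C i) (n + i). \<exists>s\<in>module_hom S (P (n + i)) (C (Suc i)).
  \<forall>x\<in>carrier (P (n + i)). k i x = t x \<oplus>\<^bsub>C i\<^esub> c i (s x)"
proof -
 note CD = aug_exactD[OF C]
 note kD = chain_liftsD[OF k]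
 have split: "\<exists>s\<in>module_hom S (P (n + i)) (C (Suc i)). \<forall>x\<in>carrier (P (n + i)). k i x = t x \<oplus>\<^bsub>C i\<^esub> c i (s x)"
  if t: "t \<in> module_hom S (P (n + i)) (C i)"
   and ker: "!!x. x \<in> carrier (P (n + i)) ==> k i x \<ominus>\<^bsub>C i\<^esub> t x \<in> c i ` carrier (C (Suc i))" for i t
 proof -
  interpret Ci: left_module S "C i" by (rule CD(2))
  have l: "(%x. k i x \<ominus>\<^bsub>C i\<^esub> t x) \<in> lin S (P (n + i)) (C i)"
   by (rule lin_diff[OF P_mod CD(2) module_hom_lin[OF kD(1)] module_hom_lin[OF t]])
  have im: "(%x. k i x \<ominus>\<^bsub>C i\<^esub> t x) ` carrier (P (n + i)) \<subseteq> c i ` carrier (C (Suc i))"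
   using ker by auto
  obtain s where s: "s \<in> module_hom S (P (n + i)) (C (Suc i))"
    "!!x. x \<in> carrier (P (n + i)) ==> c i (s x) = k i x \<ominus>\<^bsub>C i\<^esub> t x"
   using projective_lift[OF P_proj CD(2) CD(2) CD(3) l im] by auto
  have "k i x = t x \<oplus>\<^bsub>C i\<^esub> c i (s x)" if "x \<in> carrier (P (n + i))" for x
   using hom_closed[OF kD(1) that] hom_closed[OF t that] s(2)[OF that]
   by (simp add: Ci.M.add_minus_cancel)
  then show ?thesis using s(1) by blast
 qed
 show ?thesis
 proof (induction i)
  case 0
  have "\<exists>t\<in>BC (C 0) n. \<forall>x\<in>carrier (P n). \<eta> (t x) = \<beta> x"
   using \<beta> unfolding coboundaries_iff[of \<beta>]
  proof (elim disjE exE conjE)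
   assume "n = 0" "\<beta> = (onP 0 (%x. \<zero>\<^bsub>V\<^esub>))"
   then show ?thesis
    using coboundary_zero[OF CD(2)[of 0], of n] lin_zero[OF CD(2) CD(1) CD(4)]
    by (intro bexI[of _ "\<lambda>x\<in>carrier (P n). \<zero>\<^bsub>C 0\<^esub>"]) simp_all
  next
   fix m \<gamma> assume h: "n = Suc m" "\<gamma> \<in> module_hom S (P m) V" "\<beta> = (onP n (%x. \<gamma> (d m x)))"
   have im: "\<gamma> ` carrier (P m) \<subseteq> \<eta> ` carrier (C 0)" using hom_closed[OF h(2)] CD(5) by auto
   obtain g where g: "g \<in> module_hom S (P m) (C 0)" "!!x. x \<in> carrier (P m) ==> \<eta> (g x) = \<gamma> x"
    using projective_lift[OF P_proj CD(2) CD(1) CD(4) module_hom_lin[OF h(2)] im] by auto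
   show ?thesis
    by (rule bexI[OF _ coboundaryI[OF module_hom_lin[OF g(1)], folded h(1)]])
     (use h(1) in \<open>simp add: h(3) g(2) d_closed\<close>)
  qed
  then obtain t where t: "t \<in> BC (C 0) n" "!!x. x \<in> carrier (P n) ==> \<eta> (t x) = \<beta> x"
   by blast
  have th: "t \<in> module_hom S (P n) (C 0)" by (rule coboundary_hom[OF CD(2) t(1)])
  interpret V: left_module S V by (rule CD(1))
  interpret C0: left_module S "C 0" by (rule CD(2))
  have "k 0 x \<ominus>\<^bsub>C 0\<^esub> t x \<in> c 0 ` carrier (C (Suc 0))" if x: "x \<in> carrier (P n)" for x
  proof -
   have c: "k 0 x \<in> carrier (C 0)" "t x \<in> carrier (C 0)"
    using hom_closed[OF kD(1)[of 0]] hom_closed[OF th] x by simp_all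
   have "\<eta> (k 0 x \<ominus>\<^bsub>C 0\<^esub> t x) = \<beta> x \<ominus>\<^bsub>V\<^esub> \<beta> x"
    by (simp add: lin_minus[OF CD(2) CD(1) CD(4) c] kD(2) t(2) x)
   also have "\<dots> = \<zero>\<^bsub>V\<^esub>"
    using hom_closed[OF coboundary_hom[OF CD(1) \<beta>] x] by (simp add: a_minus_def V.M.r_neg)
   finally show ?thesis unfolding CD(6) using c by simp
  qed
  then show ?case using split[of t 0] th t(1) by auto
 next
  case (Suc i)
  then obtain t s where t: "t \<in> BC (C i) (n + i)"
    and s: "s \<in> module_hom S (P (n + i)) (C (Suc i))"
    and ks: "!!x. x \<in> carrier (P (n + i)) ==> k i x = t x \<oplus>\<^bsub>C i\<^esub> c i (s x)"
   by blast
  define t' where "t' = (\<lambda>x\<in>carrier (P (Suc (n + i))). s (d (n + i) x))"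
  have t': "t' \<in> BC (C (Suc i)) (n + Suc i)"
   using coboundaryI[OF module_hom_lin[OF s]] by (simp add: t'_def)
  have th: "t' \<in> module_hom S (P (n + Suc i)) (C (Suc i))" by (rule coboundary_hom[OF CD(2) t'])
  interpret Ci: left_module S "C i" by (rule CD(2))
  interpret CS: left_module S "C (Suc i)" by (rule CD(2))
  have "k (Suc i) x \<ominus>\<^bsub>C (Suc i)\<^esub> t' x \<in> c (Suc i) ` carrier (C (Suc (Suc i)))"
   if x: "x \<in> carrier (P (n + Suc i))" for x
  proof -
   have x': "x \<in> carrier (P (Suc (n + i)))" using x by simp
   note dx = d_closed[OF x']
   have c: "k (Suc i) x \<in> carrier (C (Suc i))" "t' x \<in> carrier (C (Suc i))"
    using hom_closed[OF kD(1) x] hom_closed[OF th x] by simp_all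
   have cs: "c i (s (d (n + i) x)) \<in> carrier (C i)" by (rule lin_closed[OF CD(3) hom_closed[OF s dx]])
   have "c i (k (Suc i) x \<ominus>\<^bsub>C (Suc i)\<^esub> t' x) = k i (d (n + i) x) \<ominus>\<^bsub>C i\<^esub> c i (s (d (n + i) x))"
    unfolding lin_minus[OF CD(2) CD(2) CD(3) c] using x' by (simp add: kD(3) t'_def)
   also have "\<dots> = \<zero>\<^bsub>C i\<^esub>"
    using ks[OF dx] cocycle_d[OF coboundary_cocycle[OF CD(2) t] x'] cs by (simp add: a_minus_def Ci.M.r_neg)
   finally show ?thesis unfolding CD(7) using c by simp
  qed
  then show ?case using split[of t' "Suc i"] th t' by blast
 qed
qed

lemma lift_pairing_cocycle:
 assumes C: "aug_exact S C c \<eta> V" and h: "h \<in> chain_lifts S P d C c \<eta> n g"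
  and Y: "left_module S Y" and F: "F \<in> lin S (C m) Y"
  and Fc: "!!x. x \<in> carrier (C (Suc m)) ==> F (c m x) = \<zero>\<^bsub>Y\<^esub>"
 shows "(onP (m + n) (%x. F (h m x))) \<in> ZC Y (m + n)"
 unfolding add.commute[of m n]
proof (rule cocycleI)
 show "(%x. F (h m x)) \<in> lin S (P (n + m)) Y"
  by (rule lin_comp[OF module_hom_lin[OF chain_liftsD(1)[OF h]] F])
 show "F (h m (d (n + m) x)) = \<zero>\<^bsub>Y\<^esub>" if "x \<in> carrier (P (Suc (n + m)))" for x
  using Fc[of "h (Suc m) x"] hom_closed[OF chain_liftsD(1)[OF h, of "Suc m"]] that
  by (simp add: chain_liftsD(3)[OF h that])
qed

lemma lift_pairing_null:
 assumes C: "aug_exact S C c \<eta> V" and k: "k \<in> chain_lifts S P d C c \<eta> n \<beta>"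
  and \<beta>: "\<beta> \<in> BC V n" and Y: "left_module S Y" and F: "F \<in> lin S (C m) Y"
  and Fc: "!!x. x \<in> carrier (C (Suc m)) ==> F (c m x) = \<zero>\<^bsub>Y\<^esub>"
 shows "(onP (m + n) (%x. F (k m x))) \<in> BC Y (m + n)"
 unfolding add.commute[of m n]
proof -
 note CD = aug_exactD[OF C]
 interpret Y: left_module S Y by fact
 obtain t s where t: "t \<in> BC (C m) (n + m)" and s: "s \<in> module_hom S (P (n + m)) (C (Suc m))"
  and ks: "!!x. x \<in> carrier (P (n + m)) ==> k m x = t x \<oplus>\<^bsub>C m\<^esub> c m (s x)"
  using null_lift[OF C k \<beta>, of m] by blast
 have "(onP (n + m) (%x. F (k m x))) = (onP (n + m) (%x. F (t x)))"
 proof (rule restrict_ext)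
  fix x assume x: "x \<in> carrier (P (n + m))"
  note sx = hom_closed[OF s x] and tx = hom_closed[OF coboundary_hom[OF CD(2) t] x]
  show "F (k m x) = F (t x)"
   using lin_closed[OF F tx]
   by (simp add: ks[OF x] lin_add[OF F tx lin_closed[OF CD(3) sx]] Fc[OF sx])
 qed
 then show "(onP (n + m) (%x. F (k m x))) \<in> BC Y (n + m)"
  using coboundary_image[OF CD(2) Y F t] by simp
qed

lemma lift_diff:
 assumes C: "aug_exact S C c \<eta> V" and h: "h \<in> chain_lifts S P d C c \<eta> n g"
  and h': "h' \<in> chain_lifts S P d C c \<eta> n g'"
  and b: "!!x. x \<in> carrier (P n) ==> g x \<ominus>\<^bsub>V\<^esub> g' x = b x"
 shows "(%i. \<lambda>x\<in>carrier (P (n + i)). h i x \<ominus>\<^bsub>C i\<^esub> h' i x) \<in> chain_lifts S P d C c \<eta> n b"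
 unfolding chain_lifts_def
proof (intro CollectI conjI allI ballI)
 note CD = aug_exactD[OF C] and D = chain_liftsD[OF h] and D' = chain_liftsD[OF h']
 show "(onP (n + i) (%x. h i x \<ominus>\<^bsub>C i\<^esub> h' i x)) \<in> module_hom S (P (n + i)) (C i)" for i
  by (rule lin_restrict[OF P_mod lin_diff[OF P_mod CD(2) module_hom_lin[OF D(1)] module_hom_lin[OF D'(1)]]])
 show "\<eta> ((onP (n + 0) (%x. h 0 x \<ominus>\<^bsub>C 0\<^esub> h' 0 x)) x) = b x" if "x \<in> carrier (P n)" for x
  using that hom_closed[OF D(1)[of 0]] hom_closed[OF D'(1)[of 0]]
  by (simp add: lin_minus[OF CD(2) CD(1) CD(4)] D(2) D'(2) b)
 show "c i ((onP (n + Suc i) (%x. h (Suc i) x \<ominus>\<^bsub>C (Suc i)\<^esub> h' (Suc i) x)) x) =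
   (onP (n + i) (%x. h i x \<ominus>\<^bsub>C i\<^esub> h' i x)) (d (n + i) x)"
  if x: "x \<in> carrier (P (Suc (n + i)))" for i x
  using x hom_closed[OF D(1)[of "Suc i"]] hom_closed[OF D'(1)[of "Suc i"]]
  by (simp add: lin_minus[OF CD(2) CD(2) CD(3)] D(3) D'(3) d_closed)
qed

lemma lift_pairing_unique:
 assumes C: "aug_exact S C c \<eta> V" and h: "h \<in> chain_lifts S P d C c \<eta> n g"
  and h': "h' \<in> chain_lifts S P d C c \<eta> n g'"
  and g: "g \<in> ZC V n" and g': "g' \<in> ZC V n"
  and eq: "cls V n g = cls V n g'"
  and Y: "left_module S Y" and F: "F \<in> lin S (C m) Y"
  and Fc: "!!x. x \<in> carrier (C (Suc m)) ==> F (c m x) = \<zero>\<^bsub>Y\<^esub>"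
 shows "cls Y (m + n) (onP (m + n) (%x. F (h m x))) =
  cls Y (m + n) (onP (m + n) (%x. F (h' m x)))"
proof -
 note CD = aug_exactD[OF C] and D = chain_liftsD[OF h] and D' = chain_liftsD[OF h']
 interpret V: left_module S V by (rule CD(1))
 interpret Y: left_module S Y by fact
 obtain b where b: "b \<in> BC V n" "!!x. x \<in> carrier (P n) ==> g x = b x \<oplus>\<^bsub>V\<^esub> g' x"
  using Ext_class_eqD[OF CD(1) g eq] by auto
 have "g x \<ominus>\<^bsub>V\<^esub> g' x = b x" if "x \<in> carrier (P n)" for x
  using b(2)[OF that] hom_closed[OF coboundary_hom[OF CD(1) b(1)] that] hom_closed[OF cocycle_hom[OF g'] that]
  by (simp add: a_minus_def V.M.a_assoc V.M.r_neg)
 then have k: "(%i. \<lambda>x\<in>carrier (P (n + i)). h i x \<ominus>\<^bsub>C i\<^esub> h' i x) \<in> chain_lifts S P d C c \<eta> n b"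
  by (rule lift_diff[OF C h h'])
 let ?b = "\<lambda>x\<in>carrier (P (m + n)). F ((onP (n + m) (%x. h m x \<ominus>\<^bsub>C m\<^esub> h' m x)) x)"
 have B: "?b \<in> BC Y (m + n)" by (rule lift_pairing_null[OF C k b(1) Y F Fc])
 show ?thesis
 proof (rule Ext_class_eqI[OF Y _ _ B])
  show "(onP (m + n) (%x. F (h m x))) \<in> module_hom S (P (m + n)) Y"
   by (rule cocycle_hom[OF lift_pairing_cocycle[OF C h Y F Fc]])
  show "(onP (m + n) (%x. F (h' m x))) \<in> module_hom S (P (m + n)) Y"
   by (rule cocycle_hom[OF lift_pairing_cocycle[OF C h' Y F Fc]])
  fix x assume "x \<in> carrier (P (m + n))"
  then have x: "x \<in> carrier (P (n + m))" by (simp add: add.commute)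
  note hx = hom_closed[OF D(1) x] and hx' = hom_closed[OF D'(1) x]
  show "(onP (m + n) (%x. F (h m x))) x = ?b x \<oplus>\<^bsub>Y\<^esub> (onP (m + n) (%x. F (h' m x))) x"
   using x lin_closed[OF F hx] lin_closed[OF F hx']
   by (simp add: add.commute[of m n] lin_minus[OF CD(2) Y F hx hx'] Y.M.add_minus_cancel)
 qed
qed

lemma lift_pairing_coboundary:
 assumes h: "h \<in> chain_lifts S P d C c \<eta> n g" and G: "G \<in> lin S (C j) Y"
 shows "(onP (Suc j + n) (%x. G (c j (h (Suc j) x)))) \<in> BC Y (Suc j + n)"
proof -
 note D = chain_liftsD[OF h]
 have "(\<lambda>x\<in>carrier (P (Suc (n + j))). G (h j (d (n + j) x))) \<in> BC Y (Suc (n + j))"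
  by (rule coboundaryI[OF lin_comp[OF module_hom_lin[OF D(1)] G]])
 moreover have "(onP (Suc j + n) (%x. G (c j (h (Suc j) x)))) =
   (\<lambda>x\<in>carrier (P (Suc (n + j))). G (h j (d (n + j) x)))"
  by (auto simp: D(3) add.commute intro!: restrict_ext)
 ultimately show ?thesis by (simp add: add.commute)
qed


lemma comp_lift_coboundary:
 assumes Y: "left_module S Y" and h: "h \<in> chain_lifts S P d P d \<epsilon> n g" and b: "b \<in> BC Y m"
 shows "(onP (m + n) (%x. b (h m x))) \<in> BC Y (m + n)"
 using b unfolding coboundaries_iff[of b]
proof (elim disjE exE conjE)
 have hc: "h m x \<in> carrier (P m)" if "x \<in> carrier (P (m + n))" for x
  using hom_closed[OF chain_liftsD(1)[OF h]] that by (simp add: add.commute)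
 show ?thesis if "m = 0" "b = (onP 0 (%x. \<zero>\<^bsub>Y\<^esub>))"
 proof -
  have "(onP (m + n) (%x. b (h m x))) = (onP (m + n) (%x. \<zero>\<^bsub>Y\<^esub>))"
   using hc that by (intro restrict_ext) simp
  then show ?thesis using coboundary_zero[OF Y] by simp
 qed
 show ?thesis if that: "m = Suc j" "\<gamma> \<in> module_hom S (P j) Y" "b = (onP m (%x. \<gamma> (d j x)))" for j \<gamma>
 proof -
  have "(onP (m + n) (%x. b (h m x))) = (onP (Suc j + n) (%x. \<gamma> (d j (h (Suc j) x))))"
   unfolding that(1,3) by (rule restrict_ext) (use hc that(1) in simp)
  then show ?thesis using lift_pairing_coboundary[OF h module_hom_lin[OF that(2)]] that(1) by simp
 qed
qed

lemma comp_lift_cocycle: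
 assumes exact: "aug_exact S P d \<epsilon> V" and Y: "left_module S Y"
  and f: "f \<in> ZC Y m" and h: "h \<in> chain_lifts S P d P d \<epsilon> n g"
 shows "(onP (m + n) (%x. f (h m x))) \<in> ZC Y (m + n)"
 by (rule lift_pairing_cocycle[OF exact h Y cocycle_lin[OF f] cocycle_d[OF f]])

lemma yoneda_Ext_class:
 assumes exact: "aug_exact S P d \<epsilon> V" and Y: "left_module S Y"
  and f: "f \<in> ZC Y m" and g: "g \<in> ZC V n"
  and h: "h \<in> chain_lifts S P d P d \<epsilon> n g"
 shows "yoneda S P d \<epsilon> Y m n (cls Y m f) (cls V n g) =
  cls Y (m + n) (onP (m + n) (%x. f (h m x)))"
proof -
 interpret Y: left_module S Y by fact
 note V = aug_exactD(1)[OF exact]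
 have *: "cls Y (m + n) (compose (carrier (P (m + n))) f' (h' m)) =
   cls Y (m + n) (onP (m + n) (%x. f (h m x)))"
  if f': "f' \<in> cls Y m f" and g': "g' \<in> cls V n g"
   and h': "h' \<in> chain_lifts S P d P d \<epsilon> n g'" for f' g' h'
 proof -
  note fc = Ext_class_memD[OF Y f f'] and gc = Ext_class_memD[OF V g g']
  have "cls Y (m + n) (onP (m + n) (%x. f' (h' m x))) =
    cls Y (m + n) (onP (m + n) (%x. f' (h m x)))"
   by (rule lift_pairing_unique[OF exact h' h gc(1) g gc(2) Y cocycle_lin[OF fc(1)] cocycle_d[OF fc(1)]])
  also obtain b where b: "b \<in> BC Y m" "!!x. x \<in> carrier (P m) ==> f' x = b x \<oplus>\<^bsub>Y\<^esub> f x"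
   using f' unfolding Ext_class_mem_iff by auto
  have "cls Y (m + n) (onP (m + n) (%x. f' (h m x))) =
    cls Y (m + n) (onP (m + n) (%x. f (h m x)))"
   by (rule Ext_class_eqI[OF Y cocycle_hom[OF comp_lift_cocycle[OF exact Y fc(1) h]]
      cocycle_hom[OF comp_lift_cocycle[OF exact Y f h]] comp_lift_coboundary[OF Y h b(1)]])
    (use hom_closed[OF chain_liftsD(1)[OF h, of m]] in \<open>simp add: b(2) add.commute\<close>)
  finally show ?thesis by (simp add: compose_def)
 qed
 show ?thesis unfolding yoneda_def
 proof (intro equalityI UN_least)
  show "cls Y (m + n) (onP (m + n) (%x. f (h m x))) \<subseteq>
   (\<Union>f\<in>cls Y m f. \<Union>g\<in>cls V n g. \<Union>h\<in>chain_lifts S P d P d \<epsilon> n g.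
    cls Y (m + n) (compose (carrier (P (m + n))) f (h m)))"
   using *[OF Ext_class_self[OF Y f] Ext_class_self[OF V g] h]
    Ext_class_self[OF Y f] Ext_class_self[OF V g] h by (intro subsetI UN_I) auto
 qed (simp add: *)
qed

lemma lift_exists_cocycle:
 assumes "aug_exact S C c \<eta> V" "g \<in> ZC V n"
 shows "\<exists>h. h \<in> chain_lifts S P d C c \<eta> n g"
 by (rule lift_exists[OF assms(1) cocycle_lin[OF assms(2)] cocycle_d[OF assms(2)]])

lemma yoneda_closed:
 assumes exact: "aug_exact S P d \<epsilon> V" and Y: "left_module S Y"
  and \<alpha>: "\<alpha> \<in> carrier (ExtG Y m)" and \<beta>: "\<beta> \<in> carrier (ExtG V n)"
 shows "yoneda S P d \<epsilon> Y m n \<alpha> \<beta> \<in> carrier (ExtG Y (m + n))"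
proof -
 obtain f g where fg: "f \<in> ZC Y m" "\<alpha> = cls Y m f"
   "g \<in> ZC V n" "\<beta> = cls V n g"
  using \<alpha> \<beta> by (auto simp: Ext_carrier)
 obtain h where h: "h \<in> chain_lifts S P d P d \<epsilon> n g" using lift_exists_cocycle[OF exact fg(3)] by auto
 show ?thesis unfolding fg(2,4) yoneda_Ext_class[OF exact Y fg(1,3) h]
  by (rule Ext_class_closed[OF comp_lift_cocycle[OF exact Y fg(1) h]])
qed

lemma aug_cocycle:
 assumes exact: "aug_exact S P d \<epsilon> V"
 shows "(onP 0 (%x. \<epsilon> x)) \<in> ZC V 0"
 by (rule cocycleI[OF aug_exactD(4)[OF exact] aug_exact_eps[OF exact]])

lemma id_lift: "(%i. \<lambda>x\<in>carrier (P i). x) \<in> chain_lifts S P d P d \<epsilon> 0 \<epsilon>"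
 unfolding chain_lifts_def using lin_restrict[OF P_mod lin_id] by (auto simp: d_closed)

lemma lift_cong:
 "(!!x. x \<in> carrier (P n) ==> g x = g' x) ==>
  h \<in> chain_lifts S P d C c \<eta> n g \<longleftrightarrow> h \<in> chain_lifts S P d C c \<eta> n g'"
 unfolding chain_lifts_def by auto

lemma Ext_class_comp_chain_map:
 assumes exact: "aug_exact S P d \<epsilon> V" and \<tau>: "\<tau> \<in> chain_lifts S P d P d \<epsilon> 0 \<epsilon>"
  and Y: "left_module S Y" and f: "f \<in> ZC Y m"
 shows "(onP m (%x. f (\<tau> m x))) \<in> ZC Y m"
  "cls Y m (onP m (%x. f (\<tau> m x))) = cls Y m f"
proof -
 let ?e = "\<lambda>x\<in>carrier (P 0). \<epsilon> x"
 have \<tau>': "\<tau> \<in> chain_lifts S P d P d \<epsilon> 0 ?e" and i: "(%i. \<lambda>x\<in>carrier (P i). x) \<in> chain_lifts S P d P d \<epsilon> 0 ?e"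
  using \<tau> id_lift[of \<epsilon>] by (subst lift_cong[of 0 ?e \<epsilon>]; simp)+
 have e: "?e \<in> ZC V 0" by (rule aug_cocycle[OF exact])
 show "(onP m (%x. f (\<tau> m x))) \<in> ZC Y m"
  using comp_lift_cocycle[OF exact Y f \<tau>] by simp
 have "(onP m (%x. f ((onP m (%x. x)) x))) = f"
  using cocycle_hom[OF f] by (auto simp: module_hom_iff extensional_def restrict_def)
 then show "cls Y m (onP m (%x. f (\<tau> m x))) = cls Y m f"
  using lift_pairing_unique[OF exact \<tau>' i e e refl Y cocycle_lin[OF f] cocycle_d[OF f]] by simp
qed

end

section \<open>The universal property of the tensor product\<close>

definition balanced ::
 "'s set \<Rightarrow> ('x, 'z1) ring_scheme \<Rightarrow> ('x \<Rightarrow> 's \<Rightarrow> 'x) \<Rightarrow> ('y, 'z2) ring_scheme \<Rightarrow> ('s \<Rightarrow> 'y \<Rightarrow> 'y)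
  \<Rightarrow> ('g, 'z) monoid_scheme \<Rightarrow> ('x \<Rightarrow> 'y \<Rightarrow> 'g) \<Rightarrow> bool" where
 "balanced S V r Y l G b \<longleftrightarrow>
  (\<forall>x\<in>carrier V. \<forall>y\<in>carrier Y. b x y \<in> carrier G) \<and>
  (\<forall>x\<in>carrier V. \<forall>x'\<in>carrier V. \<forall>y\<in>carrier Y. b (x \<oplus>\<^bsub>V\<^esub> x') y = b x y \<otimes>\<^bsub>G\<^esub> b x' y) \<and>
  (\<forall>x\<in>carrier V. \<forall>y\<in>carrier Y. \<forall>y'\<in>carrier Y. b x (y \<oplus>\<^bsub>Y\<^esub> y') = b x y \<otimes>\<^bsub>G\<^esub> b x y') \<and>
  (\<forall>x\<in>carrier V. \<forall>s\<in>S. \<forall>y\<in>carrier Y. b (r x s) y = b x (l s y))"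

lemma balancedI:
 assumes "!!x y. x \<in> carrier V ==> y \<in> carrier Y ==> b x y \<in> carrier G"
  and "!!x x' y. x \<in> carrier V ==> x' \<in> carrier V ==> y \<in> carrier Y ==> b (x \<oplus>\<^bsub>V\<^esub> x') y = b x y \<otimes>\<^bsub>G\<^esub> b x' y"
  and "!!x y y'. x \<in> carrier V ==> y \<in> carrier Y ==> y' \<in> carrier Y ==> b x (y \<oplus>\<^bsub>Y\<^esub> y') = b x y \<otimes>\<^bsub>G\<^esub> b x y'"
  and "!!x s y. x \<in> carrier V ==> s \<in> S ==> y \<in> carrier Y ==> b (r x s) y = b x (l s y)"
 shows "balanced S V r Y l G b"
 using assms unfolding balanced_def by simp

lemma balancedD:
 assumes "balanced S V r Y l G b"
 shows "x \<in> carrier V ==> y \<in> carrier Y ==> b x y \<in> carrier G"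
  and "x \<in> carrier V ==> x' \<in> carrier V ==> y \<in> carrier Y ==> b (x \<oplus>\<^bsub>V\<^esub> x') y = b x y \<otimes>\<^bsub>G\<^esub> b x' y"
  and "x \<in> carrier V ==> y \<in> carrier Y ==> y' \<in> carrier Y ==> b x (y \<oplus>\<^bsub>Y\<^esub> y') = b x y \<otimes>\<^bsub>G\<^esub> b x y'"
  and "x \<in> carrier V ==> s \<in> S ==> y \<in> carrier Y ==> b (r x s) y = b x (l s y)"
 using assms unfolding balanced_def by simp_all

lemma (in group) mult_inv_eq_one_imp: "x \<in> carrier G ==> y \<in> carrier G ==> x \<otimes> inv y = \<one> ==> x = y"
 using inv_equality[of x "inv y"] inv_closed[of y] inv_inv[of y] by simp

locale tensor_data =
 fixes S :: "'s set" and V :: "('x, 'z1) ring_scheme" and r :: "'x \<Rightarrow> 's \<Rightarrow> 'x"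
  and Y :: "('y, 'z2) ring_scheme" and l :: "'s \<Rightarrow> 'y \<Rightarrow> 'y"
 assumes V_grp: "abelian_group V" and Y_grp: "abelian_group Y"
  and r_closed: "x \<in> carrier V ==> s \<in> S ==> r x s \<in> carrier V"
  and l_closed: "y \<in> carrier Y ==> s \<in> S ==> l s y \<in> carrier Y"
begin

abbreviation "FA \<equiv> free_Abelian_group (carrier V \<times> carrier Y)"
abbreviation "NA \<equiv> generate FA (tensor_relations S V r Y l)"
abbreviation "T \<equiv> tensor_group S V r Y l"

lemma T_eq: "T = FA Mod NA"
 by (simp add: tensor_group_def Let_def)

lemma relations_subset: "tensor_relations S V r Y l \<subseteq> carrier FA"
proof -
 interpret V: abelian_group V by (rule V_grp)
 interpret Y: abelian_group Y by (rule Y_grp)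
 interpret F: comm_group FA by (rule abelian_free_Abelian_group)
 have d: "a - b \<in> carrier FA" if "a \<in> carrier FA" "b \<in> carrier FA" for a b :: "('x \<times> 'y) \<Rightarrow>\<^sub>0 int"
  using that keys_diff[of a b] unfolding carrier_free_Abelian_group_iff by (meson Un_least order_trans)
 have f: "frag_of (x, y) \<in> carrier FA" if "x \<in> carrier V" "y \<in> carrier Y" for x y
  using that by simp
 show ?thesis unfolding tensor_relations_def
  by (intro Un_least subsetI) (elim CollectE exE conjE, simp only:,
   intro d f; simp add: r_closed l_closed)+
qed

lemma NA_subgroup: "subgroup NA FA"
 by (rule group.generate_is_subgroup[OF group_free_Abelian_group relations_subset])

lemma T_comm_group: "comm_group T"
 unfolding T_eq by (rule comm_group.abelian_FactGroup[OF abelian_free_Abelian_group NA_subgroup])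

lemma NA_normal: "normal NA FA"
 by (rule comm_group.subgroup_imp_normal[OF abelian_free_Abelian_group NA_subgroup])

lemma quot_hom: "(%w. NA #>\<^bsub>FA\<^esub> w) \<in> hom FA T"
 unfolding T_eq by (rule normal.r_coset_hom_Mod[OF NA_normal])

lemma pure_eq: "pure_tensor T x y = NA #>\<^bsub>FA\<^esub> frag_of (x, y)"
 by (simp add: pure_tensor_def T_eq r_coset_def)

lemma group_hom_quot: "group_hom FA T (%w. NA #>\<^bsub>FA\<^esub> w)"
 using quot_hom comm_group.axioms(2)[OF T_comm_group] by (simp add: group_hom_def group_hom_axioms_def)

lemma pure_closed: "x \<in> carrier V ==> y \<in> carrier Y ==> pure_tensor T x y \<in> carrier T"
 unfolding pure_eq by (rule hom_in_carrier[OF quot_hom]) simp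

lemma T_induct [consumes 1, case_names one minus pure]:
 assumes t: "t \<in> carrier T" and one: "Q \<one>\<^bsub>T\<^esub>"
  and minus: "!!t t'. t \<in> carrier T ==> t' \<in> carrier T ==> Q t ==> Q t' ==> Q (t \<otimes>\<^bsub>T\<^esub> inv\<^bsub>T\<^esub> t')"
  and pure: "!!x y. x \<in> carrier V ==> y \<in> carrier Y ==> Q (pure_tensor T x y)"
 shows "Q t"
proof -
 interpret q: group_hom FA T "%w. NA #>\<^bsub>FA\<^esub> w" by (rule group_hom_quot)
 obtain w where w: "w \<in> carrier FA" "t = NA #>\<^bsub>FA\<^esub> w"
  using t unfolding T_eq carrier_FactGroup by auto
 have "Poly_Mapping.keys w \<subseteq> carrier V \<times> carrier Y" using w(1) by simp
 then have "Q (NA #>\<^bsub>FA\<^esub> w)"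
 proof (rule free_Abelian_group_induct)
  show "Q (NA #>\<^bsub>FA\<^esub> 0)" using one q.hom_one by simp
  show "Q (NA #>\<^bsub>FA\<^esub> frag_of a)" if "a \<in> carrier V \<times> carrier Y" for a
   using that pure[of "fst a" "snd a"] by (auto simp: pure_eq)
 next
  fix a b :: "('x \<times> 'y) \<Rightarrow>\<^sub>0 int"
  assume h: "Poly_Mapping.keys a \<subseteq> carrier V \<times> carrier Y" "Poly_Mapping.keys b \<subseteq> carrier V \<times> carrier Y"
   "Q (NA #>\<^bsub>FA\<^esub> a)" "Q (NA #>\<^bsub>FA\<^esub> b)"
  then have ab: "a \<in> carrier FA" "b \<in> carrier FA" by simp_all
  have "a - b = a \<otimes>\<^bsub>FA\<^esub> inv\<^bsub>FA\<^esub> b" using h by simp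
  then have "NA #>\<^bsub>FA\<^esub> (a - b) = (NA #>\<^bsub>FA\<^esub> a) \<otimes>\<^bsub>T\<^esub> inv\<^bsub>T\<^esub> (NA #>\<^bsub>FA\<^esub> b)"
   by (simp only: q.hom_mult[OF ab(1) q.G.inv_closed[OF ab(2)]] q.hom_inv[OF ab(2)])
  then show "Q (NA #>\<^bsub>FA\<^esub> (a - b))" using minus[OF q.hom_closed[OF ab(1)] q.hom_closed[OF ab(2)] h(3,4)] by simp
 qed
 then show ?thesis by (simp add: w(2))
qed

lemma T_hom_unique:
 assumes G: "group G" and f: "f \<in> hom T G" and g: "g \<in> hom T G"
  and eq: "!!x y. x \<in> carrier V ==> y \<in> carrier Y ==> f (pure_tensor T x y) = g (pure_tensor T x y)"
  and t: "t \<in> carrier T"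
 shows "f t = g t"
proof -
 have T: "group T" using T_comm_group by (rule comm_group.axioms(2))
 interpret f: group_hom T G f using f T G by (simp add: group_hom_def group_hom_axioms_def)
 interpret g: group_hom T G g using g T G by (simp add: group_hom_def group_hom_axioms_def)
 show ?thesis using t by (induction t rule: T_induct) (simp_all add: eq)
qed

lemma rel_quot: "w \<in> tensor_relations S V r Y l ==> NA #>\<^bsub>FA\<^esub> w = \<one>\<^bsub>T\<^esub>"
 using group.coset_join2[OF group_free_Abelian_group subsetD[OF relations_subset] NA_subgroup]
 by (simp add: T_eq generate.incl)

lemma pure_balanced: "balanced S V r Y l T (pure_tensor T)"
proof -
 interpret V: abelian_group V by (rule V_grp)
 interpret Y: abelian_group Y by (rule Y_grp)
 interpret q: group_hom FA T "%w. NA #>\<^bsub>FA\<^esub> w" by (rule group_hom_quot)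
 interpret T: comm_group T by (rule T_comm_group)
 have qd: "NA #>\<^bsub>FA\<^esub> (a - b) = (NA #>\<^bsub>FA\<^esub> a) \<otimes>\<^bsub>T\<^esub> inv\<^bsub>T\<^esub> (NA #>\<^bsub>FA\<^esub> b)"
  if ab: "a \<in> carrier FA" "b \<in> carrier FA" for a b
 proof -
  have "a - b = a \<otimes>\<^bsub>FA\<^esub> inv\<^bsub>FA\<^esub> b" using ab by simp
  then show ?thesis by (simp only: q.hom_mult[OF ab(1) q.G.inv_closed[OF ab(2)]] q.hom_inv[OF ab(2)])
 qed
 have fc: "frag_of (x, y) \<in> carrier FA" if "x \<in> carrier V" "y \<in> carrier Y" for x y
  using that by simp
 have dc: "a - b \<in> carrier FA" if "a \<in> carrier FA" "b \<in> carrier FA" for a b :: "('x \<times> 'y) \<Rightarrow>\<^sub>0 int"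
  using that keys_diff[of a b] unfolding carrier_free_Abelian_group_iff by (meson Un_least order_trans)
 have three: "NA #>\<^bsub>FA\<^esub> a = (NA #>\<^bsub>FA\<^esub> b) \<otimes>\<^bsub>T\<^esub> (NA #>\<^bsub>FA\<^esub> c)"
  if "a - b - c \<in> tensor_relations S V r Y l" "a \<in> carrier FA" "b \<in> carrier FA" "c \<in> carrier FA" for a b c
 proof -
  have "(NA #>\<^bsub>FA\<^esub> a) \<otimes>\<^bsub>T\<^esub> inv\<^bsub>T\<^esub> (NA #>\<^bsub>FA\<^esub> b) \<otimes>\<^bsub>T\<^esub> inv\<^bsub>T\<^esub> (NA #>\<^bsub>FA\<^esub> c) = \<one>\<^bsub>T\<^esub>"
   using rel_quot[OF that(1)] that by (simp add: qd dc del: carrier_free_Abelian_group_iff)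
  moreover have c: "NA #>\<^bsub>FA\<^esub> a \<in> carrier T" "NA #>\<^bsub>FA\<^esub> b \<in> carrier T" "NA #>\<^bsub>FA\<^esub> c \<in> carrier T"
   using q.hom_closed that by simp_all
  ultimately have "(NA #>\<^bsub>FA\<^esub> a) \<otimes>\<^bsub>T\<^esub> inv\<^bsub>T\<^esub> ((NA #>\<^bsub>FA\<^esub> b) \<otimes>\<^bsub>T\<^esub> (NA #>\<^bsub>FA\<^esub> c)) = \<one>\<^bsub>T\<^esub>"
   by (simp add: T.inv_mult q.H.m_assoc)
  then show ?thesis by (rule q.H.mult_inv_eq_one_imp[OF c(1) q.H.m_closed[OF c(2,3)]])
 qed
 show ?thesis
 proof (rule balancedI, unfold pure_eq)
  fix x y assume "x \<in> carrier V" "y \<in> carrier Y"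
  then show "NA #>\<^bsub>FA\<^esub> frag_of (x, y) \<in> carrier T" by (intro q.hom_closed fc)
 next
  fix x x' y assume h: "x \<in> carrier V" "x' \<in> carrier V" "y \<in> carrier Y"
  have "frag_of (x \<oplus>\<^bsub>V\<^esub> x', y) - frag_of (x, y) - frag_of (x', y) \<in> tensor_relations S V r Y l"
   unfolding tensor_relations_def by (rule UnI1, rule UnI1, rule CollectI, rule exI[of _ x], rule exI[of _ x'], rule exI[of _ y], simp add: h)
  then show "NA #>\<^bsub>FA\<^esub> frag_of (x \<oplus>\<^bsub>V\<^esub> x', y) = (NA #>\<^bsub>FA\<^esub> frag_of (x, y)) \<otimes>\<^bsub>T\<^esub> (NA #>\<^bsub>FA\<^esub> frag_of (x', y))"
   by (rule three) (use h in \<open>auto intro!: fc\<close>)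
 next
  fix x y y' assume h: "x \<in> carrier V" "y \<in> carrier Y" "y' \<in> carrier Y"
  have "frag_of (x, y \<oplus>\<^bsub>Y\<^esub> y') - frag_of (x, y) - frag_of (x, y') \<in> tensor_relations S V r Y l"
   unfolding tensor_relations_def by (rule UnI1, rule UnI2, rule CollectI, rule exI[of _ x], rule exI[of _ y], rule exI[of _ y'], simp add: h)
  then show "NA #>\<^bsub>FA\<^esub> frag_of (x, y \<oplus>\<^bsub>Y\<^esub> y') = (NA #>\<^bsub>FA\<^esub> frag_of (x, y)) \<otimes>\<^bsub>T\<^esub> (NA #>\<^bsub>FA\<^esub> frag_of (x, y'))"
   by (rule three) (use h in \<open>auto intro!: fc\<close>)
 next
  fix x s y assume h: "x \<in> carrier V" "s \<in> S" "y \<in> carrier Y"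
  have rel: "frag_of (r x s, y) - frag_of (x, l s y) \<in> tensor_relations S V r Y l"
   unfolding tensor_relations_def by (rule UnI2, rule CollectI, rule exI[of _ x], rule exI[of _ s], rule exI[of _ y], simp add: h)
  have c: "frag_of (r x s, y) \<in> carrier FA" "frag_of (x, l s y) \<in> carrier FA"
   using h r_closed l_closed by (auto intro!: fc)
  show "NA #>\<^bsub>FA\<^esub> frag_of (r x s, y) = NA #>\<^bsub>FA\<^esub> frag_of (x, l s y)"
   by (rule q.H.mult_inv_eq_one_imp[OF q.hom_closed[OF c(1)] q.hom_closed[OF c(2)]])
    (simp only: qd[OF c, symmetric] rel_quot[OF rel])
 qed
qed

lemmas pure_add_left = balancedD(2)[OF pure_balanced]
lemmas pure_add_right = balancedD(3)[OF pure_balanced]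
lemmas pure_middle = balancedD(4)[OF pure_balanced]

lemma tensor_lift:
 assumes G: "comm_group G" and b: "balanced S V r Y l G b"
 shows "tensor_lift G b \<in> hom T G"
  and "!!x y. x \<in> carrier V ==> y \<in> carrier Y ==> tensor_lift G b (pure_tensor T x y) = b x y"
proof -
 interpret G: comm_group G by fact
 interpret V: abelian_group V by (rule V_grp)
 interpret Y: abelian_group Y by (rule Y_grp)
 note bD = balancedD[OF b]
 define E where "E = (%w :: 'x \<times> 'y \<Rightarrow>\<^sub>0 int. finprod G (%(x, y). b x y [^]\<^bsub>G\<^esub> Poly_Mapping.lookup w (x, y)) (Poly_Mapping.keys w))"
 have E_sup: "E w = finprod G (%(x, y). b x y [^]\<^bsub>G\<^esub> Poly_Mapping.lookup w (x, y)) I"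
  if "finite I" "Poly_Mapping.keys w \<subseteq> I" "I \<subseteq> carrier V \<times> carrier Y" for w :: "'x \<times> 'y \<Rightarrow>\<^sub>0 int" and I
  unfolding E_def
  by (rule G.finprod_mono_neutral_cong_left)
   (use that in \<open>auto simp: in_keys_iff subset_iff intro!: bD(1) G.int_pow_closed\<close>)
 have E_add: "E (w + w') = E w \<otimes>\<^bsub>G\<^esub> E w'" if w: "w \<in> carrier FA" "w' \<in> carrier FA" for w w'
 proof -
  let ?I = "Poly_Mapping.keys w \<union> Poly_Mapping.keys w'"
  have I: "finite ?I" "?I \<subseteq> carrier V \<times> carrier Y" using w by auto
  have c: "b (fst z) (snd z) \<in> carrier G" if "z \<in> ?I" for z
   using that I(2) by (intro bD(1)) auto
  have "E (w + w') = finprod G (%(x, y). b x y [^]\<^bsub>G\<^esub> Poly_Mapping.lookup (w + w') (x, y)) ?I"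
   by (rule E_sup) (use I keys_add[of w w'] in auto)
  also have "\<dots> = finprod G (%z. (case z of (x, y) \<Rightarrow> b x y [^]\<^bsub>G\<^esub> Poly_Mapping.lookup w (x, y)) \<otimes>\<^bsub>G\<^esub>
    (case z of (x, y) \<Rightarrow> b x y [^]\<^bsub>G\<^esub> Poly_Mapping.lookup w' (x, y))) ?I"
   by (rule G.finprod_cong') (use c in \<open>force simp: Poly_Mapping.lookup_add G.int_pow_mult\<close>)+
  also have "\<dots> = finprod G (%(x, y). b x y [^]\<^bsub>G\<^esub> Poly_Mapping.lookup w (x, y)) ?I \<otimes>\<^bsub>G\<^esub>
    finprod G (%(x, y). b x y [^]\<^bsub>G\<^esub> Poly_Mapping.lookup w' (x, y)) ?I"
   by (rule G.finprod_multf) (use c in \<open>force\<close>)+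
  also have "\<dots> = E w \<otimes>\<^bsub>G\<^esub> E w'"
   by (subst (1 2) E_sup[symmetric]) (use I in auto)
  finally show ?thesis .
 qed
 have E_closed: "E w \<in> carrier G" if "w \<in> carrier FA" for w
  unfolding E_def by (rule G.finprod_closed) (use that in \<open>auto intro!: bD(1) G.int_pow_closed\<close>)
 have E_frag: "E (frag_of (x, y)) = b x y" if "x \<in> carrier V" "y \<in> carrier Y" for x y
  unfolding E_def using bD(1)[OF that] by simp
 interpret E: group_hom FA G E
  by (simp add: group_hom_def group_hom_axioms_def G.is_group hom_def E_closed E_add Pi_def del: carrier_free_Abelian_group_iff)
 have fc: "frag_of (x, y) \<in> carrier FA" if "x \<in> carrier V" "y \<in> carrier Y" for x y
  using that by simp
 have Ed: "E (a - b) = E a \<otimes>\<^bsub>G\<^esub> inv\<^bsub>G\<^esub> E b" if ab: "a \<in> carrier FA" "b \<in> carrier FA" for a b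
 proof -
  have "a - b = a \<otimes>\<^bsub>FA\<^esub> inv\<^bsub>FA\<^esub> b" using ab by simp
  then show ?thesis by (simp only: E.hom_mult[OF ab(1) E.G.inv_closed[OF ab(2)]] E.hom_inv[OF ab(2)])
 qed
 have dc: "a - b \<in> carrier FA" if "a \<in> carrier FA" "b \<in> carrier FA" for a b :: "('x \<times> 'y) \<Rightarrow>\<^sub>0 int"
  using that keys_diff[of a b] unfolding carrier_free_Abelian_group_iff by (meson Un_least order_trans)
 have three: "u \<otimes>\<^bsub>G\<^esub> v \<otimes>\<^bsub>G\<^esub> inv\<^bsub>G\<^esub> u \<otimes>\<^bsub>G\<^esub> inv\<^bsub>G\<^esub> v = \<one>\<^bsub>G\<^esub>" if "u \<in> carrier G" "v \<in> carrier G" for u v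
  using that by (simp add: G.m_comm[of u v] G.m_assoc[of v u "inv\<^bsub>G\<^esub> u"])
 have "E w = \<one>\<^bsub>G\<^esub>" if "w \<in> tensor_relations S V r Y l" for w
  using that unfolding tensor_relations_def
 proof (elim UnE CollectE exE conjE)
  show ?thesis if w: "w = frag_of (x \<oplus>\<^bsub>V\<^esub> x', y) - frag_of (x, y) - frag_of (x', y)"
    and h: "x \<in> carrier V" "x' \<in> carrier V" "y \<in> carrier Y" for x x' y
   unfolding w using h three[OF bD(1)[OF h(1,3)] bD(1)[OF h(2,3)]]
   by (simp add: Ed dc E_frag bD(2) del: carrier_free_Abelian_group_iff)
  show ?thesis if w: "w = frag_of (x, y \<oplus>\<^bsub>Y\<^esub> y') - frag_of (x, y) - frag_of (x, y')"
    and h: "x \<in> carrier V" "y \<in> carrier Y" "y' \<in> carrier Y" for x y y'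
   unfolding w using h three[OF bD(1)[OF h(1,2)] bD(1)[OF h(1,3)]]
   by (simp add: Ed dc E_frag bD(3) del: carrier_free_Abelian_group_iff)
  show ?thesis if w: "w = frag_of (r x s, y) - frag_of (x, l s y)"
    and h: "x \<in> carrier V" "s \<in> S" "y \<in> carrier Y" for x s y
   unfolding w using h bD(1)[OF h(1) l_closed[OF h(3,2)]]
   by (simp add: Ed dc E_frag bD(4) r_closed l_closed del: carrier_free_Abelian_group_iff)
 qed
 then have "tensor_relations S V r Y l \<subseteq> kernel FA G E"
  using subsetD[OF relations_subset]
  by (intro subsetI) (simp add: kernel_def del: carrier_free_Abelian_group_iff)
 then have "NA \<subseteq> kernel FA G E"
  by (intro E.G.generate_subgroup_incl E.subgroup_kernel)
 then have EN: "E w = \<one>\<^bsub>G\<^esub>" "w \<in> carrier FA" if "w \<in> NA" for w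
  using that by (auto simp: kernel_def)
 have lift: "tensor_lift G b (NA #>\<^bsub>FA\<^esub> w) = E w" if w: "w \<in> carrier FA" for w
 proof -
  have "E ` (NA #>\<^bsub>FA\<^esub> w) = {E w}"
  proof (intro equalityI subsetI)
   fix z assume "z \<in> E ` (NA #>\<^bsub>FA\<^esub> w)"
   then obtain k where "k \<in> NA" "z = E (k + w)" by (auto simp: r_coset_def)
   then show "z \<in> {E w}" using E_add[OF EN(2) w] EN(1) E_closed[OF w] by simp
  next
   fix z assume "z \<in> {E w}"
   then show "z \<in> E ` (NA #>\<^bsub>FA\<^esub> w)"
    using group.rcos_self[OF group_free_Abelian_group w NA_subgroup] by auto
  qed
  then show ?thesis unfolding tensor_lift_def E_def[symmetric] by simp
 qed
 show "tensor_lift G b (pure_tensor T x y) = b x y" if "x \<in> carrier V" "y \<in> carrier Y" for x y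
  unfolding pure_eq by (simp only: lift[OF fc[OF that]] E_frag[OF that])
 interpret q: group_hom FA T "%w. NA #>\<^bsub>FA\<^esub> w" by (rule group_hom_quot)
 show "tensor_lift G b \<in> hom T G"
 proof (rule homI)
  fix t assume "t \<in> carrier T"
  then obtain w where w: "w \<in> carrier FA" "t = NA #>\<^bsub>FA\<^esub> w" unfolding T_eq carrier_FactGroup by auto
  then show "tensor_lift G b t \<in> carrier G" by (simp add: lift E_closed del: carrier_free_Abelian_group_iff)
  fix t' assume "t' \<in> carrier T"
  then obtain w' where w': "w' \<in> carrier FA" "t' = NA #>\<^bsub>FA\<^esub> w'" unfolding T_eq carrier_FactGroup by auto
  have "t \<otimes>\<^bsub>T\<^esub> t' = NA #>\<^bsub>FA\<^esub> (w \<otimes>\<^bsub>FA\<^esub> w')" unfolding w w' by (rule q.hom_mult[OF w(1) w'(1), symmetric])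
  then show "tensor_lift G b (t \<otimes>\<^bsub>T\<^esub> t') = tensor_lift G b t \<otimes>\<^bsub>G\<^esub> tensor_lift G b t'"
   using lift[OF E.G.m_closed[OF w(1) w'(1)]] unfolding w(2) w'(2) lift[OF w(1)] lift[OF w'(1)]
   by (simp add: E_add[OF w(1) w'(1)])
 qed
qed

end


lemma tensor_map:
 assumes T: "tensor_data S V r Y l" and T': "tensor_data S' V' r' Y' l'"
  and f: "!!x. x \<in> carrier V ==> f x \<in> carrier V'"
   "!!x x'. x \<in> carrier V ==> x' \<in> carrier V ==> f (x \<oplus>\<^bsub>V\<^esub> x') = f x \<oplus>\<^bsub>V'\<^esub> f x'"
  and g: "!!y. y \<in> carrier Y ==> g y \<in> carrier Y'"
   "!!y y'. y \<in> carrier Y ==> y' \<in> carrier Y ==> g (y \<oplus>\<^bsub>Y\<^esub> y') = g y \<oplus>\<^bsub>Y'\<^esub> g y'"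
  and mid: "!!x s y. x \<in> carrier V ==> s \<in> S ==> y \<in> carrier Y ==>
   pure_tensor (tensor_group S' V' r' Y' l') (f (r x s)) (g y) =
   pure_tensor (tensor_group S' V' r' Y' l') (f x) (g (l s y))"
 shows "tensor_map (tensor_group S' V' r' Y' l') f g \<in>
   hom (tensor_group S V r Y l) (tensor_group S' V' r' Y' l')"
  and "!!x y. x \<in> carrier V ==> y \<in> carrier Y ==> tensor_map (tensor_group S' V' r' Y' l') f g (pure_tensor (tensor_group S V r Y l) x y) =
   pure_tensor (tensor_group S' V' r' Y' l') (f x) (g y)"
proof -
 interpret T: tensor_data S V r Y l by fact
 interpret T': tensor_data S' V' r' Y' l' by fact
 have b: "balanced S V r Y l (tensor_group S' V' r' Y' l')
   (%x y. pure_tensor (tensor_group S' V' r' Y' l') (f x) (g y))"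
  by (rule balancedI) (simp_all add: f g mid T'.pure_closed T'.pure_add_left T'.pure_add_right)
 show "tensor_map (tensor_group S' V' r' Y' l') f g \<in> hom (tensor_group S V r Y l) (tensor_group S' V' r' Y' l')"
  unfolding tensor_map_def by (rule T.tensor_lift(1)[OF T'.T_comm_group b])
 show "tensor_map (tensor_group S' V' r' Y' l') f g (pure_tensor (tensor_group S V r Y l) x y) =
   pure_tensor (tensor_group S' V' r' Y' l') (f x) (g y)" if "x \<in> carrier V" "y \<in> carrier Y" for x y
  unfolding tensor_map_def by (rule T.tensor_lift(2)[OF T'.T_comm_group b that])
qed

section \<open>The enveloping algebra and its modules\<close>

lemma comm_group_cong:
 assumes "comm_group G" "carrier H = carrier G" "monoid.mult H = monoid.mult G" "\<one>\<^bsub>H\<^esub> = \<one>\<^bsub>G\<^esub>"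
 shows "comm_group H"
proof -
 interpret G: comm_group G by fact
 show ?thesis
  by (rule comm_groupI; unfold assms(2-4))
   (use G.m_closed G.m_assoc G.m_comm G.l_inv_ex in auto)
qed

lemma hom_pointwise_mult:
 assumes "comm_group H" "f \<in> hom G H" "g \<in> hom G H"
 shows "(%x. f x \<otimes>\<^bsub>H\<^esub> g x) \<in> hom G H"
proof -
 interpret H: comm_group H by fact
 show ?thesis using assms(2,3) by (auto simp: hom_def Pi_iff H.m_ac)
qed

lemma hom_compose: "f \<in> hom G H ==> g \<in> hom H L ==> (%x. g (f x)) \<in> hom G L"
 by (auto simp: hom_def Pi_iff)

lemma hom_id: "(%x. x) \<in> hom G G"
 by (auto simp: hom_def)

lemma comm_group_group: "comm_group G ==> group G"
 by (rule comm_group.axioms(2))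

lemma hom_addI:
 assumes "!!x. x \<in> carrier G ==> f x \<in> carrier H"
  "!!x y. x \<in> carrier G ==> y \<in> carrier G ==> f (x \<otimes>\<^bsub>G\<^esub> y) = f x \<otimes>\<^bsub>H\<^esub> f y"
 shows "f \<in> hom G H"
 using assms by (auto simp: hom_def)

lemma tensor_lift_group_cong:
 assumes "carrier H = carrier G" "monoid.mult H = monoid.mult G" "\<one>\<^bsub>H\<^esub> = \<one>\<^bsub>G\<^esub>"
 shows "tensor_lift H b t = tensor_lift G b t"
proof -
 have "m_inv H = m_inv G" by (rule ext) (simp add: m_inv_def assms)
 then show ?thesis unfolding tensor_lift_def finprod_def nat_pow_def int_pow_def by (simp add: assms cong: if_cong)
qed

context fd_algebra
begin

abbreviation "Ae \<equiv> env K A"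
abbreviation "bimod \<equiv> left_module Ae"
abbreviation "la \<equiv> lact K A"
abbreviation "ra \<equiv> ract K A"
abbreviation amult (infixl "\<star>" 70) where "a \<star> b \<equiv> a \<otimes>\<^bsub>A\<^esub> b"
abbreviation "bten \<equiv> btensor K A"
abbreviation "bgrp \<equiv> btensor_group K A"
abbreviation "mten \<equiv> mtensor K A"
abbreviation "mgrp \<equiv> mtensor_group K A"
abbreviation "uA \<equiv> \<one>\<^bsub>A\<^esub>"
abbreviation "sc c \<equiv> c \<odot>\<^bsub>A\<^esub> uA"

lemma A_abelian: "abelian_group A"
 by (rule A.is_abelian_group)

lemma K_smult_closed: "c \<in> carrier K ==> x \<in> carrier A ==> c \<odot>\<^bsub>A\<^esub> x \<in> carrier A"
 by (rule smult_closed)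

sublocale ET: tensor_data "carrier K" A "%x c. c \<odot>\<^bsub>A\<^esub> x" A "%c x. c \<odot>\<^bsub>A\<^esub> x"
 by (rule tensor_data.intro) (simp_all add: A_abelian K_smult_closed)

abbreviation "Te \<equiv> env_group K A"
abbreviation "pr \<equiv> pure_tensor (env_group K A)"

lemma ET_T: "ET.T = Te"
 by (simp add: env_group_def)

lemmas Te_comm_group = ET.T_comm_group[unfolded ET_T]
lemmas Te_group = comm_group_group[OF Te_comm_group]
lemmas pr_closed = ET.pure_closed[unfolded ET_T]
lemmas pr_balanced = ET.pure_balanced[unfolded ET_T]
lemmas pr_add_left = balancedD(2)[OF pr_balanced]
lemmas pr_add_right = balancedD(3)[OF pr_balanced]
lemmas pr_middle = balancedD(4)[OF pr_balanced]
lemmas Te_hom_unique = ET.T_hom_unique[unfolded ET_T]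
lemmas Te_lift = ET.tensor_lift[unfolded ET_T]

lemma env_simps:
 "carrier Ae = carrier Te" "\<one>\<^bsub>Ae\<^esub> = pr uA uA"
 "\<zero>\<^bsub>Ae\<^esub> = \<one>\<^bsub>Te\<^esub>" "s \<oplus>\<^bsub>Ae\<^esub> t = s \<otimes>\<^bsub>Te\<^esub> t"
 "s \<otimes>\<^bsub>Ae\<^esub> t = tensor_lift Te (%a b. tensor_lift Te (%a' b'. pr (a \<star> a') (b' \<star> b)) t) s"
 by (simp_all add: env_def Let_def)

lemma env_inner:
 assumes "a \<in> carrier A" "b \<in> carrier A"
 shows "tensor_lift Te (%a' b'. pr (a \<star> a') (b' \<star> b)) \<in> hom Te Te"
  and "a' \<in> carrier A ==> b' \<in> carrier A ==>
   tensor_lift Te (%a' b'. pr (a \<star> a') (b' \<star> b)) (pr a' b') = pr (a \<star> a') (b' \<star> b)"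
proof -
 have "balanced (carrier K) A (%x c. c \<odot>\<^bsub>A\<^esub> x) A (%c x. c \<odot>\<^bsub>A\<^esub> x) Te
   (%a' b'. pr (a \<star> a') (b' \<star> b))"
  by (rule balancedI)
   (use assms in \<open>simp_all add: pr_closed A.r_distr A.l_distr pr_add_left pr_add_right
    smult_mult_left smult_mult_right pr_middle\<close>)
 note * = Te_lift[OF Te_comm_group this]
 show "tensor_lift Te (%a' b'. pr (a \<star> a') (b' \<star> b)) \<in> hom Te Te" by (rule *(1))
 show "a' \<in> carrier A ==> b' \<in> carrier A ==>
   tensor_lift Te (%a' b'. pr (a \<star> a') (b' \<star> b)) (pr a' b') = pr (a \<star> a') (b' \<star> b)"
  by (rule *(2))
qed

lemma env_mult_left:
 assumes t: "t \<in> carrier Te"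
 shows "(%s. s \<otimes>\<^bsub>Ae\<^esub> t) \<in> hom Te Te"
  and "a \<in> carrier A ==> b \<in> carrier A ==>
   pr a b \<otimes>\<^bsub>Ae\<^esub> t = tensor_lift Te (%a' b'. pr (a \<star> a') (b' \<star> b)) t"
proof -
 note u = Te_hom_unique[OF Te_group _ _ _ t]
 have "balanced (carrier K) A (%x c. c \<odot>\<^bsub>A\<^esub> x) A (%c x. c \<odot>\<^bsub>A\<^esub> x) Te
   (%a b. tensor_lift Te (%a' b'. pr (a \<star> a') (b' \<star> b)) t)"
 proof (rule balancedI)
  fix x y assume "x \<in> carrier A" "y \<in> carrier A"
  then show "tensor_lift Te (%a' b'. pr (x \<star> a') (b' \<star> y)) t \<in> carrier Te"
   by (rule hom_in_carrier[OF env_inner(1) t])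
 next
  fix x x' y assume h: "x \<in> carrier A" "x' \<in> carrier A" "y \<in> carrier A"
  show "tensor_lift Te (%a' b'. pr ((x \<oplus>\<^bsub>A\<^esub> x') \<star> a') (b' \<star> y)) t =
    tensor_lift Te (%a' b'. pr (x \<star> a') (b' \<star> y)) t \<otimes>\<^bsub>Te\<^esub>
    tensor_lift Te (%a' b'. pr (x' \<star> a') (b' \<star> y)) t"
   by (rule u[OF env_inner(1) hom_pointwise_mult[OF Te_comm_group env_inner(1) env_inner(1)]])
    (use h in \<open>simp_all add: env_inner(2) A.l_distr pr_add_left\<close>)
 next
  fix x y y' assume h: "x \<in> carrier A" "y \<in> carrier A" "y' \<in> carrier A"
  show "tensor_lift Te (%a' b'. pr (x \<star> a') (b' \<star> (y \<oplus>\<^bsub>A\<^esub> y'))) t =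
    tensor_lift Te (%a' b'. pr (x \<star> a') (b' \<star> y)) t \<otimes>\<^bsub>Te\<^esub>
    tensor_lift Te (%a' b'. pr (x \<star> a') (b' \<star> y')) t"
   by (rule u[OF env_inner(1) hom_pointwise_mult[OF Te_comm_group env_inner(1) env_inner(1)]])
    (use h in \<open>simp_all add: env_inner(2) A.r_distr pr_add_right\<close>)
 next
  fix x c y assume h: "x \<in> carrier A" "c \<in> carrier K" "y \<in> carrier A"
  show "tensor_lift Te (%a' b'. pr ((c \<odot>\<^bsub>A\<^esub> x) \<star> a') (b' \<star> y)) t =
    tensor_lift Te (%a' b'. pr (x \<star> a') (b' \<star> (c \<odot>\<^bsub>A\<^esub> y))) t"
   by (rule u[OF env_inner(1) env_inner(1)])
    (use h in \<open>simp_all add: env_inner(2) smult_mult_left smult_mult_right pr_middle\<close>)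
 qed
 note * = Te_lift[OF Te_comm_group this]
 show "(%s. s \<otimes>\<^bsub>Ae\<^esub> t) \<in> hom Te Te" unfolding env_simps by (rule *(1))
 show "a \<in> carrier A ==> b \<in> carrier A ==>
   pr a b \<otimes>\<^bsub>Ae\<^esub> t = tensor_lift Te (%a' b'. pr (a \<star> a') (b' \<star> b)) t"
  unfolding env_simps by (rule *(2))
qed

lemma env_mult_pr:
 "a \<in> carrier A ==> b \<in> carrier A ==> a' \<in> carrier A ==> b' \<in> carrier A ==>
  pr a b \<otimes>\<^bsub>Ae\<^esub> pr a' b' = pr (a \<star> a') (b' \<star> b)"
 by (simp add: env_mult_left(2) pr_closed env_inner(2))

lemma env_mult_pr_hom:
 assumes "a \<in> carrier A" "b \<in> carrier A"
 shows "(%t. pr a b \<otimes>\<^bsub>Ae\<^esub> t) \<in> hom Te Te"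
proof -
 have eq: "pr a b \<otimes>\<^bsub>Ae\<^esub> t = tensor_lift Te (%a' b'. pr (a \<star> a') (b' \<star> b)) t"
  if "t \<in> carrier Te" for t using env_mult_left(2)[OF that assms] .
 have cl: "s \<otimes>\<^bsub>Te\<^esub> t \<in> carrier Te" if "s \<in> carrier Te" "t \<in> carrier Te" for s t
  using comm_groupE(1)[OF Te_comm_group that] .
 show ?thesis
  by (rule hom_addI) (use env_inner(1)[OF assms] in \<open>simp_all add: eq cl hom_in_carrier hom_mult\<close>)
qed

lemma env_mult_closed: "s \<in> carrier Te ==> t \<in> carrier Te ==> s \<otimes>\<^bsub>Ae\<^esub> t \<in> carrier Te"
 by (rule hom_in_carrier[OF env_mult_left(1)])

lemma env_mult_right:
 assumes s: "s \<in> carrier Te"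
 shows "(%t. s \<otimes>\<^bsub>Ae\<^esub> t) \<in> hom Te Te"
proof (rule hom_addI)
 show "s \<otimes>\<^bsub>Ae\<^esub> t \<in> carrier Te" if "t \<in> carrier Te" for t by (rule env_mult_closed[OF s that])
 fix t u assume t: "t \<in> carrier Te" and u: "u \<in> carrier Te"
 have tu: "t \<otimes>\<^bsub>Te\<^esub> u \<in> carrier Te" using comm_groupE(1)[OF Te_comm_group t u] .
 show "s \<otimes>\<^bsub>Ae\<^esub> (t \<otimes>\<^bsub>Te\<^esub> u) = (s \<otimes>\<^bsub>Ae\<^esub> t) \<otimes>\<^bsub>Te\<^esub> (s \<otimes>\<^bsub>Ae\<^esub> u)"
  by (rule Te_hom_unique[OF Te_group env_mult_left(1)[OF tu]
     hom_pointwise_mult[OF Te_comm_group env_mult_left(1)[OF t] env_mult_left(1)[OF u]] _ s])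
   (rule hom_mult[OF env_mult_pr_hom t u])
qed

lemma env_assoc:
 assumes s: "s \<in> carrier Te" and t: "t \<in> carrier Te" and u: "u \<in> carrier Te"
 shows "(s \<otimes>\<^bsub>Ae\<^esub> t) \<otimes>\<^bsub>Ae\<^esub> u = s \<otimes>\<^bsub>Ae\<^esub> (t \<otimes>\<^bsub>Ae\<^esub> u)"
proof (rule Te_hom_unique[OF Te_group hom_compose[OF env_mult_left(1)[OF t] env_mult_left(1)[OF u]]
   env_mult_left(1)[OF env_mult_closed[OF t u]] _ s])
 fix a b assume ab: "a \<in> carrier A" "b \<in> carrier A"
 note p = pr_closed[OF ab]
 show "pr a b \<otimes>\<^bsub>Ae\<^esub> t \<otimes>\<^bsub>Ae\<^esub> u = pr a b \<otimes>\<^bsub>Ae\<^esub> (t \<otimes>\<^bsub>Ae\<^esub> u)"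
 proof (rule Te_hom_unique[OF Te_group hom_compose[OF env_mult_right[OF p] env_mult_left(1)[OF u]]
   hom_compose[OF env_mult_left(1)[OF u] env_mult_right[OF p]] _ t])
  fix a' b' assume ab': "a' \<in> carrier A" "b' \<in> carrier A"
  note p' = pr_closed[OF ab']
  show "pr a b \<otimes>\<^bsub>Ae\<^esub> pr a' b' \<otimes>\<^bsub>Ae\<^esub> u = pr a b \<otimes>\<^bsub>Ae\<^esub> (pr a' b' \<otimes>\<^bsub>Ae\<^esub> u)"
   by (rule Te_hom_unique[OF Te_group env_mult_right[OF env_mult_closed[OF p p']]
     hom_compose[OF env_mult_right[OF p'] env_mult_right[OF p]] _ u])
    (use ab ab' in \<open>simp add: env_mult_pr A.m_assoc\<close>)
 qed
qed

lemma env_ring: "ring Ae"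
proof (rule ringI)
 show "abelian_group Ae"
  by (rule comm_group_abelian_groupI, rule comm_group_cong[OF Te_comm_group]) (simp_all add: env_def Let_def)
 show "monoid Ae"
 proof (rule monoidI; unfold env_simps(1))
  have e: "\<one>\<^bsub>Ae\<^esub> = pr uA uA" by (simp add: env_simps)
  show e1: "\<one>\<^bsub>Ae\<^esub> \<in> carrier Te" unfolding e by (simp add: pr_closed)
  show "\<one>\<^bsub>Ae\<^esub> \<otimes>\<^bsub>Ae\<^esub> s = s" if s: "s \<in> carrier Te" for s
   by (rule Te_hom_unique[OF Te_group env_mult_right[OF e1] hom_id _ s]) (simp add: e env_mult_pr)
  show "s \<otimes>\<^bsub>Ae\<^esub> \<one>\<^bsub>Ae\<^esub> = s" if s: "s \<in> carrier Te" for s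
   by (rule Te_hom_unique[OF Te_group env_mult_left(1)[OF e1] hom_id _ s]) (simp add: e env_mult_pr)
 qed (simp_all add: env_mult_closed env_assoc)
 fix x y z assume "x \<in> carrier Ae" "y \<in> carrier Ae" "z \<in> carrier Ae"
 then have h: "x \<in> carrier Te" "y \<in> carrier Te" "z \<in> carrier Te" by (simp_all add: env_simps)
 show "(x \<oplus>\<^bsub>Ae\<^esub> y) \<otimes>\<^bsub>Ae\<^esub> z = x \<otimes>\<^bsub>Ae\<^esub> z \<oplus>\<^bsub>Ae\<^esub> y \<otimes>\<^bsub>Ae\<^esub> z"
  unfolding env_simps(4) by (rule hom_mult[OF env_mult_left(1)[OF h(3)] h(1,2)])
 show "z \<otimes>\<^bsub>Ae\<^esub> (x \<oplus>\<^bsub>Ae\<^esub> y) = z \<otimes>\<^bsub>Ae\<^esub> x \<oplus>\<^bsub>Ae\<^esub> z \<otimes>\<^bsub>Ae\<^esub> y"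
  unfolding env_simps(4) by (rule hom_mult[OF env_mult_right[OF h(3)] h(1,2)])
qed

lemma env_moduleI:
 fixes N :: "(('a, 'a) tensor, 'n) module"
 assumes N: "abelian_group N"
  and closed: "!!a b x. a \<in> carrier A ==> b \<in> carrier A ==> x \<in> carrier N ==> \<beta> a b x \<in> carrier N"
  and add: "!!a b x y. a \<in> carrier A ==> b \<in> carrier A ==> x \<in> carrier N ==> y \<in> carrier N ==>
   \<beta> a b (x \<oplus>\<^bsub>N\<^esub> y) = \<beta> a b x \<oplus>\<^bsub>N\<^esub> \<beta> a b y"
  and add_left: "!!a a' b x. a \<in> carrier A ==> a' \<in> carrier A ==> b \<in> carrier A ==> x \<in> carrier N ==>
   \<beta> (a \<oplus>\<^bsub>A\<^esub> a') b x = \<beta> a b x \<oplus>\<^bsub>N\<^esub> \<beta> a' b x"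
  and add_right: "!!a b b' x. a \<in> carrier A ==> b \<in> carrier A ==> b' \<in> carrier A ==> x \<in> carrier N ==>
   \<beta> a (b \<oplus>\<^bsub>A\<^esub> b') x = \<beta> a b x \<oplus>\<^bsub>N\<^esub> \<beta> a b' x"
  and mid: "!!c a b x. c \<in> carrier K ==> a \<in> carrier A ==> b \<in> carrier A ==> x \<in> carrier N ==>
   \<beta> (c \<odot>\<^bsub>A\<^esub> a) b x = \<beta> a (c \<odot>\<^bsub>A\<^esub> b) x"
  and mult: "!!a a' b b' x. a \<in> carrier A ==> a' \<in> carrier A ==> b \<in> carrier A ==> b' \<in> carrier A ==> x \<in> carrier N ==>
   \<beta> (a \<star> a') (b' \<star> b) x = \<beta> a b (\<beta> a' b' x)"
  and one: "!!x. x \<in> carrier N ==> \<beta> uA uA x = x"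
  and smult: "!!s x. s \<in> carrier Te ==> x \<in> carrier N ==>
   s \<odot>\<^bsub>N\<^esub> x = tensor_lift (add_monoid N) (%a b. \<beta> a b x) s"
 shows "bimod N"
  and "!!a b x. a \<in> carrier A ==> b \<in> carrier A ==> x \<in> carrier N ==> pr a b \<odot>\<^bsub>N\<^esub> x = \<beta> a b x"
proof -
 interpret N: abelian_group N by fact
 note cg = N.a_comm_group and g = N.a_group
 have bal: "balanced (carrier K) A (%x c. c \<odot>\<^bsub>A\<^esub> x) A (%c x. c \<odot>\<^bsub>A\<^esub> x) (add_monoid N) (%a b. \<beta> a b x)"
  if "x \<in> carrier N" for x
  by (rule balancedI) (use that in \<open>simp_all add: closed add_left add_right mid\<close>)
 note lift = Te_lift[OF cg bal]
 have hom: "(%s. s \<odot>\<^bsub>N\<^esub> x) \<in> hom Te (add_monoid N)" if x: "x \<in> carrier N" for x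
 proof (rule hom_addI)
  show "s \<odot>\<^bsub>N\<^esub> x \<in> carrier (add_monoid N)" if "s \<in> carrier Te" for s
   using hom_in_carrier[OF lift(1)[OF x] that] by (simp add: smult[OF that x])
  show "(s \<otimes>\<^bsub>Te\<^esub> t) \<odot>\<^bsub>N\<^esub> x = (s \<odot>\<^bsub>N\<^esub> x) \<otimes>\<^bsub>add_monoid N\<^esub> (t \<odot>\<^bsub>N\<^esub> x)"
   if "s \<in> carrier Te" "t \<in> carrier Te" for s t
   using hom_mult[OF lift(1)[OF x] that] by (simp add: smult x that comm_groupE(1)[OF Te_comm_group])
 qed
 show pure: "pr a b \<odot>\<^bsub>N\<^esub> x = \<beta> a b x" if "a \<in> carrier A" "b \<in> carrier A" "x \<in> carrier N" for a b x
  using lift(2)[OF that(3,1,2)] by (simp add: smult pr_closed that)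
 have homx: "(%x. pr a b \<odot>\<^bsub>N\<^esub> x) \<in> hom (add_monoid N) (add_monoid N)" if "a \<in> carrier A" "b \<in> carrier A" for a b
  by (rule hom_addI) (use that in \<open>simp_all add: pure closed add\<close>)
 have cl: "s \<odot>\<^bsub>N\<^esub> x \<in> carrier N" if "s \<in> carrier Te" "x \<in> carrier N" for s x
  using hom_in_carrier[OF hom[OF that(2)] that(1)] by simp
 show "bimod N"
 proof (intro left_module.intro left_module_axioms.intro env_ring N)
  fix s t x y assume st': "s \<in> carrier Ae" "t \<in> carrier Ae" and x: "x \<in> carrier N" and y: "y \<in> carrier N"
  note st = st'[unfolded env_simps(1)]
  show "s \<odot>\<^bsub>N\<^esub> x \<in> carrier N" by (rule cl[OF st(1) x])
  show "(s \<oplus>\<^bsub>Ae\<^esub> t) \<odot>\<^bsub>N\<^esub> x = s \<odot>\<^bsub>N\<^esub> x \<oplus>\<^bsub>N\<^esub> t \<odot>\<^bsub>N\<^esub> x"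
   using hom_mult[OF hom[OF x] st] by (simp add: env_simps)
  have "s \<odot>\<^bsub>N\<^esub> (x \<oplus>\<^bsub>N\<^esub> y) = (s \<odot>\<^bsub>N\<^esub> x) \<otimes>\<^bsub>add_monoid N\<^esub> (s \<odot>\<^bsub>N\<^esub> y)"
   by (rule Te_hom_unique[OF g hom[OF N.a_closed[OF x y]] hom_pointwise_mult[OF cg hom[OF x] hom[OF y]] _ st(1)])
    (use x y in \<open>simp add: pure add\<close>)
  then show "s \<odot>\<^bsub>N\<^esub> (x \<oplus>\<^bsub>N\<^esub> y) = s \<odot>\<^bsub>N\<^esub> x \<oplus>\<^bsub>N\<^esub> s \<odot>\<^bsub>N\<^esub> y" by simp
  show "(s \<otimes>\<^bsub>Ae\<^esub> t) \<odot>\<^bsub>N\<^esub> x = s \<odot>\<^bsub>N\<^esub> (t \<odot>\<^bsub>N\<^esub> x)"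
  proof (rule Te_hom_unique[OF g hom_compose[OF env_mult_left(1)[OF st(2)] hom[OF x]] hom[OF cl[OF st(2) x]] _ st(1)])
   fix a b assume ab: "a \<in> carrier A" "b \<in> carrier A"
   show "(pr a b \<otimes>\<^bsub>Ae\<^esub> t) \<odot>\<^bsub>N\<^esub> x = pr a b \<odot>\<^bsub>N\<^esub> (t \<odot>\<^bsub>N\<^esub> x)"
    by (rule Te_hom_unique[OF g hom_compose[OF env_mult_right[OF pr_closed[OF ab]] hom[OF x]]
       hom_compose[OF hom[OF x] homx[OF ab]] _ st(2)])
     (use ab x in \<open>simp add: env_mult_pr pure mult closed\<close>)
  qed
 next
  show "\<one>\<^bsub>Ae\<^esub> \<odot>\<^bsub>N\<^esub> x = x" if "x \<in> carrier N" for x using that by (simp add: env_simps pure one)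
 qed
qed

context
 fixes N :: "(('a, 'a) tensor, 'n) module"
 assumes N: "bimod N"
begin

lemma pr_in_env: "a \<in> carrier A ==> b \<in> carrier A ==> pr a b \<in> carrier Ae"
 using pr_closed by (simp add: env_simps)

lemma pr_smult_pr: "a \<in> carrier A ==> b \<in> carrier A ==> a' \<in> carrier A ==> b' \<in> carrier A ==> x \<in> carrier N ==>
  pr a b \<odot>\<^bsub>N\<^esub> (pr a' b' \<odot>\<^bsub>N\<^esub> x) = pr (a \<star> a') (b' \<star> b) \<odot>\<^bsub>N\<^esub> x"
 by (simp add: left_module.smult_assoc1[OF N, symmetric] pr_in_env env_mult_pr)

lemma pr_add_env:
 "a \<in> carrier A ==> a' \<in> carrier A ==> b \<in> carrier A ==> pr (a \<oplus>\<^bsub>A\<^esub> a') b = pr a b \<oplus>\<^bsub>Ae\<^esub> pr a' b"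
 "a \<in> carrier A ==> b \<in> carrier A ==> b' \<in> carrier A ==> pr a (b \<oplus>\<^bsub>A\<^esub> b') = pr a b \<oplus>\<^bsub>Ae\<^esub> pr a b'"
 using pr_add_left pr_add_right by (simp_all add: env_simps)

lemma pr_one_smult: "x \<in> carrier N ==> pr uA uA \<odot>\<^bsub>N\<^esub> x = x"
 using left_module.smult_one[OF N] by (simp add: env_simps)

end

lemma lactract:
 fixes N :: "(('a, 'a) tensor, 'n) module"
 assumes N: "bimod N"
 shows lact_closed: "a \<in> carrier A ==> x \<in> carrier N ==> la N a x \<in> carrier N"
  and ract_closed: "a \<in> carrier A ==> x \<in> carrier N ==> ra N x a \<in> carrier N"
  and lact_add: "a \<in> carrier A ==> x \<in> carrier N ==> y \<in> carrier N ==>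
   la N a (x \<oplus>\<^bsub>N\<^esub> y) = la N a x \<oplus>\<^bsub>N\<^esub> la N a y"
  and ract_add: "a \<in> carrier A ==> x \<in> carrier N ==> y \<in> carrier N ==>
   ra N (x \<oplus>\<^bsub>N\<^esub> y) a = ra N x a \<oplus>\<^bsub>N\<^esub> ra N y a"
  and lact_add_left: "a \<in> carrier A ==> a' \<in> carrier A ==> x \<in> carrier N ==>
   la N (a \<oplus>\<^bsub>A\<^esub> a') x = la N a x \<oplus>\<^bsub>N\<^esub> la N a' x"
  and ract_add_right: "a \<in> carrier A ==> a' \<in> carrier A ==> x \<in> carrier N ==>
   ra N x (a \<oplus>\<^bsub>A\<^esub> a') = ra N x a \<oplus>\<^bsub>N\<^esub> ra N x a'"
  and lact_mult: "a \<in> carrier A ==> a' \<in> carrier A ==> x \<in> carrier N ==>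
   la N (a \<star> a') x = la N a (la N a' x)"
  and ract_mult: "a \<in> carrier A ==> a' \<in> carrier A ==> x \<in> carrier N ==>
   ra N x (a \<star> a') = ra N (ra N x a) a'"
  and lact_one: "x \<in> carrier N ==> la N uA x = x"
  and ract_one: "x \<in> carrier N ==> ra N x uA = x"
  and pr_smult: "a \<in> carrier A ==> b \<in> carrier A ==> x \<in> carrier N ==>
   pr a b \<odot>\<^bsub>N\<^esub> x = la N a (ra N x b)"
  and lact_ract: "a \<in> carrier A ==> b \<in> carrier A ==> x \<in> carrier N ==>
   la N a (ra N x b) = ra N (la N a x) b"
  and lact_central: "c \<in> carrier K ==> x \<in> carrier N ==>
   la N (sc c) x = ra N x (sc c)"
 using N by (simp_all add: lact_def ract_def left_module.smult_closed[OF N] left_module.smult_r_distr[OF N] pr_in_env pr_add_env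
   left_module.smult_l_distr[OF N] pr_smult_pr pr_one_smult pr_middle)

lemma env_lin_prI:
 assumes N: "bimod N" and N': "bimod N'"
  and cl: "!!x. x \<in> carrier N ==> f x \<in> carrier N'"
  and add: "!!x y. x \<in> carrier N ==> y \<in> carrier N ==> f (x \<oplus>\<^bsub>N\<^esub> y) = f x \<oplus>\<^bsub>N'\<^esub> f y"
  and p: "!!a b x. a \<in> carrier A ==> b \<in> carrier A ==> x \<in> carrier N ==>
   f (pr a b \<odot>\<^bsub>N\<^esub> x) = pr a b \<odot>\<^bsub>N'\<^esub> f x"
 shows "f \<in> lin Ae N N'"
proof (rule linI[OF cl add])
 interpret N: left_module Ae N by fact
 interpret N': left_module Ae N' by fact
 fix s x assume s: "s \<in> carrier Ae" and x: "x \<in> carrier N"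
 have h: "(%s. f (s \<odot>\<^bsub>N\<^esub> x)) \<in> hom Te (add_monoid N')" "(%s. s \<odot>\<^bsub>N'\<^esub> f x) \<in> hom Te (add_monoid N')"
  by (rule hom_addI; use x in \<open>simp add: cl add N.smult_closed N'.smult_closed N.smult_l_distr
    N'.smult_l_distr flip: env_simps\<close>)+
 show "f (s \<odot>\<^bsub>N\<^esub> x) = s \<odot>\<^bsub>N'\<^esub> f x"
  by (rule Te_hom_unique[OF N'.M.a_group h _ s[unfolded env_simps(1)]]) (use x in \<open>simp add: p\<close>)
qed

lemma env_linI:
 assumes N: "bimod N" and N': "bimod N'"
  and cl: "!!x. x \<in> carrier N ==> f x \<in> carrier N'"
  and add: "!!x y. x \<in> carrier N ==> y \<in> carrier N ==> f (x \<oplus>\<^bsub>N\<^esub> y) = f x \<oplus>\<^bsub>N'\<^esub> f y"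
  and l: "!!a x. a \<in> carrier A ==> x \<in> carrier N ==> f (la N a x) = la N' a (f x)"
  and r: "!!a x. a \<in> carrier A ==> x \<in> carrier N ==> f (ra N x a) = ra N' (f x) a"
 shows "f \<in> lin Ae N N'"
 by (rule env_lin_prI[OF N N' cl add])
  (simp_all add: pr_smult[OF N] pr_smult[OF N'] cl l r ract_closed[OF N])

lemma env_lin_lact: "f \<in> lin Ae N N' ==> a \<in> carrier A ==> x \<in> carrier N ==>
  f (la N a x) = la N' a (f x)"
 unfolding lact_def by (erule lin_smult) (simp_all add: env_simps pr_closed)

lemma env_lin_ract: "f \<in> lin Ae N N' ==> a \<in> carrier A ==> x \<in> carrier N ==>
  f (ra N x a) = ra N' (f x) a"
 unfolding ract_def by (erule lin_smult) (simp_all add: env_simps pr_closed)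

lemma regular_simps:
 "carrier (regular_bimodule A) = carrier A" "\<zero>\<^bsub>regular_bimodule A\<^esub> = \<zero>\<^bsub>A\<^esub>"
 "x \<oplus>\<^bsub>regular_bimodule A\<^esub> y = x \<oplus>\<^bsub>A\<^esub> y"
 by (simp_all add: regular_bimodule_def)

lemma regular_bimodule:
 shows regular_left_module: "bimod (regular_bimodule A)"
  and regular_lact: "a \<in> carrier A ==> x \<in> carrier A ==> la (regular_bimodule A) a x = a \<star> x"
  and regular_ract: "a \<in> carrier A ==> x \<in> carrier A ==> ra (regular_bimodule A) x a = x \<star> a"
proof -
 let ?N = "regular_bimodule A"
 have ab: "abelian_group ?N"
  by (rule comm_group_abelian_groupI, rule comm_group_cong[OF abelian_group.a_comm_group[OF A_abelian]]) (simp_all add: regular_bimodule_def)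
 have sm: "s \<odot>\<^bsub>?N\<^esub> x = tensor_lift (add_monoid ?N) (%a b. a \<star> x \<star> b) s" for s x
  unfolding regular_bimodule_def by (simp, rule tensor_lift_group_cong) simp_all
 note * = env_moduleI[OF ab, of "%a b x. a \<star> x \<star> b", OF _ _ _ _ _ _ _ sm]
 have **: "bimod ?N \<and>
   (\<forall>a\<in>carrier A. \<forall>b\<in>carrier A. \<forall>x\<in>carrier A. pr a b \<odot>\<^bsub>?N\<^esub> x = a \<star> x \<star> b)"
  by (intro conjI ballI *; simp add: regular_simps A.l_distr A.r_distr A.m_assoc smult_mult_left smult_mult_right)
 then show "bimod ?N"
  "a \<in> carrier A ==> x \<in> carrier A ==> la ?N a x = a \<star> x"
  "a \<in> carrier A ==> x \<in> carrier A ==> ra ?N x a = x \<star> a"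
  by (simp_all add: lact_def ract_def)
qed


section \<open>Tensor products with bimodules\<close>

lemma btensor_data:
 "bimod N ==> bimod M ==>
  tensor_data (carrier A) N (ra N) M (la M)"
 by (rule tensor_data.intro) (simp_all add: left_module_abelian_group ract_closed lact_closed)

lemma mtensor_data:
 assumes N: "bimod N" and M: "left_module A M"
 shows "tensor_data (carrier A) N (ra N) M (%a m. a \<odot>\<^bsub>M\<^esub> m)"
 using N M by (intro tensor_data.intro) (simp_all add: left_module_abelian_group ract_closed left_module.smult_closed)

lemma btensor_simps:
 "carrier (bten N M) = carrier (bgrp N M)"
 "\<zero>\<^bsub>bten N M\<^esub> = \<one>\<^bsub>bgrp N M\<^esub>"
 "s \<oplus>\<^bsub>bten N M\<^esub> t = s \<otimes>\<^bsub>bgrp N M\<^esub> t"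
 by (simp_all add: btensor_def Let_def)

lemma mtensor_simps:
 "carrier (mten N M) = carrier (mgrp N M)"
 "\<zero>\<^bsub>mten N M\<^esub> = \<one>\<^bsub>mgrp N M\<^esub>"
 "s \<oplus>\<^bsub>mten N M\<^esub> t = s \<otimes>\<^bsub>mgrp N M\<^esub> t"
 by (simp_all add: mtensor_def Let_def)

lemma btensor_minus: "\<ominus>\<^bsub>bten N M\<^esub> t = inv\<^bsub>bgrp N M\<^esub> t"
 by (simp add: a_inv_def m_inv_def btensor_def Let_def)

lemma hom_btensor_iff:
 "f \<in> hom G (add_monoid (bten N M)) \<longleftrightarrow> f \<in> hom G (bgrp N M)"
 "f' \<in> hom (add_monoid (bten N M)) G' \<longleftrightarrow> f' \<in> hom (bgrp N M) G'"
 by (simp_all add: hom_def btensor_simps)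

lemma hom_mtensor_iff:
 "f \<in> hom G (add_monoid (mten N M)) \<longleftrightarrow> f \<in> hom G (mgrp N M)"
 "f' \<in> hom (add_monoid (mten N M)) G' \<longleftrightarrow> f' \<in> hom (mgrp N M) G'"
 by (simp_all add: hom_def mtensor_simps)

lemma lin_hom: "f \<in> lin S V Y ==> f \<in> hom (add_monoid V) (add_monoid Y)"
 by (auto simp: lin_def hom_def)

lemma tensor_lift_btensor:
 "tensor_lift (add_monoid (bten N M)) b t = tensor_lift (bgrp N M) b t"
 by (rule tensor_lift_group_cong) (simp_all add: btensor_def Let_def)

context
 fixes N :: "(('a, 'a) tensor, 'n) module" and M :: "(('a, 'a) tensor, 'm) module"
 assumes N: "bimod N" and M: "bimod M"
begin

interpretation TD: tensor_data "carrier A" N "ra N" M "la M"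
 by (rule btensor_data[OF N M])

lemma TD_T: "TD.T = bgrp N M"
 by (simp add: btensor_group_def)

lemmas btensor_comm_group = TD.T_comm_group[unfolded TD_T]
lemmas btensor_pure_closed = TD.pure_closed[unfolded TD_T]
lemmas btensor_pure_add_left = TD.pure_add_left[unfolded TD_T]
lemmas btensor_pure_add_right = TD.pure_add_right[unfolded TD_T]
lemmas btensor_pure_middle = TD.pure_middle[unfolded TD_T]
lemmas btensor_hom_unique = TD.T_hom_unique[unfolded TD_T]
lemmas btensor_lift = TD.tensor_lift[unfolded TD_T]
lemma btensor_action:
 assumes a: "a \<in> carrier A" and b: "b \<in> carrier A"
 shows "tensor_map (bgrp N M) (la N a) (%y. ra M y b)
   \<in> hom (bgrp N M) (bgrp N M)"
  and "x \<in> carrier N ==> y \<in> carrier M ==>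
   tensor_map (bgrp N M) (la N a) (%y. ra M y b) (pure_tensor (bgrp N M) x y)
    = pure_tensor (bgrp N M) (la N a x) (ra M y b)"
proof -
 note D = TD.tensor_data_axioms
 note * = tensor_map[OF D D, of "la N a" "%y. ra M y b", unfolded TD_T]
 show "tensor_map (bgrp N M) (la N a) (%y. ra M y b)
   \<in> hom (bgrp N M) (bgrp N M)"
  by (rule *(1)) (simp_all add: a b lact_closed[OF N] ract_closed[OF M] lact_add[OF N] ract_add[OF M]
    lact_ract[OF N] btensor_pure_middle lact_closed[OF M] lact_ract[OF M])
 show "x \<in> carrier N ==> y \<in> carrier M ==>
   tensor_map (bgrp N M) (la N a) (%y. ra M y b) (pure_tensor (bgrp N M) x y)
    = pure_tensor (bgrp N M) (la N a x) (ra M y b)"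
  by (rule *(2)) (simp_all add: a b lact_closed[OF N] ract_closed[OF M] lact_add[OF N] ract_add[OF M]
    lact_ract[OF N] btensor_pure_middle lact_closed[OF M] lact_ract[OF M])
qed

lemma lact_smult_middle:
 assumes c: "c \<in> carrier K" and a: "a \<in> carrier A" and b: "b \<in> carrier A" and x: "x \<in> carrier N" and y: "y \<in> carrier M"
 shows "pure_tensor (bgrp N M) (la N (c \<odot>\<^bsub>A\<^esub> a) x) (ra M y b) =
  pure_tensor (bgrp N M) (la N a x) (ra M y (c \<odot>\<^bsub>A\<^esub> b))"
proof -
 let ?c = "sc c"
 have cc: "?c \<in> carrier A" by (simp add: K_smult_closed c)
 have ca: "c \<odot>\<^bsub>A\<^esub> a = ?c \<star> a" "c \<odot>\<^bsub>A\<^esub> b = b \<star> ?c"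
  using a b c by (simp_all add: smult_mult_left smult_mult_right)
 have "la N (c \<odot>\<^bsub>A\<^esub> a) x = ra N (la N a x) ?c"
  unfolding ca lact_mult[OF N cc a x] by (rule lact_central[OF N c lact_closed[OF N a x]])
 moreover have "ra M y (c \<odot>\<^bsub>A\<^esub> b) = la M ?c (ra M y b)"
  unfolding ca ract_mult[OF M b cc y] by (rule lact_central[OF M c ract_closed[OF M b y], symmetric])
 ultimately show ?thesis
  using btensor_pure_middle[OF lact_closed[OF N a x] cc ract_closed[OF M b y]] by simp
qed

lemma btensor_module:
 shows btensor_left_module: "bimod (bten N M)"
  and btensor_lact: "a \<in> carrier A ==> x \<in> carrier N ==> y \<in> carrier M ==>
   la (bten N M) a (pure_tensor (bgrp N M) x y) =
   pure_tensor (bgrp N M) (la N a x) y"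
  and btensor_ract: "a \<in> carrier A ==> x \<in> carrier N ==> y \<in> carrier M ==>
   ra (bten N M) (pure_tensor (bgrp N M) x y) a =
   pure_tensor (bgrp N M) x (ra M y a)"
proof -
 let ?B = "bten N M" and ?T = "bgrp N M"
 let ?\<beta> = "%a b. tensor_map ?T (la N a) (%y. ra M y b)"
 have ab: "abelian_group ?B"
  by (rule comm_group_abelian_groupI, rule comm_group_cong[OF btensor_comm_group]) (simp_all add: btensor_def Let_def)
 have sm: "s \<odot>\<^bsub>?B\<^esub> t = tensor_lift (add_monoid ?B) (%a b. ?\<beta> a b t) s" for s t
  by (simp add: tensor_lift_btensor) (simp add: btensor_def Let_def)
 note g = comm_group_group[OF btensor_comm_group]
 note u = btensor_hom_unique[OF g]
 note A1 = btensor_action(1) and A2 = btensor_action(2)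
 have *: "bimod ?B \<and>
   (\<forall>a\<in>carrier A. \<forall>b\<in>carrier A. \<forall>t\<in>carrier ?B. pr a b \<odot>\<^bsub>?B\<^esub> t = ?\<beta> a b t)"
 proof (intro conjI ballI env_moduleI[OF ab, where \<beta> = ?\<beta>]; (unfold btensor_simps)?)
  fix a b t assume "a \<in> carrier A" "b \<in> carrier A" "t \<in> carrier ?T"
  then show "?\<beta> a b t \<in> carrier ?T" "?\<beta> a b t \<in> carrier ?T" by (simp_all add: hom_in_carrier[OF A1])
 next
  fix a b t t' assume "a \<in> carrier A" "b \<in> carrier A" "t \<in> carrier ?T" "t' \<in> carrier ?T"
  then show "?\<beta> a b (t \<otimes>\<^bsub>?T\<^esub> t') = ?\<beta> a b t \<otimes>\<^bsub>?T\<^esub> ?\<beta> a b t'" "?\<beta> a b (t \<otimes>\<^bsub>?T\<^esub> t') = ?\<beta> a b t \<otimes>\<^bsub>?T\<^esub> ?\<beta> a b t'"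
   by (simp_all add: hom_mult[OF A1])
 next
  fix a a' b t assume h: "a \<in> carrier A" "a' \<in> carrier A" "b \<in> carrier A" and t: "t \<in> carrier ?T"
  show "?\<beta> (a \<oplus>\<^bsub>A\<^esub> a') b t = ?\<beta> a b t \<otimes>\<^bsub>?T\<^esub> ?\<beta> a' b t"
   by (rule u[OF A1 hom_pointwise_mult[OF btensor_comm_group A1 A1] _ t])
    (use h in \<open>simp_all add: A2 lact_add_left[OF N] btensor_pure_add_left lact_closed[OF N] ract_closed[OF M]\<close>)
  then show "?\<beta> (a \<oplus>\<^bsub>A\<^esub> a') b t = ?\<beta> a b t \<otimes>\<^bsub>?T\<^esub> ?\<beta> a' b t" .
 next
  fix a b b' t assume h: "a \<in> carrier A" "b \<in> carrier A" "b' \<in> carrier A" and t: "t \<in> carrier ?T"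
  show "?\<beta> a (b \<oplus>\<^bsub>A\<^esub> b') t = ?\<beta> a b t \<otimes>\<^bsub>?T\<^esub> ?\<beta> a b' t"
   by (rule u[OF A1 hom_pointwise_mult[OF btensor_comm_group A1 A1] _ t])
    (use h in \<open>simp_all add: A2 ract_add_right[OF M] btensor_pure_add_right lact_closed[OF N] ract_closed[OF M]\<close>)
  then show "?\<beta> a (b \<oplus>\<^bsub>A\<^esub> b') t = ?\<beta> a b t \<otimes>\<^bsub>?T\<^esub> ?\<beta> a b' t" .
 next
  fix c a b t assume h: "c \<in> carrier K" "a \<in> carrier A" "b \<in> carrier A" and t: "t \<in> carrier ?T"
  show "?\<beta> (c \<odot>\<^bsub>A\<^esub> a) b t = ?\<beta> a (c \<odot>\<^bsub>A\<^esub> b) t"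
   by (rule u[OF A1 A1 _ t]) (use h in \<open>simp_all add: A2 K_smult_closed lact_smult_middle\<close>)
  then show "?\<beta> (c \<odot>\<^bsub>A\<^esub> a) b t = ?\<beta> a (c \<odot>\<^bsub>A\<^esub> b) t" .
 next
  fix a a' b b' t assume h: "a \<in> carrier A" "a' \<in> carrier A" "b \<in> carrier A" "b' \<in> carrier A" and t: "t \<in> carrier ?T"
  show "?\<beta> (a \<star> a') (b' \<star> b) t = ?\<beta> a b (?\<beta> a' b' t)"
   by (rule u[OF A1 hom_compose[OF A1 A1] _ t])
    (use h in \<open>simp_all add: A2 lact_mult[OF N] ract_mult[OF M] lact_closed[OF N] ract_closed[OF M]\<close>)
  then show "?\<beta> (a \<star> a') (b' \<star> b) t = ?\<beta> a b (?\<beta> a' b' t)" .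
 next
  fix t assume t: "t \<in> carrier ?T"
  show "?\<beta> uA uA t = t"
   by (rule u[OF A1 hom_id _ t]) (simp_all add: A2 lact_one[OF N] ract_one[OF M])
  then show "?\<beta> uA uA t = t" .
 qed (simp_all only: sm, (rule tensor_lift_group_cong; simp add: btensor_def Let_def)+)
 then show "bimod ?B" by blast
 show "la ?B a (pure_tensor ?T x y) = pure_tensor ?T (la N a x) y"
  if "a \<in> carrier A" "x \<in> carrier N" "y \<in> carrier M"
  unfolding lact_def[of K A ?B] using * that
  by (simp add: btensor_simps btensor_pure_closed A2 ract_one[OF M])
 show "ra ?B (pure_tensor ?T x y) a = pure_tensor ?T x (ra M y a)"
  if "a \<in> carrier A" "x \<in> carrier N" "y \<in> carrier M"
  unfolding ract_def[of K A ?B] using * that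
  by (simp add: btensor_simps btensor_pure_closed A2 lact_one[OF N])
qed

lemma btensor_linI:
 assumes L: "bimod L" and f: "f \<in> hom (bgrp N M) (add_monoid L)"
  and l: "!!a x y. a \<in> carrier A ==> x \<in> carrier N ==> y \<in> carrier M ==>
   f (pure_tensor (bgrp N M) (la N a x) y) = la L a (f (pure_tensor (bgrp N M) x y))"
  and r: "!!a x y. a \<in> carrier A ==> x \<in> carrier N ==> y \<in> carrier M ==>
   f (pure_tensor (bgrp N M) x (ra M y a)) = ra L (f (pure_tensor (bgrp N M) x y)) a"
 shows "f \<in> lin Ae (bten N M) L"
proof -
 let ?B = "bten N M" and ?T = "bgrp N M"
 interpret L: left_module Ae L by fact
 note B = btensor_left_module
 interpret B: left_module Ae ?B by (rule B)
 have fc: "f t \<in> carrier L" if "t \<in> carrier ?T" for t using hom_in_carrier[OF f that] by simp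
 have fa: "f (t \<otimes>\<^bsub>?T\<^esub> t') = f t \<oplus>\<^bsub>L\<^esub> f t'" if "t \<in> carrier ?T" "t' \<in> carrier ?T" for t t'
  using hom_mult[OF f that] by simp
 show ?thesis
 proof (rule env_linI[OF B L]; unfold btensor_simps)
  fix a t assume a: "a \<in> carrier A" and t: "t \<in> carrier ?T"
  have h1: "la ?B a \<in> hom ?T ?T" "(%t. ra ?B t a) \<in> hom ?T ?T"
   by (rule hom_addI; use a lact_closed[OF B] ract_closed[OF B] lact_add[OF B] ract_add[OF B] in \<open>simp add: btensor_simps\<close>)+
  have h2: "la L a \<in> hom (add_monoid L) (add_monoid L)" "(%t. ra L t a) \<in> hom (add_monoid L) (add_monoid L)"
   by (rule hom_addI; use a lact_closed[OF L] ract_closed[OF L] lact_add[OF L] ract_add[OF L] in simp)+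
  show "f (la ?B a t) = la L a (f t)"
   by (rule btensor_hom_unique[OF L.M.a_group hom_compose[OF h1(1) f] hom_compose[OF f h2(1)] _ t])
    (simp add: btensor_lact a l)
  show "f (ra ?B t a) = ra L (f t) a"
   by (rule btensor_hom_unique[OF L.M.a_group hom_compose[OF h1(2) f] hom_compose[OF f h2(2)] _ t])
    (simp add: btensor_ract a r)
 qed (simp_all add: fc fa)
qed

end

lemma mtensor_module:
 assumes N: "bimod N" and M: "left_module A M"
 shows mtensor_left_module: "left_module A (mten N M)"
  and mtensor_smult: "a \<in> carrier A ==> x \<in> carrier N ==> y \<in> carrier M ==>
   a \<odot>\<^bsub>mten N M\<^esub> (pure_tensor (mgrp N M) x y) =
   pure_tensor (mgrp N M) (la N a x) y"
proof -
 let ?B = "mten N M" and ?T = "mgrp N M"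
 interpret M: left_module A M by fact
 interpret TD: tensor_data "carrier A" N "ra N" M "%a m. a \<odot>\<^bsub>M\<^esub> m" by (rule mtensor_data[OF N M])
 note D = TD.tensor_data_axioms
 have TT: "TD.T = ?T" by (simp add: mtensor_group_def)
 note cg = TD.T_comm_group[unfolded TT]
 note u = TD.T_hom_unique[OF comm_group_group[OF TD.T_comm_group], unfolded TT]
 have sm: "a \<odot>\<^bsub>?B\<^esub> t = tensor_map ?T (la N a) (%m. m) t" for a t
  by (simp add: mtensor_def Let_def)
 have M1: "(%t. a \<odot>\<^bsub>?B\<^esub> t) \<in> hom ?T ?T" if a: "a \<in> carrier A" for a
  unfolding sm by (rule tensor_map(1)[OF D D, unfolded TT])
   (simp_all add: a lact_closed[OF N] lact_add[OF N] lact_ract[OF N] TD.pure_middle[unfolded TT])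
 have M2: "a \<odot>\<^bsub>?B\<^esub> (pure_tensor ?T x y) = pure_tensor ?T (la N a x) y"
  if a: "a \<in> carrier A" and xy: "x \<in> carrier N" "y \<in> carrier M" for a x y
  unfolding sm by (rule tensor_map(2)[OF D D, unfolded TT])
   (simp_all add: a xy lact_closed[OF N] lact_add[OF N] lact_ract[OF N] TD.pure_middle[unfolded TT])
 show "a \<odot>\<^bsub>?B\<^esub> (pure_tensor ?T x y) = pure_tensor ?T (la N a x) y"
  if "a \<in> carrier A" "x \<in> carrier N" "y \<in> carrier M" by (rule M2[OF that])
 have ab: "abelian_group ?B"
  by (rule comm_group_abelian_groupI, rule comm_group_cong[OF cg]) (simp_all add: mtensor_def Let_def)
 show "left_module A ?B"
 proof (intro left_module.intro left_module_axioms.intro A.ring_axioms ab; (unfold mtensor_simps)?)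
  fix a b t assume ab: "a \<in> carrier A" "b \<in> carrier A" and t: "t \<in> carrier ?T"
  show "a \<odot>\<^bsub>?B\<^esub> t \<in> carrier ?T" by (rule hom_in_carrier[OF M1[OF ab(1)] t])
  show "(a \<oplus>\<^bsub>A\<^esub> b) \<odot>\<^bsub>?B\<^esub> t = (a \<odot>\<^bsub>?B\<^esub> t) \<otimes>\<^bsub>?T\<^esub> (b \<odot>\<^bsub>?B\<^esub> t)"
   by (rule u[OF M1 hom_pointwise_mult[OF cg M1[OF ab(1)] M1[OF ab(2)]] _ t])
    (use ab in \<open>simp_all add: M2 lact_add_left[OF N] TD.pure_add_left[unfolded TT] lact_closed[OF N]\<close>)
  show "(a \<star> b) \<odot>\<^bsub>?B\<^esub> t = a \<odot>\<^bsub>?B\<^esub> (b \<odot>\<^bsub>?B\<^esub> t)"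
   by (rule u[OF M1 hom_compose[OF M1[OF ab(2)] M1[OF ab(1)]] _ t])
    (use ab in \<open>simp_all add: M2 lact_mult[OF N] lact_closed[OF N]\<close>)
 next
  fix a t t' assume "a \<in> carrier A" "t \<in> carrier ?T" "t' \<in> carrier ?T"
  then show "a \<odot>\<^bsub>?B\<^esub> (t \<otimes>\<^bsub>?T\<^esub> t') = (a \<odot>\<^bsub>?B\<^esub> t) \<otimes>\<^bsub>?T\<^esub> (a \<odot>\<^bsub>?B\<^esub> t')" by (simp add: hom_mult[OF M1])
 next
  fix t assume t: "t \<in> carrier ?T"
  show "uA \<odot>\<^bsub>?B\<^esub> t = t" by (rule u[OF M1 hom_id _ t]) (simp_all add: M2 lact_one[OF N])
 qed
qed

end

section \<open>Finite dimensional vector spaces\<close>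

lemma lin_finsum:
 assumes V: "left_module S V" and Y: "left_module S Y" and f: "f \<in> lin S V Y" and g: "g \<in> I \<rightarrow> carrier V"
 shows "f (finsum V g I) = finsum Y (%i. f (g i)) I"
proof -
 interpret V: left_module S V by fact
 interpret Y: left_module S Y by fact
 show ?thesis using g
 proof (induction I rule: infinite_finite_induct)
  case (insert i I)
  then have gi: "g i \<in> carrier V" "g \<in> I \<rightarrow> carrier V" by auto
  have "f (finsum V g (insert i I)) = f (g i) \<oplus>\<^bsub>Y\<^esub> f (finsum V g I)"
   using insert.hyps gi by (simp add: V.M.finsum_insert lin_add[OF f])
  also have "\<dots> = finsum Y (%i. f (g i)) (insert i I)"
   using insert.hyps gi insert.IH[OF gi(2)]
   by (subst Y.M.finsum_insert) (auto simp: lin_closed[OF f] Pi_iff)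
  finally show ?case .
 qed (simp_all add: lin_zero[OF V Y f] V.M.finsum_infinite Y.M.finsum_infinite)
qed

definition lincomb :: "('k, 'v) module \<Rightarrow> ('v \<Rightarrow> 'k) \<Rightarrow> 'v set \<Rightarrow> 'v" where
 "lincomb V c F = finsum V (%x. c x \<odot>\<^bsub>V\<^esub> x) F"

locale vec = V?: left_module K V for K :: "('k, 'z) ring_scheme" and V :: "('k, 'v) module" +
 assumes K_field: "field K"
begin

lemma lincomb_closed: "F \<subseteq> carrier V ==> c \<in> F \<rightarrow> carrier K ==> lincomb V c F \<in> carrier V"
 unfolding lincomb_def by (rule M.finsum_closed) (auto simp: smult_closed Pi_iff subset_iff)

lemma lincomb_add:
 assumes "F \<subseteq> carrier V" "c \<in> F \<rightarrow> carrier K" "c' \<in> F \<rightarrow> carrier K"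
 shows "lincomb V (%x. c x \<oplus>\<^bsub>K\<^esub> c' x) F = lincomb V c F \<oplus>\<^bsub>V\<^esub> lincomb V c' F"
proof -
 have "lincomb V (%x. c x \<oplus>\<^bsub>K\<^esub> c' x) F = finsum V (%x. c x \<odot>\<^bsub>V\<^esub> x \<oplus>\<^bsub>V\<^esub> c' x \<odot>\<^bsub>V\<^esub> x) F"
  unfolding lincomb_def by (rule M.finsum_cong') (use assms in \<open>auto simp: Pi_iff subset_iff smult_l_distr smult_closed\<close>)
 also have "\<dots> = lincomb V c F \<oplus>\<^bsub>V\<^esub> lincomb V c' F"
  unfolding lincomb_def by (rule M.finsum_addf) (use assms in \<open>auto simp: Pi_iff subset_iff smult_closed\<close>)
 finally show ?thesis .
qed

lemma lincomb_smult:
 assumes "F \<subseteq> carrier V" "c \<in> F \<rightarrow> carrier K" "k \<in> carrier K"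
 shows "lincomb V (%x. k \<otimes>\<^bsub>K\<^esub> c x) F = k \<odot>\<^bsub>V\<^esub> lincomb V c F"
proof -
 have "lincomb V (%x. k \<otimes>\<^bsub>K\<^esub> c x) F = finsum V (%x. k \<odot>\<^bsub>V\<^esub> (c x \<odot>\<^bsub>V\<^esub> x)) F"
  unfolding lincomb_def by (rule M.finsum_cong') (use assms in \<open>auto simp: Pi_iff subset_iff smult_assoc1 smult_closed\<close>)
 also have "\<dots> = k \<odot>\<^bsub>V\<^esub> lincomb V c F"
  unfolding lincomb_def by (rule smult_finsum[symmetric]) (use assms in \<open>auto simp: Pi_iff subset_iff smult_closed\<close>)
 finally show ?thesis .
qed

lemma lincomb_remove:
 assumes "finite F" "F \<subseteq> carrier V" "c \<in> F \<rightarrow> carrier K" "y \<in> F"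
 shows "lincomb V c F = c y \<odot>\<^bsub>V\<^esub> y \<oplus>\<^bsub>V\<^esub> lincomb V c (F - {y})"
proof -
 have F: "F = insert y (F - {y})" using assms(4) by auto
 show ?thesis unfolding lincomb_def
  by (subst F, rule M.finsum_insert) (use assms in \<open>auto simp: smult_closed Pi_iff subset_iff\<close>)
qed

lemma span_stable_subgroup:
 assumes F: "finite F" "F \<subseteq> carrier V"
 shows "stable_subgroup (carrier K) (%c x. c \<odot>\<^bsub>V\<^esub> x) (add_monoid V) {lincomb V c F | c. c \<in> F \<rightarrow> carrier K}"
proof -
 interpret K: field K by (rule K_field)
 let ?S = "{lincomb V c F | c. c \<in> F \<rightarrow> carrier K}"
 have sm: "k \<odot>\<^bsub>V\<^esub> x \<in> ?S" if k: "k \<in> carrier K" and x: "x \<in> ?S" for k x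
 proof -
  obtain c where c: "c \<in> F \<rightarrow> carrier K" "x = lincomb V c F" using x by auto
  have "(%x. k \<otimes>\<^bsub>K\<^esub> c x) \<in> F \<rightarrow> carrier K" using c(1) k by auto
  then show ?thesis using lincomb_smult[OF F(2) c(1) k] unfolding c(2) by (intro CollectI exI[of _ "%x. k \<otimes>\<^bsub>K\<^esub> c x"]) simp
 qed
 have "subgroup ?S (add_monoid V)"
 proof (rule group.subgroupI[OF M.a_group])
  show "?S \<subseteq> carrier (add_monoid V)" using lincomb_closed[OF F(2)] by auto
  show "?S \<noteq> {}" using R.zero_closed by (auto intro!: exI[of _ "%_. \<zero>\<^bsub>K\<^esub>"])
  show "inv\<^bsub>add_monoid V\<^esub> a \<in> ?S" if a: "a \<in> ?S" for a
  proof -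
   have ac: "a \<in> carrier V" using a lincomb_closed[OF F(2)] by auto
   have "(\<ominus>\<^bsub>K\<^esub> \<one>\<^bsub>K\<^esub>) \<odot>\<^bsub>V\<^esub> a = \<ominus>\<^bsub>V\<^esub> a"
    using additive_hom(2)[of K V "%k. k \<odot>\<^bsub>V\<^esub> a" "\<one>\<^bsub>K\<^esub>"] ac
    by (simp add: R.is_abelian_group M.abelian_group_axioms smult_closed smult_l_distr smult_one)
   then show ?thesis using sm[OF _ a, of "\<ominus>\<^bsub>K\<^esub> \<one>\<^bsub>K\<^esub>"] by (simp add: a_inv_def)
  qed
  show "a \<otimes>\<^bsub>add_monoid V\<^esub> b \<in> ?S" if ab: "a \<in> ?S" "b \<in> ?S" for a b
  proof -
   obtain c c' where c: "c \<in> F \<rightarrow> carrier K" "a = lincomb V c F" "c' \<in> F \<rightarrow> carrier K" "b = lincomb V c' F"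
    using ab by auto
   have "(%x. c x \<oplus>\<^bsub>K\<^esub> c' x) \<in> F \<rightarrow> carrier K" using c by auto
   moreover have "a \<otimes>\<^bsub>add_monoid V\<^esub> b = lincomb V (%x. c x \<oplus>\<^bsub>K\<^esub> c' x) F"
    by (simp add: lincomb_add[OF F(2) c(1,3)] c(2,4))
   ultimately show ?thesis by (intro CollectI exI[of _ "%x. c x \<oplus>\<^bsub>K\<^esub> c' x"] conjI)
  qed
 qed
 then show ?thesis using sm unfolding stable_subgroup_def by blast
qed

lemma span_self:
 assumes F: "finite F" "F \<subseteq> carrier V"
 shows "F \<subseteq> {lincomb V c F | c. c \<in> F \<rightarrow> carrier K}"
proof
 interpret K: field K by (rule K_field)
 fix y assume y: "y \<in> F"
 let ?c = "%x. if x = y then \<one>\<^bsub>K\<^esub> else \<zero>\<^bsub>K\<^esub>"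
 have "lincomb V ?c (F - {y}) = finsum V (%x. \<zero>\<^bsub>V\<^esub>) (F - {y})"
  unfolding lincomb_def by (rule M.finsum_cong') (use F in \<open>auto simp: zero_smult\<close>)
 then have "lincomb V ?c F = y"
  using lincomb_remove[OF F(1,2) _ y, of ?c] y F by (auto simp: smult_one M.finsum_zero subset_iff)
 then show "y \<in> {lincomb V c F | c. c \<in> F \<rightarrow> carrier K}" by (intro CollectI exI[of _ ?c]) auto
qed

text \<open>A generating set of minimal cardinality is a basis; its coordinate functions are linear.\<close>

definition dual_basis :: "'v set \<Rightarrow> ('v \<Rightarrow> 'v \<Rightarrow> 'k) \<Rightarrow> bool" where
 "dual_basis F \<kappa> \<longleftrightarrow> finite F \<and> F \<subseteq> carrier V \<and> (\<forall>x\<in>F. \<forall>v\<in>carrier V. \<kappa> v x \<in> carrier K) \<and>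
  (\<forall>v\<in>carrier V. lincomb V (\<kappa> v) F = v) \<and>
  (\<forall>x\<in>F. \<forall>v\<in>carrier V. \<forall>w\<in>carrier V. \<kappa> (v \<oplus>\<^bsub>V\<^esub> w) x = \<kappa> v x \<oplus>\<^bsub>K\<^esub> \<kappa> w x) \<and>
  (\<forall>x\<in>F. \<forall>k\<in>carrier K. \<forall>v\<in>carrier V. \<kappa> (k \<odot>\<^bsub>V\<^esub> v) x = k \<otimes>\<^bsub>K\<^esub> \<kappa> v x)"

lemma dual_basisD:
 assumes "dual_basis F \<kappa>"
 shows "finite F" "F \<subseteq> carrier V" "x \<in> F ==> v \<in> carrier V ==> \<kappa> v x \<in> carrier K"
  "v \<in> carrier V ==> lincomb V (\<kappa> v) F = v"
  "x \<in> F ==> v \<in> carrier V ==> w \<in> carrier V ==> \<kappa> (v \<oplus>\<^bsub>V\<^esub> w) x = \<kappa> v x \<oplus>\<^bsub>K\<^esub> \<kappa> w x"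
  "x \<in> F ==> k \<in> carrier K ==> v \<in> carrier V ==> \<kappa> (k \<odot>\<^bsub>V\<^esub> v) x = k \<otimes>\<^bsub>K\<^esub> \<kappa> v x"
 using assms unfolding dual_basis_def by simp_all

lemma dual_basis_exists:
 assumes gen: "fin_generated (carrier K) (%c x. c \<odot>\<^bsub>V\<^esub> x) (add_monoid V) (carrier V)"
 shows "\<exists>F \<kappa>. dual_basis F \<kappa>"
proof -
 interpret K: field K by (rule K_field)
 define spans where "spans = (%F. finite F \<and> F \<subseteq> carrier V \<and> carrier V \<subseteq> {lincomb V c F | c. c \<in> F \<rightarrow> carrier K})"
 obtain F0 where F0: "finite F0" "F0 \<subseteq> carrier V"
   "!!L. stable_subgroup (carrier K) (%c x. c \<odot>\<^bsub>V\<^esub> x) (add_monoid V) L ==> F0 \<subseteq> L ==> carrier V \<subseteq> L"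
  using gen unfolding fin_generated_def by auto
 have "spans F0" unfolding spans_def
  using F0(1,2) F0(3)[OF span_stable_subgroup[OF F0(1,2)] span_self[OF F0(1,2)]] by blast
 then obtain F where F: "spans F" and min: "!!F'. spans F' ==> card F \<le> card F'"
  using ex_has_least_nat[of spans F0 card] by blast
 have fin: "finite F" and sub: "F \<subseteq> carrier V" using F by (auto simp: spans_def)
 have indep: "c y = \<zero>\<^bsub>K\<^esub>" if c: "c \<in> F \<rightarrow> carrier K" and z: "lincomb V c F = \<zero>\<^bsub>V\<^esub>" and y: "y \<in> F" for c y
 proof (rule ccontr)
  assume nz: "c y \<noteq> \<zero>\<^bsub>K\<^esub>"
  have cy: "c y \<in> carrier K" using c y by auto
  have yV: "y \<in> carrier V" using y sub by auto
  have subF: "F - {y} \<subseteq> carrier V" "finite (F - {y})" using sub fin by auto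
  have c': "c \<in> F - {y} \<rightarrow> carrier K" using c by auto
  let ?i = "inv\<^bsub>K\<^esub> (c y)"
  have i: "?i \<in> carrier K" "?i \<otimes>\<^bsub>K\<^esub> c y = \<one>\<^bsub>K\<^esub>"
   using nz cy by (simp_all add: K.field_Units)
  define W where "W = {lincomb V c (F - {y}) | c. c \<in> F - {y} \<rightarrow> carrier K}"
  have W: "stable_subgroup (carrier K) (%c x. c \<odot>\<^bsub>V\<^esub> x) (add_monoid V) W"
   unfolding W_def by (rule span_stable_subgroup[OF subF(2,1)])
  have Wg: "subgroup W (add_monoid V)" and Ws: "!!k x. k \<in> carrier K ==> x \<in> W ==> k \<odot>\<^bsub>V\<^esub> x \<in> W"
   using W by (auto simp: stable_subgroup_def)
  let ?r = "lincomb V c (F - {y})"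
  have r: "?r \<in> carrier V" by (rule lincomb_closed[OF subF(1) c'])
  have "c y \<odot>\<^bsub>V\<^esub> y \<oplus>\<^bsub>V\<^esub> ?r = \<zero>\<^bsub>V\<^esub>" using lincomb_remove[OF fin sub c y] z by simp
  then have "c y \<odot>\<^bsub>V\<^esub> y = \<ominus>\<^bsub>V\<^esub> ?r" using r smult_closed[OF cy yV] by (metis M.minus_equality)
  moreover have "?r \<in> W" unfolding W_def using c' by blast
  then have "\<ominus>\<^bsub>V\<^esub> ?r \<in> W" using subgroup.m_inv_closed[OF Wg] by (simp add: a_inv_def)
  ultimately have "?i \<odot>\<^bsub>V\<^esub> (c y \<odot>\<^bsub>V\<^esub> y) \<in> W" using Ws[OF i(1)] by simp
  then have yW: "y \<in> W" using i cy yV by (simp add: smult_assoc1[symmetric] smult_one)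
  have "F - {y} \<subseteq> W" unfolding W_def by (rule span_self[OF subF(2,1)])
  have "spans (F - {y})" unfolding spans_def W_def[symmetric]
  proof (intro conjI subF subsetI)
   fix v assume "v \<in> carrier V"
   then obtain b where b: "b \<in> F \<rightarrow> carrier K" "v = lincomb V b F" using F unfolding spans_def by auto
   have "b y \<odot>\<^bsub>V\<^esub> y \<in> W" using Ws[OF _ yW] b(1) y by auto
   moreover have "lincomb V b (F - {y}) \<in> W" unfolding W_def using b(1) by auto
   ultimately show "v \<in> W" unfolding b(2) lincomb_remove[OF fin sub b(1) y]
    using subgroup.m_closed[OF Wg] by fastforce
  qed
  from min[OF this] show False using fin y by (metis card_Diff1_less not_le)
 qed
 have uniq: "c y = c' y"
  if c: "c \<in> F \<rightarrow> carrier K" "c' \<in> F \<rightarrow> carrier K" "lincomb V c F = lincomb V c' F" and y: "y \<in> F" for c c' y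
 proof -
  let ?m = "%x. (\<ominus>\<^bsub>K\<^esub> \<one>\<^bsub>K\<^esub>) \<otimes>\<^bsub>K\<^esub> c' x"
  have m: "?m \<in> F \<rightarrow> carrier K" using c(2) by auto
  have "lincomb V (%x. c' x \<oplus>\<^bsub>K\<^esub> ?m x) F = lincomb V (%x. \<zero>\<^bsub>K\<^esub> \<otimes>\<^bsub>K\<^esub> c' x) F"
   unfolding lincomb_def
   by (rule M.finsum_cong') (use c(2) sub in \<open>auto simp: R.l_minus R.r_neg zero_smult Pi_iff subset_iff\<close>)
  also have "\<dots> = \<zero>\<^bsub>V\<^esub>"
   unfolding lincomb_smult[OF sub c(2) R.zero_closed] using lincomb_closed[OF sub c(2)] by (rule zero_smult)
  finally have "lincomb V (%x. c x \<oplus>\<^bsub>K\<^esub> ?m x) F = \<zero>\<^bsub>V\<^esub>"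
   by (simp only: lincomb_add[OF sub c(1) m] lincomb_add[OF sub c(2) m] c(3))
  moreover have "(%x. c x \<oplus>\<^bsub>K\<^esub> ?m x) \<in> F \<rightarrow> carrier K" using c m by auto
  ultimately have "c y \<oplus>\<^bsub>K\<^esub> ?m y = \<zero>\<^bsub>K\<^esub>" using indep y by blast
  then have "c y \<ominus>\<^bsub>K\<^esub> c' y = \<zero>\<^bsub>K\<^esub>" using c y by (auto simp: R.l_minus a_minus_def Pi_iff)
  then show ?thesis using c y by (auto simp: Pi_iff)
 qed
 have "\<exists>c. c \<in> F \<rightarrow> carrier K \<and> lincomb V c F = v" if "v \<in> carrier V" for v
  using F that unfolding spans_def by blast
 then obtain \<kappa> where \<kappa>: "!!v. v \<in> carrier V ==> \<kappa> v \<in> F \<rightarrow> carrier K" "!!v. v \<in> carrier V ==> lincomb V (\<kappa> v) F = v"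
  by metis
 show ?thesis
  unfolding dual_basis_def
 proof (intro exI conjI ballI fin sub)
  fix x assume x: "x \<in> F"
  show "\<kappa> v x \<in> carrier K" if "v \<in> carrier V" for v using \<kappa>(1)[OF that] x by auto
  show "\<kappa> (v \<oplus>\<^bsub>V\<^esub> w) x = \<kappa> v x \<oplus>\<^bsub>K\<^esub> \<kappa> w x" if "v \<in> carrier V" "w \<in> carrier V" for v w
   by (rule uniq[OF _ _ _ x])
    (use that \<kappa>[of v] \<kappa>[of w] \<kappa>[of "v \<oplus>\<^bsub>V\<^esub> w"] in \<open>auto simp: lincomb_add[OF sub]\<close>)
  show "\<kappa> (k \<odot>\<^bsub>V\<^esub> v) x = k \<otimes>\<^bsub>K\<^esub> \<kappa> v x" if "k \<in> carrier K" "v \<in> carrier V" for k v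
   by (rule uniq[OF _ _ _ x])
    (use that \<kappa>[of v] \<kappa>[of "k \<odot>\<^bsub>V\<^esub> v"] in \<open>auto simp: lincomb_smult[OF sub] smult_closed\<close>)
 qed ((rule fin sub \<kappa>(2); assumption?)+)
qed

lemma basis_extension:
 assumes db: "dual_basis F \<kappa>"
  and W: "left_module K W" and w: "w \<in> F \<rightarrow> carrier W"
 shows "(%v. finsum W (%x. \<kappa> v x \<odot>\<^bsub>W\<^esub> w x) F) \<in> lin K V W"
proof -
 note F = dual_basisD(2)[OF db] and \<kappa> = dual_basisD(3,5,6)[OF db]
 interpret W: left_module K W by fact
 have wx: "w x \<in> carrier W" if "x \<in> F" for x using w that by auto
 show ?thesis
 proof (rule linI)
  fix v v' assume v: "v \<in> carrier V" "v' \<in> carrier V"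
  show "finsum W (%x. \<kappa> v x \<odot>\<^bsub>W\<^esub> w x) F \<in> carrier W"
   by (rule W.M.finsum_closed) (use v wx in \<open>auto simp: \<kappa> W.smult_closed\<close>)
  have "finsum W (%x. \<kappa> (v \<oplus>\<^bsub>V\<^esub> v') x \<odot>\<^bsub>W\<^esub> w x) F =
    finsum W (%x. \<kappa> v x \<odot>\<^bsub>W\<^esub> w x \<oplus>\<^bsub>W\<^esub> \<kappa> v' x \<odot>\<^bsub>W\<^esub> w x) F"
   by (rule W.M.finsum_cong') (use v wx in \<open>auto simp: \<kappa> W.smult_closed W.smult_l_distr\<close>)
  also have "\<dots> = finsum W (%x. \<kappa> v x \<odot>\<^bsub>W\<^esub> w x) F \<oplus>\<^bsub>W\<^esub> finsum W (%x. \<kappa> v' x \<odot>\<^bsub>W\<^esub> w x) F"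
   by (rule W.M.finsum_addf) (use v wx in \<open>auto simp: \<kappa> W.smult_closed\<close>)
  finally show "finsum W (%x. \<kappa> (v \<oplus>\<^bsub>V\<^esub> v') x \<odot>\<^bsub>W\<^esub> w x) F =
   finsum W (%x. \<kappa> v x \<odot>\<^bsub>W\<^esub> w x) F \<oplus>\<^bsub>W\<^esub> finsum W (%x. \<kappa> v' x \<odot>\<^bsub>W\<^esub> w x) F" .
 next
  fix k v assume v: "k \<in> carrier K" "v \<in> carrier V"
  have "finsum W (%x. \<kappa> (k \<odot>\<^bsub>V\<^esub> v) x \<odot>\<^bsub>W\<^esub> w x) F = finsum W (%x. k \<odot>\<^bsub>W\<^esub> (\<kappa> v x \<odot>\<^bsub>W\<^esub> w x)) F"
   by (rule W.M.finsum_cong') (use v wx in \<open>auto simp: \<kappa> W.smult_closed W.smult_assoc1\<close>)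
  also have "\<dots> = k \<odot>\<^bsub>W\<^esub> finsum W (%x. \<kappa> v x \<odot>\<^bsub>W\<^esub> w x) F"
   by (rule W.smult_finsum[symmetric]) (use v wx in \<open>auto simp: \<kappa> W.smult_closed\<close>)
  finally show "finsum W (%x. \<kappa> (k \<odot>\<^bsub>V\<^esub> v) x \<odot>\<^bsub>W\<^esub> w x) F = k \<odot>\<^bsub>W\<^esub> finsum W (%x. \<kappa> v x \<odot>\<^bsub>W\<^esub> w x) F" .
 qed
qed

lemma linear_lift:
 assumes gen: "fin_generated (carrier K) (%c x. c \<odot>\<^bsub>V\<^esub> x) (add_monoid V) (carrier V)"
  and W: "left_module K W" and Y: "left_module K Y" and dl: "dl \<in> lin K W Y"
  and l: "l \<in> lin K V Y" and im: "l ` carrier V \<subseteq> dl ` carrier W"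
 shows "\<exists>l'\<in>module_hom K V W. \<forall>v\<in>carrier V. dl (l' v) = l v"
proof -
 interpret W: left_module K W by fact
 interpret Y: left_module K Y by fact
 obtain F \<kappa> where db: "dual_basis F \<kappa>" using dual_basis_exists[OF gen] by auto
 note F = dual_basisD(1,2)[OF db] and \<kappa> = dual_basisD(3,5,6)[OF db] and rep = dual_basisD(4)[OF db]
 have "\<exists>w. w \<in> carrier W \<and> dl w = l x" if "x \<in> F" for x
 proof -
  have "l x \<in> dl ` carrier W" using that F(2) by (intro subsetD[OF im imageI]) auto
  then show ?thesis by (metis imageE)
 qed
 then obtain w where w: "!!x. x \<in> F ==> w x \<in> carrier W" "!!x. x \<in> F ==> dl (w x) = l x" by metis
 let ?l = "%v. finsum W (%x. \<kappa> v x \<odot>\<^bsub>W\<^esub> w x) F"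
 have lin: "?l \<in> lin K V W" by (rule basis_extension[OF db W]) (use w in auto)
 have "dl (?l v) = l v" if v: "v \<in> carrier V" for v
 proof -
  have "dl (?l v) = finsum Y (%x. dl (\<kappa> v x \<odot>\<^bsub>W\<^esub> w x)) F"
   by (rule lin_finsum[OF W Y dl]) (use v in \<open>auto simp: \<kappa> w W.smult_closed\<close>)
  also have "\<dots> = finsum Y (%x. l (\<kappa> v x \<odot>\<^bsub>V\<^esub> x)) F"
   by (rule Y.M.finsum_cong')
    (use v F(2) in \<open>auto simp: \<kappa> w lin_smult[OF dl] lin_smult[OF l] subset_iff Y.smult_closed lin_closed[OF l]\<close>)
  also have "\<dots> = l (lincomb V (\<kappa> v) F)"
   unfolding lincomb_def
   by (rule lin_finsum[OF left_module_axioms Y l, symmetric]) (use v F(2) in \<open>auto simp: \<kappa> smult_closed subset_iff\<close>)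
  finally show ?thesis by (simp add: rep v)
 qed
 then show ?thesis
  by (intro bexI[OF _ lin_restrict[OF left_module_axioms lin]]) simp
qed

end

section \<open>Bimodules of linear maps\<close>

definition with_smult :: "('m, 'z) ring_scheme \<Rightarrow> ('k \<Rightarrow> 'm \<Rightarrow> 'm) \<Rightarrow> ('k, 'm) module" where
 "with_smult M act = \<lparr>carrier = carrier M, monoid.mult = undefined, monoid.one = undefined,
  ring.zero = \<zero>\<^bsub>M\<^esub>, ring.add = (\<oplus>\<^bsub>M\<^esub>), smult = act\<rparr>"

lemma with_smult_simps [simp]:
 "carrier (with_smult M act) = carrier M" "\<zero>\<^bsub>with_smult M act\<^esub> = \<zero>\<^bsub>M\<^esub>"
 "x \<oplus>\<^bsub>with_smult M act\<^esub> y = x \<oplus>\<^bsub>M\<^esub> y" "c \<odot>\<^bsub>with_smult M act\<^esub> x = act c x"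
 by (simp_all add: with_smult_def)

lemma with_smult_abelian_group: "abelian_group M ==> abelian_group (with_smult M act)"
 by (rule comm_group_abelian_groupI, rule comm_group_cong[OF abelian_group.a_comm_group[of M]])
  (simp_all add: with_smult_def)

definition hom_group :: "('k, 'z) ring_scheme \<Rightarrow> ('k, 'v) module \<Rightarrow> ('k, 'w) module \<Rightarrow> ('v \<Rightarrow> 'w) monoid" where
 "hom_group K V W = \<lparr>carrier = module_hom K V W,
  monoid.mult = (%f g. \<lambda>x\<in>carrier V. f x \<oplus>\<^bsub>W\<^esub> g x), monoid.one = (\<lambda>x\<in>carrier V. \<zero>\<^bsub>W\<^esub>)\<rparr>"

definition hom_bimodule ::
 "('k, 'z) ring_scheme \<Rightarrow> ('k, 'v) module \<Rightarrow> ('k, 'w) module \<Rightarrow> ('a \<Rightarrow> 'a \<Rightarrow> ('v \<Rightarrow> 'w) \<Rightarrow> 'v \<Rightarrow> 'w)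
  \<Rightarrow> (('a, 'a) tensor, 'v \<Rightarrow> 'w) module" where
 "hom_bimodule K V W B = \<lparr>carrier = module_hom K V W, monoid.mult = undefined, monoid.one = undefined,
  ring.zero = (\<lambda>x\<in>carrier V. \<zero>\<^bsub>W\<^esub>), ring.add = (%f g. \<lambda>x\<in>carrier V. f x \<oplus>\<^bsub>W\<^esub> g x),
  smult = (%s f. tensor_lift (hom_group K V W) (%a b. \<lambda>x\<in>carrier V. B a b f x) s)\<rparr>"

lemma hom_bimodule_simps:
 "carrier (hom_bimodule K V W B) = module_hom K V W"
 "\<zero>\<^bsub>hom_bimodule K V W B\<^esub> = (\<lambda>x\<in>carrier V. \<zero>\<^bsub>W\<^esub>)"
 "f \<oplus>\<^bsub>hom_bimodule K V W B\<^esub> g = (\<lambda>x\<in>carrier V. f x \<oplus>\<^bsub>W\<^esub> g x)"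
 by (simp_all add: hom_bimodule_def)

lemma module_hom_closed: "f \<in> module_hom S V Y ==> x \<in> carrier V ==> f x \<in> carrier Y"
 by (rule lin_closed[OF module_hom_lin])

lemma module_hom_restrict: "f \<in> module_hom S V Y ==> (\<lambda>x\<in>carrier V. f x) = f"
 by (auto simp: module_hom_iff extensional_def restrict_def)

context fd_algebra
begin

lemma K_ring: "ring K"
 by (rule cring.axioms(1)[OF domain.axioms(1)[OF field.axioms(1)[OF field]]])

lemma A_left_module: "left_module K A"
 by (intro left_module.intro left_module_axioms.intro K_ring A_abelian)
  (simp_all add: smult_closed smult_l_distr smult_r_distr smult_assoc1 smult_one)

lemma unit_scalar:
 shows "c \<in> carrier K ==> sc c \<in> carrier A"
  and "c \<in> carrier K ==> a \<in> carrier A ==> (sc c) \<star> a = c \<odot>\<^bsub>A\<^esub> a"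
  and "c \<in> carrier K ==> a \<in> carrier A ==> a \<star> (sc c) = c \<odot>\<^bsub>A\<^esub> a"
  and "c \<in> carrier K ==> c' \<in> carrier K ==>
   (c \<oplus>\<^bsub>K\<^esub> c') \<odot>\<^bsub>A\<^esub> uA = sc c \<oplus>\<^bsub>A\<^esub> c' \<odot>\<^bsub>A\<^esub> uA"
  and "c \<in> carrier K ==> c' \<in> carrier K ==>
   (c \<otimes>\<^bsub>K\<^esub> c') \<odot>\<^bsub>A\<^esub> uA = (sc c) \<star> (c' \<odot>\<^bsub>A\<^esub> uA)"
  and "\<one>\<^bsub>K\<^esub> \<odot>\<^bsub>A\<^esub> uA = uA"
proof -
 show "c \<in> carrier K ==> c' \<in> carrier K ==>
   (c \<otimes>\<^bsub>K\<^esub> c') \<odot>\<^bsub>A\<^esub> uA = (sc c) \<star> (c' \<odot>\<^bsub>A\<^esub> uA)"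
  by (simp add: K_smult_closed smult_mult_left smult_assoc1)
qed (simp_all add: K_smult_closed smult_mult_left smult_mult_right smult_l_distr smult_one)

definition scal :: "('a, 'm) module \<Rightarrow> ('k, 'm) module" where
 "scal M = with_smult M (%c x. (sc c) \<odot>\<^bsub>M\<^esub> x)"

definition bscal :: "(('a, 'a) tensor, 'n) module \<Rightarrow> ('k, 'n) module" where
 "bscal N = with_smult N (%c x. la N (sc c) x)"

lemma scal_simps [simp]:
 "carrier (scal M) = carrier M" "\<zero>\<^bsub>scal M\<^esub> = \<zero>\<^bsub>M\<^esub>" "x \<oplus>\<^bsub>scal M\<^esub> y = x \<oplus>\<^bsub>M\<^esub> y"
 "c \<odot>\<^bsub>scal M\<^esub> x = (sc c) \<odot>\<^bsub>M\<^esub> x"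
 by (simp_all add: scal_def)

lemma bscal_simps [simp]:
 "carrier (bscal N) = carrier N" "\<zero>\<^bsub>bscal N\<^esub> = \<zero>\<^bsub>N\<^esub>" "x \<oplus>\<^bsub>bscal N\<^esub> y = x \<oplus>\<^bsub>N\<^esub> y"
 "c \<odot>\<^bsub>bscal N\<^esub> x = la N (sc c) x"
 by (simp_all add: bscal_def)

lemma scal_left_module:
 assumes M: "left_module A M"
 shows "left_module K (scal M)"
proof -
 interpret M: left_module A M by fact
 have "abelian_group (scal M)" unfolding scal_def by (rule with_smult_abelian_group) (rule M.M.abelian_group_axioms)
 then show ?thesis
  by (intro left_module.intro left_module_axioms.intro K_ring)
   (simp_all add: unit_scalar(1,4-6) M.smult_closed M.smult_l_distr M.smult_r_distr M.smult_assoc1 M.smult_one)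
qed

lemma bscal_left_module:
 assumes N: "bimod N"
 shows "left_module K (bscal N)"
proof -
 have "abelian_group (bscal N)" unfolding bscal_def
  by (rule with_smult_abelian_group) (rule left_module_abelian_group[OF N])
 then show ?thesis
  by (intro left_module.intro left_module_axioms.intro K_ring)
   (simp_all add: unit_scalar(1,4-6) lact_closed[OF N] lact_add_left[OF N] lact_add[OF N] lact_mult[OF N] lact_one[OF N])
qed

lemma hom_group_comm_group:
 assumes V: "left_module K V" and W: "left_module K W"
 shows "comm_group (hom_group K V W)"
proof -
 interpret W: left_module K W by fact
 have s: "carrier (hom_group K V W) = module_hom K V W"
  "!!f g. f \<otimes>\<^bsub>hom_group K V W\<^esub> g = (\<lambda>x\<in>carrier V. f x \<oplus>\<^bsub>W\<^esub> g x)"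
  "\<one>\<^bsub>hom_group K V W\<^esub> = (\<lambda>x\<in>carrier V. \<zero>\<^bsub>W\<^esub>)"
  by (simp_all add: hom_group_def)
 show ?thesis
 proof (rule comm_groupI; unfold s)
  fix f g h assume f: "f \<in> module_hom K V W" and g: "g \<in> module_hom K V W" and h: "h \<in> module_hom K V W"
  note cl = module_hom_closed[OF f] module_hom_closed[OF g] module_hom_closed[OF h]
  show "(\<lambda>x\<in>carrier V. f x \<oplus>\<^bsub>W\<^esub> g x) \<in> module_hom K V W"
   by (rule lin_restrict[OF V lin_plus[OF V W module_hom_lin[OF f] module_hom_lin[OF g]]])
  show "(\<lambda>x\<in>carrier V. (\<lambda>x\<in>carrier V. f x \<oplus>\<^bsub>W\<^esub> g x) x \<oplus>\<^bsub>W\<^esub> h x) =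
   (\<lambda>x\<in>carrier V. f x \<oplus>\<^bsub>W\<^esub> (\<lambda>x\<in>carrier V. g x \<oplus>\<^bsub>W\<^esub> h x) x)"
   by (rule restrict_ext) (simp add: cl W.M.a_assoc)
  show "(\<lambda>x\<in>carrier V. f x \<oplus>\<^bsub>W\<^esub> g x) = (\<lambda>x\<in>carrier V. g x \<oplus>\<^bsub>W\<^esub> f x)"
   by (rule restrict_ext) (simp add: cl W.M.a_comm)
  have "(\<lambda>x\<in>carrier V. (\<lambda>x\<in>carrier V. \<zero>\<^bsub>W\<^esub>) x \<oplus>\<^bsub>W\<^esub> f x) = (\<lambda>x\<in>carrier V. f x)"
   by (rule restrict_ext) (simp add: cl)
  then show "(\<lambda>x\<in>carrier V. (\<lambda>x\<in>carrier V. \<zero>\<^bsub>W\<^esub>) x \<oplus>\<^bsub>W\<^esub> f x) = f" by (simp only: module_hom_restrict[OF f])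
  show "\<exists>g\<in>module_hom K V W. (\<lambda>x\<in>carrier V. g x \<oplus>\<^bsub>W\<^esub> f x) = (\<lambda>x\<in>carrier V. \<zero>\<^bsub>W\<^esub>)"
  proof (rule bexI)
   show "(\<lambda>x\<in>carrier V. \<ominus>\<^bsub>W\<^esub> f x) \<in> module_hom K V W"
    by (rule lin_restrict[OF V lin_neg[OF V W module_hom_lin[OF f]]])
   show "(\<lambda>x\<in>carrier V. (\<lambda>x\<in>carrier V. \<ominus>\<^bsub>W\<^esub> f x) x \<oplus>\<^bsub>W\<^esub> f x) = (\<lambda>x\<in>carrier V. \<zero>\<^bsub>W\<^esub>)"
    by (rule restrict_ext) (simp add: cl W.M.l_neg)
  qed
 next
  show "(\<lambda>x\<in>carrier V. \<zero>\<^bsub>W\<^esub>) \<in> module_hom K V W" by (rule lin_restrict[OF V lin_null[OF V W]])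
 qed
qed

lemma hom_bimodule_module:
 assumes V: "left_module K V" and W: "left_module K W"
  and closed: "!!a b f. a \<in> carrier A ==> b \<in> carrier A ==> f \<in> module_hom K V W ==> B a b f \<in> lin K V W"
  and add: "!!a b f g x. a \<in> carrier A ==> b \<in> carrier A ==> f \<in> module_hom K V W ==> g \<in> module_hom K V W ==>
   x \<in> carrier V ==> B a b (\<lambda>x\<in>carrier V. f x \<oplus>\<^bsub>W\<^esub> g x) x = B a b f x \<oplus>\<^bsub>W\<^esub> B a b g x"
  and add_left: "!!a a' b f x. a \<in> carrier A ==> a' \<in> carrier A ==> b \<in> carrier A ==> f \<in> module_hom K V W ==>
   x \<in> carrier V ==> B (a \<oplus>\<^bsub>A\<^esub> a') b f x = B a b f x \<oplus>\<^bsub>W\<^esub> B a' b f x"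
  and add_right: "!!a b b' f x. a \<in> carrier A ==> b \<in> carrier A ==> b' \<in> carrier A ==> f \<in> module_hom K V W ==>
   x \<in> carrier V ==> B a (b \<oplus>\<^bsub>A\<^esub> b') f x = B a b f x \<oplus>\<^bsub>W\<^esub> B a b' f x"
  and mid: "!!c a b f x. c \<in> carrier K ==> a \<in> carrier A ==> b \<in> carrier A ==> f \<in> module_hom K V W ==>
   x \<in> carrier V ==> B (c \<odot>\<^bsub>A\<^esub> a) b f x = B a (c \<odot>\<^bsub>A\<^esub> b) f x"
  and mult: "!!a a' b b' f x. a \<in> carrier A ==> a' \<in> carrier A ==> b \<in> carrier A ==> b' \<in> carrier A ==>
   f \<in> module_hom K V W ==> x \<in> carrier V ==>
   B (a \<star> a') (b' \<star> b) f x = B a b (\<lambda>x\<in>carrier V. B a' b' f x) x"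
  and one: "!!f x. f \<in> module_hom K V W ==> x \<in> carrier V ==> B uA uA f x = f x"
 shows "bimod (hom_bimodule K V W B)"
  and "!!a b f. a \<in> carrier A ==> b \<in> carrier A ==> f \<in> module_hom K V W ==>
   pr a b \<odot>\<^bsub>hom_bimodule K V W B\<^esub> f = (\<lambda>x\<in>carrier V. B a b f x)"
proof -
 let ?H = "hom_bimodule K V W B"
 have ab: "abelian_group ?H"
  by (rule comm_group_abelian_groupI, rule comm_group_cong[OF hom_group_comm_group[OF V W]])
   (simp_all add: hom_bimodule_def hom_group_def)
 have sm: "s \<odot>\<^bsub>?H\<^esub> f = tensor_lift (add_monoid ?H) (%a b. \<lambda>x\<in>carrier V. B a b f x) s" for s f
  by (subst tensor_lift_group_cong[of _ "hom_group K V W"]) (simp_all add: hom_bimodule_def hom_group_def)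
 have cl: "(\<lambda>x\<in>carrier V. B a b f x) \<in> module_hom K V W"
  if "a \<in> carrier A" "b \<in> carrier A" "f \<in> module_hom K V W" for a b f
  by (rule lin_restrict[OF V closed[OF that]])
 have *: "bimod ?H \<and> (\<forall>a\<in>carrier A. \<forall>b\<in>carrier A. \<forall>f\<in>carrier ?H.
   pr a b \<odot>\<^bsub>?H\<^esub> f = (\<lambda>x\<in>carrier V. B a b f x))"
 proof (intro conjI ballI env_moduleI[OF ab, where \<beta> = "%a b f. \<lambda>x\<in>carrier V. B a b f x"]; (unfold hom_bimodule_simps)?)
 qed (simp_all add: cl add add_left add_right mid mult module_hom_restrict
   cong: restrict_cong, simp_all add: one module_hom_restrict cong: restrict_cong,
   (simp only: sm, rule tensor_lift_group_cong; simp add: hom_bimodule_def)+)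
 then show "bimod ?H" by (rule conjunct1)
 show "pr a b \<odot>\<^bsub>?H\<^esub> f = (\<lambda>x\<in>carrier V. B a b f x)"
  if "a \<in> carrier A" "b \<in> carrier A" "f \<in> module_hom K V W" for a b f
  using * that by (simp add: hom_bimodule_simps)
qed

section \<open>One-sided splittings of bimodule resolutions\<close>

definition right_linear ::
 "(('a, 'a) tensor, 'n) module \<Rightarrow> (('a, 'a) tensor, 'm) module \<Rightarrow> ('n \<Rightarrow> 'm) \<Rightarrow> bool" where
 "right_linear N M f \<longleftrightarrow> (\<forall>x\<in>carrier N. f x \<in> carrier M) \<and>
  (\<forall>x\<in>carrier N. \<forall>y\<in>carrier N. f (x \<oplus>\<^bsub>N\<^esub> y) = f x \<oplus>\<^bsub>M\<^esub> f y) \<and>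
  (\<forall>a\<in>carrier A. \<forall>x\<in>carrier N. f (ra N x a) = ra M (f x) a)"

lemma right_linearD:
 assumes "right_linear N M f"
 shows "x \<in> carrier N ==> f x \<in> carrier M"
  "x \<in> carrier N ==> y \<in> carrier N ==> f (x \<oplus>\<^bsub>N\<^esub> y) = f x \<oplus>\<^bsub>M\<^esub> f y"
  "a \<in> carrier A ==> x \<in> carrier N ==> f (ra N x a) = ra M (f x) a"
 using assms unfolding right_linear_def by simp_all

lemma lin_right_linear: "f \<in> lin Ae N M ==> right_linear N M f"
 unfolding right_linear_def by (simp add: lin_closed lin_add env_lin_ract)

definition coind :: "(('a, 'a) tensor, 'n) module \<Rightarrow> (('a, 'a) tensor, 'a \<Rightarrow> 'n) module" where
 "coind N = hom_bimodule K A (bscal N) (%a b f x. ra N (f (x \<star> a)) b)"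

lemma coind_module:
 assumes N: "bimod N"
 shows "bimod (coind N)"
  and "!!a b f. a \<in> carrier A ==> b \<in> carrier A ==> f \<in> module_hom K A (bscal N) ==>
   pr a b \<odot>\<^bsub>coind N\<^esub> f = (\<lambda>x\<in>carrier A. ra N (f (x \<star> a)) b)"
proof -
 let ?W = "bscal N"
 let ?B = "%a b f x. ra N (f (x \<star> a)) b"
 interpret N: left_module Ae N by fact
 have fl: "f x \<in> carrier N" if "f \<in> module_hom K A ?W" "x \<in> carrier A" for f x
  using module_hom_closed[OF that] by simp
 have fadd: "f (x \<oplus>\<^bsub>A\<^esub> y) = f x \<oplus>\<^bsub>N\<^esub> f y" if "f \<in> module_hom K A ?W" "x \<in> carrier A" "y \<in> carrier A" for f x y
  using lin_add[OF module_hom_lin[OF that(1)] that(2,3)] by simp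
 have fsm: "f (c \<odot>\<^bsub>A\<^esub> x) = la N (sc c) (f x)"
  if "f \<in> module_hom K A ?W" "c \<in> carrier K" "x \<in> carrier A" for f c x
  using lin_smult[OF module_hom_lin[OF that(1)] that(2,3)] by simp
 have W: "left_module K ?W" by (rule bscal_left_module[OF N])
 have mid: "?B (c \<odot>\<^bsub>A\<^esub> a) b f x = ?B a (c \<odot>\<^bsub>A\<^esub> b) f x"
  if c: "c \<in> carrier K" and a: "a \<in> carrier A" and b: "b \<in> carrier A" and f: "f \<in> module_hom K A ?W" and x: "x \<in> carrier A"
  for c a b f x
 proof -
  have xa: "x \<star> a \<in> carrier A" using x a by simp
  have "ra N (f (x \<star> a)) (c \<odot>\<^bsub>A\<^esub> b) = ra N (f (x \<star> a)) ((sc c) \<star> b)"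
   by (simp add: unit_scalar c b)
  also have "\<dots> = ra N (la N (sc c) (f (x \<star> a))) b"
   using fl[OF f xa] c b by (simp only: ract_mult[OF N unit_scalar(1)] lact_central[OF N])
  also have "\<dots> = ?B (c \<odot>\<^bsub>A\<^esub> a) b f x"
   by (simp add: fsm[OF f c xa, symmetric] smult_mult_right c x a)
  finally show ?thesis by simp
 qed
 have lin: "?B a b f \<in> lin K A ?W" if a: "a \<in> carrier A" and b: "b \<in> carrier A" and f: "f \<in> module_hom K A ?W" for a b f
 proof (rule linI)
  fix x y assume x: "x \<in> carrier A" and y: "y \<in> carrier A"
  show "?B a b f x \<in> carrier ?W" using a b x by (simp add: fl[OF f] ract_closed[OF N])
  show "?B a b f (x \<oplus>\<^bsub>A\<^esub> y) = ?B a b f x \<oplus>\<^bsub>?W\<^esub> ?B a b f y"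
   using a b x y by (simp add: A.l_distr fadd[OF f] ract_add[OF N] fl[OF f])
 next
  fix c x assume c: "c \<in> carrier K" and x: "x \<in> carrier A"
  show "?B a b f (c \<odot>\<^bsub>A\<^esub> x) = c \<odot>\<^bsub>?W\<^esub> ?B a b f x"
   using a b c x by (simp add: smult_mult_left fsm[OF f] lact_ract[OF N] unit_scalar(1) fl[OF f])
 qed
 note H = hom_bimodule_module[OF A_left_module W, of ?B, folded coind_def]
 show "bimod (coind N)"
  by (rule H(1)) (simp_all add: lin mid ract_add[OF N] fl ract_closed[OF N] A.r_distr fadd
    ract_add_right[OF N] A.m_assoc ract_mult[OF N] ract_one[OF N])
 show "pr a b \<odot>\<^bsub>coind N\<^esub> f = (\<lambda>x\<in>carrier A. ?B a b f x)"
  if "a \<in> carrier A" "b \<in> carrier A" "f \<in> module_hom K A ?W" for a b f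
  by (rule H(2)[OF _ _ _ _ _ _ _ that]) (simp_all add: lin mid ract_add[OF N] fl ract_closed[OF N] A.r_distr fadd
    ract_add_right[OF N] A.m_assoc ract_mult[OF N] ract_one[OF N])
qed

lemma right_linear_lift:
 assumes P: "projective_module Ae P" and W: "bimod W" and Y: "bimod Y"
  and dl: "dl \<in> lin Ae W Y" and t: "right_linear P Y t" and im: "t ` carrier P \<subseteq> dl ` carrier W"
 shows "\<exists>s. right_linear P W s \<and> (\<forall>x\<in>carrier P. dl (s x) = t x)"
proof -
 have PM: "bimod P" using P unfolding projective_module_def by (rule conjunct1)
 note tD = right_linearD[OF t]
 note coW = coind_module[OF W] and coY = coind_module[OF Y]
 have cs: "carrier (coind N) = module_hom K A (bscal N)" "f \<oplus>\<^bsub>coind N\<^esub> g = (\<lambda>x\<in>carrier A. f x \<oplus>\<^bsub>N\<^esub> g x)"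
  for N :: "(('a, 'a) tensor, 'n) module" and f g by (simp_all add: coind_def hom_bimodule_simps)
 have dlK: "dl \<in> lin K (bscal W) (bscal Y)"
  by (rule linI) (simp_all add: lin_closed[OF dl] lin_add[OF dl] env_lin_lact[OF dl] unit_scalar(1))
 have ndl: "(%f. \<lambda>x\<in>carrier A. dl (f x)) \<in> lin Ae (coind W) (coind Y)"
 proof (rule env_lin_prI[OF coW(1) coY(1)]; (unfold cs)?)
  fix f g assume f: "f \<in> module_hom K A (bscal W)" and g: "g \<in> module_hom K A (bscal W)"
  have fx: "f x \<in> carrier W" "g x \<in> carrier W" if "x \<in> carrier A" for x
   using module_hom_closed[OF f that] module_hom_closed[OF g that] by simp_all
  show "(\<lambda>x\<in>carrier A. dl (f x)) \<in> module_hom K A (bscal Y)"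
   by (rule lin_restrict[OF A_left_module lin_comp[OF module_hom_lin[OF f] dlK]])
  show "(\<lambda>x\<in>carrier A. dl ((\<lambda>x\<in>carrier A. f x \<oplus>\<^bsub>W\<^esub> g x) x)) =
    (\<lambda>x\<in>carrier A. (\<lambda>x\<in>carrier A. dl (f x)) x \<oplus>\<^bsub>Y\<^esub> (\<lambda>x\<in>carrier A. dl (g x)) x)"
   by (rule restrict_ext) (simp add: lin_add[OF dl] fx)
 next
  fix a b f assume ab: "a \<in> carrier A" "b \<in> carrier A" and f: "f \<in> module_hom K A (bscal W)"
  have fx: "f x \<in> carrier W" if "x \<in> carrier A" for x using module_hom_closed[OF f that] by simp
  have c: "(\<lambda>x\<in>carrier A. dl (f x)) \<in> module_hom K A (bscal Y)"
   by (rule lin_restrict[OF A_left_module lin_comp[OF module_hom_lin[OF f] dlK]])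
  show "(\<lambda>x\<in>carrier A. dl ((pr a b \<odot>\<^bsub>coind W\<^esub> f) x)) = pr a b \<odot>\<^bsub>coind Y\<^esub> (\<lambda>x\<in>carrier A. dl (f x))"
   unfolding coW(2)[OF ab f] coY(2)[OF ab c]
   by (rule restrict_ext) (use ab in \<open>simp add: env_lin_ract[OF dl] fx\<close>)
 qed
 define t' where "t' = (%p. \<lambda>x\<in>carrier A. t (la P x p))"
 have t'K: "t' p \<in> module_hom K A (bscal Y)" if p: "p \<in> carrier P" for p
  unfolding t'_def
 proof (rule lin_restrict[OF A_left_module], rule linI)
  fix x y assume x: "x \<in> carrier A" and y: "y \<in> carrier A"
  show "t (la P x p) \<in> carrier (bscal Y)" by (simp add: tD lact_closed[OF PM] x p)
  show "t (la P (x \<oplus>\<^bsub>A\<^esub> y) p) = t (la P x p) \<oplus>\<^bsub>bscal Y\<^esub> t (la P y p)"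
   by (simp add: tD lact_closed[OF PM] lact_add_left[OF PM] x y p)
 next
  fix c x assume c: "c \<in> carrier K" and x: "x \<in> carrier A"
  have "la P (c \<odot>\<^bsub>A\<^esub> x) p = ra P (la P x p) (sc c)"
   using c x p by (simp add: lact_central[OF PM, symmetric] lact_closed[OF PM] lact_mult[OF PM, symmetric] unit_scalar)
  then show "t (la P (c \<odot>\<^bsub>A\<^esub> x) p) = c \<odot>\<^bsub>bscal Y\<^esub> t (la P x p)"
   using c x p by (simp add: tD lact_closed[OF PM] unit_scalar(1) lact_central[OF Y])
 qed
 have nt: "t' \<in> lin Ae P (coind Y)"
 proof (rule env_lin_prI[OF PM coY(1)]; (unfold cs)?)
  fix p q assume p: "p \<in> carrier P" and q: "q \<in> carrier P"
  show "t' p \<in> module_hom K A (bscal Y)" by (rule t'K[OF p])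
  show "t' (p \<oplus>\<^bsub>P\<^esub> q) = (\<lambda>x\<in>carrier A. t' p x \<oplus>\<^bsub>Y\<^esub> t' q x)"
   unfolding t'_def by (rule restrict_ext) (simp add: p q lact_add[OF PM] tD lact_closed[OF PM])
 next
  fix a b p assume ab: "a \<in> carrier A" "b \<in> carrier A" and p: "p \<in> carrier P"
  show "t' (pr a b \<odot>\<^bsub>P\<^esub> p) = pr a b \<odot>\<^bsub>coind Y\<^esub> t' p"
   unfolding coY(2)[OF ab t'K[OF p]] unfolding t'_def
  proof (rule restrict_ext)
   fix x assume x: "x \<in> carrier A"
   have "la P x (pr a b \<odot>\<^bsub>P\<^esub> p) = ra P (la P (x \<star> a) p) b"
    using ab x p by (simp add: pr_smult[OF PM] lact_ract[OF PM] lact_closed[OF PM] ract_closed[OF PM] lact_mult[OF PM])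
   then show "t (la P x (pr a b \<odot>\<^bsub>P\<^esub> p)) =
     ra Y ((\<lambda>x\<in>carrier A. t (la P x p)) (x \<star> a)) b"
    using ab x p by (simp add: tD lact_closed[OF PM])
  qed
 qed
 interpret vec K A by (intro vec.intro A_left_module vec_axioms.intro field)
 have "t' ` carrier P \<subseteq> (%f. \<lambda>x\<in>carrier A. dl (f x)) ` carrier (coind W)"
 proof (rule image_subsetI, unfold cs)
  fix p assume p: "p \<in> carrier P"
  have "t' p ` carrier A \<subseteq> dl ` carrier (bscal W)"
   using im p lact_closed[OF PM] by (auto simp: t'_def)
  then obtain f where f: "f \<in> module_hom K A (bscal W)" "\<forall>x\<in>carrier A. dl (f x) = t' p x"
   using linear_lift[OF finite_dimensional bscal_left_module[OF W] bscal_left_module[OF Y] dlK module_hom_lin[OF t'K[OF p]]]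
   by auto
  have "(\<lambda>x\<in>carrier A. dl (f x)) = t' p"
   using f(2) by (auto simp: t'_def intro!: restrict_ext)
  then show "t' p \<in> (%f. \<lambda>x\<in>carrier A. dl (f x)) ` module_hom K A (bscal W)" using f(1) by (metis imageI)
 qed
 from projective_lift[OF P coW(1) coY(1) ndl nt this]
 obtain s' where s': "s' \<in> module_hom Ae P (coind W)" "!!p. p \<in> carrier P ==> (\<lambda>x\<in>carrier A. dl (s' p x)) = t' p"
  by auto
 have s'K: "s' p \<in> module_hom K A (bscal W)" if "p \<in> carrier P" for p
  using module_hom_closed[OF s'(1) that] by (simp add: cs)
 define s where "s = (%p. s' p uA)"
 have "right_linear P W s" unfolding right_linear_def
 proof (intro conjI ballI)
  fix p q assume p: "p \<in> carrier P" and q: "q \<in> carrier P"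
  show "s p \<in> carrier W" unfolding s_def using module_hom_closed[OF s'K[OF p], of "uA"] by simp
  show "s (p \<oplus>\<^bsub>P\<^esub> q) = s p \<oplus>\<^bsub>W\<^esub> s q"
   unfolding s_def lin_add[OF module_hom_lin[OF s'(1)] p q] cs by simp
 next
  fix a p assume a: "a \<in> carrier A" and p: "p \<in> carrier P"
  have "s' (ra P p a) = pr uA a \<odot>\<^bsub>coind W\<^esub> s' p"
   unfolding ract_def by (rule lin_smult[OF module_hom_lin[OF s'(1)] _ p]) (simp add: env_simps pr_closed a)
  then show "s (ra P p a) = ra W (s p) a"
   unfolding s_def by (simp add: coW(2)[OF A.one_closed a s'K[OF p]])
 qed
 moreover have "dl (s p) = t p" if p: "p \<in> carrier P" for p
 proof -
  have "(\<lambda>x\<in>carrier A. dl (s' p x)) uA = t' p uA" using s'(2)[OF p] by simp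
  then show ?thesis by (simp add: s_def t'_def lact_one[OF PM] p)
 qed
 ultimately show ?thesis by auto
qed

end

section \<open>Tensoring a bimodule resolution of the algebra\<close>

context fd_algebra
begin

lemma ract_minus:
 assumes N: "bimod N" and "a \<in> carrier A" "x \<in> carrier N" "y \<in> carrier N"
 shows "ra N (x \<ominus>\<^bsub>N\<^esub> y) a = ra N x a \<ominus>\<^bsub>N\<^esub> ra N y a"
 using additive_hom(3)[of N N "%x. ra N x a" x y] assms
 by (simp add: left_module_abelian_group[OF N] ract_closed[OF N] ract_add[OF N])

lemma right_linear_diff:
 assumes N: "bimod N" and M: "bimod M"
  and f: "right_linear N M f" and g: "right_linear N M g"
 shows "right_linear N M (%x. f x \<ominus>\<^bsub>M\<^esub> g x)"
proof -
 interpret M: left_module Ae M by fact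
 show ?thesis unfolding right_linear_def
 proof (intro conjI ballI)
  fix x y assume "x \<in> carrier N" "y \<in> carrier N"
  then show "f x \<ominus>\<^bsub>M\<^esub> g x \<in> carrier M"
   "f (x \<oplus>\<^bsub>N\<^esub> y) \<ominus>\<^bsub>M\<^esub> g (x \<oplus>\<^bsub>N\<^esub> y) = f x \<ominus>\<^bsub>M\<^esub> g x \<oplus>\<^bsub>M\<^esub> (f y \<ominus>\<^bsub>M\<^esub> g y)"
   by (simp_all add: right_linearD(1,2)[OF f] right_linearD(1,2)[OF g] a_minus_def M.M.minus_add M.M.a_ac)
 next
  fix a x assume "a \<in> carrier A" "x \<in> carrier N"
  then show "f (ra N x a) \<ominus>\<^bsub>M\<^esub> g (ra N x a) = ra M (f x \<ominus>\<^bsub>M\<^esub> g x) a"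
   by (simp add: right_linearD[OF f] right_linearD[OF g] ract_minus[OF M])
 qed
qed

lemma right_linear_comp: "right_linear N M f ==> right_linear M L g ==> right_linear N L (%x. g (f x))"
 unfolding right_linear_def by simp

lemma right_linear_id: "right_linear N N (%x. x)"
 unfolding right_linear_def by simp

lemma right_contraction:
 assumes ex: "aug_exact Ae P d \<epsilon> (regular_bimodule A)" and proj: "!!n. projective_module Ae (P n)"
 shows "\<exists>p s. p \<in> carrier (P 0) \<and> \<epsilon> p = uA \<and> (\<forall>n. right_linear (P n) (P (Suc n)) (s n)) \<and>
  (\<forall>x\<in>carrier (P 0). d 0 (s 0 x) = x \<ominus>\<^bsub>P 0\<^esub> ra (P 0) p (\<epsilon> x)) \<and>
  (\<forall>n. \<forall>x\<in>carrier (P (Suc n)). d (Suc n) (s (Suc n) x) = x \<ominus>\<^bsub>P (Suc n)\<^esub> s n (d n x))"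
proof -
 note D = aug_exactD[OF ex]
 have PM: "bimod (P n)" for n by (rule D(2))
 have eps: "\<epsilon> x \<in> carrier A" if "x \<in> carrier (P 0)" for x using lin_closed[OF D(4) that] by (simp add: regular_simps)
 have dcl: "d n x \<in> carrier (P n)" if "x \<in> carrier (P (Suc n))" for n x by (rule lin_closed[OF D(3) that])
 have "uA \<in> \<epsilon> ` carrier (P 0)" using D(5) by (simp add: regular_simps)
 then obtain p where p: "p \<in> carrier (P 0)" "\<epsilon> p = uA" by (metis imageE)
 have eps_add: "\<epsilon> (x \<oplus>\<^bsub>P 0\<^esub> y) = \<epsilon> x \<oplus>\<^bsub>A\<^esub> \<epsilon> y" if "x \<in> carrier (P 0)" "y \<in> carrier (P 0)" for x y
  using lin_add[OF D(4) that] by (simp add: regular_simps)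
 have eps_ract: "\<epsilon> (ra (P 0) x a) = \<epsilon> x \<star> a" if "a \<in> carrier A" "x \<in> carrier (P 0)" for x a
  using env_lin_ract[OF D(4) that] that eps by (simp add: regular_ract)
 have r0: "right_linear (P 0) (P 0) (%x. ra (P 0) p (\<epsilon> x))"
  unfolding right_linear_def
  by (simp add: ract_closed[OF PM] eps p eps_add ract_add_right[OF PM] eps_ract ract_mult[OF PM])
 define good where "good = (%n s. right_linear (P n) (P (Suc n)) s \<and>
  (\<forall>x\<in>carrier (P (Suc n)). d n (s (d n x)) = d n x) \<and>
  (n = 0 \<longrightarrow> (\<forall>x\<in>carrier (P 0). d 0 (s x) = x \<ominus>\<^bsub>P 0\<^esub> ra (P 0) p (\<epsilon> x))))"
 have "\<exists>s. \<forall>n. good n (s n) \<and> (\<forall>x\<in>carrier (P (Suc n)). d (Suc n) (s (Suc n) x) = x \<ominus>\<^bsub>P (Suc n)\<^esub> s n (d n x))"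
 proof (rule dependent_nat_choice)
  interpret P0: left_module Ae "P 0" by (rule PM)
  have t: "right_linear (P 0) (P 0) (%x. x \<ominus>\<^bsub>P 0\<^esub> ra (P 0) p (\<epsilon> x))"
   by (rule right_linear_diff[OF PM PM right_linear_id r0])
  have "(%x. x \<ominus>\<^bsub>P 0\<^esub> ra (P 0) p (\<epsilon> x)) ` carrier (P 0) \<subseteq> d 0 ` carrier (P (Suc 0))"
  proof (rule image_subsetI)
   fix x assume x: "x \<in> carrier (P 0)"
   have "\<epsilon> (x \<ominus>\<^bsub>P 0\<^esub> ra (P 0) p (\<epsilon> x)) = \<epsilon> x \<ominus>\<^bsub>regular_bimodule A\<^esub> \<epsilon> (ra (P 0) p (\<epsilon> x))"
    by (rule lin_minus[OF PM D(1) D(4)]) (simp_all add: x ract_closed[OF PM] eps p)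
   also have "\<dots> = \<zero>\<^bsub>regular_bimodule A\<^esub>"
    using eps[OF x] abelian_group.r_neg[OF left_module_abelian_group[OF D(1)], of "\<epsilon> x"]
    by (simp add: eps_ract p a_minus_def regular_simps)
   finally show "x \<ominus>\<^bsub>P 0\<^esub> ra (P 0) p (\<epsilon> x) \<in> d 0 ` carrier (P (Suc 0))"
    unfolding D(6) using x by (simp add: ract_closed[OF PM] eps p)
  qed
  from right_linear_lift[OF proj PM PM D(3) t this]
  obtain s where s: "right_linear (P 0) (P (Suc 0)) s"
    "!!x. x \<in> carrier (P 0) ==> d 0 (s x) = x \<ominus>\<^bsub>P 0\<^esub> ra (P 0) p (\<epsilon> x)" by auto
  have "d 0 (s (d 0 x)) = d 0 x" if x: "x \<in> carrier (P (Suc 0))" for x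
  proof -
   have "ra (P 0) p \<zero>\<^bsub>A\<^esub> = \<zero>\<^bsub>P 0\<^esub>"
    using additive_hom(1)[of A "P 0" "ra (P 0) p"] p
    by (simp add: A_abelian P0.M.abelian_group_axioms ract_closed[OF PM] ract_add_right[OF PM])
   then show ?thesis
    using aug_exact_eps[OF ex x] dcl[OF x] by (simp add: s(2) regular_simps a_minus_def)
  qed
  then show "\<exists>s. good 0 s" unfolding good_def using s by (intro exI[of _ s]) simp
 next
  fix s n assume g: "good n s"
  interpret Pn: left_module Ae "P n" by (rule PM)
  interpret PS: left_module Ae "P (Suc n)" by (rule PM)
  have s: "right_linear (P n) (P (Suc n)) s" "!!x. x \<in> carrier (P (Suc n)) ==> d n (s (d n x)) = d n x"
   using g by (auto simp: good_def)
  note sc = right_linearD(1)[OF s(1)]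
  have t: "right_linear (P (Suc n)) (P (Suc n)) (%x. x \<ominus>\<^bsub>P (Suc n)\<^esub> s (d n x))"
   by (rule right_linear_diff[OF PM PM right_linear_id right_linear_comp[OF lin_right_linear[OF D(3)] s(1)]])
  have "(%x. x \<ominus>\<^bsub>P (Suc n)\<^esub> s (d n x)) ` carrier (P (Suc n)) \<subseteq> d (Suc n) ` carrier (P (Suc (Suc n)))"
  proof (rule image_subsetI)
   fix x assume x: "x \<in> carrier (P (Suc n))"
   have "d n (x \<ominus>\<^bsub>P (Suc n)\<^esub> s (d n x)) = \<zero>\<^bsub>P n\<^esub>"
    using x sc dcl lin_minus[OF PM PM D(3) x sc[OF dcl[OF x]]] by (simp add: s(2) a_minus_def Pn.M.r_neg)
   then show "x \<ominus>\<^bsub>P (Suc n)\<^esub> s (d n x) \<in> d (Suc n) ` carrier (P (Suc (Suc n)))"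
    unfolding D(7) using x sc dcl by simp
  qed
  from right_linear_lift[OF proj PM PM D(3) t this]
  obtain s' where s': "right_linear (P (Suc n)) (P (Suc (Suc n))) s'"
    "!!x. x \<in> carrier (P (Suc n)) ==> d (Suc n) (s' x) = x \<ominus>\<^bsub>P (Suc n)\<^esub> s (d n x)" by auto
  have "s \<zero>\<^bsub>P n\<^esub> = \<zero>\<^bsub>P (Suc n)\<^esub>"
   by (rule additive_hom(1)[OF Pn.M.abelian_group_axioms PS.M.abelian_group_axioms]) (simp_all add: right_linearD[OF s(1)])
  then have "d (Suc n) (s' (d (Suc n) x)) = d (Suc n) x" if "x \<in> carrier (P (Suc (Suc n)))" for x
   using that dcl by (simp add: s'(2) aug_exact_dd[OF ex] a_minus_def)
  then show "\<exists>s'. good (Suc n) s' \<and> (\<forall>x\<in>carrier (P (Suc n)). d (Suc n) (s' x) = x \<ominus>\<^bsub>P (Suc n)\<^esub> s (d n x))"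
   using s' unfolding good_def by (intro exI[of _ s']) simp
 qed
 then obtain s where s: "!!n. good n (s n)"
   "!!n x. x \<in> carrier (P (Suc n)) ==> d (Suc n) (s (Suc n) x) = x \<ominus>\<^bsub>P (Suc n)\<^esub> s n (d n x)" by auto
 show ?thesis
  by (intro exI[of _ p] exI[of _ s] conjI allI ballI p s(2)) (use s(1) in \<open>auto simp: good_def\<close>)
qed

definition left_action :: "('y, 'z) ring_scheme \<Rightarrow> ('a \<Rightarrow> 'y \<Rightarrow> 'y) \<Rightarrow> bool" where
 "left_action Y l \<longleftrightarrow> abelian_group Y \<and>
  (\<forall>a\<in>carrier A. \<forall>y\<in>carrier Y. l a y \<in> carrier Y) \<and>
  (\<forall>a\<in>carrier A. \<forall>y\<in>carrier Y. \<forall>y'\<in>carrier Y. l a (y \<oplus>\<^bsub>Y\<^esub> y') = l a y \<oplus>\<^bsub>Y\<^esub> l a y') \<and>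
  (\<forall>a\<in>carrier A. \<forall>a'\<in>carrier A. \<forall>y\<in>carrier Y. l (a \<oplus>\<^bsub>A\<^esub> a') y = l a y \<oplus>\<^bsub>Y\<^esub> l a' y) \<and>
  (\<forall>a\<in>carrier A. \<forall>a'\<in>carrier A. \<forall>y\<in>carrier Y. l (a \<star> a') y = l a (l a' y)) \<and>
  (\<forall>y\<in>carrier Y. l uA y = y)"

lemma left_actionD:
 assumes "left_action Y l"
 shows "abelian_group Y" "a \<in> carrier A ==> y \<in> carrier Y ==> l a y \<in> carrier Y"
  "a \<in> carrier A ==> y \<in> carrier Y ==> y' \<in> carrier Y ==> l a (y \<oplus>\<^bsub>Y\<^esub> y') = l a y \<oplus>\<^bsub>Y\<^esub> l a y'"
  "a \<in> carrier A ==> a' \<in> carrier A ==> y \<in> carrier Y ==> l (a \<oplus>\<^bsub>A\<^esub> a') y = l a y \<oplus>\<^bsub>Y\<^esub> l a' y"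
  "a \<in> carrier A ==> a' \<in> carrier A ==> y \<in> carrier Y ==> l (a \<star> a') y = l a (l a' y)"
  "y \<in> carrier Y ==> l uA y = y"
 using assms unfolding left_action_def by simp_all

lemma left_action_lact: "bimod N ==> left_action N (la N)"
 unfolding left_action_def
 by (simp add: left_module_abelian_group lact_closed lact_add lact_add_left lact_mult lact_one)

lemma left_action_smult: "left_module A M ==> left_action M (%a m. a \<odot>\<^bsub>M\<^esub> m)"
 unfolding left_action_def
 by (simp add: left_module_abelian_group left_module.smult_closed left_module.smult_l_distr
   left_module.smult_r_distr left_module.smult_assoc1 left_module.smult_one)

abbreviation "TT N Y l \<equiv> tensor_group (carrier A) N (ra N) Y l"

lemma TT_data:
 assumes N: "bimod N" and Y: "left_action Y l"
 shows "tensor_data (carrier A) N (ra N) Y l"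
 by (rule tensor_data.intro)
  (simp_all add: left_module_abelian_group[OF N] left_actionD[OF Y] ract_closed[OF N])

lemma TT_map:
 assumes N: "bimod N" and N': "bimod N'" and Y: "left_action Y l"
  and f: "right_linear N N' f"
 shows "tensor_map (TT N' Y l) f (%y. y) \<in> hom (TT N Y l) (TT N' Y l)"
  and "!!x y. x \<in> carrier N ==> y \<in> carrier Y ==>
   tensor_map (TT N' Y l) f (%y. y) (pure_tensor (TT N Y l) x y) = pure_tensor (TT N' Y l) (f x) y"
proof -
 note * = tensor_map[OF TT_data[OF N Y] TT_data[OF N' Y], of f "%y. y"]
 have m: "pure_tensor (TT N' Y l) (f (ra N x s)) y = pure_tensor (TT N' Y l) (f x) (l s y)"
  if "x \<in> carrier N" "s \<in> carrier A" "y \<in> carrier Y" for x s y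
  using that by (simp add: right_linearD[OF f] tensor_data.pure_middle[OF TT_data[OF N' Y]])
 show "tensor_map (TT N' Y l) f (%y. y) \<in> hom (TT N Y l) (TT N' Y l)"
  by (rule *(1)) (simp_all add: right_linearD(1,2)[OF f] m)
 show "tensor_map (TT N' Y l) f (%y. y) (pure_tensor (TT N Y l) x y) = pure_tensor (TT N' Y l) (f x) y"
  if "x \<in> carrier N" "y \<in> carrier Y" for x y
  by (rule *(2)) (simp_all add: right_linearD(1,2)[OF f] m that)
qed

lemma tensor_resolution:
 assumes ex: "aug_exact Ae P d \<epsilon> (regular_bimodule A)" and proj: "!!n. projective_module Ae (P n)"
  and Y: "left_action Y l"
 defines "T \<equiv> %i. TT (P i) Y l" and "D \<equiv> %i. tensor_map (TT (P i) Y l) (d i) (%y. y)"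
  and "E \<equiv> tensor_lift (add_monoid Y) (%p y. l (\<epsilon> p) y)"
 shows "D i \<in> hom (T (Suc i)) (T i)" "E \<in> hom (T 0) (add_monoid Y)"
  and "!!x y. x \<in> carrier (P (Suc i)) ==> y \<in> carrier Y ==> D i (pure_tensor (T (Suc i)) x y) = pure_tensor (T i) (d i x) y"
  and "!!x y. x \<in> carrier (P 0) ==> y \<in> carrier Y ==> E (pure_tensor (T 0) x y) = l (\<epsilon> x) y"
  and "E ` carrier (T 0) = carrier Y"
  and "D 0 ` carrier (T (Suc 0)) = {t \<in> carrier (T 0). E t = \<zero>\<^bsub>Y\<^esub>}"
  and "D (Suc i) ` carrier (T (Suc (Suc i))) = {t \<in> carrier (T (Suc i)). D i t = \<one>\<^bsub>T i\<^esub>}"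
proof -
 note X = aug_exactD[OF ex] and l = left_actionD[OF Y]
 have PM: "bimod (P n)" for n by (rule X(2))
 interpret Y: abelian_group Y by (rule l(1))
 have TD: "tensor_data (carrier A) (P n) (ra (P n)) Y l" for n by (rule TT_data[OF PM Y])
 have Tn: "TT (P n) Y l = T n" for n by (simp add: T_def)
 note cg = tensor_data.T_comm_group[OF TD, unfolded Tn]
 note u = tensor_data.T_hom_unique[OF TD, unfolded Tn]
 note pc = tensor_data.pure_closed[OF TD, unfolded Tn]
 note pl = tensor_data.pure_add_left[OF TD, unfolded Tn]
 note pr = tensor_data.pure_add_right[OF TD, unfolded Tn]
 note pm = tensor_data.pure_middle[OF TD, unfolded Tn]
 have eps: "\<epsilon> x \<in> carrier A" if "x \<in> carrier (P 0)" for x using lin_closed[OF X(4) that] by (simp add: regular_simps)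
 have eps_add: "\<epsilon> (x \<oplus>\<^bsub>P 0\<^esub> y) = \<epsilon> x \<oplus>\<^bsub>A\<^esub> \<epsilon> y" if "x \<in> carrier (P 0)" "y \<in> carrier (P 0)" for x y
  using lin_add[OF X(4) that] by (simp add: regular_simps)
 have eps_ract: "\<epsilon> (ra (P 0) x a) = \<epsilon> x \<star> a" if "a \<in> carrier A" "x \<in> carrier (P 0)" for x a
  using env_lin_ract[OF X(4) that] that eps by (simp add: regular_ract)
 have dcl: "d n x \<in> carrier (P n)" if "x \<in> carrier (P (Suc n))" for n x by (rule lin_closed[OF X(3) that])
 have D1: "D i \<in> hom (T (Suc i)) (T i)" for i
  unfolding D_def T_def by (rule TT_map(1)[OF PM PM Y lin_right_linear[OF X(3)]])
 have D2: "D i (pure_tensor (T (Suc i)) x y) = pure_tensor (T i) (d i x) y"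
  if "x \<in> carrier (P (Suc i))" "y \<in> carrier Y" for i x y
  unfolding D_def T_def by (rule TT_map(2)[OF PM PM Y lin_right_linear[OF X(3)] that])
 have bal: "balanced (carrier A) (P 0) (ra (P 0)) Y l (add_monoid Y) (%p y. l (\<epsilon> p) y)"
  by (rule balancedI) (simp_all add: eps l(2-5) eps_add eps_ract)
 note El = tensor_data.tensor_lift[OF TD Y.a_comm_group bal, unfolded Tn, folded E_def]
 show "D i \<in> hom (T (Suc i)) (T i)" by (rule D1)
 show E1: "E \<in> hom (T 0) (add_monoid Y)" by (rule El(1))
 show "D i (pure_tensor (T (Suc i)) x y) = pure_tensor (T i) (d i x) y"
  if "x \<in> carrier (P (Suc i))" "y \<in> carrier Y" for x y by (rule D2[OF that])
 show E2: "E (pure_tensor (T 0) x y) = l (\<epsilon> x) y" if "x \<in> carrier (P 0)" "y \<in> carrier Y" for x y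
  by (rule El(2)[OF that])
 have Dc: "D i t \<in> carrier (T i)" if "t \<in> carrier (T (Suc i))" for i t by (rule hom_in_carrier[OF D1 that])
 have Ec: "E t \<in> carrier Y" if "t \<in> carrier (T 0)" for t using hom_in_carrier[OF E1 that] by simp
 from right_contraction[OF ex proj] obtain p s where ps: "p \<in> carrier (P 0) \<and> \<epsilon> p = uA \<and>
   (\<forall>n. right_linear (P n) (P (Suc n)) (s n)) \<and>
   (\<forall>x\<in>carrier (P 0). d 0 (s 0 x) = x \<ominus>\<^bsub>P 0\<^esub> ra (P 0) p (\<epsilon> x)) \<and>
   (\<forall>n. \<forall>x\<in>carrier (P (Suc n)). d (Suc n) (s (Suc n) x) = x \<ominus>\<^bsub>P (Suc n)\<^esub> s n (d n x))"
  by (elim exE)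
 have p: "p \<in> carrier (P 0)" "\<epsilon> p = uA" and s: "!!n. right_linear (P n) (P (Suc n)) (s n)"
  using ps by simp_all
 have s0: "d 0 (s 0 x) = x \<ominus>\<^bsub>P 0\<^esub> ra (P 0) p (\<epsilon> x)" if "x \<in> carrier (P 0)" for x
  using ps that by simp
 have sS: "d (Suc n) (s (Suc n) x) = x \<ominus>\<^bsub>P (Suc n)\<^esub> s n (d n x)" if "x \<in> carrier (P (Suc n))" for n x
  using ps that by simp
 define s' where "s' = (%n. tensor_map (TT (P (Suc n)) Y l) (s n) (%y. y))"
 have S1: "s' n \<in> hom (T n) (T (Suc n))" for n
  unfolding s'_def T_def by (rule TT_map(1)[OF PM PM Y s])
 have S2: "s' n (pure_tensor (T n) x y) = pure_tensor (T (Suc n)) (s n x) y"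
  if "x \<in> carrier (P n)" "y \<in> carrier Y" for n x y
  unfolding s'_def T_def by (rule TT_map(2)[OF PM PM Y s that])
 have sc: "s n x \<in> carrier (P (Suc n))" if "x \<in> carrier (P n)" for n x by (rule right_linearD(1)[OF s that])
 have one0: "pure_tensor (T n) \<zero>\<^bsub>P n\<^esub> y = \<one>\<^bsub>T n\<^esub>" if "y \<in> carrier Y" for n y
 proof -
  interpret Pn: left_module Ae "P n" by (rule PM)
  interpret G: comm_group "T n" by (rule cg)
  have "pure_tensor (T n) \<zero>\<^bsub>P n\<^esub> y \<otimes>\<^bsub>T n\<^esub> pure_tensor (T n) \<zero>\<^bsub>P n\<^esub> y = pure_tensor (T n) \<zero>\<^bsub>P n\<^esub> y"
   using pl[OF Pn.M.zero_closed Pn.M.zero_closed that] by simp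
  then show ?thesis using pc[OF Pn.M.zero_closed that] by (metis G.r_cancel_one')
 qed
 have split: "pure_tensor (T n) x y = pure_tensor (T n) z y \<otimes>\<^bsub>T n\<^esub> pure_tensor (T n) w y"
  if "x \<in> carrier (P n)" "w \<in> carrier (P n)" "y \<in> carrier Y" "z = x \<ominus>\<^bsub>P n\<^esub> w" for n x z w y
 proof -
  interpret Pn: left_module Ae "P n" by (rule PM)
  show ?thesis using that pl[of z n w y] by (simp add: Pn.M.add_minus_cancel)
 qed
 show "E ` carrier (T 0) = carrier Y"
 proof (intro equalityI subsetI)
  fix y assume "y \<in> E ` carrier (T 0)" then show "y \<in> carrier Y" using Ec by auto
 next
  fix y assume y: "y \<in> carrier Y"
  have "y = E (pure_tensor (T 0) p y)" using y by (simp add: E2 p l(6))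
  then show "y \<in> E ` carrier (T 0)" using pc[OF p(1) y] by (rule image_eqI)
 qed
 show "D 0 ` carrier (T (Suc 0)) = {t \<in> carrier (T 0). E t = \<zero>\<^bsub>Y\<^esub>}"
 proof (intro equalityI subsetI)
  fix t assume "t \<in> D 0 ` carrier (T (Suc 0))"
  then obtain t' where t': "t' \<in> carrier (T (Suc 0))" "t = D 0 t'" by auto
  have z: "(%t. \<zero>\<^bsub>Y\<^esub>) \<in> hom (T (Suc 0)) (add_monoid Y)" by (rule hom_addI) simp_all
  have "E (D 0 t') = \<zero>\<^bsub>Y\<^esub>"
  proof (rule u[OF Y.a_group hom_compose[OF D1 E1] z _ t'(1)])
   fix x y assume x: "x \<in> carrier (P (Suc 0))" and y: "y \<in> carrier Y"
   have "l \<zero>\<^bsub>A\<^esub> y = \<zero>\<^bsub>Y\<^esub>"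
    using additive_hom(1)[of A Y "%a. l a y"] y by (simp add: A_abelian l)
   then show "E (D 0 (pure_tensor (T (Suc 0)) x y)) = \<zero>\<^bsub>Y\<^esub>"
    using x y aug_exact_eps[OF ex x] by (simp add: D2 E2 dcl regular_simps)
  qed
  then show "t \<in> {t \<in> carrier (T 0). E t = \<zero>\<^bsub>Y\<^esub>}" using t' Dc by simp
 next
  fix t assume "t \<in> {t \<in> carrier (T 0). E t = \<zero>\<^bsub>Y\<^esub>}"
  then have t: "t \<in> carrier (T 0)" "E t = \<zero>\<^bsub>Y\<^esub>" by auto
  have h: "(%y. pure_tensor (T 0) p y) \<in> hom (add_monoid Y) (T 0)"
   by (rule hom_addI) (simp_all add: pc p pr)
  have "t = D 0 (s' 0 t) \<otimes>\<^bsub>T 0\<^esub> pure_tensor (T 0) p (E t)"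
  proof (rule u[OF comm_group_group[OF cg] hom_id hom_pointwise_mult[OF cg hom_compose[OF S1 D1] hom_compose[OF E1 h]] _ t(1)])
   fix x y assume x: "x \<in> carrier (P 0)" and y: "y \<in> carrier Y"
   show "pure_tensor (T 0) x y = D 0 (s' 0 (pure_tensor (T 0) x y)) \<otimes>\<^bsub>T 0\<^esub> pure_tensor (T 0) p (E (pure_tensor (T 0) x y))"
   proof (rule trans[OF split[OF x _ y s0[OF x]]])
    show "ra (P 0) p (\<epsilon> x) \<in> carrier (P 0)" by (simp add: ract_closed[OF PM] eps p x)
    show "pure_tensor (T 0) (d 0 (s 0 x)) y \<otimes>\<^bsub>T 0\<^esub> pure_tensor (T 0) (ra (P 0) p (\<epsilon> x)) y =
     D 0 (s' 0 (pure_tensor (T 0) x y)) \<otimes>\<^bsub>T 0\<^esub> pure_tensor (T 0) p (E (pure_tensor (T 0) x y))"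
     using x y by (simp add: S2 D2 E2 sc pm[OF p(1) eps[OF x] y])
   qed
  qed
  also have "pure_tensor (T 0) p (E t) = \<one>\<^bsub>T 0\<^esub>"
   using group_hom.hom_one[of "add_monoid Y" "T 0" "%y. pure_tensor (T 0) p y"] h Y.a_group comm_group_group[OF cg]
   by (simp add: t(2) group_hom_def group_hom_axioms_def)
  finally have "t = D 0 (s' 0 t)"
   using Dc[OF hom_in_carrier[OF S1 t(1)]] monoid.r_one[OF group.is_monoid[OF comm_group_group[OF cg]]] by simp
  then show "t \<in> D 0 ` carrier (T (Suc 0))" using hom_in_carrier[OF S1 t(1)] by (rule image_eqI)
 qed
 show "D (Suc i) ` carrier (T (Suc (Suc i))) = {t \<in> carrier (T (Suc i)). D i t = \<one>\<^bsub>T i\<^esub>}"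
 proof (intro equalityI subsetI)
  fix t assume "t \<in> D (Suc i) ` carrier (T (Suc (Suc i)))"
  then obtain t' where t': "t' \<in> carrier (T (Suc (Suc i)))" "t = D (Suc i) t'" by auto
  have z: "(%t. \<one>\<^bsub>T i\<^esub>) \<in> hom (T (Suc (Suc i))) (T i)"
   by (rule hom_addI) (simp_all add: monoid.one_closed monoid.l_one group.is_monoid[OF comm_group_group[OF cg]])
  have "D i (D (Suc i) t') = \<one>\<^bsub>T i\<^esub>"
   by (rule u[OF comm_group_group[OF cg] hom_compose[OF D1 D1] z _ t'(1)])
    (simp add: D2 dcl aug_exact_dd[OF ex] one0)
  then show "t \<in> {t \<in> carrier (T (Suc i)). D i t = \<one>\<^bsub>T i\<^esub>}" using t' Dc by simp
 next
  fix t assume "t \<in> {t \<in> carrier (T (Suc i)). D i t = \<one>\<^bsub>T i\<^esub>}"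
  then have t: "t \<in> carrier (T (Suc i))" "D i t = \<one>\<^bsub>T i\<^esub>" by auto
  have "t = D (Suc i) (s' (Suc i) t) \<otimes>\<^bsub>T (Suc i)\<^esub> s' i (D i t)"
  proof (rule u[OF comm_group_group[OF cg] hom_id hom_pointwise_mult[OF cg hom_compose[OF S1 D1] hom_compose[OF D1 S1]] _ t(1)])
   fix x y assume x: "x \<in> carrier (P (Suc i))" and y: "y \<in> carrier Y"
   show "pure_tensor (T (Suc i)) x y = D (Suc i) (s' (Suc i) (pure_tensor (T (Suc i)) x y)) \<otimes>\<^bsub>T (Suc i)\<^esub>
     s' i (D i (pure_tensor (T (Suc i)) x y))"
    by (rule trans[OF split[OF x sc[OF dcl[OF x]] y sS[OF x]]]) (use x y in \<open>simp add: S2 D2 sc dcl\<close>)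
  qed
  also have "s' i (D i t) = \<one>\<^bsub>T (Suc i)\<^esub>"
   using group_hom.hom_one[of "T i" "T (Suc i)" "s' i"] S1 comm_group_group[OF cg]
   by (simp add: t(2) group_hom_def group_hom_axioms_def)
  finally have "t = D (Suc i) (s' (Suc i) t)"
   using Dc[OF hom_in_carrier[OF S1 t(1)]] monoid.r_one[OF group.is_monoid[OF comm_group_group[OF cg]]] by simp
  then show "t \<in> D (Suc i) ` carrier (T (Suc (Suc i)))" using hom_in_carrier[OF S1 t(1)] by (rule image_eqI)
 qed
qed

lemma btensor_map:
 assumes N: "bimod N" and N': "bimod N'"
  and M: "bimod M" and M': "bimod M'"
  and f: "f \<in> lin Ae N N'" and g: "g \<in> lin Ae M M'"
 shows "tensor_map (bgrp N' M') f g \<in> lin Ae (bten N M) (bten N' M')"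
  and "!!x y. x \<in> carrier N ==> y \<in> carrier M ==>
   tensor_map (bgrp N' M') f g (pure_tensor (bgrp N M) x y) =
   pure_tensor (bgrp N' M') (f x) (g y)"
proof -
 have m: "pure_tensor (bgrp N' M') (f (ra N x a)) (g y) =
   pure_tensor (bgrp N' M') (f x) (g (la M a y))"
  if "x \<in> carrier N" "a \<in> carrier A" "y \<in> carrier M" for x a y
  using that by (simp add: env_lin_ract[OF f] env_lin_lact[OF g] btensor_pure_middle[OF N' M'] lin_closed[OF f] lin_closed[OF g])
 note * = tensor_map[OF btensor_data[OF N M] btensor_data[OF N' M'], of f g, folded btensor_group_def]
 have h: "tensor_map (bgrp N' M') f g \<in> hom (bgrp N M) (bgrp N' M')"
  by (rule *(1)) (simp_all add: lin_closed[OF f] lin_closed[OF g] lin_add[OF f] lin_add[OF g] m)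
 show p: "tensor_map (bgrp N' M') f g (pure_tensor (bgrp N M) x y) =
   pure_tensor (bgrp N' M') (f x) (g y)" if "x \<in> carrier N" "y \<in> carrier M" for x y
  by (rule *(2)) (simp_all add: that lin_closed[OF f] lin_closed[OF g] lin_add[OF f] lin_add[OF g] m)
 show "tensor_map (bgrp N' M') f g \<in> lin Ae (bten N M) (bten N' M')"
  by (rule btensor_linI[OF N M btensor_left_module[OF N' M']])
   (simp_all add: hom_btensor_iff h p lact_closed[OF N] ract_closed[OF M] env_lin_lact[OF f] env_lin_ract[OF g]
    btensor_lact[OF N' M'] btensor_ract[OF N' M'] lin_closed[OF f] lin_closed[OF g])
qed

lemma btensor_resolution:
 assumes ex: "aug_exact Ae P d \<epsilon> (regular_bimodule A)" and proj: "!!n. projective_module Ae (P n)"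
  and Y: "bimod Y"
 shows "aug_exact Ae (%i. bten (P i) Y) (%i. tensor_map (bgrp (P i) Y) (d i) (%y. y))
  (tensor_lift (add_monoid Y) (%p y. la Y (\<epsilon> p) y)) Y"
proof -
 note X = aug_exactD[OF ex]
 note R = tensor_resolution[OF ex proj left_action_lact[OF Y], folded btensor_group_def]
 have PM: "bimod (P n)" for n by (rule X(2))
 have eps: "\<epsilon> x \<in> carrier A" if "x \<in> carrier (P 0)" for x using lin_closed[OF X(4) that] by (simp add: regular_simps)
 have e: "\<epsilon> (la (P 0) a x) = a \<star> \<epsilon> x" if "a \<in> carrier A" "x \<in> carrier (P 0)" for a x
  using env_lin_lact[OF X(4) that] that eps by (simp add: regular_lact)
 have "tensor_lift (add_monoid Y) (%p y. la Y (\<epsilon> p) y) \<in> lin Ae (bten (P 0) Y) Y"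
  by (rule btensor_linI[OF PM Y Y R(2)])
   (simp_all add: R(4) lact_closed[OF PM] ract_closed[OF Y] e eps lact_mult[OF Y] lact_ract[OF Y])
 then show ?thesis
  unfolding aug_exact_def btensor_simps
  using Y R(5,6,7) btensor_left_module[OF PM Y] btensor_map(1)[OF PM PM Y Y X(3) lin_id] by simp
qed

lemma mtensor_linI:
 assumes N: "bimod N" and M: "left_module A M" and L: "left_module A L"
  and f: "f \<in> hom (mgrp N M) (add_monoid L)"
  and l: "!!a x y. a \<in> carrier A ==> x \<in> carrier N ==> y \<in> carrier M ==>
   f (pure_tensor (mgrp N M) (la N a x) y) = a \<odot>\<^bsub>L\<^esub> f (pure_tensor (mgrp N M) x y)"
 shows "f \<in> lin A (mten N M) L"
proof -
 let ?B = "mten N M" and ?T = "mgrp N M"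
 interpret L: left_module A L by fact
 interpret B: left_module A ?B by (rule mtensor_left_module[OF N M])
 show ?thesis
 proof (rule linI; unfold mtensor_simps)
  fix a t assume a: "a \<in> carrier A" and t: "t \<in> carrier ?T"
  have h1: "(%t. a \<odot>\<^bsub>?B\<^esub> t) \<in> hom ?T ?T"
   by (rule hom_addI; use a B.smult_closed B.smult_r_distr in \<open>simp add: mtensor_simps\<close>)
  have h2: "(%y. a \<odot>\<^bsub>L\<^esub> y) \<in> hom (add_monoid L) (add_monoid L)"
   by (rule hom_addI; use a L.smult_closed L.smult_r_distr in simp)
  show "f (a \<odot>\<^bsub>?B\<^esub> t) = a \<odot>\<^bsub>L\<^esub> f t"
   by (rule tensor_data.T_hom_unique[OF mtensor_data[OF N M] L.M.a_group, folded mtensor_group_def,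
      OF hom_compose[OF h1 f] hom_compose[OF f h2] _ t])
    (simp add: mtensor_smult[OF N M] a l)
 qed (use hom_in_carrier[OF f] hom_mult[OF f] in simp_all)
qed

lemma mtensor_resolution:
 assumes ex: "aug_exact Ae P d \<epsilon> (regular_bimodule A)" and proj: "!!n. projective_module Ae (P n)"
  and M: "left_module A M"
 shows "aug_exact A (%i. mten (P i) M) (%i. tensor_map (mgrp (P i) M) (d i) (%y. y))
  (tensor_lift (add_monoid M) (%p y. \<epsilon> p \<odot>\<^bsub>M\<^esub> y)) M"
proof -
 note X = aug_exactD[OF ex]
 interpret M: left_module A M by fact
 note R = tensor_resolution[OF ex proj left_action_smult[OF M], folded mtensor_group_def]
 have PM: "bimod (P n)" for n by (rule X(2))
 have eps: "\<epsilon> x \<in> carrier A" if "x \<in> carrier (P 0)" for x using lin_closed[OF X(4) that] by (simp add: regular_simps)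
 have e: "\<epsilon> (la (P 0) a x) = a \<star> \<epsilon> x" if "a \<in> carrier A" "x \<in> carrier (P 0)" for a x
  using env_lin_lact[OF X(4) that] that eps by (simp add: regular_lact)
 have 1: "tensor_lift (add_monoid M) (%p y. \<epsilon> p \<odot>\<^bsub>M\<^esub> y) \<in> lin A (mten (P 0) M) M"
  by (rule mtensor_linI[OF PM M M R(2)]) (simp_all add: R(4) lact_closed[OF PM] e eps M.smult_assoc1)
 have 2: "tensor_map (mgrp (P i) M) (d i) (%y. y) \<in> lin A (mten (P (Suc i)) M) (mten (P i) M)" for i
  by (rule mtensor_linI[OF PM M mtensor_left_module[OF PM M]])
   (simp_all add: hom_mtensor_iff R(1,3) lact_closed[OF PM] env_lin_lact[OF X(3)] mtensor_smult[OF PM M] lin_closed[OF X(3)])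
 show ?thesis
  unfolding aug_exact_def mtensor_simps
  using 1 2 M R(5,6,7) mtensor_left_module[OF PM M] by simp
qed

end

section \<open>Diagonal maps\<close>

definition sg :: "('s, 'v) module \<Rightarrow> nat \<Rightarrow> 'v \<Rightarrow> 'v" where
 "sg V i z = (if even i then z else \<ominus>\<^bsub>V\<^esub> z)"

lemma lin_sg:
 "left_module S V ==> left_module S Y ==> f \<in> lin S V Y ==> z \<in> carrier V ==> f (sg V i z) = sg Y i (f z)"
 by (simp add: sg_def lin_uminus)

lemma sg_closed: "left_module S V ==> z \<in> carrier V ==> sg V i z \<in> carrier V"
 by (simp add: sg_def abelian_group.a_inv_closed[OF left_module_abelian_group])

lemma sg_sg: "left_module S V ==> z \<in> carrier V ==> sg V i (sg V j z) = sg V (i + j) z"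
 by (simp add: sg_def abelian_group.minus_minus[OF left_module_abelian_group])

lemma sg_lin: "left_module S V ==> left_module S Y ==> f \<in> lin S V Y ==> (%x. sg Y i (f x)) \<in> lin S V Y"
 by (cases "even i") (simp_all add: sg_def lin_neg)

lemma sg_zero: "left_module S V ==> sg V i \<zero>\<^bsub>V\<^esub> = \<zero>\<^bsub>V\<^esub>"
 using lin_zero[OF _ _ lin_neg[OF _ _ lin_id], of S V] by (simp add: sg_def)

lemma (in abelian_group) cancel_opposite_signs:
 assumes "z \<in> carrier G"
 shows "(\<zero> \<ominus> (if even i then z else \<ominus> z)) \<ominus> (if even (Suc i) then z else \<ominus> z) = \<zero>"
 using assms by (simp add: a_minus_def r_neg l_neg minus_minus)

locale bimodule_resolution = fd_algebra K A for K :: "'k ring" (structure) and A :: "('k, 'a) module" (structure) +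
 fixes P :: "nat \<Rightarrow> (('a, 'a) tensor, 'p) module" and d :: "nat \<Rightarrow> 'p \<Rightarrow> 'p" and \<epsilon> :: "'p \<Rightarrow> 'a"
 assumes resolution: "projective_resolution Ae P d \<epsilon> (regular_bimodule A)"
begin

lemma P_projective: "projective_module Ae (P n)"
 using resolution unfolding projective_resolution_def by simp

lemma exact: "aug_exact Ae P d \<epsilon> (regular_bimodule A)"
 by (rule projective_resolution_aug_exact[OF resolution regular_left_module])

sublocale PC: proj_complex Ae P d
 by (intro proj_complex.intro mod_complex.intro proj_complex_axioms.intro P_projective)
  (rule aug_exactD[OF exact] aug_exact_dd[OF exact]; assumption?)+

lemmas PM = PC.P_mod and d_lin = PC.d_lin and d_closed = PC.d_closed

lemma eps_closed: "x \<in> carrier (P 0) ==> \<epsilon> x \<in> carrier A"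
 using lin_closed[OF aug_exactD(4)[OF exact]] by (simp add: regular_simps)

lemma eps_add: "x \<in> carrier (P 0) ==> y \<in> carrier (P 0) ==> \<epsilon> (x \<oplus>\<^bsub>P 0\<^esub> y) = \<epsilon> x \<oplus>\<^bsub>A\<^esub> \<epsilon> y"
 using lin_add[OF aug_exactD(4)[OF exact]] by (simp add: regular_simps)

lemma eps_lact: "a \<in> carrier A ==> x \<in> carrier (P 0) ==> \<epsilon> (la (P 0) a x) = a \<star> \<epsilon> x"
 using env_lin_lact[OF aug_exactD(4)[OF exact]] eps_closed by (simp add: regular_lact)

lemma eps_ract: "a \<in> carrier A ==> x \<in> carrier (P 0) ==> \<epsilon> (ra (P 0) x a) = \<epsilon> x \<star> a"
 using env_lin_ract[OF aug_exactD(4)[OF exact]] eps_closed by (simp add: regular_ract)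

lemma eps_d: "x \<in> carrier (P (Suc 0)) ==> \<epsilon> (d 0 x) = \<zero>\<^bsub>A\<^esub>"
 using aug_exact_eps[OF exact] by (simp add: regular_simps)

abbreviation "onP n f \<equiv> restrict f (carrier (P n))"
abbreviation "BT i j \<equiv> bten (P i) (P j)"
abbreviation "bt N M \<equiv> pure_tensor (bgrp N M)"
abbreviation "dL Y i \<equiv> tensor_map (bgrp (P i) Y) (d i) (%y. y)"
abbreviation "dR N j \<equiv> tensor_map (bgrp N (P j)) (%x. x) (d j)"
abbreviation "eL Y \<equiv> tensor_lift (add_monoid Y) (%p y. la Y (\<epsilon> p) y)"

lemma BM: "bimod Y ==> bimod (bten (P i) Y)"
 by (rule btensor_left_module[OF PM])

lemma left_res:
 "bimod Y ==> aug_exact Ae (%i. bten (P i) Y) (dL Y) (eL Y) Y"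
 by (rule btensor_resolution[OF exact P_projective])

lemma dL_lin: "bimod Y ==> dL Y i \<in> lin Ae (bten (P (Suc i)) Y) (bten (P i) Y)"
 by (rule btensor_map(1)[OF PM PM _ _ d_lin lin_id])

lemma dL_pure: "bimod Y ==> x \<in> carrier (P (Suc i)) ==> y \<in> carrier Y ==>
  dL Y i (bt (P (Suc i)) Y x y) = bt (P i) Y (d i x) y"
 by (rule btensor_map(2)[OF PM PM _ _ d_lin lin_id])

lemma dR_lin: "bimod N ==> dR N j \<in> lin Ae (bten N (P (Suc j))) (bten N (P j))"
 by (rule btensor_map(1)[OF _ _ PM PM lin_id d_lin])

lemma dR_pure: "bimod N ==> x \<in> carrier N ==> y \<in> carrier (P (Suc j)) ==>
  dR N j (bt N (P (Suc j)) x y) = bt N (P j) x (d j y)"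
 by (rule btensor_map(2)[OF _ _ PM PM lin_id d_lin])

lemma eL_lin: "bimod Y ==> eL Y \<in> lin Ae (bten (P 0) Y) Y"
 by (rule aug_exactD(4)[OF left_res])

lemma eL_pure: "bimod Y ==> x \<in> carrier (P 0) ==> y \<in> carrier Y ==>
  eL Y (bt (P 0) Y x y) = la Y (\<epsilon> x) y"
 unfolding btensor_group_def by (rule tensor_resolution(4)[OF exact P_projective left_action_lact])

lemma btensor_lin_unique:
 assumes "bimod N" "bimod M" "bimod L"
  and f: "f \<in> lin Ae (bten N M) L" and g: "g \<in> lin Ae (bten N M) L"
  and "!!x y. x \<in> carrier N ==> y \<in> carrier M ==> f (bt N M x y) = g (bt N M x y)"
  and "t \<in> carrier (bten N M)"
 shows "f t = g t"
 using btensor_hom_unique[OF assms(1,2) abelian_group.a_group[OF left_module_abelian_group[OF assms(3)]]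
   lin_hom[OF f, unfolded hom_btensor_iff] lin_hom[OF g, unfolded hom_btensor_iff] assms(6)] assms(7)
 by (simp add: btensor_simps)

lemma dL_dR:
 assumes t: "t \<in> carrier (BT (Suc i) (Suc j))"
 shows "dL (P j) i (dR (P (Suc i)) j t) = dR (P i) j (dL (P (Suc j)) i t)"
 by (rule btensor_lin_unique[OF PM PM BM[OF PM] lin_comp[OF dR_lin dL_lin] lin_comp[OF dL_lin dR_lin] _ t])
  (simp_all add: PM dR_pure dL_pure d_closed)

lemma dR_dR:
 assumes t: "t \<in> carrier (BT i (Suc (Suc j)))"
 shows "dR (P i) j (dR (P i) (Suc j) t) = \<zero>\<^bsub>BT i j\<^esub>"
proof (rule btensor_lin_unique[OF PM PM BM[OF PM] lin_comp[OF dR_lin dR_lin] lin_null _ t])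
 fix x y assume x: "x \<in> carrier (P i)" and y: "y \<in> carrier (P (Suc (Suc j)))"
 interpret G: comm_group "bgrp (P i) (P j)" by (rule btensor_comm_group[OF PM PM])
 interpret Pj: left_module Ae "P j" by (rule PM)
 have "bt (P i) (P j) x \<zero>\<^bsub>P j\<^esub> \<otimes>\<^bsub>bgrp (P i) (P j)\<^esub> bt (P i) (P j) x \<zero>\<^bsub>P j\<^esub> = bt (P i) (P j) x \<zero>\<^bsub>P j\<^esub>"
  using btensor_pure_add_right[OF PM PM x Pj.M.zero_closed Pj.M.zero_closed] by simp
 then have "bt (P i) (P j) x \<zero>\<^bsub>P j\<^esub> = \<one>\<^bsub>bgrp (P i) (P j)\<^esub>"
  using btensor_pure_closed[OF PM PM x Pj.M.zero_closed] by (metis G.r_cancel_one')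
 then show "dR (P i) j (dR (P i) (Suc j) (bt (P i) (P (Suc (Suc j))) x y)) = \<zero>\<^bsub>BT i j\<^esub>"
  using x y by (simp add: PM dR_pure d_closed PC.dd btensor_simps)
qed (simp_all add: PM BM)

lemma eL_dR:
 assumes t: "t \<in> carrier (BT 0 (Suc j))"
 shows "eL (P j) (dR (P 0) j t) = d j (eL (P (Suc j)) t)"
 by (rule btensor_lin_unique[OF PM PM PM lin_comp[OF dR_lin eL_lin] lin_comp[OF eL_lin d_lin] _ t])
  (simp_all add: PM dR_pure eL_pure d_closed eps_closed env_lin_lact[OF d_lin])

text \<open>The obstruction to the next column of a diagonal map.\<close>

definition defect :: "nat \<Rightarrow> nat \<Rightarrow> (nat \<Rightarrow> 'p \<Rightarrow> ('p, 'p) tensor) \<Rightarrow> 'p \<Rightarrow> ('p, 'p) tensor" where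
 "defect i j D x = D j (d (i + j) x) \<ominus>\<^bsub>BT i j\<^esub> sg (BT i j) i (dR (P i) j (D (Suc j) x))"

lemma defect_lin:
 assumes D: "!!j. D j \<in> module_hom Ae (P (i + j)) (BT i j)"
 shows "defect i j D \<in> lin Ae (P (Suc (i + j))) (BT i j)"
proof -
 have "(%x. D (Suc j) x) \<in> lin Ae (P (Suc (i + j))) (BT i (Suc j))"
  using module_hom_lin[OF D[of "Suc j"]] by simp
 then have "(%x. sg (BT i j) i (dR (P i) j (D (Suc j) x))) \<in> lin Ae (P (Suc (i + j))) (BT i j)"
  by (intro sg_lin[OF PM BM[OF PM]] lin_comp[OF _ dR_lin[OF PM]])
 then show ?thesis unfolding defect_def
  by (intro lin_diff[OF PM BM[OF PM]] lin_comp[OF d_lin module_hom_lin[OF D]])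
qed

lemma diagonal_step:
 assumes D: "!!j. D j \<in> module_hom Ae (P (i + j)) (BT i j)"
  and D': "!!j. D' j \<in> module_hom Ae (P (Suc i + j)) (BT (Suc i) j)"
  and eq: "!!j x. x \<in> carrier (P (Suc (i + j))) ==> dL (P j) i (D' j x) = defect i j D x"
  and x: "x \<in> carrier (P (Suc (Suc i + j)))"
 shows "dL (P j) i (defect (Suc i) j D' x) = \<zero>\<^bsub>BT i j\<^esub>"
proof -
 interpret B: left_module Ae "BT i j" by (rule BM[OF PM])
 have x': "x \<in> carrier (P (Suc (Suc (i + j))))" "x \<in> carrier (P (Suc (i + Suc j)))" "x \<in> carrier (P (Suc i + Suc j))"
  using x by simp_all
 let ?y = "d (Suc (i + j)) x"
 have y: "?y \<in> carrier (P (Suc (i + j)))" "?y \<in> carrier (P (i + Suc j))" using d_closed[OF x'(1)] by simp_all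
 let ?z = "dR (P i) j (D (Suc j) ?y)"
 have Dy: "D (Suc j) ?y \<in> carrier (BT i (Suc j))" by (rule module_hom_closed[OF D y(2)])
 have zc: "?z \<in> carrier (BT i j)" by (rule lin_closed[OF dR_lin[OF PM] Dy])
 have D'x: "D' (Suc j) x \<in> carrier (BT (Suc i) (Suc j))" by (rule module_hom_closed[OF D' x'(3)])
 have D'y: "D' j ?y \<in> carrier (BT (Suc i) j)" using module_hom_closed[OF D'] y by simp
 have DD: "D (Suc (Suc j)) x \<in> carrier (BT i (Suc (Suc j)))" using module_hom_closed[OF D] x' by simp
 have dRD: "dR (P (Suc i)) j (D' (Suc j) x) \<in> carrier (BT (Suc i) j)" by (rule lin_closed[OF dR_lin[OF PM] D'x])
 have dRDD: "dR (P i) (Suc j) (D (Suc (Suc j)) x) \<in> carrier (BT i (Suc j))" by (rule lin_closed[OF dR_lin[OF PM] DD])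
 have 1: "dL (P j) i (D' j ?y) = \<zero>\<^bsub>BT i j\<^esub> \<ominus>\<^bsub>BT i j\<^esub> sg (BT i j) i ?z"
  unfolding eq[OF y(1)] defect_def
  by (simp add: PC.dd[OF x'(1)] lin_zero[OF PM BM[OF PM] module_hom_lin[OF D]])
 have "dL (P j) i (dR (P (Suc i)) j (D' (Suc j) x)) = dR (P i) j (dL (P (Suc j)) i (D' (Suc j) x))"
  by (rule dL_dR[OF D'x])
 also have "dL (P (Suc j)) i (D' (Suc j) x) = D (Suc j) ?y \<ominus>\<^bsub>BT i (Suc j)\<^esub>
   sg (BT i (Suc j)) i (dR (P i) (Suc j) (D (Suc (Suc j)) x))"
  using eq[OF x'(2)] by (simp add: defect_def)
 also have "dR (P i) j \<dots> = ?z \<ominus>\<^bsub>BT i j\<^esub> sg (BT i j) i \<zero>\<^bsub>BT i j\<^esub>"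
  by (simp only: lin_minus[OF BM[OF PM] BM[OF PM] dR_lin[OF PM] Dy sg_closed[OF BM[OF PM] dRDD]]
    lin_sg[OF BM[OF PM] BM[OF PM] dR_lin[OF PM] dRDD] dR_dR[OF DD])
 also have "\<dots> = ?z" using zc by (simp add: sg_zero[OF BM[OF PM]] a_minus_def)
 finally have 2: "dL (P j) i (dR (P (Suc i)) j (D' (Suc j) x)) = ?z" .
 have "dL (P j) i (defect (Suc i) j D' x) =
   dL (P j) i (D' j ?y) \<ominus>\<^bsub>BT i j\<^esub> sg (BT i j) (Suc i) ?z"
  unfolding defect_def
  by (simp add: lin_minus[OF BM[OF PM] BM[OF PM] dL_lin[OF PM] D'y sg_closed[OF BM[OF PM] dRD]]
    lin_sg[OF BM[OF PM] BM[OF PM] dL_lin[OF PM] dRD] 2)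
 also have "\<dots> = \<zero>\<^bsub>BT i j\<^esub>"
  unfolding 1 sg_def by (rule B.M.cancel_opposite_signs[OF zc])
 finally show ?thesis .
qed

lemma diagonal_maps_iff:
 "D \<in> diagonal_maps K A P d \<epsilon> \<longleftrightarrow>
  (\<forall>i j. D i j \<in> module_hom Ae (P (i + j)) (BT i j)) \<and>
  (\<forall>x\<in>carrier (P 0). tensor_lift (add_monoid A) (%p q. \<epsilon> p \<star> \<epsilon> q) (D 0 0 x) = \<epsilon> x) \<and>
  (\<forall>i j. \<forall>x\<in>carrier (P (Suc (i + j))). D i j (d (i + j) x) =
   dL (P j) i (D (Suc i) j x) \<oplus>\<^bsub>BT i j\<^esub> sg (BT i j) i (dR (P i) j (D i (Suc j) x)))"
 by (simp add: diagonal_maps_def Let_def btensor_simps sg_def btensor_minus)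

lemma augment_both:
 assumes t: "t \<in> carrier (BT 0 0)"
 shows "tensor_lift (add_monoid A) (%p q. \<epsilon> p \<star> \<epsilon> q) t = \<epsilon> (eL (P 0) t)"
proof -
 have bal: "balanced (carrier A) (P 0) (ra (P 0)) (P 0) (la (P 0)) (add_monoid A) (%p q. \<epsilon> p \<star> \<epsilon> q)"
  by (rule balancedI) (simp_all add: eps_closed eps_add eps_lact eps_ract A.l_distr A.r_distr A.m_assoc)
 note L = btensor_lift[OF PM PM abelian_group.a_comm_group[OF A_abelian] bal]
 have "\<epsilon> \<in> hom (add_monoid (P 0)) (add_monoid A)"
  by (rule hom_addI) (simp_all add: eps_closed eps_add)
 from hom_compose[OF lin_hom[OF eL_lin[OF PM], unfolded hom_btensor_iff] this]
 show ?thesis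
  by (rule btensor_hom_unique[OF PM PM abelian_group.a_group[OF A_abelian] L(1)])
   (use t in \<open>simp_all add: L(2) eL_pure PM eps_closed eps_lact btensor_simps\<close>)
qed

lemma diagonal_exists: "\<exists>D. D \<in> diagonal_maps K A P d \<epsilon>"
proof -
 define good where "good = (%i D. (\<forall>j. D j \<in> module_hom Ae (P (i + j)) (BT i j)) \<and>
  (i = 0 \<longrightarrow> (\<forall>j. \<forall>x\<in>carrier (P j). eL (P j) (D j x) = x)) \<and>
  (\<forall>j. \<forall>x\<in>carrier (P (Suc (i + j))). defect i j D x \<in> dL (P j) i ` carrier (BT (Suc i) j)))"
 have "\<exists>D. \<forall>i. good i (D i) \<and> (\<forall>j. \<forall>x\<in>carrier (P (Suc (i + j))). dL (P j) i (D (Suc i) j x) = defect i j (D i) x)"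
 proof (rule dependent_nat_choice)
  have "\<exists>g\<in>module_hom Ae (P j) (BT 0 j). \<forall>x\<in>carrier (P j). eL (P j) (g x) = x" for j
   by (rule projective_lift[OF P_projective BM[OF PM] PM eL_lin[OF PM] lin_id])
    (simp add: aug_exactD(5)[OF left_res[OF PM]])
  then obtain D where D: "!!j. D j \<in> module_hom Ae (P j) (BT 0 j)"
    and De: "!!j. \<forall>x\<in>carrier (P j). eL (P j) (D j x) = x" by metis
  have "defect 0 j D x \<in> dL (P j) 0 ` carrier (BT (Suc 0) j)" if x: "x \<in> carrier (P (Suc j))" for j x
  proof -
   interpret Pj: left_module Ae "P j" by (rule PM)
   have c: "D j (d j x) \<in> carrier (BT 0 j)" "D (Suc j) x \<in> carrier (BT 0 (Suc j))"
    using module_hom_closed[OF D] x d_closed by simp_all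
   have e: "eL (P (Suc j)) (D (Suc j) x) = x" "eL (P j) (D j (d j x)) = d j x"
    using De x d_closed[OF x] by simp_all
   have "eL (P j) (defect 0 j D x) = d j x \<ominus>\<^bsub>P j\<^esub> d j x"
    unfolding defect_def sg_def
    using lin_minus[OF BM[OF PM] PM eL_lin[OF PM] c(1) lin_closed[OF dR_lin[OF PM] c(2)]]
    by (simp add: eL_dR[OF c(2)] e)
   also have "\<dots> = \<zero>\<^bsub>P j\<^esub>" using d_closed[OF x] by (simp add: a_minus_def Pj.M.r_neg)
   finally show ?thesis
    using lin_closed[OF defect_lin[of D 0 j]] D x by (simp add: aug_exactD(6)[OF left_res[OF PM]])
  qed
  then show "\<exists>D. good 0 D" unfolding good_def using D De by (intro exI[of _ D]) simp
 next
  fix D i assume g: "good i D"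
  then have D: "!!j. D j \<in> module_hom Ae (P (i + j)) (BT i j)" by (simp add: good_def)
  have "\<exists>h\<in>module_hom Ae (P (Suc (i + j))) (BT (Suc i) j).
    \<forall>x\<in>carrier (P (Suc (i + j))). dL (P j) i (h x) = defect i j D x" for j
   by (rule projective_lift[OF P_projective BM[OF PM] BM[OF PM] dL_lin[OF PM] defect_lin[OF D]])
    (use g in \<open>auto simp: good_def\<close>)
  then obtain D' where D': "!!j. D' j \<in> module_hom Ae (P (Suc i + j)) (BT (Suc i) j)"
    and eq: "!!j x. x \<in> carrier (P (Suc (i + j))) ==> dL (P j) i (D' j x) = defect i j D x"
   unfolding add_Suc by metis
  have "defect (Suc i) j D' x \<in> dL (P j) (Suc i) ` carrier (BT (Suc (Suc i)) j)"
   if x: "x \<in> carrier (P (Suc (Suc i + j)))" for j x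
   unfolding aug_exactD(7)[OF left_res[OF PM]]
   using diagonal_step[OF D D' eq x] lin_closed[OF defect_lin[OF D'] x] by simp
  then have "good (Suc i) D'" unfolding good_def using D' by simp
  then show "\<exists>D'. good (Suc i) D' \<and> (\<forall>j. \<forall>x\<in>carrier (P (Suc (i + j))). dL (P j) i (D' j x) = defect i j D x)"
   using eq by blast
 qed
 then obtain D where D: "!!i. good i (D i)"
   "!!i j x. x \<in> carrier (P (Suc (i + j))) ==> dL (P j) i (D (Suc i) j x) = defect i j (D i) x" by metis
 have h: "D i j \<in> module_hom Ae (P (i + j)) (BT i j)" for i j using D(1) by (simp add: good_def)
 have "D \<in> diagonal_maps K A P d \<epsilon>" unfolding diagonal_maps_iff
 proof (intro conjI allI ballI h)
  fix x assume x: "x \<in> carrier (P 0)"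
  have "D 0 0 x \<in> carrier (BT 0 0)" using module_hom_closed[OF h[of 0 0]] x by simp
  then show "tensor_lift (add_monoid A) (%p q. \<epsilon> p \<star> \<epsilon> q) (D 0 0 x) = \<epsilon> x"
   using D(1)[of 0] x by (simp add: augment_both good_def)
 next
  fix i j x assume x: "x \<in> carrier (P (Suc (i + j)))"
  interpret B: left_module Ae "BT i j" by (rule BM[OF PM])
  have "D i (Suc j) x \<in> carrier (BT i (Suc j))" using module_hom_closed[OF h] x by simp
  then have "sg (BT i j) i (dR (P i) j (D i (Suc j) x)) \<in> carrier (BT i j)"
   by (intro sg_closed[OF BM[OF PM]] lin_closed[OF dR_lin[OF PM]])
  then show "D i j (d (i + j) x) =
   dL (P j) i (D (Suc i) j x) \<oplus>\<^bsub>BT i j\<^esub> sg (BT i j) i (dR (P i) j (D i (Suc j) x))"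
   unfolding D(2)[OF x] defect_def
   using module_hom_closed[OF h d_closed[OF x]] by (simp add: B.M.add_minus_cancel)
 qed
 then show ?thesis by (intro exI)
qed

end

section \<open>The cup product\<close>

context bimodule_resolution
begin

lemma diagonalD:
 assumes D: "D \<in> diagonal_maps K A P d \<epsilon>"
 shows "D i j \<in> module_hom Ae (P (i + j)) (BT i j)"
  and "x \<in> carrier (P 0) ==> \<epsilon> (eL (P 0) (D 0 0 x)) = \<epsilon> x"
  and "x \<in> carrier (P (Suc (i + j))) ==> D i j (d (i + j) x) =
   dL (P j) i (D (Suc i) j x) \<oplus>\<^bsub>BT i j\<^esub> sg (BT i j) i (dR (P i) j (D i (Suc j) x))"
proof -
 show h: "D i j \<in> module_hom Ae (P (i + j)) (BT i j)" for i j
  using D by (simp add: diagonal_maps_iff)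
 show "x \<in> carrier (P (Suc (i + j))) ==> D i j (d (i + j) x) =
   dL (P j) i (D (Suc i) j x) \<oplus>\<^bsub>BT i j\<^esub> sg (BT i j) i (dR (P i) j (D i (Suc j) x))"
  using D by (simp add: diagonal_maps_iff)
 show "\<epsilon> (eL (P 0) (D 0 0 x)) = \<epsilon> x" if x: "x \<in> carrier (P 0)"
 proof -
  have "D 0 0 x \<in> carrier (BT 0 0)" using module_hom_closed[OF h[of 0 0]] x by simp
  moreover have "tensor_lift (add_monoid A) (%p q. \<epsilon> p \<star> \<epsilon> q) (D 0 0 x) = \<epsilon> x"
   using D x by (simp add: diagonal_maps_iff)
  ultimately show ?thesis using augment_both by metis
 qed
qed

lemma diagonal_closed:
 assumes D: "D \<in> diagonal_maps K A P d \<epsilon>" and x: "x \<in> carrier (P (i + j))"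
 shows "D i j x \<in> carrier (BT i j)"
 by (rule module_hom_closed[OF diagonalD(1)[OF D] x])

lemma right_unit_map:
 assumes N: "bimod N"
 defines "eR \<equiv> tensor_lift (add_monoid N) (%x q. ra N x (\<epsilon> q))"
 shows "eR \<in> lin Ae (bten N (P 0)) N"
  and "!!x y. x \<in> carrier N ==> y \<in> carrier (P 0) ==> eR (bt N (P 0) x y) = ra N x (\<epsilon> y)"
  and "!!t. t \<in> carrier (bten N (P (Suc 0))) ==> eR (dR N 0 t) = \<zero>\<^bsub>N\<^esub>"
proof -
 interpret N: left_module Ae N by fact
 have bal: "balanced (carrier A) N (ra N) (P 0) (la (P 0)) (add_monoid N) (%x q. ra N x (\<epsilon> q))"
  by (rule balancedI) (simp_all add: eps_closed eps_add eps_lact ract_closed[OF N] ract_add[OF N]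
    ract_add_right[OF N] ract_mult[OF N])
 note L = btensor_lift[OF N PM N.M.a_comm_group bal, folded eR_def]
 show l: "eR \<in> lin Ae (bten N (P 0)) N"
  by (rule btensor_linI[OF N PM N L(1)])
   (simp_all add: L(2) lact_closed[OF N] ract_closed[OF PM] eps_closed lact_ract[OF N] eps_ract ract_mult[OF N])
 show p: "eR (bt N (P 0) x y) = ra N x (\<epsilon> y)" if "x \<in> carrier N" "y \<in> carrier (P 0)" for x y
  by (rule L(2)[OF that])
 show "eR (dR N 0 t) = \<zero>\<^bsub>N\<^esub>" if t: "t \<in> carrier (bten N (P (Suc 0)))" for t
 proof (rule btensor_lin_unique[OF N PM N lin_comp[OF dR_lin[OF N] l] lin_null _ t])
  fix x y assume x: "x \<in> carrier N" and y: "y \<in> carrier (P (Suc 0))"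
  have "ra N x \<zero>\<^bsub>A\<^esub> = \<zero>\<^bsub>N\<^esub>"
   using additive_hom(1)[of A N "ra N x"] x
   by (simp add: A_abelian N.M.abelian_group_axioms ract_closed[OF N] ract_add_right[OF N])
  then show "eR (dR N 0 (bt N (P (Suc 0)) x y)) = \<zero>\<^bsub>N\<^esub>"
   using x y by (simp add: dR_pure[OF N] p d_closed eps_d)
 qed (rule btensor_left_module[OF N PM], rule N)
qed

lemma left_chain_map:
 assumes D: "D \<in> diagonal_maps K A P d \<epsilon>"
 shows "(%j. \<lambda>x\<in>carrier (P j). eL (P j) (D 0 j x)) \<in> chain_lifts Ae P d P d \<epsilon> 0 \<epsilon>"
 unfolding chain_lifts_def
proof (intro CollectI conjI allI ballI)
 have D0: "D 0 j \<in> module_hom Ae (P j) (BT 0 j)" for j using diagonalD(1)[OF D, of 0 j] by simp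
 show "(onP j (%x. eL (P j) (D 0 j x))) \<in> module_hom Ae (P (0 + j)) (P j)" for j
  using lin_restrict[OF PM lin_comp[OF module_hom_lin[OF D0] eL_lin[OF PM]]] by simp
 show "\<epsilon> ((onP 0 (%x. eL (P 0) (D 0 0 x))) x) = \<epsilon> x" if "x \<in> carrier (P 0)" for x
  using that diagonalD(2)[OF D] by simp
 fix j x assume "x \<in> carrier (P (Suc (0 + j)))"
 then have x: "x \<in> carrier (P (Suc j))" by simp
 interpret Pj: left_module Ae "P j" by (rule PM)
 have c: "D (Suc 0) j x \<in> carrier (BT (Suc 0) j)" "D 0 (Suc j) x \<in> carrier (BT 0 (Suc j))"
  using diagonal_closed[OF D, of x "Suc 0" j] diagonal_closed[OF D, of x 0 "Suc j"] x by simp_all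
 have c': "dL (P j) 0 (D (Suc 0) j x) \<in> carrier (BT 0 j)" "dR (P 0) j (D 0 (Suc j) x) \<in> carrier (BT 0 j)"
  by (rule lin_closed[OF dL_lin[OF PM] c(1)], rule lin_closed[OF dR_lin[OF PM] c(2)])
 have "eL (P j) (D 0 j (d j x)) = eL (P j) (dL (P j) 0 (D (Suc 0) j x)) \<oplus>\<^bsub>P j\<^esub> eL (P j) (dR (P 0) j (D 0 (Suc j) x))"
  using diagonalD(3)[OF D, of x 0 j] x by (simp add: sg_def lin_add[OF eL_lin[OF PM] c'])
 also have "\<dots> = d j (eL (P (Suc j)) (D 0 (Suc j) x))"
  using aug_exact_eps[OF left_res[OF PM] c(1)] lin_closed[OF eL_lin[OF PM] c(2)]
  by (simp add: eL_dR[OF c(2)] d_closed)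
 finally show "d j ((onP (Suc j) (%x. eL (P (Suc j)) (D 0 (Suc j) x))) x) =
   (onP j (%x. eL (P j) (D 0 j x))) (d (0 + j) x)"
  using x d_closed by simp
qed

abbreviation "eR N \<equiv> tensor_lift (add_monoid N) (%x q. ra N x (\<epsilon> q))"

lemma right_chain_map:
 assumes D: "D \<in> diagonal_maps K A P d \<epsilon>"
 shows "(%i. \<lambda>x\<in>carrier (P i). eR (P i) (D i 0 x)) \<in> chain_lifts Ae P d P d \<epsilon> 0 \<epsilon>"
 unfolding chain_lifts_def
proof (intro CollectI conjI allI ballI)
 note E = right_unit_map[OF PM]
 have D0: "D i 0 \<in> module_hom Ae (P i) (BT i 0)" for i using diagonalD(1)[OF D, of i 0] by simp
 show "(onP i (%x. eR (P i) (D i 0 x))) \<in> module_hom Ae (P (0 + i)) (P i)" for i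
  using lin_restrict[OF PM lin_comp[OF module_hom_lin[OF D0] E(1)]] by simp
 show "\<epsilon> ((onP 0 (%x. eR (P 0) (D 0 0 x))) x) = \<epsilon> x" if x: "x \<in> carrier (P 0)" for x
 proof -
  have "\<epsilon> (eR (P 0) t) = \<epsilon> (eL (P 0) t)" if "t \<in> carrier (BT 0 0)" for t
   by (rule btensor_lin_unique[OF PM PM regular_left_module lin_comp[OF E(1) aug_exactD(4)[OF exact]]
      lin_comp[OF eL_lin[OF PM] aug_exactD(4)[OF exact]] _ that])
    (simp add: E(2) eL_pure[OF PM] eps_ract eps_lact eps_closed)
  then show ?thesis using x diagonalD(2)[OF D x] diagonal_closed[OF D, of x 0 0] by simp
 qed
 fix i x assume "x \<in> carrier (P (Suc (0 + i)))"
 then have x: "x \<in> carrier (P (Suc i))" by simp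
 interpret Pi: left_module Ae "P i" by (rule PM)
 have c: "D (Suc i) 0 x \<in> carrier (BT (Suc i) 0)" "D i (Suc 0) x \<in> carrier (BT i (Suc 0))"
  using diagonal_closed[OF D, of x "Suc i" 0] diagonal_closed[OF D, of x i "Suc 0"] x by simp_all
 have c': "dL (P 0) i (D (Suc i) 0 x) \<in> carrier (BT i 0)" "dR (P i) 0 (D i (Suc 0) x) \<in> carrier (BT i 0)"
  by (rule lin_closed[OF dL_lin[OF PM] c(1)], rule lin_closed[OF dR_lin[OF PM] c(2)])
 have e: "eR (P i) (dL (P 0) i t) = d i (eR (P (Suc i)) t)" if "t \<in> carrier (BT (Suc i) 0)" for t
  by (rule btensor_lin_unique[OF PM PM PM lin_comp[OF dL_lin[OF PM] E(1)] lin_comp[OF E(1) d_lin] _ that])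
   (simp add: dL_pure[OF PM] E(2) d_closed eps_closed env_lin_ract[OF d_lin])
 have "eR (P i) (D i 0 (d i x)) = eR (P i) (dL (P 0) i (D (Suc i) 0 x)) \<oplus>\<^bsub>P i\<^esub>
   eR (P i) (sg (BT i 0) i (dR (P i) 0 (D i (Suc 0) x)))"
  using diagonalD(3)[OF D, of x i 0] x by (simp add: lin_add[OF E(1) c'(1) sg_closed[OF BM[OF PM] c'(2)]])
 also have "\<dots> = d i (eR (P (Suc i)) (D (Suc i) 0 x))"
  using lin_closed[OF E(1) c(1)]
  by (simp add: lin_sg[OF BM[OF PM] PM E(1) c'(2)] E(3)[OF c(2)] e[OF c(1)] sg_zero[OF PM] d_closed)
 finally show "d i ((onP (Suc i) (%x. eR (P (Suc i)) (D (Suc i) 0 x))) x) =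
   (onP i (%x. eR (P i) (D i 0 x))) (d (0 + i) x)"
  using x d_closed by simp
qed

abbreviation "idt N Y g \<equiv> tensor_map (bgrp N Y) (%x. x) g"

lemma idt:
 assumes N: "bimod N" and M: "bimod M" and Y: "bimod Y"
  and g: "g \<in> lin Ae M Y"
 shows "idt N Y g \<in> lin Ae (bten N M) (bten N Y)"
  and "!!x y. x \<in> carrier N ==> y \<in> carrier M ==> idt N Y g (bt N M x y) = bt N Y x (g y)"
 by (rule btensor_map[OF N N M Y lin_id g])+

lemma bt_zero_right:
 assumes N: "bimod N" and Y: "bimod Y" and x: "x \<in> carrier N"
 shows "bt N Y x \<zero>\<^bsub>Y\<^esub> = \<zero>\<^bsub>bten N Y\<^esub>"
proof -
 interpret Y: left_module Ae Y by fact
 interpret G: comm_group "bgrp N Y" by (rule btensor_comm_group[OF N Y])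
 have "bt N Y x \<zero>\<^bsub>Y\<^esub> \<otimes>\<^bsub>bgrp N Y\<^esub> bt N Y x \<zero>\<^bsub>Y\<^esub> = bt N Y x \<zero>\<^bsub>Y\<^esub>"
  using btensor_pure_add_right[OF N Y x Y.M.zero_closed Y.M.zero_closed] by simp
 then show ?thesis
  using btensor_pure_closed[OF N Y x Y.M.zero_closed] by (simp add: btensor_simps)
qed

lemma diagonal_lift:
 assumes D: "D \<in> diagonal_maps K A P d \<epsilon>" and Y: "bimod Y"
  and g: "g \<in> cocycles Ae P d Y n"
 shows "(%i. \<lambda>x\<in>carrier (P (n + i)). idt (P i) Y g (D i n x)) \<in>
  chain_lifts Ae P d (%i. bten (P i) Y) (dL Y) (eL Y) n (onP n (%x. g (eL (P n) (D 0 n x))))"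
 unfolding chain_lifts_def
proof (intro CollectI conjI allI ballI)
 note gl = PC.cocycle_lin[OF g]
 note I = idt[OF PM PM Y gl]
 have Dn: "D i n \<in> module_hom Ae (P (n + i)) (BT i n)" for i
  using diagonalD(1)[OF D, of i n] by (simp add: add.commute)
 show "(onP (n + i) (%x. idt (P i) Y g (D i n x))) \<in> module_hom Ae (P (n + i)) (bten (P i) Y)" for i
  by (rule lin_restrict[OF PM lin_comp[OF module_hom_lin[OF Dn] I(1)]])
 have e: "eL Y (idt (P 0) Y g t) = g (eL (P n) t)" if "t \<in> carrier (BT 0 n)" for t
  by (rule btensor_lin_unique[OF PM PM Y lin_comp[OF I(1) eL_lin[OF Y]] lin_comp[OF eL_lin[OF PM] gl] _ that])
   (simp add: I(2) eL_pure[OF Y] eL_pure[OF PM] lin_closed[OF gl] env_lin_lact[OF gl] eps_closed)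
 show "eL Y ((onP (n + 0) (%x. idt (P 0) Y g (D 0 n x))) x) = (onP n (%x. g (eL (P n) (D 0 n x)))) x"
  if "x \<in> carrier (P n)" for x
  using that e module_hom_closed[OF Dn[of 0]] by simp
 fix i x assume x: "x \<in> carrier (P (Suc (n + i)))"
 interpret B: left_module Ae "bten (P i) Y" by (rule BM[OF Y])
 have c: "D (Suc i) n x \<in> carrier (BT (Suc i) n)" "D i (Suc n) x \<in> carrier (BT i (Suc n))"
  using diagonal_closed[OF D, of x "Suc i" n] diagonal_closed[OF D, of x i "Suc n"] x by (simp_all add: add.commute)
 have c': "dL (P n) i (D (Suc i) n x) \<in> carrier (BT i n)" "dR (P i) n (D i (Suc n) x) \<in> carrier (BT i n)"
  by (rule lin_closed[OF dL_lin[OF PM] c(1)], rule lin_closed[OF dR_lin[OF PM] c(2)])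
 have 1: "idt (P i) Y g (dL (P n) i t) = dL Y i (idt (P (Suc i)) Y g t)" if "t \<in> carrier (BT (Suc i) n)" for t
  by (rule btensor_lin_unique[OF PM PM BM[OF Y] lin_comp[OF dL_lin[OF PM] I(1)] lin_comp[OF I(1) dL_lin[OF Y]] _ that])
   (simp add: I(2) dL_pure[OF PM] dL_pure[OF Y] d_closed lin_closed[OF gl])
 have 2: "idt (P i) Y g (dR (P i) n t) = \<zero>\<^bsub>bten (P i) Y\<^esub>" if "t \<in> carrier (BT i (Suc n))" for t
  by (rule btensor_lin_unique[OF PM PM BM[OF Y] lin_comp[OF dR_lin[OF PM] I(1)] lin_null[OF BM[OF PM] BM[OF Y]] _ that])
   (simp add: I(2) dR_pure[OF PM] d_closed PC.cocycle_d[OF g] bt_zero_right[OF PM Y])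
 have "idt (P i) Y g (D i n (d (i + n) x)) = idt (P i) Y g (dL (P n) i (D (Suc i) n x)) \<oplus>\<^bsub>bten (P i) Y\<^esub>
   idt (P i) Y g (sg (BT i n) i (dR (P i) n (D i (Suc n) x)))"
  using diagonalD(3)[OF D, of x i n] x
  by (simp add: add.commute lin_add[OF I(1) c'(1) sg_closed[OF BM[OF PM] c'(2)]])
 also have "\<dots> = dL Y i (idt (P (Suc i)) Y g (D (Suc i) n x))"
  using lin_closed[OF dL_lin[OF Y] lin_closed[OF I(1) c(1)]]
  by (simp add: lin_sg[OF BM[OF PM] BM[OF Y] I(1) c'(2)] 1[OF c(1)] 2[OF c(2)] sg_zero[OF BM[OF Y]])
 finally show "dL Y i ((onP (n + Suc i) (%x. idt (P (Suc i)) Y g (D (Suc i) n x))) x) =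
   (onP (n + i) (%x. idt (P i) Y g (D i n x))) (d (n + i) x)"
  using x d_closed[OF x] by (simp add: add.commute)
qed

lemma scalar_map:
 assumes N: "bimod N" and M: "bimod M"
  and f: "f \<in> lin Ae N (regular_bimodule A)"
 defines "aL \<equiv> tensor_lift (add_monoid M) (%p q. la M (f p) q)"
 shows "aL \<in> lin Ae (bten N M) M"
  and "!!x y. x \<in> carrier N ==> y \<in> carrier M ==> aL (bt N M x y) = la M (f x) y"
proof -
 interpret M: left_module Ae M by fact
 have fc: "f x \<in> carrier A" if "x \<in> carrier N" for x using lin_closed[OF f that] by (simp add: regular_simps)
 have fa: "f (x \<oplus>\<^bsub>N\<^esub> y) = f x \<oplus>\<^bsub>A\<^esub> f y" if "x \<in> carrier N" "y \<in> carrier N" for x y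
  using lin_add[OF f that] by (simp add: regular_simps)
 have fl: "f (la N a x) = a \<star> f x" if "a \<in> carrier A" "x \<in> carrier N" for a x
  using env_lin_lact[OF f that] that fc by (simp add: regular_lact)
 have fr: "f (ra N x a) = f x \<star> a" if "a \<in> carrier A" "x \<in> carrier N" for a x
  using env_lin_ract[OF f that] that fc by (simp add: regular_ract)
 have bal: "balanced (carrier A) N (ra N) M (la M) (add_monoid M) (%p q. la M (f p) q)"
  by (rule balancedI) (simp_all add: fc fa fr lact_closed[OF M] lact_add[OF M] lact_add_left[OF M] lact_mult[OF M])
 note L = btensor_lift[OF N M M.M.a_comm_group bal, folded aL_def]
 show "aL \<in> lin Ae (bten N M) M"
  by (rule btensor_linI[OF N M M L(1)])
   (simp_all add: L(2) fc fl lact_closed[OF N] ract_closed[OF M] lact_mult[OF M] lact_ract[OF M])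
 show "aL (bt N M x y) = la M (f x) y" if "x \<in> carrier N" "y \<in> carrier M" for x y by (rule L(2)[OF that])
qed

text \<open>Contracting the first factor of a diagonal map with a cocycle gives, up to the sign, a lift
 of that cocycle.\<close>

lemma contraction_lift:
 assumes D: "D \<in> diagonal_maps K A P d \<epsilon>" and f: "f \<in> cocycles Ae P d (regular_bimodule A) m"
 defines "aL \<equiv> %j. tensor_lift (add_monoid (P j)) (%p q. la (P j) (f p) q)"
 shows "(%j. \<lambda>x\<in>carrier (P (m + j)). sg (P j) (m * j) (aL j (D m j x))) \<in>
  chain_lifts Ae P d P d \<epsilon> m (onP m (%x. f (eR (P m) (D m 0 x))))"
 unfolding chain_lifts_def
proof (intro CollectI conjI allI ballI)
 note fl = PC.cocycle_lin[OF f]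
 note L = scalar_map[OF PM PM fl, folded aL_def]
 have L1: "aL j \<in> lin Ae (BT m j) (P j)" for j unfolding aL_def by (rule scalar_map(1)[OF PM PM fl])
 have L2: "aL j (bt (P m) (P j) x y) = la (P j) (f x) y" if "x \<in> carrier (P m)" "y \<in> carrier (P j)" for j x y
  unfolding aL_def by (rule scalar_map(2)[OF PM PM fl that])
 have fc: "f x \<in> carrier A" if "x \<in> carrier (P m)" for x using lin_closed[OF fl that] by (simp add: regular_simps)
 note E = right_unit_map[OF PM]
 show "(onP (m + j) (%x. sg (P j) (m * j) (aL j (D m j x)))) \<in> module_hom Ae (P (m + j)) (P j)" for j
  by (rule lin_restrict[OF PM sg_lin[OF PM PM lin_comp[OF module_hom_lin[OF diagonalD(1)[OF D]] L1]]])
 have e: "\<epsilon> (aL 0 t) = f (eR (P m) t)" if "t \<in> carrier (BT m 0)" for t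
  by (rule btensor_lin_unique[OF PM PM regular_left_module lin_comp[OF L1 aug_exactD(4)[OF exact]]
     lin_comp[OF E(1) fl] _ that])
   (simp add: L2 E(2) eps_lact fc eps_closed env_lin_ract[OF fl] regular_ract)
 show "\<epsilon> ((onP (m + 0) (%x. sg (P 0) (m * 0) (aL 0 (D m 0 x)))) x) = (onP m (%x. f (eR (P m) (D m 0 x)))) x"
  if x: "x \<in> carrier (P m)" for x
  using x e[OF diagonal_closed[OF D, of x m 0]] by (simp add: sg_def)
 fix j x assume x: "x \<in> carrier (P (Suc (m + j)))"
 interpret Pj: left_module Ae "P j" by (rule PM)
 have c: "D (Suc m) j x \<in> carrier (BT (Suc m) j)" "D m (Suc j) x \<in> carrier (BT m (Suc j))"
  using diagonal_closed[OF D, of x "Suc m" j] diagonal_closed[OF D, of x m "Suc j"] x by simp_all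
 have c': "dL (P j) m (D (Suc m) j x) \<in> carrier (BT m j)" "dR (P m) j (D m (Suc j) x) \<in> carrier (BT m j)"
  by (rule lin_closed[OF dL_lin[OF PM] c(1)], rule lin_closed[OF dR_lin[OF PM] c(2)])
 have 1: "aL j (dL (P j) m t) = \<zero>\<^bsub>P j\<^esub>" if "t \<in> carrier (BT (Suc m) j)" for t
 proof (rule btensor_lin_unique[OF PM PM PM lin_comp[OF dL_lin[OF PM] L1] lin_null[OF BM[OF PM] PM] _ that])
  fix x y assume x: "x \<in> carrier (P (Suc m))" and y: "y \<in> carrier (P j)"
  have "la (P j) \<zero>\<^bsub>A\<^esub> y = \<zero>\<^bsub>P j\<^esub>"
   using additive_hom(1)[of A "P j" "%a. la (P j) a y"] y
   by (simp add: A_abelian Pj.M.abelian_group_axioms lact_closed[OF PM] lact_add_left[OF PM])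
  then show "aL j (dL (P j) m (bt (P (Suc m)) (P j) x y)) = \<zero>\<^bsub>P j\<^esub>"
   using x y PC.cocycle_d[OF f x] by (simp add: dL_pure[OF PM] L2 d_closed regular_simps)
 qed
 have 2: "aL j (dR (P m) j t) = d j (aL (Suc j) t)" if "t \<in> carrier (BT m (Suc j))" for t
  by (rule btensor_lin_unique[OF PM PM PM lin_comp[OF dR_lin[OF PM] L1] lin_comp[OF L1 d_lin] _ that])
   (simp add: L2 dR_pure[OF PM] d_closed fc env_lin_lact[OF d_lin])
 have ac: "aL (Suc j) (D m (Suc j) x) \<in> carrier (P (Suc j))" by (rule lin_closed[OF L1 c(2)])
 have "aL j (D m j (d (m + j) x)) = aL j (dL (P j) m (D (Suc m) j x)) \<oplus>\<^bsub>P j\<^esub>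
   aL j (sg (BT m j) m (dR (P m) j (D m (Suc j) x)))"
  using diagonalD(3)[OF D, of x m j] x by (simp add: lin_add[OF L1 c'(1) sg_closed[OF BM[OF PM] c'(2)]])
 also have "\<dots> = sg (P j) m (d j (aL (Suc j) (D m (Suc j) x)))"
  by (simp add: lin_sg[OF BM[OF PM] PM L1 c'(2)] 1[OF c(1)] 2[OF c(2)] sg_closed[OF PM] d_closed[OF ac])
 finally have "sg (P j) (m * j) (aL j (D m j (d (m + j) x))) = sg (P j) (m * j + m) (d j (aL (Suc j) (D m (Suc j) x)))"
  by (simp add: sg_sg[OF PM] d_closed[OF ac])
 also have "\<dots> = d j (sg (P (Suc j)) (m * Suc j) (aL (Suc j) (D m (Suc j) x)))"
  by (simp add: lin_sg[OF PM PM d_lin ac] add.commute)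
 finally show "d j ((onP (m + Suc j) (%x. sg (P (Suc j)) (m * Suc j) (aL (Suc j) (D m (Suc j) x)))) x) =
   (onP (m + j) (%x. sg (P j) (m * j) (aL j (D m j x)))) (d (m + j) x)"
  using x d_closed[OF x] by simp
qed

end

section \<open>The cohomology algebra of a bimodule algebra\<close>

locale bimodule_algebra_resolution = bimodule_resolution K A P d \<epsilon>
 for K :: "'k ring" (structure) and A :: "('k, 'a) module" (structure) and P d \<epsilon> +
 fixes R :: "(('a, 'a) tensor, 'r) module" and \<mu> :: "('r, 'r) tensor \<Rightarrow> 'r" and \<eta> :: "'a \<Rightarrow> 'r"
 assumes algebra: "bimodule_algebra K A R \<mu> \<eta>"
begin

abbreviation "cupR \<equiv> cup K A P d \<epsilon> R \<mu>"

definition mul :: "'r \<Rightarrow> 'r \<Rightarrow> 'r" where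
 "mul x y = \<mu> (bt R R x y)"

lemma R_module: "bimod R"
 using algebra by (simp add: bimodule_algebra_def Let_def)

lemma mu_lin: "\<mu> \<in> lin Ae (bten R R) R"
 using algebra by (simp add: bimodule_algebra_def Let_def module_hom_iff)

lemma eta_lin: "\<eta> \<in> lin Ae (regular_bimodule A) R"
 using algebra by (simp add: bimodule_algebra_def Let_def module_hom_iff)

lemma mul_assoc: "x \<in> carrier R ==> y \<in> carrier R ==> z \<in> carrier R ==> mul (mul x y) z = mul x (mul y z)"
 using algebra by (simp add: bimodule_algebra_def Let_def mul_def)

lemma eta_mul: "a \<in> carrier A ==> x \<in> carrier R ==> mul (\<eta> a) x = la R a x"
 using algebra by (simp add: bimodule_algebra_def Let_def mul_def)

lemma mul_eta: "a \<in> carrier A ==> x \<in> carrier R ==> mul x (\<eta> a) = ra R x a"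
 using algebra by (simp add: bimodule_algebra_def Let_def mul_def)

lemma bt_closed: "bimod N ==> bimod M ==> x \<in> carrier N ==> y \<in> carrier M ==>
  bt N M x y \<in> carrier (bten N M)"
 by (simp add: btensor_simps btensor_pure_closed)

lemma mul_closed: "x \<in> carrier R ==> y \<in> carrier R ==> mul x y \<in> carrier R"
 unfolding mul_def by (rule lin_closed[OF mu_lin bt_closed[OF R_module R_module]])

lemma mul_add_left: "x \<in> carrier R ==> x' \<in> carrier R ==> y \<in> carrier R ==>
  mul (x \<oplus>\<^bsub>R\<^esub> x') y = mul x y \<oplus>\<^bsub>R\<^esub> mul x' y"
 unfolding mul_def using lin_add[OF mu_lin bt_closed[OF R_module R_module] bt_closed[OF R_module R_module]]
 by (simp add: btensor_pure_add_left[OF R_module R_module] btensor_simps)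

lemma mul_add_right: "x \<in> carrier R ==> y \<in> carrier R ==> y' \<in> carrier R ==>
  mul x (y \<oplus>\<^bsub>R\<^esub> y') = mul x y \<oplus>\<^bsub>R\<^esub> mul x y'"
 unfolding mul_def using lin_add[OF mu_lin bt_closed[OF R_module R_module] bt_closed[OF R_module R_module]]
 by (simp add: btensor_pure_add_right[OF R_module R_module] btensor_simps)

lemma mul_middle: "x \<in> carrier R ==> a \<in> carrier A ==> y \<in> carrier R ==>
  mul (ra R x a) y = mul x (la R a y)"
 unfolding mul_def by (simp add: btensor_pure_middle[OF R_module R_module])

lemma mul_lact: "a \<in> carrier A ==> x \<in> carrier R ==> y \<in> carrier R ==>
  mul (la R a x) y = la R a (mul x y)"
 unfolding mul_def
 by (simp add: btensor_lact[OF R_module R_module, symmetric] env_lin_lact[OF mu_lin] bt_closed R_module)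

lemma mul_ract: "a \<in> carrier A ==> x \<in> carrier R ==> y \<in> carrier R ==>
  mul x (ra R y a) = ra R (mul x y) a"
 unfolding mul_def
 by (simp add: btensor_ract[OF R_module R_module, symmetric] env_lin_ract[OF mu_lin] bt_closed R_module)

lemma eta_closed: "a \<in> carrier A ==> \<eta> a \<in> carrier R"
 using lin_closed[OF eta_lin] by (simp add: regular_simps)

lemma eta_lact: "a \<in> carrier A ==> la R a (\<eta> uA) = \<eta> a"
 using env_lin_lact[OF eta_lin, of a "uA"] by (simp add: regular_simps regular_lact)

lemma eta_ract: "a \<in> carrier A ==> ra R (\<eta> uA) a = \<eta> a"
 using env_lin_ract[OF eta_lin, of a "uA"] by (simp add: regular_simps regular_ract)

text \<open>The extension of a bimodule map into \<open>R\<close> to a map that is linear over \<open>R\<close> from the right.\<close>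

definition rext :: "('n \<Rightarrow> 'r) \<Rightarrow> ('n, 'r) tensor \<Rightarrow> 'r" where
 "rext f = tensor_lift (add_monoid R) (%p r. mul (f p) r)"

lemma rext:
 assumes N: "bimod N" and f: "f \<in> lin Ae N R"
 shows rext_lin: "rext f \<in> lin Ae (bten N R) R"
  and rext_pure: "x \<in> carrier N ==> r \<in> carrier R ==> rext f (bt N R x r) = mul (f x) r"
proof -
 interpret R: left_module Ae R by (rule R_module)
 note fc = lin_closed[OF f]
 have bal: "balanced (carrier A) N (ra N) R (la R) (add_monoid R) (%p r. mul (f p) r)"
  by (rule balancedI) (simp_all add: fc mul_closed lin_add[OF f] mul_add_left mul_add_right env_lin_ract[OF f] mul_middle)
 note L = btensor_lift[OF N R_module R.M.a_comm_group bal, folded rext_def]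
 show "rext f \<in> lin Ae (bten N R) R"
  by (rule btensor_linI[OF N R_module R_module L(1)])
   (simp_all add: L(2) fc lact_closed[OF N] ract_closed[OF R_module] env_lin_lact[OF f] mul_lact mul_ract)
 show "x \<in> carrier N ==> r \<in> carrier R ==> rext f (bt N R x r) = mul (f x) r" by (rule L(2))
qed

lemma rext_unique:
 assumes N: "bimod N" and f: "f \<in> lin Ae N R" and g: "g \<in> lin Ae (bten N R) R"
  and "!!x r. x \<in> carrier N ==> r \<in> carrier R ==> g (bt N R x r) = mul (f x) r" and t: "t \<in> carrier (bten N R)"
 shows "rext f t = g t"
 by (rule btensor_lin_unique[OF N R_module R_module rext_lin[OF N f] g _ t]) (simp add: rext_pure[OF N f] assms(4))

lemma mul_zero_left: "r \<in> carrier R ==> mul \<zero>\<^bsub>R\<^esub> r = \<zero>\<^bsub>R\<^esub>"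
 using additive_hom(1)[of R R "%x. mul x r"]
 by (simp add: left_module_abelian_group[OF R_module] mul_closed mul_add_left)

lemma rext_dL:
 assumes f: "f \<in> lin Ae (P j) R" and t: "t \<in> carrier (bten (P (Suc j)) R)"
 shows "rext f (dL R j t) = rext (%x. f (d j x)) t"
 by (rule rext_unique[OF PM lin_comp[OF d_lin f] lin_comp[OF dL_lin[OF R_module] rext_lin[OF PM f]] _ t, symmetric])
  (simp add: dL_pure[OF R_module] rext_pure[OF PM f] d_closed)

lemma rext_cocycle:
 assumes f: "f \<in> cocycles Ae P d R m" and t: "t \<in> carrier (bten (P (Suc m)) R)"
 shows "rext f (dL R m t) = \<zero>\<^bsub>R\<^esub>"
 unfolding rext_dL[OF PC.cocycle_lin[OF f] t]
 by (rule rext_unique[OF PM lin_comp[OF d_lin PC.cocycle_lin[OF f]] lin_null[OF BM[OF R_module] R_module] _ t])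
  (simp add: PC.cocycle_d[OF f] mul_zero_left)

lemma rext_add:
 assumes N: "bimod N" and f: "f \<in> lin Ae N R" and g: "g \<in> lin Ae N R"
  and h: "!!x. x \<in> carrier N ==> h x = f x \<oplus>\<^bsub>R\<^esub> g x" and t: "t \<in> carrier (bten N R)"
 shows "rext h t = rext f t \<oplus>\<^bsub>R\<^esub> rext g t"
proof (rule rext_unique[OF N _ lin_plus[OF btensor_left_module[OF N R_module] R_module rext_lin[OF N f] rext_lin[OF N g]] _ t])
 show "h \<in> lin Ae N R" by (rule lin_cong[OF N lin_plus[OF N R_module f g] h])
 show "rext f (bt N R x r) \<oplus>\<^bsub>R\<^esub> rext g (bt N R x r) = mul (h x) r" if "x \<in> carrier N" "r \<in> carrier R" for x r
  using that by (simp add: rext_pure[OF N f] rext_pure[OF N g] h mul_add_left lin_closed[OF f] lin_closed[OF g])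
qed

abbreviation "CR \<equiv> cocycles Ae P d R"
abbreviation "ER \<equiv> Ext_class Ae P d R"
abbreviation "CA \<equiv> cocycles Ae P d (regular_bimodule A)"
abbreviation "EA \<equiv> Ext_class Ae P d (regular_bimodule A)"
abbreviation "lifts n g \<equiv> chain_lifts Ae P d (%i. bten (P i) R) (dL R) (eL R) n g"

lemma rext_lift_cocycle:
 assumes f: "f \<in> CR m" and h: "h \<in> lifts n g"
 shows "(onP (m + n) (%x. rext f (h m x))) \<in> CR (m + n)"
 by (rule PC.lift_pairing_cocycle[OF left_res[OF R_module] h R_module rext_lin[OF PM PC.cocycle_lin[OF f]] rext_cocycle[OF f]])

lemma rext_lift_coboundary:
 assumes h: "h \<in> lifts n g" and b: "b \<in> coboundaries Ae P d R m"
 shows "(onP (m + n) (%x. rext b (h m x))) \<in> coboundaries Ae P d R (m + n)"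
 using b unfolding PC.coboundaries_iff[of b]
proof (elim disjE exE conjE)
 have hc: "h m x \<in> carrier (bten (P m) R)" if "x \<in> carrier (P (m + n))" for x
  using module_hom_closed[OF chain_liftsD(1)[OF h]] that by (simp add: add.commute)
 have bl: "b \<in> lin Ae (P m) R" by (rule module_hom_lin[OF PC.coboundary_hom[OF R_module b]])
 show ?thesis if m: "m = 0" "b = (onP 0 (%x. \<zero>\<^bsub>R\<^esub>))"
 proof -
  have "rext b t = \<zero>\<^bsub>R\<^esub>" if "t \<in> carrier (bten (P m) R)" for t
   by (rule rext_unique[OF PM bl lin_null[OF BM[OF R_module] R_module] _ that]) (simp add: m mul_zero_left)
  then have "(onP (m + n) (%x. rext b (h m x))) = (onP (m + n) (%x. \<zero>\<^bsub>R\<^esub>))"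
   using hc by (intro restrict_ext) simp
  then show ?thesis using PC.coboundary_zero[OF R_module] by simp
 qed
 show ?thesis if m: "m = Suc j" "\<gamma> \<in> module_hom Ae (P j) R" "b = (onP m (%x. \<gamma> (d j x)))" for j \<gamma>
 proof -
  have "rext b t = rext \<gamma> (dL R j t)" if "t \<in> carrier (bten (P m) R)" for t
   by (rule rext_unique[OF PM bl, unfolded m(1), OF lin_comp[OF dL_lin[OF R_module] rext_lin[OF PM module_hom_lin[OF m(2)]]]])
    (use that m in \<open>simp_all add: dL_pure[OF R_module] rext_pure[OF PM module_hom_lin[OF m(2)]] d_closed\<close>)
  then have "(onP (m + n) (%x. rext b (h m x))) = (onP (Suc j + n) (%x. rext \<gamma> (dL R j (h (Suc j) x))))"
   unfolding m(1) by (intro restrict_ext) (use hc m(1) in simp)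
  then show ?thesis
   using PC.lift_pairing_coboundary[OF h rext_lin[OF PM module_hom_lin[OF m(2)]]] m(1) by simp
 qed
qed

lemma cup_value:
 assumes N: "bimod N" and M: "bimod M"
  and f: "f \<in> lin Ae N R" and g: "g \<in> lin Ae M R" and t: "t \<in> carrier (bten N M)"
 shows "\<mu> (tensor_map (bgrp R R) f g t) = rext f (idt N R g t)"
proof -
 note FG = btensor_map[OF N R_module M R_module f g]
 note I = idt[OF N M R_module g]
 show ?thesis
  by (rule btensor_lin_unique[OF N M R_module lin_comp[OF FG(1) mu_lin] lin_comp[OF I(1) rext_lin[OF N f]] _ t])
   (simp add: FG(2) I(2) rext_pure[OF N f] lin_closed[OF g] mul_def)
qed

lemma cup_representative:
 assumes D: "D \<in> diagonal_maps K A P d \<epsilon>" and f: "f \<in> CR m" and g: "g \<in> CR n" and h: "h \<in> lifts n g"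
 shows "(onP (m + n) (%x. \<mu> (tensor_map (bgrp R R) f g (D m n x)))) \<in> CR (m + n)" (is "?c \<in> _")
  and "ER (m + n) (onP (m + n) (%x. \<mu> (tensor_map (bgrp R R) f g (D m n x)))) =
   ER (m + n) (onP (m + n) (%x. rext f (h m x)))"
proof -
 note fl = PC.cocycle_lin[OF f] and gl = PC.cocycle_lin[OF g]
 let ?t = "\<lambda>x\<in>carrier (P n). g (eL (P n) (D 0 n x))"
 note H = diagonal_lift[OF D R_module g]
 have \<tau>: "(onP n (%x. g ((onP n (%x. eL (P n) (D 0 n x))) x))) = ?t"
  by (rule restrict_ext) simp
 note T = PC.Ext_class_comp_chain_map[OF exact left_chain_map[OF D] R_module g, unfolded \<tau>]
 have c: "?c = (onP (m + n) (%x. rext f ((onP (n + m) (%x. idt (P m) R g (D m n x))) x)))"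
  by (rule restrict_ext) (simp add: cup_value[OF PM PM fl gl diagonal_closed[OF D]] add.commute)
 show "?c \<in> CR (m + n)" unfolding c by (rule rext_lift_cocycle[OF f H])
 show "ER (m + n) ?c = ER (m + n) (onP (m + n) (%x. rext f (h m x)))"
  unfolding c
  by (rule PC.lift_pairing_unique[OF left_res[OF R_module] H h T(1) g T(2) R_module
     rext_lin[OF PM fl] rext_cocycle[OF f]])
qed

lemma cup_Ext_class:
 assumes f: "f \<in> CR m" and g: "g \<in> CR n" and h: "h \<in> lifts n g"
 shows "cupR m n (ER m f) (ER n g) = ER (m + n) (onP (m + n) (%x. rext f (h m x)))"
proof -
 interpret R: left_module Ae R by (rule R_module)
 have *: "ER (m + n) (onP (m + n) (%x. \<mu> (tensor_map (bgrp R R) f' g' (D m n x)))) =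
   ER (m + n) (onP (m + n) (%x. rext f (h m x)))"
  if f': "f' \<in> ER m f" and g': "g' \<in> ER n g" and D: "D \<in> diagonal_maps K A P d \<epsilon>" for f' g' D
 proof -
  note fc = PC.Ext_class_memD[OF R_module f f'] and gc = PC.Ext_class_memD[OF R_module g g']
  note fl = PC.cocycle_lin[OF fc(1)] and f0 = PC.cocycle_lin[OF f]
  obtain h' where h': "h' \<in> lifts n g'" using PC.lift_exists_cocycle[OF left_res[OF R_module] gc(1)] by auto
  have "ER (m + n) (onP (m + n) (%x. \<mu> (tensor_map (bgrp R R) f' g' (D m n x)))) =
    ER (m + n) (onP (m + n) (%x. rext f' (h' m x)))"
   by (rule cup_representative(2)[OF D fc(1) gc(1) h'])
  also have "\<dots> = ER (m + n) (onP (m + n) (%x. rext f' (h m x)))"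
   by (rule PC.lift_pairing_unique[OF left_res[OF R_module] h' h gc(1) g gc(2) R_module rext_lin[OF PM fl] rext_cocycle[OF fc(1)]])
  also have "\<dots> = ER (m + n) (onP (m + n) (%x. rext f (h m x)))"
  proof -
   obtain b where b: "b \<in> coboundaries Ae P d R m" "!!x. x \<in> carrier (P m) ==> f' x = b x \<oplus>\<^bsub>R\<^esub> f x"
    using f' unfolding PC.Ext_class_mem_iff by auto
   have bl: "b \<in> lin Ae (P m) R" by (rule module_hom_lin[OF PC.coboundary_hom[OF R_module b(1)]])
   show ?thesis
    by (rule PC.Ext_class_eqI[OF R_module PC.cocycle_hom[OF rext_lift_cocycle[OF fc(1) h]]
       PC.cocycle_hom[OF rext_lift_cocycle[OF f h]] rext_lift_coboundary[OF h b(1)]])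
     (use module_hom_closed[OF chain_liftsD(1)[OF h, of m]] rext_add[OF PM bl f0 b(2)] in \<open>simp add: add.commute\<close>)
  qed
  finally show ?thesis .
 qed
 obtain D where D: "D \<in> diagonal_maps K A P d \<epsilon>" using diagonal_exists by auto
 show ?thesis unfolding cup_def
 proof (intro equalityI UN_least)
  show "ER (m + n) (onP (m + n) (%x. rext f (h m x))) \<subseteq>
   (\<Union>f\<in>ER m f. \<Union>g\<in>ER n g. \<Union>D\<in>diagonal_maps K A P d \<epsilon>.
    ER (m + n) (onP (m + n) (%x. \<mu> (tensor_map (bgrp R R) f g (D m n x)))))"
   using *[OF PC.Ext_class_self[OF R_module f] PC.Ext_class_self[OF R_module g] D]
    PC.Ext_class_self[OF R_module f] PC.Ext_class_self[OF R_module g] D by (intro subsetI UN_I) auto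
 qed (simp add: *)
qed

lemma cup_diagonal:
 assumes D: "D \<in> diagonal_maps K A P d \<epsilon>" and f: "f \<in> CR m" and g: "g \<in> CR n"
 shows "cupR m n (ER m f) (ER n g) =
  ER (m + n) (onP (m + n) (%x. \<mu> (tensor_map (bgrp R R) f g (D m n x))))"
proof -
 obtain h where h: "h \<in> lifts n g" using PC.lift_exists_cocycle[OF left_res[OF R_module] g] by auto
 show ?thesis unfolding cup_Ext_class[OF f g h] cup_representative(2)[OF D f g h] ..
qed

subsection \<open>Associativity\<close>

definition rmul :: "(('a, 'a) tensor, 'n) module \<Rightarrow> 'r \<Rightarrow> ('n, 'r) tensor \<Rightarrow> ('n, 'r) tensor" where
 "rmul N r = tensor_map (bgrp N R) (%x. x) (%x. mul x r)"

lemma rmul: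
 assumes N: "bimod N" and r: "r \<in> carrier R"
 shows rmul_hom: "rmul N r \<in> hom (bgrp N R) (bgrp N R)"
  and rmul_pure: "x \<in> carrier N ==> y \<in> carrier R ==> rmul N r (bt N R x y) = bt N R x (mul y r)"
proof -
 have td: "tensor_data (carrier A) N (ra N) R (la R)" by (rule btensor_data[OF N R_module])
 note * = tensor_map[OF td td, of "%x. x" "%x. mul x r", folded btensor_group_def]
 have m: "bt N R (ra N x a) (mul y r) = bt N R x (mul (la R a y) r)"
  if "x \<in> carrier N" "a \<in> carrier A" "y \<in> carrier R" for x a y
  using that r by (simp add: btensor_pure_middle[OF N R_module] mul_closed mul_lact)
 show "rmul N r \<in> hom (bgrp N R) (bgrp N R)"
  unfolding rmul_def by (rule *(1)) (simp_all add: mul_closed mul_add_left r m)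
 show "rmul N r (bt N R x y) = bt N R x (mul y r)" if "x \<in> carrier N" "y \<in> carrier R"
  unfolding rmul_def by (rule *(2)) (simp_all add: mul_closed mul_add_left r m that)
qed

lemma rmul_closed: "bimod N ==> r \<in> carrier R ==> t \<in> carrier (bten N R) ==>
  rmul N r t \<in> carrier (bten N R)"
 using hom_in_carrier[OF rmul_hom] by (simp add: btensor_simps)

lemma rmul_laws:
 assumes N: "bimod N" and t: "t \<in> carrier (bten N R)"
 shows rmul_add: "r \<in> carrier R ==> r' \<in> carrier R ==>
   rmul N (r \<oplus>\<^bsub>R\<^esub> r') t = rmul N r t \<oplus>\<^bsub>bten N R\<^esub> rmul N r' t"
  and rmul_lact: "a \<in> carrier A ==> r \<in> carrier R ==>
   rmul N r (la (bten N R) a t) = la (bten N R) a (rmul N r t)"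
  and rmul_ract: "a \<in> carrier A ==> r \<in> carrier R ==>
   rmul N (ra R r a) t = ra (bten N R) (rmul N r t) a"
  and rmul_middle: "a \<in> carrier A ==> r \<in> carrier R ==>
   rmul N r (ra (bten N R) t a) = rmul N (la R a r) t"
proof -
 let ?B = "bten N R" and ?T = "bgrp N R"
 interpret R: left_module Ae R by (rule R_module)
 note B = btensor_left_module[OF N R_module]
 note cg = btensor_comm_group[OF N R_module]
 note u = btensor_hom_unique[OF N R_module comm_group_group[OF cg]]
 have t': "t \<in> carrier ?T" using t by (simp add: btensor_simps)
 have la: "la ?B a \<in> hom ?T ?T" and ra: "(%t. ra ?B t a) \<in> hom ?T ?T" if a: "a \<in> carrier A" for a
  by (rule hom_addI; use a lact_closed[OF B] ract_closed[OF B] lact_add[OF B] ract_add[OF B] in \<open>simp add: btensor_simps\<close>)+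
 note H = rmul_hom[OF N] and p = rmul_pure[OF N]
 show "rmul N (r \<oplus>\<^bsub>R\<^esub> r') t = rmul N r t \<oplus>\<^bsub>?B\<^esub> rmul N r' t" if r: "r \<in> carrier R" "r' \<in> carrier R" for r r'
  unfolding btensor_simps
  by (rule u[OF H[OF R.M.a_closed[OF r]]
     hom_pointwise_mult[OF cg H[OF r(1)] H[OF r(2)]] _ t'])
   (use r in \<open>simp add: p mul_add_right btensor_pure_add_right[OF N R_module] mul_closed
    R.M.a_closed\<close>)
 show "rmul N r (la ?B a t) = la ?B a (rmul N r t)" if h: "a \<in> carrier A" "r \<in> carrier R" for a r
  by (rule u[OF hom_compose[OF la[OF h(1)] H[OF h(2)]] hom_compose[OF H[OF h(2)] la[OF h(1)]] _ t'])
   (use h in \<open>simp add: p btensor_lact[OF N R_module] lact_closed[OF N] mul_closed\<close>)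
 show "rmul N (ra R r a) t = ra ?B (rmul N r t) a" if h: "a \<in> carrier A" "r \<in> carrier R" for a r
  by (rule u[OF H[OF ract_closed[OF R_module h]] hom_compose[OF H[OF h(2)] ra[OF h(1)]] _ t'])
   (use h in \<open>simp add: p btensor_ract[OF N R_module] ract_closed[OF R_module] mul_closed mul_ract\<close>)
 show "rmul N r (ra ?B t a) = rmul N (la R a r) t" if h: "a \<in> carrier A" "r \<in> carrier R" for a r
  by (rule u[OF hom_compose[OF ra[OF h(1)] H[OF h(2)]] H[OF lact_closed[OF R_module h]] _ t'])
   (use h in \<open>simp add: p btensor_ract[OF N R_module] ract_closed[OF R_module] lact_closed[OF R_module] mul_middle\<close>)
qed

definition rlift :: "(('a, 'a) tensor, 'm) module \<Rightarrow> ('n \<Rightarrow> ('m, 'r) tensor) \<Rightarrow> ('n, 'r) tensor \<Rightarrow> ('m, 'r) tensor" where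
 "rlift M F = tensor_lift (add_monoid (bten M R)) (%p r. rmul M r (F p))"

lemma rlift:
 assumes N: "bimod N" and M: "bimod M" and F: "F \<in> lin Ae N (bten M R)"
 shows rlift_lin: "rlift M F \<in> lin Ae (bten N R) (bten M R)"
  and rlift_pure: "x \<in> carrier N ==> r \<in> carrier R ==> rlift M F (bt N R x r) = rmul M r (F x)"
proof -
 let ?B = "bten M R"
 note B = btensor_left_module[OF M R_module]
 interpret B: left_module Ae ?B by (rule B)
 note Fc = lin_closed[OF F]
 have radd: "rmul M r (F x \<oplus>\<^bsub>?B\<^esub> F y) = rmul M r (F x) \<oplus>\<^bsub>?B\<^esub> rmul M r (F y)"
  if "x \<in> carrier N" "y \<in> carrier N" "r \<in> carrier R" for x y r
  using hom_mult[OF rmul_hom[OF M that(3)], of "F x" "F y"] Fc that by (simp add: btensor_simps)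
 have bal: "balanced (carrier A) N (ra N) R (la R) (add_monoid ?B) (%p r. rmul M r (F p))"
  by (rule balancedI) (simp_all add: rmul_closed[OF M] Fc lin_add[OF F] radd rmul_add[OF M] env_lin_ract[OF F] rmul_middle[OF M])
 note L = btensor_lift[OF N R_module B.M.a_comm_group bal, folded rlift_def]
 show "rlift M F \<in> lin Ae (bten N R) ?B"
  by (rule btensor_linI[OF N R_module B L(1)])
   (simp_all add: L(2) Fc lact_closed[OF N] ract_closed[OF R_module] env_lin_lact[OF F] rmul_lact[OF M] rmul_ract[OF M])
 show "x \<in> carrier N ==> r \<in> carrier R ==> rlift M F (bt N R x r) = rmul M r (F x)" by (rule L(2))
qed

lemma rext_rmul:
 assumes N: "bimod N" and f: "f \<in> lin Ae N R" and r: "r \<in> carrier R" and t: "t \<in> carrier (bten N R)"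
 shows "rext f (rmul N r t) = mul (rext f t) r"
proof -
 interpret R: left_module Ae R by (rule R_module)
 have h: "(%x. mul x r) \<in> hom (add_monoid R) (add_monoid R)"
  by (rule hom_addI) (use r in \<open>simp_all add: mul_closed mul_add_left\<close>)
 note l = lin_hom[OF rext_lin[OF N f], unfolded hom_btensor_iff]
 show ?thesis
  by (rule btensor_hom_unique[OF N R_module R.M.a_group hom_compose[OF rmul_hom[OF N r] l] hom_compose[OF l h]])
   (use t r in \<open>simp_all add: rmul_pure[OF N] rext_pure[OF N f] mul_closed mul_assoc lin_closed[OF f] btensor_simps\<close>)
qed

lemma rext_rlift:
 assumes N: "bimod N" and M: "bimod M" and F: "F \<in> lin Ae N (bten M R)"
  and e: "e \<in> lin Ae M R" and t: "t \<in> carrier (bten N R)"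
  and h: "!!x. x \<in> carrier N ==> h x = rext e (F x)"
 shows "rext e (rlift M F t) = rext h t"
proof (rule rext_unique[OF N _ lin_comp[OF rlift_lin[OF N M F] rext_lin[OF M e]] _ t, symmetric])
 show "h \<in> lin Ae N R" by (rule lin_cong[OF N lin_comp[OF F rext_lin[OF M e]] h])
qed (simp add: rlift_pure[OF N M F] rext_rmul[OF M e] lin_closed[OF F] h)

lemma lift_product:
 assumes f: "f \<in> CR m" and F: "F \<in> lifts m f" and H: "H \<in> lifts n g"
 shows "(%i. \<lambda>x\<in>carrier (P (m + n + i)). rlift (P i) (F i) (H (m + i) x)) \<in>
  lifts (m + n) (onP (m + n) (%x. rext f (H m x)))"
 unfolding chain_lifts_def
proof (intro CollectI conjI allI ballI)
 note FD = chain_liftsD[OF F] and HD = chain_liftsD[OF H]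
 have Fl: "F i \<in> lin Ae (P (m + i)) (bten (P i) R)" for i by (rule module_hom_lin[OF FD(1)])
 have Hm: "H (m + i) \<in> module_hom Ae (P (m + n + i)) (bten (P (m + i)) R)" for i
  using HD(1)[of "m + i"] by (simp add: ac_simps)
 note L = rlift_lin[OF PM PM Fl] and Lp = rlift_pure[OF PM PM Fl]
 show "(onP (m + n + i) (%x. rlift (P i) (F i) (H (m + i) x))) \<in>
   module_hom Ae (P (m + n + i)) (bten (P i) R)" for i
  by (rule lin_restrict[OF PM lin_comp[OF module_hom_lin[OF Hm] L]])
 have e: "eL R (rmul (P 0) r t) = mul (eL R t) r" if "t \<in> carrier (bten (P 0) R)" and r: "r \<in> carrier R" for t r
 proof -
  interpret R: left_module Ae R by (rule R_module)
  have h: "(%x. mul x r) \<in> hom (add_monoid R) (add_monoid R)"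
   by (rule hom_addI) (use r in \<open>simp_all add: mul_closed mul_add_left\<close>)
  note l = lin_hom[OF eL_lin[OF R_module], unfolded hom_btensor_iff]
  show ?thesis
   by (rule btensor_hom_unique[OF PM R_module R.M.a_group hom_compose[OF rmul_hom[OF PM r] l] hom_compose[OF l h]])
    (use that in \<open>simp_all add: rmul_pure[OF PM] eL_pure[OF R_module] mul_closed mul_lact eps_closed btensor_simps\<close>)
 qed
 have e': "eL R (rlift (P 0) (F 0) t) = rext f t" if "t \<in> carrier (bten (P m) R)" for t
 proof (rule rext_unique[OF PM PC.cocycle_lin[OF f] _ _ that, symmetric])
  show "(%t. eL R (rlift (P 0) (F 0) t)) \<in> lin Ae (bten (P m) R) R"
   using lin_comp[OF L[of 0] eL_lin[OF R_module]] by simp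
  show "eL R (rlift (P 0) (F 0) (bt (P m) R x r)) = mul (f x) r" if "x \<in> carrier (P m)" "r \<in> carrier R" for x r
   using that Lp[of x 0 r] e[OF lin_closed[OF Fl[of 0]]] FD(2)[of x] by simp
 qed
 show "eL R ((onP (m + n + 0) (%x. rlift (P 0) (F 0) (H (m + 0) x))) x) =
   (onP (m + n) (%x. rext f (H m x))) x" if "x \<in> carrier (P (m + n))" for x
  using that e'[OF module_hom_closed[OF Hm[of 0], simplified]] by simp
 fix i x assume x: "x \<in> carrier (P (Suc (m + n + i)))"
 have dr: "dL R i (rmul (P (Suc i)) r t) = rmul (P i) r (dL R i t)"
  if t: "t \<in> carrier (bten (P (Suc i)) R)" and r: "r \<in> carrier R" for t r
 proof -
  note l = lin_hom[OF dL_lin[OF R_module], unfolded hom_btensor_iff]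
  show ?thesis
   by (rule btensor_hom_unique[OF PM R_module comm_group_group[OF btensor_comm_group[OF PM R_module]]
      hom_compose[OF rmul_hom[OF PM r] l] hom_compose[OF l rmul_hom[OF PM r]]])
    (use t r in \<open>simp_all add: rmul_pure[OF PM] dL_pure[OF R_module] mul_closed d_closed btensor_simps\<close>)
 qed
 have key: "dL R i (rlift (P (Suc i)) (F (Suc i)) t) = rlift (P i) (F i) (dL R (m + i) t)"
  if t: "t \<in> carrier (bten (P (Suc (m + i))) R)" for t
 proof (rule btensor_lin_unique[OF PM R_module BM[OF R_module] _ lin_comp[OF dL_lin[OF R_module] L] _ t])
  show "(%t. dL R i (rlift (P (Suc i)) (F (Suc i)) t)) \<in> lin Ae (bten (P (Suc (m + i))) R) (bten (P i) R)"
   using lin_comp[OF L[of "Suc i"] dL_lin[OF R_module]] by simp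
  fix y r assume y: "y \<in> carrier (P (Suc (m + i)))" and r: "r \<in> carrier R"
  show "dL R i (rlift (P (Suc i)) (F (Suc i)) (bt (P (Suc (m + i))) R y r)) =
    rlift (P i) (F i) (dL R (m + i) (bt (P (Suc (m + i))) R y r))"
   using y r Lp[of y "Suc i" r] lin_closed[OF Fl[of "Suc i"], of y]
   by (simp add: dr FD(3) dL_pure[OF R_module] Lp d_closed)
 qed
 have "H (m + Suc i) x \<in> carrier (bten (P (Suc (m + i))) R)"
  using module_hom_closed[OF Hm[of "Suc i"]] x by simp
 from key[OF this] show "dL R i ((onP (m + n + Suc i) (%x. rlift (P (Suc i)) (F (Suc i)) (H (m + Suc i) x))) x) =
   (onP (m + n + i) (%x. rlift (P i) (F i) (H (m + i) x))) (d (m + n + i) x)"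
  using x HD(3)[of x "m + i"] d_closed[OF x] by (simp add: ac_simps)
qed

lemma cup_assoc:
 assumes e: "e \<in> CR l" and f: "f \<in> CR m" and g: "g \<in> CR n"
 shows "cupR (l + m) n (cupR l m (ER l e) (ER m f)) (ER n g) =
  cupR l (m + n) (ER l e) (cupR m n (ER m f) (ER n g))"
proof -
 obtain F where F: "F \<in> lifts m f" using PC.lift_exists_cocycle[OF left_res[OF R_module] f] by auto
 obtain H where H: "H \<in> lifts n g" using PC.lift_exists_cocycle[OF left_res[OF R_module] g] by auto
 have Fl: "F l \<in> lin Ae (P (l + m)) (bten (P l) R)"
  using module_hom_lin[OF chain_liftsD(1)[OF F, of l]] by (simp add: add.commute)
 have Hc: "H (l + m) x \<in> carrier (bten (P (l + m)) R)" if "x \<in> carrier (P (l + m + n))" for x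
  using module_hom_closed[OF chain_liftsD(1)[OF H, of "l + m"]] that by (simp add: ac_simps)
 have "(onP (l + m + n) (%x. rext (onP (l + m) (%x. rext e (F l x))) (H (l + m) x))) =
   (\<lambda>x\<in>carrier (P (l + (m + n))). rext e ((onP (m + n + l) (%x. rlift (P l) (F l) (H (m + l) x))) x))"
 proof (unfold add.assoc[of l m n], rule restrict_ext)
  fix x assume x: "x \<in> carrier (P (l + (m + n)))"
  have "rext e (rlift (P l) (F l) (H (l + m) x)) = rext (onP (l + m) (%x. rext e (F l x))) (H (l + m) x)"
   by (rule rext_rlift[OF PM PM Fl PC.cocycle_lin[OF e] Hc]) (use x in \<open>simp_all add: add.assoc\<close>)
  then show "rext (onP (l + m) (%x. rext e (F l x))) (H (l + m) x) =
    rext e ((onP (m + n + l) (%x. rlift (P l) (F l) (H (m + l) x))) x)"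
   using x by (simp add: ac_simps)
 qed
 then show ?thesis
  by (simp only: cup_Ext_class[OF e f F] cup_Ext_class[OF f g H] cup_Ext_class[OF rext_lift_cocycle[OF e F] g H]
    cup_Ext_class[OF e rext_lift_cocycle[OF f H] lift_product[OF f F H]] add.assoc)
qed

end

section \<open>Change of coefficients and graded commutativity\<close>

context proj_complex
begin

definition
 "Ext_map Z \<theta> n \<alpha> = (\<Union>f\<in>\<alpha>. cls Z n (compose (carrier (P n)) \<theta> f))"

lemma map_cocycle:
 assumes Y: "left_module S Y" and Z: "left_module S Z" and \<theta>: "\<theta> \<in> lin S Y Z" and f: "f \<in> ZC Y n"
 shows "(onP n (%x. \<theta> (f x))) \<in> ZC Z n"
 by (rule cocycleI[OF lin_comp[OF cocycle_lin[OF f] \<theta>]]) (simp add: cocycle_d[OF f] lin_zero[OF Y Z \<theta>])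

lemma map_class_cong:
 assumes Y: "left_module S Y" and Z: "left_module S Z" and \<theta>: "\<theta> \<in> lin S Y Z"
  and f: "f \<in> ZC Y n" and g: "g \<in> ZC Y n"
  and eq: "cls Y n f = cls Y n g"
 shows "cls Z n (onP n (%x. \<theta> (f x))) = cls Z n (onP n (%x. \<theta> (g x)))"
proof -
 obtain b where b: "b \<in> BC Y n" "!!x. x \<in> carrier (P n) ==> f x = b x \<oplus>\<^bsub>Y\<^esub> g x"
  using Ext_class_eqD[OF Y f eq] by auto
 show ?thesis
  by (rule Ext_class_eqI[OF Z cocycle_hom[OF map_cocycle[OF Y Z \<theta> f]] cocycle_hom[OF map_cocycle[OF Y Z \<theta> g]]
     coboundary_image[OF Y Z \<theta> b(1)]])
   (simp add: b(2) lin_add[OF \<theta>] hom_closed[OF coboundary_hom[OF Y b(1)]] hom_closed[OF cocycle_hom[OF g]])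
qed

lemma Ext_map_class:
 assumes Y: "left_module S Y" and Z: "left_module S Z" and \<theta>: "\<theta> \<in> lin S Y Z" and f: "f \<in> ZC Y n"
 shows "Ext_map Z \<theta> n (cls Y n f) = cls Z n (onP n (%x. \<theta> (f x)))"
proof -
 have *: "cls Z n (compose (carrier (P n)) \<theta> f') = cls Z n (onP n (%x. \<theta> (f x)))"
  if "f' \<in> cls Y n f" for f'
  unfolding compose_def
  by (rule map_class_cong[OF Y Z \<theta> Ext_class_memD(1)[OF Y f that] f Ext_class_memD(2)[OF Y f that]])
 show ?thesis unfolding Ext_map_def
  using *[OF Ext_class_self[OF Y f]] Ext_class_self[OF Y f] * by blast
qed

lemma Ext_map_hom:
 assumes Y: "left_module S Y" and Z: "left_module S Z" and \<theta>: "\<theta> \<in> lin S Y Z"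
 shows "Ext_map Z \<theta> n \<in> hom (ExtG Y n) (ExtG Z n)"
proof (rule hom_addI)
 fix x assume "x \<in> carrier (ExtG Y n)"
 then obtain f where f: "f \<in> ZC Y n" "x = cls Y n f" by (auto simp: Ext_carrier)
 show "Ext_map Z \<theta> n x \<in> carrier (ExtG Z n)"
  unfolding f(2) Ext_map_class[OF Y Z \<theta> f(1)] by (rule Ext_class_closed[OF map_cocycle[OF Y Z \<theta> f(1)]])
 fix y assume "y \<in> carrier (ExtG Y n)"
 then obtain g where g: "g \<in> ZC Y n" "y = cls Y n g" by (auto simp: Ext_carrier)
 have fg: "(onP n (%x. f x \<oplus>\<^bsub>Y\<^esub> g x)) \<in> ZC Y n"
  using subgroup.m_closed[OF cocycles_subgroup[OF Y] f(1) g(1)] by (simp add: cochain_simps)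
 have "(onP n (%x. \<theta> ((onP n (%x. f x \<oplus>\<^bsub>Y\<^esub> g x)) x))) =
   (onP n (%x. (onP n (%x. \<theta> (f x))) x \<oplus>\<^bsub>Z\<^esub> (onP n (%x. \<theta> (g x))) x))"
  by (rule restrict_ext) (simp add: lin_add[OF \<theta>] hom_closed[OF cocycle_hom[OF f(1)]] hom_closed[OF cocycle_hom[OF g(1)]])
 then show "Ext_map Z \<theta> n (x \<otimes>\<^bsub>ExtG Y n\<^esub> y) = Ext_map Z \<theta> n x \<otimes>\<^bsub>ExtG Z n\<^esub> Ext_map Z \<theta> n y"
  unfolding f(2) g(2)
  by (simp only: Ext_class_mult[OF Y f(1) g(1)] Ext_map_class[OF Y Z \<theta>] f(1) g(1) fg
    Ext_class_mult[OF Z map_cocycle[OF Y Z \<theta> f(1)] map_cocycle[OF Y Z \<theta> g(1)]])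
qed

lemma Ext_map_yoneda:
 assumes exact: "aug_exact S P d \<epsilon> V" and Y: "left_module S Y" and Z: "left_module S Z" and \<theta>: "\<theta> \<in> lin S Y Z"
  and \<alpha>: "\<alpha> \<in> carrier (ExtG Y m)" and \<beta>: "\<beta> \<in> carrier (ExtG V n)"
 shows "Ext_map Z \<theta> (m + n) (yoneda S P d \<epsilon> Y m n \<alpha> \<beta>) = yoneda S P d \<epsilon> Z m n (Ext_map Z \<theta> m \<alpha>) \<beta>"
proof -
 obtain f where f: "f \<in> ZC Y m" "\<alpha> = cls Y m f" using \<alpha> by (auto simp: Ext_carrier)
 obtain g where g: "g \<in> ZC V n" "\<beta> = cls V n g" using \<beta> by (auto simp: Ext_carrier)
 obtain h where h: "h \<in> chain_lifts S P d P d \<epsilon> n g" using lift_exists_cocycle[OF exact g(1)] by auto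
 have "(onP (m + n) (%x. \<theta> ((onP (m + n) (%x. f (h m x))) x))) =
   (onP (m + n) (%x. (onP m (%x. \<theta> (f x))) (h m x)))"
  by (rule restrict_ext) (use hom_closed[OF chain_liftsD(1)[OF h, of m]] in \<open>simp add: add.commute\<close>)
 then show ?thesis unfolding f(2) g(2)
  by (simp only: yoneda_Ext_class[OF exact Y f(1) g(1) h] Ext_map_class[OF Y Z \<theta>] f(1)
    comp_lift_cocycle[OF exact Y f(1) h] yoneda_Ext_class[OF exact Z map_cocycle[OF Y Z \<theta> f(1)] g(1) h])
qed

lemma Ext_map_surj:
 assumes Y: "left_module S Y" and Z: "left_module S Z" and \<theta>: "\<theta> \<in> lin S Y Z"
  and \<psi>: "\<psi> \<in> lin S Z Y" and inv: "!!z. z \<in> carrier Z ==> \<theta> (\<psi> z) = z"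
 shows "carrier (ExtG Z n) \<subseteq> Ext_map Z \<theta> n ` carrier (ExtG Y n)"
proof
 fix y assume "y \<in> carrier (ExtG Z n)"
 then obtain g where g: "g \<in> ZC Z n" "y = cls Z n g" by (auto simp: Ext_carrier)
 have "(onP n (%x. \<theta> ((onP n (%x. \<psi> (g x))) x))) = (onP n (%x. g x))"
  by (rule restrict_ext) (simp add: inv hom_closed[OF cocycle_hom[OF g(1)]])
 also have "\<dots> = g" using cocycle_hom[OF g(1)] by (simp add: module_hom_restrict)
 finally have "y = Ext_map Z \<theta> n (cls Y n (onP n (%x. \<psi> (g x))))"
  by (simp only: Ext_map_class[OF Y Z \<theta> map_cocycle[OF Z Y \<psi> g(1)]] g(2))
 then show "y \<in> Ext_map Z \<theta> n ` carrier (ExtG Y n)"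
  by (rule image_eqI) (rule Ext_class_closed[OF map_cocycle[OF Z Y \<psi> g(1)]])
qed

lemma yoneda_unit:
 assumes exact: "aug_exact S P d \<epsilon> V" and Y: "left_module S Y" and f: "f \<in> ZC Y m"
  and \<epsilon>: "\<epsilon> \<in> ZC V 0"
 shows "yoneda S P d \<epsilon> Y m 0 (cls Y m f) (cls V 0 \<epsilon>) = cls Y m f"
proof -
 have "(onP m (%x. f ((onP m (%x. x)) x))) = (onP m (%x. f x))"
  by (rule restrict_ext) simp
 also have "\<dots> = f" using cocycle_hom[OF f] by (simp add: module_hom_restrict)
 finally show ?thesis using yoneda_Ext_class[OF exact Y f \<epsilon> id_lift] by simp
qed

end

context bimodule_resolution
begin

lemma eps_cocycle: "\<epsilon> \<in> cocycles Ae P d (regular_bimodule A) 0"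
proof -
 have "\<epsilon> \<in> module_hom Ae (P 0) (regular_bimodule A)"
  using resolution by (simp add: projective_resolution_def)
 then show ?thesis using PC.aug_cocycle[OF exact] by (simp add: module_hom_restrict)
qed

end

context bimodule_algebra_resolution
begin

abbreviation "etf m f \<equiv> \<lambda>x\<in>carrier (P m). \<eta> (f x)"

lemma etf_cocycle: "f \<in> CA m ==> etf m f \<in> CR m"
 by (rule PC.map_cocycle[OF regular_left_module R_module eta_lin])

lemma cup_unit_map_right:
 assumes g: "g \<in> CR m" and f: "f \<in> CA n"
 shows "cupR m n (ER m g) (ER n (etf n f)) = yoneda Ae P d \<epsilon> R m n (ER m g) (EA n f)"
proof -
 obtain h where h: "h \<in> chain_lifts Ae P d P d \<epsilon> n f"
  using PC.lift_exists_cocycle[OF exact f] by auto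
 note hD = chain_liftsD[OF h]
 have e1: "\<eta> uA \<in> carrier R" by (simp add: eta_closed)
 have il: "(%p. bt (P i) R p (\<eta> uA)) \<in> lin Ae (P i) (bten (P i) R)" for i
  by (rule env_linI[OF PM BM[OF R_module]])
   (simp_all add: bt_closed PM R_module e1 btensor_simps(3) btensor_pure_add_left btensor_lact btensor_ract
    btensor_pure_middle eta_lact eta_ract)
 have fc: "f x \<in> carrier A" if "x \<in> carrier (P n)" for x
  using lin_closed[OF PC.cocycle_lin[OF f] that] by (simp add: regular_simps)
 have hc: "h i x \<in> carrier (P i)" if "x \<in> carrier (P (n + i))" for i x by (rule module_hom_closed[OF hD(1) that])
 have L: "(%i. \<lambda>x\<in>carrier (P (n + i)). bt (P i) R (h i x) (\<eta> uA)) \<in> lifts n (etf n f)"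
  unfolding chain_lifts_def
 proof (intro CollectI conjI allI ballI)
  show "(onP (n + i) (%x. bt (P i) R (h i x) (\<eta> uA))) \<in> module_hom Ae (P (n + i)) (bten (P i) R)" for i
   by (rule lin_restrict[OF PM lin_comp[OF module_hom_lin[OF hD(1)] il]])
  show "eL R ((onP (n + 0) (%x. bt (P 0) R (h 0 x) (\<eta> uA))) x) = etf n f x" if "x \<in> carrier (P n)" for x
   using that hc[of x 0] hD(2)[OF that] by (simp add: eL_pure[OF R_module] e1 fc eta_lact)
  fix i x assume x: "x \<in> carrier (P (Suc (n + i)))"
  show "dL R i ((onP (n + Suc i) (%x. bt (P (Suc i)) R (h (Suc i) x) (\<eta> uA))) x) =
    (onP (n + i) (%x. bt (P i) R (h i x) (\<eta> uA))) (d (n + i) x)"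
   using x hc[of x "Suc i"] hD(3)[OF x] d_closed[OF x] by (simp add: dL_pure[OF R_module] e1)
 qed
 have gl: "g \<in> lin Ae (P m) R" by (rule PC.cocycle_lin[OF g])
 have "(onP (m + n) (%x. rext g ((onP (n + m) (%x. bt (P m) R (h m x) (\<eta> uA))) x))) =
   (onP (m + n) (%x. g (h m x)))"
  by (rule restrict_ext)
   (use hc[of _ m] in \<open>simp add: add.commute rext_pure[OF PM gl] e1 mul_eta lin_closed[OF gl] ract_one[OF R_module]\<close>)
 then show ?thesis
  by (simp only: cup_Ext_class[OF g etf_cocycle[OF f] L] PC.yoneda_Ext_class[OF exact R_module g f h])
qed

lemma cup_unit_map_left:
 assumes f: "f \<in> CA m" and g: "g \<in> CR n"
 shows "cupR m n (ER m (etf m f)) (ER n g) =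
  (if even (m * n) then cupR n m (ER n g) (ER m (etf m f))
  else inv\<^bsub>Ext_group Ae P d R (m + n)\<^esub> cupR n m (ER n g) (ER m (etf m f)))"
proof -
 interpret R: left_module Ae R by (rule R_module)
 obtain D where D: "D \<in> diagonal_maps K A P d \<epsilon>" using diagonal_exists by auto
 note fl = PC.cocycle_lin[OF f] and gl = PC.cocycle_lin[OF g] and efl = PC.cocycle_lin[OF etf_cocycle[OF f]]
 define aL where "aL = (%j. tensor_lift (add_monoid (P j)) (%p q. la (P j) (f p) q))"
 have L1: "aL j \<in> lin Ae (BT m j) (P j)" for j unfolding aL_def by (rule scalar_map(1)[OF PM PM fl])
 have L2: "aL j (bt (P m) (P j) x y) = la (P j) (f x) y" if "x \<in> carrier (P m)" "y \<in> carrier (P j)" for j x y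
  unfolding aL_def by (rule scalar_map(2)[OF PM PM fl that])
 have fc: "f x \<in> carrier A" if "x \<in> carrier (P m)" for x
  using lin_closed[OF fl that] by (simp add: regular_simps)
 let ?c = "%x. g (aL n (D m n x))"
 have cl: "?c \<in> lin Ae (P (m + n)) R"
  by (rule lin_comp[OF lin_comp[OF module_hom_lin[OF diagonalD(1)[OF D]] L1] gl])
 note FG = btensor_map[OF PM R_module PM R_module efl gl]
 have v: "\<mu> (tensor_map (bgrp R R) (etf m f) g t) = g (aL n t)" if "t \<in> carrier (BT m n)" for t
  by (rule btensor_lin_unique[OF PM PM R_module lin_comp[OF FG(1) mu_lin] lin_comp[OF L1 gl] _ that])
   (simp add: FG(2) L2 mul_def[symmetric] eta_mul fc lin_closed[OF gl] env_lin_lact[OF gl])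
 have lhs: "(onP (m + n) (%x. \<mu> (tensor_map (bgrp R R) (etf m f) g (D m n x)))) =
   (onP (m + n) (%x. ?c x))"
  by (rule restrict_ext) (rule v[OF diagonal_closed[OF D]])
 have cc: "(onP (m + n) (%x. ?c x)) \<in> CR (m + n)"
 proof -
  obtain h where h: "h \<in> lifts n g" using PC.lift_exists_cocycle[OF left_res[OF R_module] g] by auto
  show ?thesis using cup_representative(1)[OF D etf_cocycle[OF f] g h] unfolding lhs .
 qed
 let ?f = "\<lambda>x\<in>carrier (P m). f (eR (P m) (D m 0 x))"
 have \<sigma>: "(onP m (%x. f ((onP m (%x. eR (P m) (D m 0 x))) x))) = ?f"
  by (rule restrict_ext) simp
 note F = PC.Ext_class_comp_chain_map[OF exact right_chain_map[OF D] regular_left_module f, unfolded \<sigma>]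
 have G': "(%j. \<lambda>x\<in>carrier (P (m + j)). sg (P j) (m * j) (aL j (D m j x))) \<in> chain_lifts Ae P d P d \<epsilon> m ?f"
  unfolding aL_def by (rule contraction_lift[OF D f])
 have ac: "aL n (D m n x) \<in> carrier (P n)" if "x \<in> carrier (P (m + n))" for x
  by (rule lin_closed[OF L1 diagonal_closed[OF D that]])
 have "cupR n m (ER n g) (ER m (etf m f)) = yoneda Ae P d \<epsilon> R n m (ER n g) (EA m ?f)"
  by (simp only: cup_unit_map_right[OF g f] F(2))
 also have "\<dots> = ER (n + m) (onP (n + m) (%x. g ((onP (m + n) (%x. sg (P n) (m * n) (aL n (D m n x)))) x)))"
  by (rule PC.yoneda_Ext_class[OF exact R_module g F(1) G'])
 also have "\<dots> = ER (m + n) (onP (m + n) (%x. sg R (m * n) (?c x)))"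
 proof -
  have "(onP (n + m) (%x. g ((onP (m + n) (%x. sg (P n) (m * n) (aL n (D m n x)))) x))) =
    (onP (m + n) (%x. sg R (m * n) (?c x)))"
   unfolding add.commute[of n m] by (rule restrict_ext) (simp add: lin_sg[OF PM R_module gl] ac)
  then show ?thesis by (simp add: add.commute)
 qed
 finally have r: "cupR n m (ER n g) (ER m (etf m f)) =
   ER (m + n) (onP (m + n) (%x. sg R (m * n) (?c x)))" .
 have l: "cupR m n (ER m (etf m f)) (ER n g) = ER (m + n) (onP (m + n) (%x. ?c x))"
  by (simp only: cup_diagonal[OF D etf_cocycle[OF f] g] lhs)
 show ?thesis
 proof (cases "even (m * n)")
  case True then show ?thesis unfolding l r by (simp add: sg_def)
 next
  case False
  have n: "(onP (m + n) (%x. \<ominus>\<^bsub>R\<^esub> ?c x)) \<in> CR (m + n)"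
   by (rule PC.cocycleI[OF lin_neg[OF PM R_module cl]]) (use PC.cocycle_d[OF cc] d_closed in simp)
  have "(onP (m + n) (%x. \<ominus>\<^bsub>R\<^esub> (onP (m + n) (%x. \<ominus>\<^bsub>R\<^esub> ?c x)) x)) = (onP (m + n) (%x. ?c x))"
   by (rule restrict_ext) (simp add: lin_closed[OF cl] R.M.minus_minus)
  then show ?thesis unfolding l r using False by (simp only: sg_def if_False PC.Ext_class_inv[OF R_module n])
 qed
qed

lemma cup_add_left:
 assumes f: "f \<in> CR m" and f': "f' \<in> CR m" and g: "g \<in> CR n"
 shows "cupR m n (ER m f \<otimes>\<^bsub>Ext_group Ae P d R m\<^esub> ER m f') (ER n g) =
  cupR m n (ER m f) (ER n g) \<otimes>\<^bsub>Ext_group Ae P d R (m + n)\<^esub> cupR m n (ER m f') (ER n g)"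
proof -
 let ?s = "\<lambda>x\<in>carrier (P m). f x \<oplus>\<^bsub>R\<^esub> f' x"
 have s: "?s \<in> CR m"
  using subgroup.m_closed[OF PC.cocycles_subgroup[OF R_module] f f'] by (simp add: PC.cochain_simps)
 obtain h where h: "h \<in> lifts n g" using PC.lift_exists_cocycle[OF left_res[OF R_module] g] by auto
 have hc: "h m x \<in> carrier (bten (P m) R)" if "x \<in> carrier (P (m + n))" for x
  using module_hom_closed[OF chain_liftsD(1)[OF h]] that by (simp add: add.commute)
 have "(onP (m + n) (%x. rext ?s (h m x))) = (\<lambda>x\<in>carrier (P (m + n)).
   (onP (m + n) (%x. rext f (h m x))) x \<oplus>\<^bsub>R\<^esub> (onP (m + n) (%x. rext f' (h m x))) x)"
  by (rule restrict_ext) (simp add: rext_add[OF PM PC.cocycle_lin[OF f] PC.cocycle_lin[OF f'] _ hc])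
 then show ?thesis
  by (simp only: PC.Ext_class_mult[OF R_module f f'] cup_Ext_class[OF s g h] cup_Ext_class[OF f g h] cup_Ext_class[OF f' g h]
    PC.Ext_class_mult[OF R_module rext_lift_cocycle[OF f h] rext_lift_cocycle[OF f' h]])
qed

lemma cup_add_right:
 assumes f: "f \<in> CR m" and g: "g \<in> CR n" and g': "g' \<in> CR n"
 shows "cupR m n (ER m f) (ER n g \<otimes>\<^bsub>Ext_group Ae P d R n\<^esub> ER n g') =
  cupR m n (ER m f) (ER n g) \<otimes>\<^bsub>Ext_group Ae P d R (m + n)\<^esub> cupR m n (ER m f) (ER n g')"
proof -
 let ?s = "\<lambda>x\<in>carrier (P n). g x \<oplus>\<^bsub>R\<^esub> g' x"
 have s: "?s \<in> CR n"
  using subgroup.m_closed[OF PC.cocycles_subgroup[OF R_module] g g'] by (simp add: PC.cochain_simps)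
 obtain D where D: "D \<in> diagonal_maps K A P d \<epsilon>" using diagonal_exists by auto
 obtain h h' where h: "h \<in> lifts n g" "h' \<in> lifts n g'"
  using PC.lift_exists_cocycle[OF left_res[OF R_module] g] PC.lift_exists_cocycle[OF left_res[OF R_module] g'] by auto
 note fl = PC.cocycle_lin[OF f] and gl = PC.cocycle_lin[OF g] and gl' = PC.cocycle_lin[OF g'] and sl = PC.cocycle_lin[OF s]
 note FG = btensor_map[OF PM R_module PM R_module fl gl] and FG' = btensor_map[OF PM R_module PM R_module fl gl']
  and FS = btensor_map[OF PM R_module PM R_module fl sl]
 have v: "\<mu> (tensor_map (bgrp R R) f ?s t) =
   \<mu> (tensor_map (bgrp R R) f g t) \<oplus>\<^bsub>R\<^esub> \<mu> (tensor_map (bgrp R R) f g' t)"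
  if "t \<in> carrier (BT m n)" for t
  by (rule btensor_lin_unique[OF PM PM R_module lin_comp[OF FS(1) mu_lin]
     lin_plus[OF BM[OF PM] R_module lin_comp[OF FG(1) mu_lin] lin_comp[OF FG'(1) mu_lin]] _ that])
   (simp add: FG(2) FG'(2) FS(2) mul_def[symmetric] mul_add_right lin_closed[OF fl] lin_closed[OF gl] lin_closed[OF gl'])
 have "(onP (m + n) (%x. \<mu> (tensor_map (bgrp R R) f ?s (D m n x)))) = (\<lambda>x\<in>carrier (P (m + n)).
   (onP (m + n) (%x. \<mu> (tensor_map (bgrp R R) f g (D m n x)))) x \<oplus>\<^bsub>R\<^esub>
   (onP (m + n) (%x. \<mu> (tensor_map (bgrp R R) f g' (D m n x)))) x)"
  by (rule restrict_ext) (simp add: v diagonal_closed[OF D])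
 then show ?thesis
  by (simp only: PC.Ext_class_mult[OF R_module g g'] cup_diagonal[OF D f s] cup_diagonal[OF D f g] cup_diagonal[OF D f g']
    PC.Ext_class_mult[OF R_module cup_representative(1)[OF D f g h(1)] cup_representative(1)[OF D f g' h(2)]])
qed

lemma cup_class_closed:
 assumes f: "f \<in> CR m" and g: "g \<in> CR n"
 shows "cupR m n (ER m f) (ER n g) \<in> carrier (Ext_group Ae P d R (m + n))"
proof -
 obtain h where h: "h \<in> lifts n g" using PC.lift_exists_cocycle[OF left_res[OF R_module] g] by auto
 show ?thesis unfolding cup_Ext_class[OF f g h] by (rule PC.Ext_class_closed[OF rext_lift_cocycle[OF f h]])
qed

lemma cup_one_right:
 assumes g: "g \<in> CR m"
 shows "cupR m 0 (ER m g) (ER 0 (etf 0 \<epsilon>)) = ER m g"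
 unfolding cup_unit_map_right[OF g eps_cocycle] by (rule PC.yoneda_unit[OF exact R_module g eps_cocycle])

lemma cup_one_left:
 assumes g: "g \<in> CR m"
 shows "cupR 0 m (ER 0 (etf 0 \<epsilon>)) (ER m g) = ER m g"
 using cup_unit_map_left[OF eps_cocycle g] cup_one_right[OF g] by simp

end

section \<open>Graded rings and the noetherian property\<close>

lemma preimage_stable:
 assumes L: "stable_subgroup S' act' G' L"
  and G: "group G" and G': "group G'" and \<Theta>: "\<Theta> \<in> hom G G'"
  and closed: "!!s x. s \<in> S ==> x \<in> carrier G ==> act s x \<in> carrier G"
  and act: "!!s x. s \<in> S ==> x \<in> carrier G ==> \<exists>s'\<in>S'. \<Theta> (act s x) = act' s' (\<Theta> x)"
 shows "stable_subgroup S act G {x \<in> carrier G. \<Theta> x \<in> L}"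
 unfolding stable_subgroup_def
proof (intro conjI ballI)
 interpret \<Theta>: group_hom G G' \<Theta> using G G' \<Theta> by (simp add: group_hom_def group_hom_axioms_def)
 have sg: "subgroup L G'" using L by (simp add: stable_subgroup_def)
 show "subgroup {x \<in> carrier G. \<Theta> x \<in> L} G"
  by (rule \<Theta>.G.subgroupI) (use subgroup.one_closed[OF sg] subgroup.m_closed[OF sg] subgroup.m_inv_closed[OF sg] in auto)
 fix s x assume s: "s \<in> S" and x: "x \<in> {x \<in> carrier G. \<Theta> x \<in> L}"
 then have xG: "x \<in> carrier G" by simp
 obtain s' where s': "s' \<in> S'" "\<Theta> (act s x) = act' s' (\<Theta> x)" using act[OF s xG] by (rule bexE)
 have "act' s' (\<Theta> x) \<in> L" using L s'(1) x unfolding stable_subgroup_def by simp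
 then show "act s x \<in> {x \<in> carrier G. \<Theta> x \<in> L}" using closed[OF s xG] s'(2) by simp
qed

context
 fixes S :: "'s set" and act :: "'s \<Rightarrow> 'g \<Rightarrow> 'g" and G :: "('g, 'z) monoid_scheme"
  and S' :: "'t set" and act' :: "'t \<Rightarrow> 'h \<Rightarrow> 'h" and G' :: "('h, 'y) monoid_scheme" and \<Theta>
 assumes G: "group G" and G': "group G'"
  and \<Theta>: "\<Theta> \<in> hom G G'" and surj: "carrier G' \<subseteq> \<Theta> ` carrier G"
  and closed: "!!s x. s \<in> S ==> x \<in> carrier G ==> act s x \<in> carrier G"
  and act: "!!s x. s \<in> S ==> x \<in> carrier G ==> \<exists>s'\<in>S'. \<Theta> (act s x) = act' s' (\<Theta> x)"
begin

lemma preimage_stable_closed: "stable_subgroup S' act' G' L ==> stable_subgroup S act G {x \<in> carrier G. \<Theta> x \<in> L}"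
 by (erule preimage_stable[OF _ G G' \<Theta>]) (rule closed act, assumption, assumption)+

lemma fin_generated_transfer:
 assumes fg: "fin_generated S act G {x \<in> carrier G. \<Theta> x \<in> N}" and N: "N \<subseteq> carrier G'"
 shows "fin_generated S' act' G' N"
proof -
 obtain F where "finite F \<and> F \<subseteq> {x \<in> carrier G. \<Theta> x \<in> N} \<and>
   (\<forall>L. stable_subgroup S act G L \<and> F \<subseteq> L \<longrightarrow> {x \<in> carrier G. \<Theta> x \<in> N} \<subseteq> L)"
  using fg unfolding fin_generated_def by (rule exE)
 then have F: "finite F" "F \<subseteq> {x \<in> carrier G. \<Theta> x \<in> N}"
  "!!L. stable_subgroup S act G L ==> F \<subseteq> L ==> {x \<in> carrier G. \<Theta> x \<in> N} \<subseteq> L"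
  by simp_all
 show ?thesis unfolding fin_generated_def
 proof (intro exI[of _ "\<Theta> ` F"] conjI allI impI subsetI)
  show "finite (\<Theta> ` F)" using F(1) by simp
  show "y \<in> N" if "y \<in> \<Theta> ` F" for y using that F(2) by auto
  fix L y assume L: "stable_subgroup S' act' G' L \<and> \<Theta> ` F \<subseteq> L" and y: "y \<in> N"
  have FL: "F \<subseteq> {x \<in> carrier G. \<Theta> x \<in> L}" using L F(2) by auto
  obtain x where x: "x \<in> carrier G" "y = \<Theta> x" using y N surj by auto
  have "{x \<in> carrier G. \<Theta> x \<in> N} \<subseteq> {x \<in> carrier G. \<Theta> x \<in> L}"
   by (rule F(3)[OF preimage_stable_closed[OF conjunct1[OF L]] FL])
  then show "y \<in> L" using x y by blast
 qed
qed

lemma noetherian_transfer: "noetherian_action S act G ==> noetherian_action S' act' G'"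
 unfolding noetherian_action_def
proof (intro allI impI)
 fix N assume noeth: "\<forall>N. stable_subgroup S act G N \<longrightarrow> fin_generated S act G N" and N: "stable_subgroup S' act' G' N"
 show "fin_generated S' act' G' N"
 proof (rule fin_generated_transfer)
  show "fin_generated S act G {x \<in> carrier G. \<Theta> x \<in> N}"
   by (rule mp[OF spec[OF noeth] preimage_stable_closed[OF N]])
  show "N \<subseteq> carrier G'" using N by (simp add: stable_subgroup_def subgroup.subset)
 qed
qed

end

lemma hom_finprod:
 assumes "comm_group G" "comm_group H" "h \<in> hom G H" "f \<in> I \<rightarrow> carrier G"
 shows "h (finprod G f I) = finprod H (%i. h (f i)) I"
proof -
 interpret G: comm_group G by fact
 interpret H: comm_group H by fact
 interpret h: group_hom G H h by unfold_locales fact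
 show ?thesis using assms(4)
 proof (induction I rule: infinite_finite_induct)
  case (insert i I)
  then have "f \<in> I \<rightarrow> carrier G" "(%i. h (f i)) \<in> I \<rightarrow> carrier H" "f i \<in> carrier G"
   by (auto intro!: h.hom_closed)
  then show ?case using insert by simp
 qed simp_all
qed

lemma subgroup_finsum_closed:
 assumes "abelian_group E" and L: "subgroup L (add_monoid E)" and g: "g \<in> I \<rightarrow> L"
 shows "finsum E g I \<in> L"
proof -
 interpret abelian_group E by fact
 have c: "x \<in> carrier E" if "x \<in> L" for x using subgroup.mem_carrier[OF L that] by simp
 show ?thesis using g
 proof (induction I rule: infinite_finite_induct)
  case (insert i I)
  then have "finsum E g (insert i I) = g i \<oplus>\<^bsub>E\<^esub> finsum E g I" by (intro finsum_insert) (auto intro: c)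
  then show ?case using insert subgroup.m_closed[OF L, of "g i" "finsum E g I"] by auto
 qed (use subgroup.one_closed[OF L] in simp_all)
qed

lemma (in comm_monoid) finprod_triangle:
 assumes "!!i j. f i j \<in> carrier G"
 shows "(\<Otimes>i\<in>{..n}. \<Otimes>j\<in>{..i}. f i j) = (\<Otimes>j\<in>{..n::nat}. \<Otimes>k\<in>{..n - j}. f (j + k) j)"
proof (induction n)
 case (Suc n)
 have "(\<Otimes>j\<in>{..n}. \<Otimes>k\<in>{..Suc n - j}. f (j + k) j) = (\<Otimes>j\<in>{..n}. f (Suc n) j \<otimes> (\<Otimes>k\<in>{..n - j}. f (j + k) j))"
  by (rule finprod_cong') (auto simp: assms Suc_diff_le)
 also have "\<dots> = (\<Otimes>j\<in>{..n}. f (Suc n) j) \<otimes> (\<Otimes>j\<in>{..n}. \<Otimes>k\<in>{..n - j}. f (j + k) j)"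
  by (rule finprod_multf) (auto simp: assms)
 finally show ?case by (simp add: assms Pi_def Suc.IH m_assoc)
qed (simp add: assms)

lemma sum_group_mem:
 assumes "!!n. group (G n)"
 shows "x \<in> carrier (sum_group UNIV G) \<longleftrightarrow> (\<forall>n. x n \<in> carrier (G n)) \<and> finite {n. x n \<noteq> \<one>\<^bsub>G n\<^esub>}"
 using assms by (auto simp: carrier_sum_group PiE_def)

lemma graded_terms:
 fixes N :: "nat \<Rightarrow> ('c, 'z) monoid_scheme" and H :: "nat \<Rightarrow> ('b, 'y) monoid_scheme"
 assumes closed: "!!m n x z. x \<in> carrier (N m) ==> z \<in> carrier (H n) ==> p m n x z \<in> carrier (N (m + n))"
  and "!!n. x n \<in> carrier (N n)" "!!n. z n \<in> carrier (H n)"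
 shows "(%i. p i (n - i) (x i) (z (n - i))) \<in> {..n} \<rightarrow> carrier (N n)"
proof
 fix i assume "i \<in> {..n}"
 then have e: "i + (n - i) = n" by simp
 show "p i (n - i) (x i) (z (n - i)) \<in> carrier (N n)"
  using closed[OF assms(2)[of i] assms(3)[of "n - i"]] unfolding e .
qed

locale graded_pairing =
 fixes N :: "nat \<Rightarrow> 'c monoid" and H :: "nat \<Rightarrow> 'b monoid" and p
 assumes N: "!!n. comm_group (N n)" and H: "!!n. comm_group (H n)"
  and closed: "!!m n x z. x \<in> carrier (N m) ==> z \<in> carrier (H n) ==> p m n x z \<in> carrier (N (m + n))"
  and zero_left: "!!m n z. z \<in> carrier (H n) ==> p m n \<one>\<^bsub>N m\<^esub> z = \<one>\<^bsub>N (m + n)\<^esub>"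
  and zero_right: "!!m n x. x \<in> carrier (N m) ==> p m n x \<one>\<^bsub>H n\<^esub> = \<one>\<^bsub>N (m + n)\<^esub>"
begin

lemma N_group: "group (N n)" and H_group: "group (H n)"
 using N H by (simp_all add: comm_group_def)

lemma graded_prod_closed:
 assumes "x \<in> carrier (sum_group UNIV N)" "z \<in> carrier (sum_group UNIV H)"
 shows "graded_prod N p x z \<in> carrier (sum_group UNIV N)"
proof -
 have x: "x n \<in> carrier (N n)" "finite {n. x n \<noteq> \<one>\<^bsub>N n\<^esub>}" for n using assms(1) by (simp_all add: sum_group_mem N_group)
 have z: "z n \<in> carrier (H n)" "finite {n. z n \<noteq> \<one>\<^bsub>H n\<^esub>}" for n using assms(2) by (simp_all add: sum_group_mem H_group)
 have c: "graded_prod N p x z n \<in> carrier (N n)" for n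
  unfolding graded_prod_def by (rule comm_monoid.finprod_closed[OF comm_group.axioms(1)[OF N] graded_terms[where N = N and H = H and p = p, OF closed]]) (use x z in auto)
 have "graded_prod N p x z n = \<one>\<^bsub>N n\<^esub>"
  if "n \<notin> (%(i, j). i + j) ` ({n. x n \<noteq> \<one>\<^bsub>N n\<^esub>} \<times> {n. z n \<noteq> \<one>\<^bsub>H n\<^esub>})" for n
  unfolding graded_prod_def
 proof (rule comm_monoid.finprod_one_eqI[OF comm_group.axioms(1)[OF N]])
  fix i assume i: "i \<in> {..n}"
  then have "x i = \<one>\<^bsub>N i\<^esub> \<or> z (n - i) = \<one>\<^bsub>H (n - i)\<^esub>" using that image_eqI[of n "%(i, j). i + j" "(i, n - i)"] i by auto
  then show "p i (n - i) (x i) (z (n - i)) = \<one>\<^bsub>N n\<^esub>"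
   using zero_left[OF z(1)[of "n - i"], of i] zero_right[OF x(1)[of i], of "n - i"] i by auto
 qed
 then have "{n. graded_prod N p x z n \<noteq> \<one>\<^bsub>N n\<^esub>} \<subseteq>
   (%(i, j). i + j) ` ({n. x n \<noteq> \<one>\<^bsub>N n\<^esub>} \<times> {n. z n \<noteq> \<one>\<^bsub>H n\<^esub>})" by auto
 then show ?thesis using c finite_subset[OF _ finite_imageI[OF finite_cartesian_product[OF x(2) z(2)]]]
  by (auto simp: sum_group_mem N_group)
qed

end

lemma graded_prod_map:
 fixes N :: "nat \<Rightarrow> ('c, 'z) monoid_scheme" and H :: "nat \<Rightarrow> ('b, 'x) monoid_scheme" and G :: "nat \<Rightarrow> ('d, 'y) monoid_scheme"
 assumes N: "!!n. comm_group (N n)" and G: "!!n. comm_group (G n)"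
  and \<theta>: "!!n. \<theta> n \<in> hom (N n) (G n)"
  and closed: "!!m n x z. x \<in> carrier (N m) ==> z \<in> carrier (H n) ==> p m n x z \<in> carrier (N (m + n))"
  and mult: "!!m n x z. x \<in> carrier (N m) ==> z \<in> carrier (H n) ==> \<theta> (m + n) (p m n x z) = q m n (\<theta> m x) (\<phi> n z)"
  and x: "!!n. x n \<in> carrier (N n)" and z: "!!n. z n \<in> carrier (H n)"
 shows "(%n. \<theta> n (graded_prod N p x z n)) = graded_prod G q (%n. \<theta> n (x n)) (%n. \<phi> n (z n))"
proof
 fix n
 have terms: "(%i. p i (n - i) (x i) (z (n - i))) \<in> {..n} \<rightarrow> carrier (N n)"
  using graded_terms[where N = N and H = H and p = p and x = x and z = z] closed x z by simp
 have t: "\<theta> n (p i (n - i) (x i) (z (n - i))) = q i (n - i) (\<theta> i (x i)) (\<phi> (n - i) (z (n - i)))" if "i \<in> {..n}" for i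
  using mult[OF x[of i] z[of "n - i"]] that by simp
 have "(%i. q i (n - i) (\<theta> i (x i)) (\<phi> (n - i) (z (n - i)))) \<in> {..n} \<rightarrow> carrier (G n)"
  using terms t \<theta>[of n] by (auto simp: hom_def Pi_def simp flip: t)
 then show "\<theta> n (graded_prod N p x z n) = graded_prod G q (%n. \<theta> n (x n)) (%n. \<phi> n (z n)) n"
  unfolding graded_prod_def hom_finprod[OF N G \<theta> terms]
  by (intro comm_monoid.finprod_cong'[OF comm_group.axioms(1)[OF G]]) (simp_all add: t)
qed

lemma sum_map_hom:
 assumes N: "!!n. group (N n)" and G: "!!n. group (G n)" and \<theta>: "!!n::nat. \<theta> n \<in> hom (N n) (G n)"
 shows "(%x n. \<theta> n (x n)) \<in> hom (sum_group UNIV N) (sum_group UNIV G)"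
proof (rule hom_addI)
 have one: "\<theta> n \<one>\<^bsub>N n\<^esub> = \<one>\<^bsub>G n\<^esub>" for n by (rule hom_one[OF \<theta> N G])
 have c: "\<theta> n a \<in> carrier (G n)" if "a \<in> carrier (N n)" for n a using \<theta> that by (rule hom_in_carrier)
 show "(%n. \<theta> n (x n)) \<in> carrier (sum_group UNIV G)" if "x \<in> carrier (sum_group UNIV N)" for x
 proof -
  have "{n. \<theta> n (x n) \<noteq> \<one>\<^bsub>G n\<^esub>} \<subseteq> {n. x n \<noteq> \<one>\<^bsub>N n\<^esub>}" using one by auto
  then show ?thesis using that c by (auto simp: sum_group_mem N G intro: finite_subset)
 qed
 show "(%n. \<theta> n ((x \<otimes>\<^bsub>sum_group UNIV N\<^esub> y) n)) = (%n. \<theta> n (x n)) \<otimes>\<^bsub>sum_group UNIV G\<^esub> (%n. \<theta> n (y n))"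
  if "x \<in> carrier (sum_group UNIV N)" "y \<in> carrier (sum_group UNIV N)" for x y
  using that by (simp add: sum_group_mem N hom_mult[OF \<theta>] restrict_UNIV)
qed

lemma sum_map_surj:
 assumes N: "!!n. group (N n)" and G: "!!n. group (G n)" and \<theta>: "!!n::nat. \<theta> n \<in> hom (N n) (G n)"
  and surj: "!!n. carrier (G n) \<subseteq> \<theta> n ` carrier (N n)"
 shows "carrier (sum_group UNIV G) \<subseteq> (%x n. \<theta> n (x n)) ` carrier (sum_group UNIV N)"
proof
 fix y assume y: "y \<in> carrier (sum_group UNIV G)"
 have one: "\<theta> n \<one>\<^bsub>N n\<^esub> = \<one>\<^bsub>G n\<^esub>" for n by (rule hom_one[OF \<theta> N G])
 have "\<exists>a. a \<in> carrier (N n) \<and> \<theta> n a = y n \<and> (y n = \<one>\<^bsub>G n\<^esub> \<longrightarrow> a = \<one>\<^bsub>N n\<^esub>)" for n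
 proof (cases "y n = \<one>\<^bsub>G n\<^esub>")
  case True then show ?thesis using one monoid.one_closed[OF group.is_monoid[OF N]] by auto
 next
  case False
  have "y n \<in> \<theta> n ` carrier (N n)" using surj[of n] y by (auto simp: sum_group_mem G)
  then show ?thesis using False by auto
 qed
 then have "\<exists>a. \<forall>n. a n \<in> carrier (N n) \<and> \<theta> n (a n) = y n \<and> (y n = \<one>\<^bsub>G n\<^esub> \<longrightarrow> a n = \<one>\<^bsub>N n\<^esub>)"
  by (intro choice allI)
 then obtain a where "\<forall>n. a n \<in> carrier (N n) \<and> \<theta> n (a n) = y n \<and> (y n = \<one>\<^bsub>G n\<^esub> \<longrightarrow> a n = \<one>\<^bsub>N n\<^esub>)"
  by (rule exE)
 then have a: "!!n. a n \<in> carrier (N n)" "!!n. \<theta> n (a n) = y n" "!!n. y n = \<one>\<^bsub>G n\<^esub> ==> a n = \<one>\<^bsub>N n\<^esub>"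
  by simp_all
 have "finite {n. a n \<noteq> \<one>\<^bsub>N n\<^esub>}"
  by (rule finite_subset[of _ "{n. y n \<noteq> \<one>\<^bsub>G n\<^esub>}"]) (use a(3) y in \<open>auto simp: sum_group_mem G\<close>)
 then have "a \<in> carrier (sum_group UNIV N)" using a(1) by (simp add: sum_group_mem N)
 then show "y \<in> (%x n. \<theta> n (x n)) ` carrier (sum_group UNIV N)" using a(2) by (intro image_eqI[of _ _ a]) auto
qed

locale graded_product =
 fixes G :: "nat \<Rightarrow> 'c monoid" and p and u
 assumes G: "!!n. comm_group (G n)"
  and p_closed: "!!m n x y. x \<in> carrier (G m) ==> y \<in> carrier (G n) ==> p m n x y \<in> carrier (G (m + n))"
  and p_add_left: "!!m n x x' y. x \<in> carrier (G m) ==> x' \<in> carrier (G m) ==> y \<in> carrier (G n) ==>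
   p m n (x \<otimes>\<^bsub>G m\<^esub> x') y = p m n x y \<otimes>\<^bsub>G (m + n)\<^esub> p m n x' y"
  and p_add_right: "!!m n x y y'. x \<in> carrier (G m) ==> y \<in> carrier (G n) ==> y' \<in> carrier (G n) ==>
   p m n x (y \<otimes>\<^bsub>G n\<^esub> y') = p m n x y \<otimes>\<^bsub>G (m + n)\<^esub> p m n x y'"
  and p_assoc: "!!l m n x y z. x \<in> carrier (G l) ==> y \<in> carrier (G m) ==> z \<in> carrier (G n) ==>
   p (l + m) n (p l m x y) z = p l (m + n) x (p m n y z)"
  and u: "u \<in> carrier (G 0)"
  and p_one_left: "!!n x. x \<in> carrier (G n) ==> p 0 n u x = x"
  and p_one_right: "!!n x. x \<in> carrier (G n) ==> p n 0 x u = x"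
begin

sublocale Gn: comm_group "G n" for n by (rule G)

lemma G_group: "group (G n)" and G_monoid: "comm_monoid (G n)" using G by (simp_all add: comm_group_def)

lemma p_hom_left: "y \<in> carrier (G n) ==> (%x. p m n x y) \<in> hom (G m) (G (m + n))"
 by (rule hom_addI) (simp_all add: p_closed p_add_left)

lemma p_hom_right: "x \<in> carrier (G m) ==> p m n x \<in> hom (G n) (G (m + n))"
 by (rule hom_addI) (simp_all add: p_closed p_add_right)

lemma pairing: "graded_pairing G G p"
 by unfold_locales (auto intro: G p_closed hom_one[OF p_hom_left G_group G_group] hom_one[OF p_hom_right G_group G_group])

abbreviation "E \<equiv> graded_ring G p u"

lemma E_simps: "carrier E = carrier (sum_group UNIV G)" "x \<otimes>\<^bsub>E\<^esub> y = graded_prod G p x y"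
  "\<one>\<^bsub>E\<^esub> = (%n. if n = 0 then u else \<one>\<^bsub>G n\<^esub>)" "\<zero>\<^bsub>E\<^esub> = (%n. \<one>\<^bsub>G n\<^esub>)" "x \<oplus>\<^bsub>E\<^esub> y = (%n. x n \<otimes>\<^bsub>G n\<^esub> y n)"
 by (simp_all add: graded_ring_def restrict_UNIV)

lemma E_add_monoid: "add_monoid E = sum_group UNIV G"
 by (simp add: graded_ring_def)

lemma E_mem: "x \<in> carrier E \<longleftrightarrow> (\<forall>n. x n \<in> carrier (G n)) \<and> finite {n. x n \<noteq> \<one>\<^bsub>G n\<^esub>}"
 unfolding E_simps(1) by (rule sum_group_mem[OF G_group])

lemma E_abelian: "abelian_group E"
proof -
 interpret group "sum_group UNIV G" by (rule sum_group) (rule G_group)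
 have "comm_group (sum_group UNIV G)"
  by (rule group_comm_groupI) (simp add: sum_group_mem G_group Gn.m_comm)
 then show ?thesis
  by (intro abelian_group.intro abelian_monoid.intro abelian_group_axioms.intro)
   (simp_all only: E_add_monoid comm_group_def)
qed

lemma prod_component:
 assumes "x \<in> carrier E" "y \<in> carrier E"
 shows "(%i. p i (n - i) (x i) (y (n - i))) \<in> {..n} \<rightarrow> carrier (G n)"
 using graded_terms[where N = G and H = G and p = p, OF p_closed] assms by (simp add: E_mem)

lemma E_closed: "x \<in> carrier E ==> y \<in> carrier E ==> graded_prod G p x y \<in> carrier E"
 using graded_pairing.graded_prod_closed[OF pairing] by (simp add: E_simps(1))

lemma graded_prod_assoc:
 assumes x: "x \<in> carrier E" and y: "y \<in> carrier E" and z: "z \<in> carrier E"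
 shows "graded_prod G p (graded_prod G p x y) z = graded_prod G p x (graded_prod G p y z)"
proof
 fix n
 have c: "x i \<in> carrier (G i)" "y i \<in> carrier (G i)" "z i \<in> carrier (G i)" for i using x y z by (simp_all add: E_mem)
 define f where "f = (%i j. if j \<le> i \<and> i \<le> n then p i (n - i) (p j (i - j) (x j) (y (i - j))) (z (n - i)) else \<one>\<^bsub>G n\<^esub>)"
 have fc: "f i j \<in> carrier (G n)" for i j
  using p_closed[OF p_closed[OF c(1)[of j] c(2)[of "i - j"]] c(3)[of "n - i"]] by (auto simp: f_def)
 have "graded_prod G p (graded_prod G p x y) z n = (\<Otimes>\<^bsub>G n\<^esub>i\<in>{..n}. \<Otimes>\<^bsub>G n\<^esub>j\<in>{..i}. f i j)"
 proof (unfold graded_prod_def[of _ _ _ z], rule Gn.finprod_cong')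
  show "(%i. \<Otimes>\<^bsub>G n\<^esub>j\<in>{..i}. f i j) \<in> {..n} \<rightarrow> carrier (G n)" by (auto simp: fc)
  fix i assume i: "i \<in> {..n}"
  then have e: "G (i + (n - i)) = G n" by simp
  show "p i (n - i) (graded_prod G p x y i) (z (n - i)) = (\<Otimes>\<^bsub>G n\<^esub>j\<in>{..i}. f i j)"
   unfolding graded_prod_def hom_finprod[OF G G p_hom_left[where m = i, OF c(3)[of "n - i"]] prod_component[OF x y], unfolded e]
  proof (rule Gn.finprod_cong'[OF refl])
   show "f i \<in> {..i} \<rightarrow> carrier (G n)" by (simp add: fc)
  qed (use i in \<open>simp add: f_def\<close>)
 qed simp
 also have "\<dots> = (\<Otimes>\<^bsub>G n\<^esub>j\<in>{..n}. \<Otimes>\<^bsub>G n\<^esub>k\<in>{..n - j}. f (j + k) j)" by (rule Gn.finprod_triangle[OF fc])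
 also have "\<dots> = graded_prod G p x (graded_prod G p y z) n"
 proof (unfold graded_prod_def[of _ _ x], rule Gn.finprod_cong')
  fix j assume j: "j \<in> {..n}"
  then have e: "G (j + (n - j)) = G n" by simp
  have "(\<Otimes>\<^bsub>G n\<^esub>k\<in>{..n - j}. f (j + k) j) =
    (\<Otimes>\<^bsub>G n\<^esub>k\<in>{..n - j}. p j (n - j) (x j) (p k (n - j - k) (y k) (z (n - j - k))))"
  proof (rule Gn.finprod_cong')
   fix k assume k: "k \<in> {..n - j}"
   then show "f (j + k) j = p j (n - j) (x j) (p k (n - j - k) (y k) (z (n - j - k)))"
    using p_assoc[OF c(1)[of j] c(2)[of k] c(3)[of "n - j - k"]] j by (auto simp: f_def)
  next
   show "(%k. p j (n - j) (x j) (p k (n - j - k) (y k) (z (n - j - k)))) \<in> {..n - j} \<rightarrow> carrier (G n)"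
    using prod_component[OF y z, of "n - j"] p_closed[OF c(1)[of j], of _ "n - j", unfolded e] by auto
  qed simp
  then show "(\<Otimes>\<^bsub>G n\<^esub>k\<in>{..n - j}. f (j + k) j) = p j (n - j) (x j) (graded_prod G p y z (n - j))"
   unfolding graded_prod_def hom_finprod[OF G G p_hom_right[where n = "n - j", OF c(1)[of j]] prod_component[OF y z], unfolded e] .
 qed (use prod_component[OF x E_closed[OF y z]] in simp_all)
 finally show "graded_prod G p (graded_prod G p x y) z n = graded_prod G p x (graded_prod G p y z) n" .
qed

lemma graded_prod_add_left:
 assumes x: "x \<in> carrier E" and x': "x' \<in> carrier E" and y: "y \<in> carrier E"
 shows "graded_prod G p (x \<oplus>\<^bsub>E\<^esub> x') y = graded_prod G p x y \<oplus>\<^bsub>E\<^esub> graded_prod G p x' y"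
proof
 fix n
 have "p i (n - i) (x i \<otimes>\<^bsub>G i\<^esub> x' i) (y (n - i)) =
   p i (n - i) (x i) (y (n - i)) \<otimes>\<^bsub>G n\<^esub> p i (n - i) (x' i) (y (n - i))" if "i \<in> {..n}" for i
  using p_add_left[of "x i" i "x' i" "y (n - i)" "n - i"] x x' y that by (simp add: E_mem)
 then have "graded_prod G p (x \<oplus>\<^bsub>E\<^esub> x') y n =
   (\<Otimes>\<^bsub>G n\<^esub>i\<in>{..n}. p i (n - i) (x i) (y (n - i)) \<otimes>\<^bsub>G n\<^esub> p i (n - i) (x' i) (y (n - i)))"
  unfolding graded_prod_def E_simps
  using prod_component[OF x y, of n] prod_component[OF x' y, of n] by (intro Gn.finprod_cong'[OF refl]) (auto simp: Pi_def)
 then show "graded_prod G p (x \<oplus>\<^bsub>E\<^esub> x') y n = (graded_prod G p x y \<oplus>\<^bsub>E\<^esub> graded_prod G p x' y) n"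
  by (simp only: graded_prod_def E_simps Gn.finprod_multf[OF prod_component[OF x y] prod_component[OF x' y]])
qed

lemma graded_prod_add_right:
 assumes x: "x \<in> carrier E" and y: "y \<in> carrier E" and y': "y' \<in> carrier E"
 shows "graded_prod G p x (y \<oplus>\<^bsub>E\<^esub> y') = graded_prod G p x y \<oplus>\<^bsub>E\<^esub> graded_prod G p x y'"
proof
 fix n
 have "p i (n - i) (x i) (y (n - i) \<otimes>\<^bsub>G (n - i)\<^esub> y' (n - i)) =
   p i (n - i) (x i) (y (n - i)) \<otimes>\<^bsub>G n\<^esub> p i (n - i) (x i) (y' (n - i))" if "i \<in> {..n}" for i
  using p_add_right[of "x i" i "y (n - i)" "n - i" "y' (n - i)"] x y y' that by (simp add: E_mem)
 then have "graded_prod G p x (y \<oplus>\<^bsub>E\<^esub> y') n =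
   (\<Otimes>\<^bsub>G n\<^esub>i\<in>{..n}. p i (n - i) (x i) (y (n - i)) \<otimes>\<^bsub>G n\<^esub> p i (n - i) (x i) (y' (n - i)))"
  unfolding graded_prod_def E_simps
  using prod_component[OF x y, of n] prod_component[OF x y', of n] by (intro Gn.finprod_cong'[OF refl]) (auto simp: Pi_def)
 then show "graded_prod G p x (y \<oplus>\<^bsub>E\<^esub> y') n = (graded_prod G p x y \<oplus>\<^bsub>E\<^esub> graded_prod G p x y') n"
  by (simp only: graded_prod_def E_simps Gn.finprod_multf[OF prod_component[OF x y] prod_component[OF x y']])
qed

lemma graded_prod_homogeneous:
 assumes z: "z \<in> carrier E" and zm: "!!i. i \<noteq> m ==> z i = \<one>\<^bsub>G i\<^esub>"
  and x: "x \<in> carrier E" and xn: "!!i. i \<noteq> n ==> x i = \<one>\<^bsub>G i\<^esub>"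
 shows "graded_prod G p z x = (%k. if k = m + n then p m n (z m) (x n) else \<one>\<^bsub>G k\<^esub>)"
proof
 fix k
 note zero = graded_pairing.zero_left[OF pairing] graded_pairing.zero_right[OF pairing]
 have t: "p i (k - i) (z i) (x (k - i)) = \<one>\<^bsub>G k\<^esub>" if "i \<in> {..k}" "\<not> (i = m \<and> k = m + n)" for i
 proof -
  have "z i = \<one>\<^bsub>G i\<^esub> \<or> x (k - i) = \<one>\<^bsub>G (k - i)\<^esub>" using zm[of i] xn[of "k - i"] that by fastforce
  then show ?thesis using zero[of "x (k - i)" "k - i" i] zero(2)[of "z i" i "k - i"] z x that by (auto simp: E_mem)
 qed
 show "graded_prod G p z x k = (if k = m + n then p m n (z m) (x n) else \<one>\<^bsub>G k\<^esub>)"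
 proof (cases "k = m + n")
  case True
  have "graded_prod G p z x k = (\<Otimes>\<^bsub>G k\<^esub>i\<in>{m}. p i (k - i) (z i) (x (k - i)))"
   unfolding graded_prod_def by (rule Gn.finprod_mono_neutral_cong_right) (use True t prod_component[OF z x] in auto)
  then show ?thesis using True p_closed[of "z m" m "x n" n] z x by (simp add: E_mem)
 next
  case False
  have "graded_prod G p z x k = \<one>\<^bsub>G k\<^esub>" unfolding graded_prod_def
   by (rule Gn.finprod_one_eqI) (use t False in auto)
  then show ?thesis using False by simp
 qed
qed

abbreviation "single n a \<equiv> %k. if k = n then a else \<one>\<^bsub>G k\<^esub>"

lemma single_closed: "a \<in> carrier (G n) ==> single n a \<in> carrier E"
 unfolding E_mem using Gn.one_closed
 by (auto intro: finite_subset[of _ "{n}"])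

lemma graded_prod_one:
 assumes x: "x \<in> carrier E"
 shows "graded_prod G p \<one>\<^bsub>E\<^esub> x = x" "graded_prod G p x \<one>\<^bsub>E\<^esub> = x"
proof -
 have one: "\<one>\<^bsub>E\<^esub> \<in> carrier E" using single_closed[OF u] by (simp add: E_simps if_distrib cong: if_cong)
 note zero = graded_pairing.zero_left[OF pairing] graded_pairing.zero_right[OF pairing]
 have xc: "x i \<in> carrier (G i)" for i using x by (simp add: E_mem)
 show "graded_prod G p \<one>\<^bsub>E\<^esub> x = x"
 proof
  fix n
  have "graded_prod G p \<one>\<^bsub>E\<^esub> x n = (\<Otimes>\<^bsub>G n\<^esub>i\<in>{0}. p i (n - i) (\<one>\<^bsub>E\<^esub> i) (x (n - i)))"
   unfolding graded_prod_def
   by (rule Gn.finprod_mono_neutral_cong_right)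
    (use zero(1)[OF xc] prod_component[OF one x] in \<open>auto simp: E_simps(3)\<close>)
  then show "graded_prod G p \<one>\<^bsub>E\<^esub> x n = x n" using xc by (simp add: E_simps(3) p_one_left)
 qed
 show "graded_prod G p x \<one>\<^bsub>E\<^esub> = x"
 proof
  fix n
  have "graded_prod G p x \<one>\<^bsub>E\<^esub> n = (\<Otimes>\<^bsub>G n\<^esub>i\<in>{n}. p i (n - i) (x i) (\<one>\<^bsub>E\<^esub> (n - i)))"
   unfolding graded_prod_def
   by (rule Gn.finprod_mono_neutral_cong_right)
    (use zero(2)[OF xc] prod_component[OF x one] in \<open>auto simp: E_simps(3)\<close>)
  then show "graded_prod G p x \<one>\<^bsub>E\<^esub> n = x n" using xc by (simp add: E_simps(3) p_one_right)
 qed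
qed

lemma E_ring: "ring E"
proof (rule ringI)
 show "monoid E"
  by (rule monoidI)
   (use single_closed[OF u] in \<open>simp_all add: E_simps(2) E_closed graded_prod_assoc graded_prod_one, simp add: E_simps if_distrib cong: if_cong\<close>)
qed (simp_all add: E_abelian E_simps(2) graded_prod_add_left graded_prod_add_right)

lemma sum_of_singles:
 assumes L: "subgroup L (add_monoid E)" and x: "x \<in> carrier E" and s: "!!n. single n (x n) \<in> L"
 shows "x \<in> L"
proof -
 have "\<forall>x. x \<in> carrier E \<longrightarrow> (\<forall>n. single n (x n) \<in> L) \<longrightarrow> {n. x n \<noteq> \<one>\<^bsub>G n\<^esub>} \<subseteq> S \<longrightarrow> x \<in> L" if "finite S" for S
  using that
 proof (induction S)
  case empty
  show ?case
  proof (intro allI impI)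
   fix x assume "{n. x n \<noteq> \<one>\<^bsub>G n\<^esub>} \<subseteq> {}"
   then have "x = \<zero>\<^bsub>E\<^esub>" unfolding E_simps by (simp add: fun_eq_iff)
   then show "x \<in> L" using subgroup.one_closed[OF L] by simp
  qed
 next
  case (insert n S)
  show ?case
  proof (intro allI impI)
   fix x assume x: "x \<in> carrier E" and s: "\<forall>n. single n (x n) \<in> L" and S: "{n. x n \<noteq> \<one>\<^bsub>G n\<^esub>} \<subseteq> insert n S"
   let ?y = "x(n := \<one>\<^bsub>G n\<^esub>)"
   have one: "single k \<one>\<^bsub>G k\<^esub> \<in> L" for k
   proof -
    have "single k \<one>\<^bsub>G k\<^esub> = \<zero>\<^bsub>E\<^esub>" by (auto simp: E_simps)
    then show ?thesis using subgroup.one_closed[OF L] by simp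
   qed
   have "?y \<in> carrier E" using x Gn.one_closed
    by (auto simp: E_mem intro: finite_subset[of _ "{n. x n \<noteq> \<one>\<^bsub>G n\<^esub>}"])
   moreover have "\<forall>k. single k (?y k) \<in> L"
   proof
    show "single k (?y k) \<in> L" for k by (cases "k = n") (use s one in \<open>auto cong: if_cong\<close>)
   qed
   moreover have "{n. ?y n \<noteq> \<one>\<^bsub>G n\<^esub>} \<subseteq> S" using S by auto
   ultimately have "?y \<in> L" using insert.IH by blast
   then have "?y \<oplus>\<^bsub>E\<^esub> single n (x n) \<in> L" using subgroup.m_closed[OF L] s by simp
   moreover have "?y \<oplus>\<^bsub>E\<^esub> single n (x n) = x"
    using x[unfolded E_mem] by (simp add: E_simps fun_eq_iff)
   ultimately show "x \<in> L" by simp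
  qed
 qed
 then show ?thesis using x s by (auto simp: E_mem)
qed

lemma graded_center_memI:
 assumes x: "x \<in> carrier E"
  and comm: "!!m n y. y \<in> carrier (G n) ==>
   p m n (x m) y = (if even (m * n) then p n m y (x m) else inv\<^bsub>G (m + n)\<^esub> p n m y (x m))"
 shows "x \<in> graded_center E"
 unfolding graded_center_def
proof (rule sum_of_singles[OF _ x])
 interpret E: ring E by (rule E_ring)
 let ?Z = "{z. \<exists>m. z \<in> homogeneous E m \<and>
   (\<forall>n. \<forall>x\<in>homogeneous E n. z \<otimes>\<^bsub>E\<^esub> x = (if even (m * n) then x \<otimes>\<^bsub>E\<^esub> z else \<ominus>\<^bsub>E\<^esub> (x \<otimes>\<^bsub>E\<^esub> z)))}"
 show "subgroup (generate (add_monoid E) ?Z) (add_monoid E)"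
  by (rule E.add.generate_is_subgroup) (auto simp: homogeneous_def)
 fix m
 have xm: "single m (x m) \<in> carrier E" by (rule single_closed) (use x in \<open>simp add: E_mem\<close>)
 have "single m (x m) \<in> ?Z"
 proof (intro CollectI exI[of _ m] conjI allI ballI)
  show h: "single m (x m) \<in> homogeneous E m" using xm by (simp add: homogeneous_def E_simps(4))
  fix n y assume "y \<in> homogeneous E n"
  then have y: "y \<in> carrier E" "!!i. i \<noteq> n ==> y i = \<one>\<^bsub>G i\<^esub>" by (auto simp: homogeneous_def E_simps(4))
  have yn: "y n \<in> carrier (G n)" using y(1) by (simp add: E_mem)
  have l: "single m (x m) \<otimes>\<^bsub>E\<^esub> y = single (m + n) (p m n (x m) (y n))"
   unfolding E_simps(2) using graded_prod_homogeneous[OF xm _ y, of m] by simp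
  have r: "y \<otimes>\<^bsub>E\<^esub> single m (x m) = single (m + n) (p n m (y n) (x m))"
   unfolding E_simps(2) using graded_prod_homogeneous[where m = n and n = m, OF y(1) y(2) xm] by (simp add: add.commute)
  have c: "p n m (y n) (x m) \<in> carrier (G (m + n))"
   using p_closed[OF yn, of "x m" m] x by (simp add: E_mem add.commute)
  have "\<ominus>\<^bsub>E\<^esub> single (m + n) (p n m (y n) (x m)) = single (m + n) (inv\<^bsub>G (m + n)\<^esub> p n m (y n) (x m))"
  proof (rule E.minus_equality)
   show "single (m + n) (inv\<^bsub>G (m + n)\<^esub> p n m (y n) (x m)) \<oplus>\<^bsub>E\<^esub> single (m + n) (p n m (y n) (x m)) = \<zero>\<^bsub>E\<^esub>"
    using Gn.l_inv[OF c] Gn.l_one[OF Gn.one_closed]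
    by (auto simp: E_simps fun_eq_iff)
  qed (use c in \<open>auto intro!: single_closed Gn.inv_closed\<close>)
  then show "single m (x m) \<otimes>\<^bsub>E\<^esub> y = (if even (m * n) then y \<otimes>\<^bsub>E\<^esub> single m (x m) else \<ominus>\<^bsub>E\<^esub> (y \<otimes>\<^bsub>E\<^esub> single m (x m)))"
   unfolding l r comm[OF yn] by (cases "even (m * n)") (simp_all cong: if_cong)
 qed
 then show "single m (x m) \<in> generate (add_monoid E) ?Z" by (rule generate.incl)
qed

end

text \<open>\<open>twist\<close> is the additive automorphism with \<open>twist (x y) = \<plusminus> twist y twist x\<close>.\<close>

fun sign :: "nat \<Rightarrow> bool" where
 "sign 0 = True"
| "sign (Suc n) = (sign n = even n)"

lemma sign_add: "sign (m + n) = ((sign m = sign n) = even (m * n))"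
 by (induction n) auto

definition twist :: "(nat \<Rightarrow> 'c monoid) \<Rightarrow> (nat \<Rightarrow> 'c) \<Rightarrow> nat \<Rightarrow> 'c" where
 "twist G x n = (if sign n then x n else inv\<^bsub>G n\<^esub> x n)"

lemma twist_component_hom:
 assumes "comm_group G"
 shows "(%x. if b then x else inv\<^bsub>G\<^esub> x) \<in> hom G G"
proof -
 interpret comm_group G by fact
 show ?thesis by (rule hom_addI) (auto simp: inv_mult)
qed

lemma twist_hom:
 assumes "!!n. comm_group (G n)"
 shows "twist G \<in> hom (sum_group UNIV G) (sum_group UNIV G)"
 unfolding twist_def[abs_def]
 by (rule sum_map_hom[where \<theta> = "%n x. if sign n then x else inv\<^bsub>G n\<^esub> x"])
  (use assms twist_component_hom in \<open>auto simp: comm_group_def\<close>)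

lemma twist_surj:
 assumes "!!n. comm_group (G n)"
 shows "carrier (sum_group UNIV G) \<subseteq> twist G ` carrier (sum_group UNIV G)"
 unfolding twist_def[abs_def]
proof (rule sum_map_surj[where \<theta> = "%n x. if sign n then x else inv\<^bsub>G n\<^esub> x"])
 fix n
 interpret comm_group "G n" by (rule assms)
 show "carrier (G n) \<subseteq> (%x. if sign n then x else inv\<^bsub>G n\<^esub> x) ` carrier (G n)"
 proof
  show "x \<in> (%x. if sign n then x else inv\<^bsub>G n\<^esub> x) ` carrier (G n)" if "x \<in> carrier (G n)" for x
   by (rule image_eqI[of _ _ "if sign n then x else inv\<^bsub>G n\<^esub> x"]) (use that in auto)
 qed
qed (use assms twist_component_hom in \<open>auto simp: comm_group_def\<close>)

locale graded_central_map = graded_product G p u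
 for G :: "nat \<Rightarrow> 'c monoid" and p u +
 fixes H :: "nat \<Rightarrow> 'b monoid" and q v \<phi>
 assumes H: "!!n. comm_group (H n)"
  and q_closed: "!!m n x y. x \<in> carrier (H m) ==> y \<in> carrier (H n) ==> q m n x y \<in> carrier (H (m + n))"
  and \<phi>: "!!n. \<phi> n \<in> hom (H n) (G n)"
  and \<phi>_mult: "!!m n x y. x \<in> carrier (H m) ==> y \<in> carrier (H n) ==> \<phi> (m + n) (q m n x y) = p m n (\<phi> m x) (\<phi> n y)"
  and \<phi>_one: "\<phi> 0 v = u"
  and \<phi>_comm: "!!m n z x. z \<in> carrier (H m) ==> x \<in> carrier (G n) ==>
   p m n (\<phi> m z) x = (if even (m * n) then p n m x (\<phi> m z) else inv\<^bsub>G (m + n)\<^esub> p n m x (\<phi> m z))"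
begin

abbreviation "F \<equiv> %x n. \<phi> n (x n)"

lemma H_group: "group (H n)" using H by (simp add: comm_group_def)

lemma \<phi>_closed: "x \<in> carrier (H n) ==> \<phi> n x \<in> carrier (G n)" using \<phi> by (rule hom_in_carrier)

lemma F_closed: "x \<in> carrier (sum_group UNIV H) ==> F x \<in> carrier E"
 unfolding E_simps(1) by (rule hom_in_carrier[OF sum_map_hom[OF H_group G_group \<phi>]])

abbreviation "HH \<equiv> graded_ring H q v"

lemma HH_mem: "z \<in> carrier HH \<longleftrightarrow> (\<forall>n. z n \<in> carrier (H n)) \<and> finite {n. z n \<noteq> \<one>\<^bsub>H n\<^esub>}"
 unfolding graded_ring_def by (simp add: sum_group_mem H_group)

lemma F_ring_hom: "F \<in> ring_hom HH E"
proof (rule ring_hom_memI)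
 fix x y assume x: "x \<in> carrier HH" and y: "y \<in> carrier HH"
 show "F x \<in> carrier E" using x F_closed by (simp add: graded_ring_def)
 have "(%n. \<phi> n (graded_prod H q x y n)) = graded_prod G p (F x) (F y)"
  by (rule graded_prod_map[where N = H and H = H and p = q and q = p and G = G and \<theta> = \<phi> and \<phi> = \<phi>, OF H G \<phi> q_closed \<phi>_mult]) (use x y in \<open>auto simp: HH_mem\<close>)
 then show "F (x \<otimes>\<^bsub>HH\<^esub> y) = F x \<otimes>\<^bsub>E\<^esub> F y" by (simp add: graded_ring_def)
 show "F (x \<oplus>\<^bsub>HH\<^esub> y) = F x \<oplus>\<^bsub>E\<^esub> F y"
  using x y by (simp add: graded_ring_def restrict_UNIV sum_group_mem H_group hom_mult[OF \<phi>])
next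
 show "F \<one>\<^bsub>HH\<^esub> = \<one>\<^bsub>E\<^esub>"
  using hom_one[OF \<phi> H_group G_group] by (auto simp: graded_ring_def \<phi>_one)
qed

lemma F_central: "z \<in> carrier HH ==> F z \<in> graded_center E"
 by (rule graded_center_memI) (use ring_hom_closed[OF F_ring_hom] \<phi>_comm in \<open>auto simp: HH_mem\<close>)

lemma p_inv_left: "x \<in> carrier (G m) ==> y \<in> carrier (G n) ==> p m n (inv\<^bsub>G m\<^esub> x) y = inv\<^bsub>G (m + n)\<^esub> p m n x y"
 using group_hom.hom_inv[of "G m" "G (m + n)" "%x. p m n x y"] p_hom_left
 by (simp add: group_hom_def group_hom_axioms_def G_group)

lemma p_inv_right: "x \<in> carrier (G m) ==> y \<in> carrier (G n) ==> p m n x (inv\<^bsub>G n\<^esub> y) = inv\<^bsub>G (m + n)\<^esub> p m n x y"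
 using group_hom.hom_inv[of "G n" "G (m + n)" "p m n x"] p_hom_right
 by (simp add: group_hom_def group_hom_axioms_def G_group)

lemma \<phi>_inv: "x \<in> carrier (H n) ==> \<phi> n (inv\<^bsub>H n\<^esub> x) = inv\<^bsub>G n\<^esub> \<phi> n x"
 using group_hom.hom_inv[of "H n" "G n" "\<phi> n"] \<phi> by (simp add: group_hom_def group_hom_axioms_def G_group H_group)

lemma twist_prod:
 assumes x: "x \<in> carrier E" and z: "z \<in> carrier HH"
 shows "twist G (graded_prod G p x (F z)) = graded_prod G p (F (twist H z)) (twist G x)"
proof
 fix n
 have zc: "z i \<in> carrier (H i)" and xc: "x i \<in> carrier (G i)" for i using z x by (simp_all add: HH_mem E_mem)
 have z': "twist H z \<in> carrier HH"
  using hom_in_carrier[OF twist_hom[where G = H, OF H]] z by (simp add: graded_ring_def)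
 have x': "twist G x \<in> carrier E"
  using hom_in_carrier[OF twist_hom[where G = G, OF G]] x by (simp add: E_simps)
 have F: "F z \<in> carrier E" "F (twist H z) \<in> carrier E" using ring_hom_closed[OF F_ring_hom] z z' by blast+
 let ?t = "%i. p i (n - i) (F (twist H z) i) (twist G x (n - i))"
 have key: "(if sign n then p i (n - i) (x i) (F z (n - i)) else inv\<^bsub>G n\<^esub> p i (n - i) (x i) (F z (n - i))) = ?t (n - i)"
  if i: "i \<in> {..n}" for i
 proof -
  let ?m = "n - i" let ?w = "F z ?m"
  have e: "G (?m + i) = G n" "n - ?m = i" "G (i + ?m) = G n" using i by simp_all
  have wc: "?w \<in> carrier (G ?m)" using zc by (rule \<phi>_closed)
  have c: "p i ?m (x i) ?w \<in> carrier (G n)" using p_closed[OF xc wc, of i] e by simp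
  have s: "sign n = ((sign i = sign ?m) = even (i * ?m))" using sign_add[of i ?m] i by simp
  have sw: "p ?m i ?w (x i) = (if even (i * ?m) then p i ?m (x i) ?w else inv\<^bsub>G n\<^esub> p i ?m (x i) ?w)"
   using \<phi>_comm[OF zc[of ?m] xc[of i]] by (simp only: e mult.commute)
  have "?t ?m = p ?m i (if sign ?m then ?w else inv\<^bsub>G ?m\<^esub> ?w) (if sign i then x i else inv\<^bsub>G i\<^esub> x i)"
   by (simp only: e twist_def \<phi>_inv[OF zc] if_distrib[of "\<phi> (n - i)"])
  also have "\<dots> = (if sign ?m = sign i then p ?m i ?w (x i) else inv\<^bsub>G n\<^esub> p ?m i ?w (x i))"
   using p_inv_left[OF wc xc[of i]] p_inv_right[OF wc xc[of i]] p_inv_left[OF wc Gn.inv_closed[OF xc[of i]]] p_closed[OF wc xc[of i]]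
   by (simp add: e)
  finally show ?thesis unfolding sw s using c by auto
 qed
 have "twist G (graded_prod G p x (F z)) n =
   (\<Otimes>\<^bsub>G n\<^esub>i\<in>{..n}. if sign n then p i (n - i) (x i) (F z (n - i)) else inv\<^bsub>G n\<^esub> p i (n - i) (x i) (F z (n - i)))"
  unfolding twist_def graded_prod_def
  by (rule hom_finprod[OF G G twist_component_hom[OF G] prod_component[OF x F(1)]])
 also have "\<dots> = (\<Otimes>\<^bsub>G n\<^esub>i\<in>{..n}. ?t (n - i))"
  using prod_component[OF F(2) x', of n] by (intro Gn.finprod_cong'[OF refl]) (auto simp: key simp del: diff_diff_cancel)
 also have "\<dots> = (\<Otimes>\<^bsub>G n\<^esub>i\<in>(%i. n - i) ` {..n}. ?t i)"
  by (rule Gn.finprod_reindex[symmetric]) (use prod_component[OF F(2) x', of n] in \<open>auto simp: inj_on_def\<close>)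
 also have "(%i. n - i) ` {..n} = {..n}"
 proof (intro subset_antisym subsetI)
  show "i \<in> (%i. n - i) ` {..n}" if "i \<in> {..n}" for i by (rule image_eqI[of _ _ "n - i"]) (use that in auto)
 qed auto
 finally show "twist G (graded_prod G p x (F z)) n = graded_prod G p (F (twist H z)) (twist G x) n"
  by (simp only: graded_prod_def)
qed

lemma noetherian_over_center:
 assumes N: "graded_pairing N H r"
  and \<theta>: "!!n. \<theta> n \<in> hom (N n) (G n)" and surj: "!!n. carrier (G n) \<subseteq> \<theta> n ` carrier (N n)"
  and mult: "!!m n x z. x \<in> carrier (N m) ==> z \<in> carrier (H n) ==> \<theta> (m + n) (r m n x z) = p m n (\<theta> m x) (\<phi> n z)"
  and noeth: "noetherian_action (carrier HH) (%z x. graded_prod N r x z) (sum_group UNIV N)"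
 shows "lr_noetherian_ring E \<and> finite_over_graded_center E"
proof -
 interpret N: graded_pairing N H r by fact
 let ?\<Theta> = "%x n. \<theta> n (x n)" and ?T = "%x. twist G (%n. \<theta> n (x n))"
 have HHc: "carrier HH = carrier (sum_group UNIV H)" by (simp add: graded_ring_def)
 have ng: "group (sum_group UNIV N)" by (rule sum_group) (rule N.N_group)
 have eg: "group (add_monoid E)" unfolding E_add_monoid by (rule sum_group) (rule G_group)
 have \<Theta>: "?\<Theta> \<in> hom (sum_group UNIV N) (add_monoid E)"
  unfolding E_add_monoid by (rule sum_map_hom[OF N.N_group G_group \<theta>])
 have \<Theta>s: "carrier (add_monoid E) \<subseteq> ?\<Theta> ` carrier (sum_group UNIV N)"
  unfolding E_add_monoid by (rule sum_map_surj[OF N.N_group G_group \<theta> surj])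
 have T: "?T \<in> hom (sum_group UNIV N) (add_monoid E)"
  unfolding E_add_monoid by (rule hom_compose[OF \<Theta>[unfolded E_add_monoid] twist_hom[where G = G, OF G]])
 have Ts: "carrier (add_monoid E) \<subseteq> ?T ` carrier (sum_group UNIV N)"
 proof
  fix y assume "y \<in> carrier (add_monoid E)"
  then obtain x where x: "y = twist G x" "x \<in> carrier (add_monoid E)"
   using twist_surj[where G = G, OF G] unfolding E_add_monoid by auto
  then obtain w where w: "x = ?\<Theta> w" "w \<in> carrier (sum_group UNIV N)" using \<Theta>s by auto
  show "y \<in> ?T ` carrier (sum_group UNIV N)" by (rule image_eqI[OF _ w(2)]) (simp only: x(1) w(1))
 qed
 have cl: "graded_prod N r x z \<in> carrier (sum_group UNIV N)"
  if "z \<in> carrier HH" "x \<in> carrier (sum_group UNIV N)" for z x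
  using N.graded_prod_closed that by (simp add: HHc)
 have m: "?\<Theta> (graded_prod N r x z) = ?\<Theta> x \<otimes>\<^bsub>E\<^esub> F z"
  if "z \<in> carrier HH" "x \<in> carrier (sum_group UNIV N)" for z x
  unfolding E_simps(2)
  by (rule graded_prod_map[where N = N and H = H and p = r and q = p and G = G and \<theta> = \<theta> and \<phi> = \<phi>, OF N.N G \<theta> N.closed mult]) (use that in \<open>auto simp: HH_mem sum_group_mem N.N_group\<close>)
 have Tm: "?T (graded_prod N r x z) = F (twist H z) \<otimes>\<^bsub>E\<^esub> ?T x"
  if "z \<in> carrier HH" "x \<in> carrier (sum_group UNIV N)" for z x
 proof -
  have "?\<Theta> x \<in> carrier E" using hom_in_carrier[OF \<Theta>] that(2) by simp
  from twist_prod[OF this that(1)] show ?thesis using m[OF that] by (simp add: E_simps(2))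
 qed
 have tw: "twist H z \<in> carrier HH" if "z \<in> carrier HH" for z
  using hom_in_carrier[OF twist_hom[where G = H, OF H]] that by (simp add: HHc)
 have Fc: "F z \<in> carrier E" if "z \<in> carrier HH" for z by (rule ring_hom_closed[OF F_ring_hom that])
 have "noetherian_action (carrier E) (%e x. x \<otimes>\<^bsub>E\<^esub> e) (add_monoid E)"
  by (rule noetherian_transfer[OF ng eg \<Theta> \<Theta>s cl _ noeth]) (use m Fc in blast)+
 moreover have l: "noetherian_action S (%e x. e \<otimes>\<^bsub>E\<^esub> x) (add_monoid E)" if "F ` carrier HH \<subseteq> S" for S
 proof (rule noetherian_transfer[OF ng eg T Ts cl _ noeth])
  fix z x assume zx: "z \<in> carrier HH" "x \<in> carrier (sum_group UNIV N)"
  show "\<exists>e\<in>S. ?T (graded_prod N r x z) = e \<otimes>\<^bsub>E\<^esub> ?T x"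
   using tw[OF zx(1)] that by (intro bexI[where x = "F (twist H z)"] Tm[OF zx]) blast
 qed
 moreover have "noetherian_action (carrier E) (%e x. e \<otimes>\<^bsub>E\<^esub> x) (add_monoid E)"
  by (rule l) (use Fc in auto)
 moreover have "finite_over_graded_center E"
 proof -
  interpret E: ring E by (rule E_ring)
  have c: "x \<in> carrier E" if "x \<in> graded_center E" for x
   using that unfolding graded_center_def
   by (rule E.add.generate_in_carrier[rotated]) (auto simp: homogeneous_def)
  have "stable_subgroup (graded_center E) (%z x. z \<otimes>\<^bsub>E\<^esub> x) (add_monoid E) (carrier E)"
   unfolding stable_subgroup_def using E.add.subgroup_self c by simp
  moreover have "noetherian_action (graded_center E) (%z x. z \<otimes>\<^bsub>E\<^esub> x) (add_monoid E)"
   by (rule l) (use F_central in auto)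
  ultimately show ?thesis by (simp add: finite_over_graded_center_def noetherian_action_def)
 qed
 ultimately show ?thesis using E_ring by (simp add: lr_noetherian_ring_def)
qed

end

section \<open>Hochschild cohomology with coefficients in an algebra\<close>

definition image_module :: "('r \<Rightarrow> 'n) \<Rightarrow> ('s, 'r) module \<Rightarrow> ('s, 'n) module" where
 "image_module \<iota> R = (let \<theta> = inv_into (carrier R) \<iota> in
  \<lparr>carrier = \<iota> ` carrier R, monoid.mult = undefined, monoid.one = undefined,
   ring.zero = \<iota> \<zero>\<^bsub>R\<^esub>, ring.add = (%x y. \<iota> (\<theta> x \<oplus>\<^bsub>R\<^esub> \<theta> y)), smult = (%s x. \<iota> (s \<odot>\<^bsub>R\<^esub> \<theta> x))\<rparr>)"

lemma image_module:
 assumes R: "left_module S R" and inj: "inj_on \<iota> (carrier R)"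
 shows "left_module S (image_module \<iota> R)" "inv_into (carrier R) \<iota> \<in> lin S (image_module \<iota> R) R"
  "\<iota> \<in> lin S R (image_module \<iota> R)"
proof -
 interpret R: left_module S R by fact
 have s: "carrier (image_module \<iota> R) = \<iota> ` carrier R" "\<zero>\<^bsub>image_module \<iota> R\<^esub> = \<iota> \<zero>\<^bsub>R\<^esub>"
  "!!x y. x \<in> carrier R ==> y \<in> carrier R ==> \<iota> x \<oplus>\<^bsub>image_module \<iota> R\<^esub> \<iota> y = \<iota> (x \<oplus>\<^bsub>R\<^esub> y)"
  "!!a x. x \<in> carrier R ==> a \<odot>\<^bsub>image_module \<iota> R\<^esub> \<iota> x = \<iota> (a \<odot>\<^bsub>R\<^esub> x)"
  using inj by (simp_all add: image_module_def Let_def)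
 have "abelian_group (image_module \<iota> R)"
 proof (rule abelian_groupI; unfold s(1,2))
  show "\<exists>y\<in>\<iota> ` carrier R. y \<oplus>\<^bsub>image_module \<iota> R\<^esub> x = \<iota> \<zero>\<^bsub>R\<^esub>" if x: "x \<in> \<iota> ` carrier R" for x
  proof -
   obtain r where r: "x = \<iota> r" "r \<in> carrier R" using x by auto
   show ?thesis by (rule bexI[of _ "\<iota> (\<ominus>\<^bsub>R\<^esub> r)"]) (simp_all add: r s R.M.l_neg)
  qed
 qed (auto simp: s(3) R.M.a_ac)
 then show "left_module S (image_module \<iota> R)"
  by (intro left_module.intro left_module_axioms.intro R.ring_axioms)
   (auto simp: s R.smult_closed R.smult_l_distr R.smult_r_distr R.smult_assoc1 R.smult_one)
 show "inv_into (carrier R) \<iota> \<in> lin S (image_module \<iota> R) R"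
  by (rule linI) (auto simp: s R.smult_closed inv_into_f_f[OF inj])
 show "\<iota> \<in> lin S R (image_module \<iota> R)"
  by (rule linI) (auto simp: s)
qed

lemma (in vec) coordinate_embedding:
 assumes "fin_generated (carrier K) (%c x. c \<odot>\<^bsub>V\<^esub> x) (add_monoid V) (carrier V)"
 shows "\<exists>\<iota> :: 'v \<Rightarrow> nat \<Rightarrow> 'k. inj_on \<iota> (carrier V)"
proof -
 obtain F \<kappa> where db: "dual_basis F \<kappa>" using dual_basis_exists[OF assms] by auto
 obtain b :: "nat \<Rightarrow> 'v" and n where b: "F = b ` {i. i < n}"
  using finite_imp_nat_seg_image_inj_on[OF dual_basisD(1)[OF db]] by auto
 have "inj_on (%v i. \<kappa> v (b i)) (carrier V)"
 proof (rule inj_onI)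
  fix v w assume v: "v \<in> carrier V" and w: "w \<in> carrier V" and e: "(%i. \<kappa> v (b i)) = (%i. \<kappa> w (b i))"
  have "\<kappa> v x = \<kappa> w x" if "x \<in> F" for x using that fun_cong[OF e] by (auto simp: b)
  then have "lincomb V (\<kappa> v) F = lincomb V (\<kappa> w) F" unfolding lincomb_def
   by (intro M.finsum_cong') (use dual_basisD(2,3)[OF db] w in \<open>auto intro!: smult_closed\<close>)
  then show "v = w" using dual_basisD(4)[OF db] v w by simp
 qed
 then show ?thesis by auto
qed

lemma fin_generated_cong:
 "carrier G = carrier G' ==> (\<otimes>\<^bsub>G\<^esub>) = (\<otimes>\<^bsub>G'\<^esub>) ==> \<one>\<^bsub>G\<^esub> = \<one>\<^bsub>G'\<^esub> ==>
  fin_generated S act G N \<longleftrightarrow> fin_generated S act G' N"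
 by (simp add: fin_generated_def stable_subgroup_def subgroup_def m_inv_def)

context proj_complex
begin

lemma yoneda_pairing:
 assumes exact: "aug_exact S P d \<epsilon> V" and Y: "left_module S Y"
 shows "graded_pairing (ExtG Y) (ExtG V) (yoneda S P d \<epsilon> Y)"
proof (rule graded_pairing.intro)
 note V = aug_exactD(1)[OF exact]
 show "comm_group (ExtG Y n)" "comm_group (ExtG V n)" for n
  by (rule Ext_comm_group[OF Y], rule Ext_comm_group[OF V])
 show "yoneda S P d \<epsilon> Y m n x z \<in> carrier (ExtG Y (m + n))"
  if "x \<in> carrier (ExtG Y m)" "z \<in> carrier (ExtG V n)" for m n x z
  by (rule yoneda_closed[OF exact Y that])
 have z: "(onP n (%x. \<zero>\<^bsub>Z\<^esub>)) \<in> ZC Z n" if "left_module S Z" for Z :: "('a, 'y) module" and n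
  by (rule coboundary_cocycle[OF that coboundary_zero[OF that]])
 have zV: "(onP n (%x. \<zero>\<^bsub>V\<^esub>)) \<in> ZC V n" for n
  by (rule coboundary_cocycle[OF V coboundary_zero[OF V]])
 show "yoneda S P d \<epsilon> Y m n \<one>\<^bsub>ExtG Y m\<^esub> z = \<one>\<^bsub>ExtG Y (m + n)\<^esub>"
  if z0: "z \<in> carrier (ExtG V n)" for m n z
 proof -
  obtain g where g: "g \<in> ZC V n" "z = cls V n g" using z0 by (auto simp: Ext_carrier)
  obtain h where h: "h \<in> chain_lifts S P d P d \<epsilon> n g" using lift_exists_cocycle[OF exact g(1)] by auto
  have "(onP (m + n) (%x. (onP m (%x. \<zero>\<^bsub>Y\<^esub>)) (h m x))) = (onP (m + n) (%x. \<zero>\<^bsub>Y\<^esub>))"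
   by (rule restrict_ext) (use hom_closed[OF chain_liftsD(1)[OF h, of m]] in \<open>simp add: add.commute\<close>)
  then show ?thesis by (simp only: Ext_one[OF Y] g(2) yoneda_Ext_class[OF exact Y z[OF Y] g(1) h])
 qed
 show "yoneda S P d \<epsilon> Y m n x \<one>\<^bsub>ExtG V n\<^esub> = \<one>\<^bsub>ExtG Y (m + n)\<^esub>"
  if x0: "x \<in> carrier (ExtG Y m)" for m n x
 proof -
  obtain f where f: "f \<in> ZC Y m" "x = cls Y m f" using x0 by (auto simp: Ext_carrier)
  have h: "(%i. \<lambda>x\<in>carrier (P (n + i)). \<zero>\<^bsub>P i\<^esub>) \<in> chain_lifts S P d P d \<epsilon> n (onP n (%x. \<zero>\<^bsub>V\<^esub>))"
   unfolding chain_lifts_def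
   using lin_restrict[OF P_mod lin_null[OF P_mod P_mod]]
   by (auto simp: d_closed lin_zero[OF P_mod P_mod d_lin] lin_zero[OF P_mod V aug_exactD(4)[OF exact]])
  have "(onP (m + n) (%x. f ((onP (n + m) (%x. \<zero>\<^bsub>P m\<^esub>)) x))) = (onP (m + n) (%x. \<zero>\<^bsub>Y\<^esub>))"
   by (rule restrict_ext) (simp add: add.commute lin_zero[OF P_mod Y cocycle_lin[OF f(1)]])
  then show ?thesis by (simp only: Ext_one[OF Y] Ext_one[OF V] f(2) yoneda_Ext_class[OF exact Y f(1) zV h])
 qed
qed

end

context bimodule_algebra_resolution
begin

abbreviation "HHR \<equiv> Ext_group Ae P d R"
abbreviation "HHA \<equiv> Ext_group Ae P d (regular_bimodule A)"

lemma HHR_cases: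
 assumes "x \<in> carrier (HHR n)"
 shows "\<exists>f. f \<in> CR n \<and> x = ER n f"
 using assms by (auto simp: PC.Ext_carrier)

lemma HHA_cases:
 assumes "x \<in> carrier (HHA n)"
 shows "\<exists>f. f \<in> CA n \<and> x = EA n f"
 using assms by (auto simp: PC.Ext_carrier)

lemma Ext_map_eta: "f \<in> CA n ==> PC.Ext_map R \<eta> n (EA n f) = ER n (etf n f)"
 by (rule PC.Ext_map_class[OF regular_left_module R_module eta_lin])

lemma Ext_map_eta_closed: "x \<in> carrier (HHA n) ==> PC.Ext_map R \<eta> n x \<in> carrier (HHR n)"
 by (rule hom_in_carrier[OF PC.Ext_map_hom[OF regular_left_module R_module eta_lin]])

lemma cup_Ext_map_eta:
 assumes "x \<in> carrier (HHR m)" "z \<in> carrier (HHA n)"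
 shows "cupR m n x (PC.Ext_map R \<eta> n z) = yoneda Ae P d \<epsilon> R m n x z"
 using HHR_cases[OF assms(1)] HHA_cases[OF assms(2)] cup_unit_map_right by (auto simp: Ext_map_eta)

lemma cup_graded_product: "graded_product HHR (cupR) (ER 0 (etf 0 \<epsilon>))"
proof (rule graded_product.intro)
 show "comm_group (HHR n)" for n by (rule PC.Ext_comm_group[OF R_module])
 show "ER 0 (etf 0 \<epsilon>) \<in> carrier (HHR 0)" by (rule PC.Ext_class_closed[OF etf_cocycle[OF eps_cocycle]])
 fix l m n x x' y y' z
 {
  assume "x \<in> carrier (HHR m)" "y \<in> carrier (HHR n)"
  then obtain f g where fg: "f \<in> CR m" "x = ER m f" "g \<in> CR n" "y = ER n g" using HHR_cases by metis
  show "cupR m n x y \<in> carrier (HHR (m + n))" unfolding fg by (rule cup_class_closed[OF fg(1,3)])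
  {
   assume "x' \<in> carrier (HHR m)"
   then obtain f' where f': "f' \<in> CR m" "x' = ER m f'" using HHR_cases by metis
   show "cupR m n (x \<otimes>\<^bsub>HHR m\<^esub> x') y =
     cupR m n x y \<otimes>\<^bsub>HHR (m + n)\<^esub> cupR m n x' y"
    unfolding fg f'(2) by (rule cup_add_left[OF fg(1) f'(1) fg(3)])
  next
   assume "y' \<in> carrier (HHR n)"
   then obtain g' where g': "g' \<in> CR n" "y' = ER n g'" using HHR_cases by metis
   show "cupR m n x (y \<otimes>\<^bsub>HHR n\<^esub> y') =
     cupR m n x y \<otimes>\<^bsub>HHR (m + n)\<^esub> cupR m n x y'"
    unfolding fg g'(2) by (rule cup_add_right[OF fg(1,3) g'(1)])
  }
 next
  assume "x \<in> carrier (HHR l)" "y \<in> carrier (HHR m)" "z \<in> carrier (HHR n)"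
  then obtain f g h where "f \<in> CR l" "x = ER l f" "g \<in> CR m" "y = ER m g" "h \<in> CR n" "z = ER n h"
   using HHR_cases by metis
  then show "cupR (l + m) n (cupR l m x y) z =
    cupR l (m + n) x (cupR m n y z)"
   using cup_assoc by simp
 next
  assume "x \<in> carrier (HHR n)"
  then obtain f where f: "f \<in> CR n" "x = ER n f" using HHR_cases by metis
  show "cupR 0 n (ER 0 (etf 0 \<epsilon>)) x = x" "cupR n 0 x (ER 0 (etf 0 \<epsilon>)) = x"
   unfolding f(2) by (rule cup_one_left[OF f(1)], rule cup_one_right[OF f(1)])
 }
qed

lemma unit_graded_central_map:
 "graded_central_map HHR (cupR) (ER 0 (etf 0 \<epsilon>)) HHA
  (yoneda Ae P d \<epsilon> (regular_bimodule A)) (EA 0 \<epsilon>) (PC.Ext_map R \<eta>)"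
proof (intro graded_central_map.intro cup_graded_product graded_central_map_axioms.intro)
 show "comm_group (HHA n)" for n by (rule PC.Ext_comm_group[OF regular_left_module])
 show "PC.Ext_map R \<eta> n \<in> hom (HHA n) (HHR n)" for n by (rule PC.Ext_map_hom[OF regular_left_module R_module eta_lin])
 show "PC.Ext_map R \<eta> 0 (EA 0 \<epsilon>) = ER 0 (etf 0 \<epsilon>)" by (rule Ext_map_eta[OF eps_cocycle])
 fix m n x y assume x: "x \<in> carrier (HHA m)"
 {
  assume y: "y \<in> carrier (HHA n)"
  show "yoneda Ae P d \<epsilon> (regular_bimodule A) m n x y \<in> carrier (HHA (m + n))"
   by (rule PC.yoneda_closed[OF exact regular_left_module x y])
  show "PC.Ext_map R \<eta> (m + n) (yoneda Ae P d \<epsilon> (regular_bimodule A) m n x y) =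
    cupR m n (PC.Ext_map R \<eta> m x) (PC.Ext_map R \<eta> n y)"
   by (simp only: cup_Ext_map_eta[OF Ext_map_eta_closed[OF x] y]
     PC.Ext_map_yoneda[OF exact regular_left_module R_module eta_lin x y])
 next
  assume "y \<in> carrier (HHR n)"
  then obtain g where g: "g \<in> CR n" "y = ER n g" using HHR_cases by metis
  obtain f where f: "f \<in> CA m" "x = EA m f" using HHA_cases x by metis
  show "cupR m n (PC.Ext_map R \<eta> m x) y =
    (if even (m * n) then cupR n m y (PC.Ext_map R \<eta> m x)
    else inv\<^bsub>HHR (m + n)\<^esub> cupR n m y (PC.Ext_map R \<eta> m x))"
   unfolding f(2) g(2) Ext_map_eta[OF f(1)] by (rule cup_unit_map_left[OF f(1) g(1)])
 }
qed

lemma HHR_noetherian: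
 assumes R: "fd_bimodule K A R" and fg: "condition_fg K A P d \<epsilon>"
 shows "noetherian_action (carrier (HH_ring K A P d \<epsilon>)) (%z x. graded_prod HHR (yoneda Ae P d \<epsilon> R) x z) (sum_group UNIV HHR)"
proof -
 interpret R: left_module Ae R by (rule R_module)
 interpret V: vec K "bscal R" by (intro vec.intro bscal_left_module[OF R_module] vec_axioms.intro field)
 have gen: "fin_generated (carrier K) (%c x. la R (sc c) x) (add_monoid R) (carrier R)"
  using R by (simp add: fd_bimodule_def)
 have e: "(\<oplus>\<^bsub>bscal R\<^esub>) = (\<oplus>\<^bsub>R\<^esub>)" "(\<odot>\<^bsub>bscal R\<^esub>) = (%c x. la R (sc c) x)"
  by (simp_all add: bscal_def with_smult_def)
 have gen': "fin_generated (carrier K) (%c x. c \<odot>\<^bsub>bscal R\<^esub> x) (add_monoid (bscal R)) (carrier (bscal R))"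
  by (subst fin_generated_cong[of "add_monoid (bscal R)" "add_monoid R"]) (use gen e in simp_all)
 obtain \<iota> :: "_ \<Rightarrow> nat \<Rightarrow> 'k" where \<iota>: "inj_on \<iota> (carrier R)" using V.coordinate_embedding[OF gen'] by auto
 let ?N = "image_module \<iota> R" and ?\<theta> = "inv_into (carrier R) \<iota>"
 note N = image_module[OF R_module \<iota>]
 interpret N: left_module Ae ?N by (rule N(1))
 have Nc: "carrier ?N = \<iota> ` carrier R" by (simp add: image_module_def Let_def)
 have "fin_generated (carrier Ae) (%s x. s \<odot>\<^bsub>?N\<^esub> x) (add_monoid ?N) (carrier ?N)"
 proof (rule fin_generated_transfer[where \<Theta> = \<iota>, OF R.M.a_group N.M.a_group])
  show "\<iota> \<in> hom (add_monoid R) (add_monoid ?N)" by (rule lin_hom[OF N(3)])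
  have "{x \<in> carrier (add_monoid R). \<iota> x \<in> carrier ?N} = carrier R" by (auto simp: Nc)
  then show "fin_generated (carrier K) (%c x. la R (sc c) x) (add_monoid R) {x \<in> carrier (add_monoid R). \<iota> x \<in> carrier ?N}"
   using gen by simp
  fix c x assume c: "c \<in> carrier K" and x: "x \<in> carrier (add_monoid R)"
  show "la R (sc c) x \<in> carrier (add_monoid R)"
   using x by (simp add: lact_closed[OF R_module] unit_scalar(1)[OF c])
  have p: "pr (sc c) uA \<in> carrier Ae" by (simp add: env_simps pr_closed unit_scalar(1)[OF c])
  show "\<exists>s'\<in>carrier Ae. \<iota> (la R (sc c) x) = s' \<odot>\<^bsub>?N\<^esub> \<iota> x"
   by (rule bexI[OF _ p], unfold lact_def) (use lin_smult[OF N(3) p] x in simp)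
 qed (simp_all add: Nc)
 then have noeth: "noetherian_action (carrier (HH_ring K A P d \<epsilon>))
   (%z x. graded_prod (Ext_group Ae P d ?N) (yoneda Ae P d \<epsilon> ?N) x z) (sum_group UNIV (Ext_group Ae P d ?N))"
  using fg N(1) unfolding condition_fg_def by blast
 interpret GN: graded_pairing "Ext_group Ae P d ?N" HHA "yoneda Ae P d \<epsilon> ?N" by (rule PC.yoneda_pairing[OF exact N(1)])
 note h = PC.Ext_map_hom[OF N(1) R_module N(2)]
 note C = PC.Ext_comm_group[OF R_module]
 note g = comm_group.axioms(2)[OF C]
 have H: "carrier (HH_ring K A P d \<epsilon>) = carrier (sum_group UNIV HHA)" by (simp add: HH_ring_def Ext_ring_def graded_ring_def)
 show ?thesis
 proof (rule noetherian_transfer[OF _ _ sum_map_hom[OF GN.N_group g h] sum_map_surj[OF GN.N_group g h] _ _ noeth])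
  show "group (sum_group UNIV HHR)" by (rule sum_group) (rule g)
  show "group (sum_group UNIV (Ext_group Ae P d ?N))" by (rule sum_group) (rule GN.N_group)
  show "carrier (HHR n) \<subseteq> PC.Ext_map R ?\<theta> n ` carrier (Ext_group Ae P d ?N n)" for n
   by (rule PC.Ext_map_surj[OF N(1) R_module N(2,3)]) (simp add: inv_into_f_f[OF \<iota>])
  fix z x assume z: "z \<in> carrier (HH_ring K A P d \<epsilon>)" and x: "x \<in> carrier (sum_group UNIV (Ext_group Ae P d ?N))"
  show "graded_prod (Ext_group Ae P d ?N) (yoneda Ae P d \<epsilon> ?N) x z \<in> carrier (sum_group UNIV (Ext_group Ae P d ?N))"
   using GN.graded_prod_closed[OF x] z H by simp
  have "(%n. PC.Ext_map R ?\<theta> n (graded_prod (Ext_group Ae P d ?N) (yoneda Ae P d \<epsilon> ?N) x z n)) =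
    graded_prod HHR (yoneda Ae P d \<epsilon> R) (%n. PC.Ext_map R ?\<theta> n (x n)) (%n. z n)"
   by (rule graded_prod_map[where N = "Ext_group Ae P d ?N" and H = HHA and p = "yoneda Ae P d \<epsilon> ?N" and \<phi> = "%n z. z",
      OF GN.N C h GN.closed PC.Ext_map_yoneda[OF exact N(1) R_module N(2)]])
    (use x z H in \<open>auto simp: sum_group_mem GN.N_group GN.H_group\<close>)
  then show "\<exists>z'\<in>carrier (HH_ring K A P d \<epsilon>).
    (%n. PC.Ext_map R ?\<theta> n (graded_prod (Ext_group Ae P d ?N) (yoneda Ae P d \<epsilon> ?N) x z n)) =
    graded_prod HHR (yoneda Ae P d \<epsilon> R) (%n. PC.Ext_map R ?\<theta> n (x n)) z'"
   using z by (intro bexI[of _ z]) simp_all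
 qed
qed

lemma coefficient_algebra_result:
 assumes R: "fd_bimodule K A R"
 defines "E \<equiv> HH_algebra K A P d \<epsilon> R \<mu> \<eta>"
 shows "unit_map K A P d R \<eta> \<in> ring_hom (HH_ring K A P d \<epsilon>) E"
  "unit_map K A P d R \<eta> ` carrier (HH_ring K A P d \<epsilon>) \<subseteq> graded_center E"
  "condition_fg K A P d \<epsilon> ==> lr_noetherian_ring E \<and> finite_over_graded_center E"
proof -
 interpret graded_central_map HHR cupR "ER 0 (etf 0 \<epsilon>)" HHA "yoneda Ae P d \<epsilon> (regular_bimodule A)" "EA 0 \<epsilon>" "PC.Ext_map R \<eta>"
  by (rule unit_graded_central_map)
 have E: "E = graded_ring HHR cupR (ER 0 (etf 0 \<epsilon>))" by (simp add: E_def HH_algebra_def compose_def)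
 have H: "HH_ring K A P d \<epsilon> = HH" by (simp add: HH_ring_def Ext_ring_def)
 have u: "unit_map K A P d R \<eta> = F" by (simp add: fun_eq_iff unit_map_def PC.Ext_map_def)
 show "unit_map K A P d R \<eta> \<in> ring_hom (HH_ring K A P d \<epsilon>) E" unfolding E H u by (rule F_ring_hom)
 show "unit_map K A P d R \<eta> ` carrier (HH_ring K A P d \<epsilon>) \<subseteq> graded_center E"
  unfolding E H u using F_central by blast
 assume fg: "condition_fg K A P d \<epsilon>"
 show "lr_noetherian_ring E \<and> finite_over_graded_center E" unfolding E
  by (rule noetherian_over_center[where \<theta> = "%n x. x", OF PC.yoneda_pairing[OF exact R_module] _ _ _ HHR_noetherian[OF R fg, unfolded H]])
   (simp_all add: hom_def cup_Ext_map_eta)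
qed

end

section \<open>Bimodules of linear maps between modules\<close>

context fd_algebra
begin

lemma scal_central:
 assumes M: "left_module A M" and "c \<in> carrier K" "b \<in> carrier A" "v \<in> carrier M"
 shows "b \<odot>\<^bsub>M\<^esub> ((sc c) \<odot>\<^bsub>M\<^esub> v) = (sc c) \<odot>\<^bsub>M\<^esub> (b \<odot>\<^bsub>M\<^esub> v)"
  "(c \<odot>\<^bsub>A\<^esub> b) \<odot>\<^bsub>M\<^esub> v = (sc c) \<odot>\<^bsub>M\<^esub> (b \<odot>\<^bsub>M\<^esub> v)"
proof -
 interpret M: left_module A M by fact
 show "b \<odot>\<^bsub>M\<^esub> ((sc c) \<odot>\<^bsub>M\<^esub> v) = (sc c) \<odot>\<^bsub>M\<^esub> (b \<odot>\<^bsub>M\<^esub> v)"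
  using assms by (simp add: M.smult_assoc1[symmetric] unit_scalar)
 show "(c \<odot>\<^bsub>A\<^esub> b) \<odot>\<^bsub>M\<^esub> v = (sc c) \<odot>\<^bsub>M\<^esub> (b \<odot>\<^bsub>M\<^esub> v)"
  using assms by (simp add: M.smult_assoc1[symmetric] unit_scalar)
qed

definition HM :: "('a, 'm) module \<Rightarrow> ('a, 'y) module \<Rightarrow> (('a, 'a) tensor, 'm \<Rightarrow> 'y) module" where
 "HM M Y = hom_bimodule K (scal M) (scal Y) (%a b f v. a \<odot>\<^bsub>Y\<^esub> f (b \<odot>\<^bsub>M\<^esub> v))"

lemma HM_simps:
 "carrier (HM M Y) = module_hom K (scal M) (scal Y)" "\<zero>\<^bsub>HM M Y\<^esub> = (\<lambda>v\<in>carrier M. \<zero>\<^bsub>Y\<^esub>)"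
 "f \<oplus>\<^bsub>HM M Y\<^esub> g = (\<lambda>v\<in>carrier M. f v \<oplus>\<^bsub>Y\<^esub> g v)"
 by (simp_all add: HM_def hom_bimodule_simps)

lemma HM_D:
 assumes "f \<in> carrier (HM M Y)"
 shows "v \<in> carrier M ==> f v \<in> carrier Y"
  "v \<in> carrier M ==> w \<in> carrier M ==> f (v \<oplus>\<^bsub>M\<^esub> w) = f v \<oplus>\<^bsub>Y\<^esub> f w"
  "c \<in> carrier K ==> v \<in> carrier M ==> f ((sc c) \<odot>\<^bsub>M\<^esub> v) = (sc c) \<odot>\<^bsub>Y\<^esub> f v"
  "(\<lambda>v\<in>carrier M. f v) = f"
proof -
 have f: "f \<in> module_hom K (scal M) (scal Y)" using assms by (simp only: HM_simps)
 note l = module_hom_lin[OF f]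
 show "v \<in> carrier M ==> f v \<in> carrier Y"
  "v \<in> carrier M ==> w \<in> carrier M ==> f (v \<oplus>\<^bsub>M\<^esub> w) = f v \<oplus>\<^bsub>Y\<^esub> f w"
  "c \<in> carrier K ==> v \<in> carrier M ==> f ((sc c) \<odot>\<^bsub>M\<^esub> v) = (sc c) \<odot>\<^bsub>Y\<^esub> f v"
  using lin_closed[OF l, of v] lin_add[OF l, of v w] lin_smult[OF l, of c v] by simp_all
 show "(\<lambda>v\<in>carrier M. f v) = f" using module_hom_restrict[OF f] by simp
qed

lemma HM_I:
 assumes M: "left_module A M"
  and "!!v. v \<in> carrier M ==> f v \<in> carrier Y"
  and "!!v w. v \<in> carrier M ==> w \<in> carrier M ==> f (v \<oplus>\<^bsub>M\<^esub> w) = f v \<oplus>\<^bsub>Y\<^esub> f w"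
  and "!!c v. c \<in> carrier K ==> v \<in> carrier M ==> f ((sc c) \<odot>\<^bsub>M\<^esub> v) = (sc c) \<odot>\<^bsub>Y\<^esub> f v"
 shows "(\<lambda>v\<in>carrier M. f v) \<in> carrier (HM M Y)"
proof -
 have "f \<in> lin K (scal M) (scal Y)" by (rule linI) (simp_all add: assms)
 from lin_restrict[OF scal_left_module[OF M] this] show ?thesis by (simp add: HM_simps)
qed

lemma HM_module:
 assumes M: "left_module A M" and Y: "left_module A Y"
 shows "bimod (HM M Y)"
  and "a \<in> carrier A ==> b \<in> carrier A ==> f \<in> carrier (HM M Y) ==>
   pr a b \<odot>\<^bsub>HM M Y\<^esub> f = (\<lambda>v\<in>carrier M. a \<odot>\<^bsub>Y\<^esub> f (b \<odot>\<^bsub>M\<^esub> v))"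
proof -
 interpret M: left_module A M by fact
 interpret Y: left_module A Y by fact
 note D = HM_D[unfolded HM_simps]
 have l: "(%v. a \<odot>\<^bsub>Y\<^esub> f (b \<odot>\<^bsub>M\<^esub> v)) \<in> lin K (scal M) (scal Y)"
  if "a \<in> carrier A" "b \<in> carrier A" "f \<in> module_hom K (scal M) (scal Y)" for a b f
  by (rule linI) (use that in \<open>simp_all add: D[OF that(3)] M.smult_closed M.smult_r_distr Y.smult_closed Y.smult_r_distr
    scal_central(1)[OF M] scal_central(1)[OF Y] unit_scalar(1)\<close>)
 have mid: "(c \<odot>\<^bsub>A\<^esub> a) \<odot>\<^bsub>Y\<^esub> f (b \<odot>\<^bsub>M\<^esub> v) = a \<odot>\<^bsub>Y\<^esub> f ((c \<odot>\<^bsub>A\<^esub> b) \<odot>\<^bsub>M\<^esub> v)"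
  if "c \<in> carrier K" "a \<in> carrier A" "b \<in> carrier A" "f \<in> module_hom K (scal M) (scal Y)" "v \<in> carrier M" for c a b f v
 proof -
  have bv: "b \<odot>\<^bsub>M\<^esub> v \<in> carrier M" using that by (simp add: M.smult_closed)
  show ?thesis
   by (simp only: scal_central(2)[OF Y that(1,2) D(1)[OF that(4) bv]] scal_central(2)[OF M that(1,3,5)] D(3)[OF that(4,1) bv]
     scal_central(1)[OF Y that(1,2) D(1)[OF that(4) bv]])
 qed
 note H = hom_bimodule_module[OF scal_left_module[OF M] scal_left_module[OF Y], of "%a b f v. a \<odot>\<^bsub>Y\<^esub> f (b \<odot>\<^bsub>M\<^esub> v)",
   folded HM_def]
 show "bimod (HM M Y)"
  by (rule H(1)) (simp_all add: l D M.smult_closed M.smult_l_distr M.smult_assoc1 M.smult_one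
    Y.smult_closed Y.smult_l_distr Y.smult_r_distr Y.smult_assoc1 Y.smult_one mid)
 show "pr a b \<odot>\<^bsub>HM M Y\<^esub> f = (\<lambda>v\<in>carrier M. a \<odot>\<^bsub>Y\<^esub> f (b \<odot>\<^bsub>M\<^esub> v))"
  if "a \<in> carrier A" "b \<in> carrier A" "f \<in> carrier (HM M Y)"
  by (rule H(2)[simplified, OF _ _ _ _ _ _ _ that[unfolded HM_simps]])
   (simp_all add: l D M.smult_closed M.smult_l_distr M.smult_assoc1 M.smult_one
    Y.smult_closed Y.smult_l_distr Y.smult_r_distr Y.smult_assoc1 Y.smult_one mid)
qed

lemma HM_actions:
 assumes M: "left_module A M" and Y: "left_module A Y" and "a \<in> carrier A" "f \<in> carrier (HM M Y)"
 shows HM_lact: "la (HM M Y) a f = (\<lambda>v\<in>carrier M. a \<odot>\<^bsub>Y\<^esub> f v)"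
  and HM_ract: "ra (HM M Y) f a = (\<lambda>v\<in>carrier M. f (a \<odot>\<^bsub>M\<^esub> v))"
 unfolding lact_def ract_def HM_module(2)[OF M Y assms(3) A.one_closed assms(4)] HM_module(2)[OF M Y A.one_closed assms(3,4)]
 by (rule restrict_ext, simp add: left_module.smult_one[OF M])
  (rule restrict_ext, simp add: left_module.smult_one[OF Y HM_D(1)[OF assms(4)]] left_module.smult_closed[OF M] assms(3))

lemma HM_map:
 assumes M: "left_module A M" and Y: "left_module A Y" and Z: "left_module A Z" and g: "g \<in> lin A Y Z"
 shows "(%f. \<lambda>v\<in>carrier M. g (f v)) \<in> lin Ae (HM M Y) (HM M Z)"
proof -
 interpret M: left_module A M by fact
 have c: "(\<lambda>v\<in>carrier M. g (f v)) \<in> carrier (HM M Z)" if "f \<in> carrier (HM M Y)" for f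
  by (rule HM_I[OF M]) (simp_all add: HM_D[OF that] lin_closed[OF g] lin_add[OF g] lin_smult[OF g] unit_scalar(1))
 show ?thesis
 proof (rule env_linI[OF HM_module(1)[OF M Y] HM_module(1)[OF M Z] c])
  fix f f' assume f: "f \<in> carrier (HM M Y)" and f': "f' \<in> carrier (HM M Y)"
  show "(\<lambda>v\<in>carrier M. g ((f \<oplus>\<^bsub>HM M Y\<^esub> f') v)) = (\<lambda>v\<in>carrier M. g (f v)) \<oplus>\<^bsub>HM M Z\<^esub> (\<lambda>v\<in>carrier M. g (f' v))"
   unfolding HM_simps by (rule restrict_ext) (simp add: lin_add[OF g] HM_D(1)[OF f] HM_D(1)[OF f'])
 next
  fix a f assume a: "a \<in> carrier A" and f: "f \<in> carrier (HM M Y)"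
  show "(\<lambda>v\<in>carrier M. g (la (HM M Y) a f v)) = la (HM M Z) a (\<lambda>v\<in>carrier M. g (f v))"
   unfolding HM_lact[OF M Y a f] HM_lact[OF M Z a c[OF f]]
   by (rule restrict_ext) (simp add: lin_smult[OF g] a HM_D(1)[OF f])
  show "(\<lambda>v\<in>carrier M. g (ra (HM M Y) f a v)) = ra (HM M Z) (\<lambda>v\<in>carrier M. g (f v)) a"
   unfolding HM_ract[OF M Y a f] HM_ract[OF M Z a c[OF f]]
   by (rule restrict_ext) (simp add: a M.smult_closed)
 qed
qed

lemma HM_map_surj:
 assumes M: "fd_module K A M" and Y: "left_module A Y" and Z: "left_module A Z" and g: "g \<in> lin A Y Z"
  and f: "f \<in> carrier (HM M Z)" and im: "f ` carrier M \<subseteq> g ` carrier Y"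
 shows "f \<in> (%f. \<lambda>v\<in>carrier M. g (f v)) ` carrier (HM M Y)"
proof -
 have lM: "left_module A M" using M by (simp add: fd_module_def)
 interpret V: vec K "scal M" by (intro vec.intro scal_left_module[OF lM] vec_axioms.intro field)
 have e: "(\<oplus>\<^bsub>scal M\<^esub>) = (\<oplus>\<^bsub>M\<^esub>)" "(\<odot>\<^bsub>scal M\<^esub>) = (%c x. (sc c) \<odot>\<^bsub>M\<^esub> x)"
  by (simp_all add: scal_def with_smult_def)
 have gen: "fin_generated (carrier K) (%c x. c \<odot>\<^bsub>scal M\<^esub> x) (add_monoid (scal M)) (carrier (scal M))"
  by (subst fin_generated_cong[of "add_monoid (scal M)" "add_monoid M"]) (use M e in \<open>simp_all add: fd_module_def\<close>)
 have gK: "g \<in> lin K (scal Y) (scal Z)"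
  by (rule linI) (simp_all add: lin_closed[OF g] lin_add[OF g] lin_smult[OF g] unit_scalar(1))
 obtain l where l: "l \<in> module_hom K (scal M) (scal Y)" "!!v. v \<in> carrier M ==> g (l v) = f v"
  using V.linear_lift[OF gen scal_left_module[OF Y] scal_left_module[OF Z] gK module_hom_lin[OF f[unfolded HM_simps]]] im
  by auto
 have "(\<lambda>v\<in>carrier M. g (l v)) = (\<lambda>v\<in>carrier M. f v)" by (rule restrict_ext) (rule l(2))
 then show ?thesis using l(1) by (intro image_eqI[of _ _ l]) (simp_all only: HM_D(4)[OF f] HM_simps)
qed

lemma HM_resolution:
 assumes M: "fd_module K A M" and ex: "aug_exact A Q e \<pi> Y"
 shows "aug_exact Ae (%i. HM M (Q i)) (%i f. \<lambda>v\<in>carrier M. e i (f v)) (%f. \<lambda>v\<in>carrier M. \<pi> (f v)) (HM M Y)"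
proof -
 have lM: "left_module A M" using M by (simp add: fd_module_def)
 note D = aug_exactD[OF ex]
 note h = HM_map[OF lM D(2) D(2) D(3)] HM_map[OF lM D(2) D(1) D(4)]
 have ker: "g ` carrier (HM M W) = {f \<in> carrier (HM M Y'). k f = \<zero>\<^bsub>HM M Z\<^esub>}"
  if W: "left_module A W" "left_module A Y'" "left_module A Z" and \<delta>: "\<delta> \<in> lin A W Y'" and \<delta>': "\<delta>' \<in> lin A Y' Z"
   and im: "\<delta> ` carrier W = {y \<in> carrier Y'. \<delta>' y = \<zero>\<^bsub>Z\<^esub>}"
   and g: "g = (%f. \<lambda>v\<in>carrier M. \<delta> (f v))" and k: "k = (%f. \<lambda>v\<in>carrier M. \<delta>' (f v))"
  for W :: "('a, 'w) module" and Y' :: "('a, 'w) module" and Z :: "('a, 'z) module" and \<delta> \<delta>' g k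
 proof (intro subset_antisym subsetI)
  fix f assume "f \<in> g ` carrier (HM M W)"
  then obtain l where l: "l \<in> carrier (HM M W)" "f = g l" by auto
  have "\<delta>' (\<delta> (l v)) = \<zero>\<^bsub>Z\<^esub>" if "v \<in> carrier M" for v
   using imageI[OF HM_D(1)[OF l(1) that], of \<delta>] unfolding im by simp
  then show "f \<in> {f \<in> carrier (HM M Y'). k f = \<zero>\<^bsub>HM M Z\<^esub>}"
   using lin_closed[OF HM_map[OF lM W(1,2) \<delta>] l(1)] by (auto simp: l(2) g k HM_simps(2) intro!: restrict_ext)
 next
  fix f assume "f \<in> {f \<in> carrier (HM M Y'). k f = \<zero>\<^bsub>HM M Z\<^esub>}"
  then have f: "f \<in> carrier (HM M Y')" "k f = \<zero>\<^bsub>HM M Z\<^esub>" by simp_all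
  have "\<delta>' (f v) = \<zero>\<^bsub>Z\<^esub>" if "v \<in> carrier M" for v using fun_cong[OF f(2), of v] that by (simp add: k HM_simps(2))
  then have "f ` carrier M \<subseteq> \<delta> ` carrier W" unfolding im using HM_D(1)[OF f(1)] by auto
  then show "f \<in> g ` carrier (HM M W)" unfolding g by (rule HM_map_surj[OF M W(1,2) \<delta> f(1)])
 qed
 have "(%f. \<lambda>v\<in>carrier M. \<pi> (f v)) ` carrier (HM M (Q 0)) = carrier (HM M Y)"
 proof (intro subset_antisym subsetI)
  show "f \<in> (%f. \<lambda>v\<in>carrier M. \<pi> (f v)) ` carrier (HM M (Q 0))" if f: "f \<in> carrier (HM M Y)" for f
   by (rule HM_map_surj[OF M D(2) D(1) D(4) f]) (use D(5) HM_D(1)[OF f] in auto)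
 qed (use lin_closed[OF h(2)] in auto)
 then show ?thesis unfolding aug_exact_def
  using HM_module(1)[OF lM D(1)] HM_module(1)[OF lM D(2)] h
   ker[OF D(2) D(2) D(1) D(3) D(4) D(6) refl refl] ker[OF D(2) D(2) D(2) D(3) D(3) D(7) refl refl] by simp
qed

subsection \<open>Evaluation\<close>

abbreviation "mt N M \<equiv> pure_tensor (mgrp N M)"

lemma mtensor_lin_unique:
 assumes N: "bimod N" and M: "left_module A M" and Y: "left_module A Y"
  and f: "f \<in> lin A (mten N M) Y" and g: "g \<in> lin A (mten N M) Y"
  and eq: "!!x v. x \<in> carrier N ==> v \<in> carrier M ==> f (mt N M x v) = g (mt N M x v)"
  and t: "t \<in> carrier (mten N M)"
 shows "f t = g t"
 by (rule tensor_data.T_hom_unique[OF mtensor_data[OF N M] abelian_group.a_group[OF left_module_abelian_group[OF Y]],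
    folded mtensor_group_def, OF lin_hom[OF f, unfolded hom_mtensor_iff] lin_hom[OF g, unfolded hom_mtensor_iff] eq
    t[unfolded mtensor_simps]])

lemma mtensor_eval:
 assumes N: "bimod N" and M: "left_module A M" and Y: "left_module A Y"
  and F: "F \<in> lin Ae N (HM M Y)"
  and b: "!!p v. p \<in> carrier N ==> v \<in> carrier M ==> b p v = F p v"
 shows "tensor_lift (add_monoid Y) b \<in> lin A (mten N M) Y"
  and "p \<in> carrier N ==> v \<in> carrier M ==> tensor_lift (add_monoid Y) b (mt N M p v) = F p v"
proof -
 interpret M: left_module A M by fact
 interpret Y: left_module A Y by fact
 interpret N: left_module Ae N by (rule N)
 note Fc = lin_closed[OF F]
 have "balanced (carrier A) N (ra N) M (%a m. a \<odot>\<^bsub>M\<^esub> m) (add_monoid Y) b"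
  by (rule balancedI) (simp_all add: b Fc HM_D(1,2)[OF Fc] lin_add[OF F]
    HM_simps(3) ract_closed[OF N] env_lin_ract[OF F] HM_ract[OF M Y _ Fc] M.smult_closed)
 note L = tensor_data.tensor_lift[OF mtensor_data[OF N M] Y.M.a_comm_group this, folded mtensor_group_def]
 show "tensor_lift (add_monoid Y) b \<in> lin A (mten N M) Y"
  by (rule mtensor_linI[OF N M Y L(1)]) (simp add: L(2) b lact_closed[OF N] env_lin_lact[OF F] HM_lact[OF M Y _ Fc] Fc)
 show "p \<in> carrier N ==> v \<in> carrier M ==> tensor_lift (add_monoid Y) b (mt N M p v) = F p v"
  by (simp add: L(2) b)
qed

text \<open>Endomorphisms of \<open>M\<close> act on the second factor of \<open>N \<otimes>\<^sub>A M\<close>.\<close>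

definition act_right :: "(('a, 'a) tensor, 'n) module \<Rightarrow> ('a, 'm) module \<Rightarrow> ('n, 'm \<Rightarrow> 'm) tensor \<Rightarrow> 'm \<Rightarrow> ('n, 'm) tensor" where
 "act_right N M = tensor_lift (add_monoid (HM M (mten N M))) (%p r. \<lambda>v\<in>carrier M. mt N M p (r v))"

lemma act_right:
 assumes N: "bimod N" and M: "left_module A M"
 shows "act_right N M \<in> lin Ae (bten N (HM M M)) (HM M (mten N M))"
  and "p \<in> carrier N ==> r \<in> carrier (HM M M) ==>
   act_right N M (pure_tensor (bgrp N (HM M M)) p r) = (\<lambda>v\<in>carrier M. mt N M p (r v))"
proof -
 let ?T = "mten N M" and ?R = "HM M M"
 note T = mtensor_left_module[OF N M] and R = HM_module(1)[OF M M]
 note L = HM_module(1)[OF M T]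
 interpret M: left_module A M by fact
 interpret L: left_module Ae "HM M ?T" by (rule L)
 interpret TD: tensor_data "carrier A" N "ra N" M "%a m. a \<odot>\<^bsub>M\<^esub> m" by (rule mtensor_data[OF N M])
 have TT: "TD.T = mgrp N M" by (simp add: mtensor_group_def)
 note pure = TD.pure_closed[unfolded TT] TD.pure_add_left[unfolded TT] TD.pure_add_right[unfolded TT] TD.pure_middle[unfolded TT]
 have cen: "mt N M p ((sc c) \<odot>\<^bsub>M\<^esub> v) = (sc c) \<odot>\<^bsub>?T\<^esub> mt N M p v"
  if "c \<in> carrier K" "p \<in> carrier N" "v \<in> carrier M" for c p v
  using that by (simp add: pure(4)[symmetric] unit_scalar(1) mtensor_smult[OF N M] lact_central[OF N])
 have c: "(\<lambda>v\<in>carrier M. mt N M p (r v)) \<in> carrier (HM M ?T)" if "p \<in> carrier N" "r \<in> carrier ?R" for p r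
  by (rule HM_I[OF M]) (use that in \<open>simp_all add: mtensor_simps pure HM_D[OF that(2)] cen\<close>)
 have "balanced (carrier A) N (ra N) ?R (la ?R) (add_monoid (HM M ?T)) (%p r. \<lambda>v\<in>carrier M. mt N M p (r v))"
 proof (rule balancedI)
  fix p p' r assume h: "p \<in> carrier N" "p' \<in> carrier N" "r \<in> carrier ?R"
  show "(\<lambda>v\<in>carrier M. mt N M (p \<oplus>\<^bsub>N\<^esub> p') (r v)) =
    (\<lambda>v\<in>carrier M. mt N M p (r v)) \<otimes>\<^bsub>add_monoid (HM M ?T)\<^esub> (\<lambda>v\<in>carrier M. mt N M p' (r v))"
   unfolding monoid.simps HM_simps by (rule restrict_ext) (simp add: h mtensor_simps pure HM_D(1)[OF h(3)])
 next
  fix p r r' assume h: "p \<in> carrier N" "r \<in> carrier ?R" "r' \<in> carrier ?R"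
  show "(\<lambda>v\<in>carrier M. mt N M p ((r \<oplus>\<^bsub>?R\<^esub> r') v)) =
    (\<lambda>v\<in>carrier M. mt N M p (r v)) \<otimes>\<^bsub>add_monoid (HM M ?T)\<^esub> (\<lambda>v\<in>carrier M. mt N M p (r' v))"
   unfolding monoid.simps HM_simps by (rule restrict_ext) (simp add: h mtensor_simps pure HM_D(1)[OF h(2)] HM_D(1)[OF h(3)])
 next
  fix p a r assume h: "p \<in> carrier N" "a \<in> carrier A" "r \<in> carrier ?R"
  show "(\<lambda>v\<in>carrier M. mt N M (ra N p a) (r v)) = (\<lambda>v\<in>carrier M. mt N M p (la ?R a r v))"
   unfolding HM_lact[OF M M h(2,3)] by (rule restrict_ext) (simp add: h pure HM_D(1)[OF h(3)])
 qed (simp add: c)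
 note B = btensor_lift[OF N R L.M.a_comm_group this, folded act_right_def]
 show "act_right N M \<in> lin Ae (bten N ?R) (HM M ?T)"
 proof (rule btensor_linI[OF N R L B(1)])
  fix a p r assume h: "a \<in> carrier A" "p \<in> carrier N" "r \<in> carrier ?R"
  show "act_right N M (pure_tensor (bgrp N ?R) (la N a p) r) =
    la (HM M ?T) a (act_right N M (pure_tensor (bgrp N ?R) p r))"
   unfolding B(2)[OF h(2,3)] B(2)[OF lact_closed[OF N h(1,2)] h(3)] HM_lact[OF M T h(1) c[OF h(2,3)]]
   by (rule restrict_ext) (simp add: h mtensor_smult[OF N M] HM_D(1)[OF h(3)])
  show "act_right N M (pure_tensor (bgrp N ?R) p (ra ?R r a)) =
    ra (HM M ?T) (act_right N M (pure_tensor (bgrp N ?R) p r)) a"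
   unfolding B(2)[OF h(2,3)] B(2)[OF h(2) ract_closed[OF R h(1,3)]] HM_ract[OF M T h(1) c[OF h(2,3)]]
   unfolding HM_ract[OF M M h(1,3)]
   by (rule restrict_ext) (simp add: h M.smult_closed)
 qed
 show "p \<in> carrier N ==> r \<in> carrier ?R ==>
   act_right N M (pure_tensor (bgrp N ?R) p r) = (\<lambda>v\<in>carrier M. mt N M p (r v))"
  by (rule B(2))
qed

end

section \<open>The Ext algebra of a module as Hochschild cohomology\<close>

lemma graded_product_image:
 assumes "graded_product G p u" and G': "!!n. comm_group (G' n)"
  and \<theta>: "!!n. \<theta> n \<in> hom (G n) (G' n)" and surj: "!!n. carrier (G' n) \<subseteq> \<theta> n ` carrier (G n)"
  and mult: "!!m n x y. x \<in> carrier (G m) ==> y \<in> carrier (G n) ==> \<theta> (m + n) (p m n x y) = p' m n (\<theta> m x) (\<theta> n y)"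
 shows "graded_product G' p' (\<theta> 0 u)"
proof (rule graded_product.intro)
 interpret graded_product G p u by fact
 note cl = hom_in_carrier[OF \<theta>] and hm = hom_mult[OF \<theta>]
 have ex: "\<exists>x\<in>carrier (G n). y = \<theta> n x" if "y \<in> carrier (G' n)" for y n using surj[of n] that by auto
 show "comm_group (G' n)" for n by (rule G')
 show "\<theta> 0 u \<in> carrier (G' 0)" by (rule cl[OF u])
 fix l m n a a' b b' c
 {
  assume "a \<in> carrier (G' m)" "b \<in> carrier (G' n)"
  then obtain x y where x: "x \<in> carrier (G m)" "a = \<theta> m x" and y: "y \<in> carrier (G n)" "b = \<theta> n y" using ex by metis
  show "p' m n a b \<in> carrier (G' (m + n))"
   unfolding x(2) y(2) mult[OF x(1) y(1), symmetric] by (rule cl[OF p_closed[OF x(1) y(1)]])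
  {
   assume "a' \<in> carrier (G' m)"
   then obtain x' where x': "x' \<in> carrier (G m)" "a' = \<theta> m x'" using ex by metis
   show "p' m n (a \<otimes>\<^bsub>G' m\<^esub> a') b = p' m n a b \<otimes>\<^bsub>G' (m + n)\<^esub> p' m n a' b"
    using p_add_left[OF x(1) x'(1) y(1)] mult[OF Gn.m_closed[OF x(1) x'(1)] y(1)]
    by (simp only: x(2) x'(2) y(2) hm[OF x(1) x'(1)] mult[OF x(1) y(1)] mult[OF x'(1) y(1)]
      hm[OF p_closed[OF x(1) y(1)] p_closed[OF x'(1) y(1)]])
  next
   assume "b' \<in> carrier (G' n)"
   then obtain y' where y': "y' \<in> carrier (G n)" "b' = \<theta> n y'" using ex by metis
   show "p' m n a (b \<otimes>\<^bsub>G' n\<^esub> b') = p' m n a b \<otimes>\<^bsub>G' (m + n)\<^esub> p' m n a b'"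
    using p_add_right[OF x(1) y(1) y'(1)] mult[OF x(1) Gn.m_closed[OF y(1) y'(1)]]
    by (simp only: x(2) y(2) y'(2) hm[OF y(1) y'(1)] mult[OF x(1) y(1)] mult[OF x(1) y'(1)]
      hm[OF p_closed[OF x(1) y(1)] p_closed[OF x(1) y'(1)]])
  }
 next
  assume "a \<in> carrier (G' l)" "b \<in> carrier (G' m)" "c \<in> carrier (G' n)"
  then obtain x y z where h: "x \<in> carrier (G l)" "y \<in> carrier (G m)" "z \<in> carrier (G n)"
   and e: "a = \<theta> l x" "b = \<theta> m y" "c = \<theta> n z" using ex by metis
  show "p' (l + m) n (p' l m a b) c = p' l (m + n) a (p' m n b c)"
   using mult[OF p_closed[OF h(1,2)] h(3)] mult[OF h(1) p_closed[OF h(2,3)]] p_assoc[OF h]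
   by (simp add: e mult[OF h(1,2)] mult[OF h(2,3)] add.assoc)
 next
  assume "a \<in> carrier (G' n)"
  then obtain x where x: "x \<in> carrier (G n)" "a = \<theta> n x" using ex by metis
  show "p' 0 n (\<theta> 0 u) a = a" "p' n 0 a (\<theta> 0 u) = a"
   using mult[OF u x(1)] mult[OF x(1) u] by (simp_all add: x p_one_left p_one_right)
 }
qed

lemma graded_central_map_image:
 assumes "graded_central_map G p u H q v \<phi>" and G': "!!n. comm_group (G' n)"
  and \<theta>: "!!n. \<theta> n \<in> hom (G n) (G' n)" and surj: "!!n. carrier (G' n) \<subseteq> \<theta> n ` carrier (G n)"
  and mult: "!!m n x y. x \<in> carrier (G m) ==> y \<in> carrier (G n) ==> \<theta> (m + n) (p m n x y) = p' m n (\<theta> m x) (\<theta> n y)"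
 shows "graded_central_map G' p' (\<theta> 0 u) H q v (%n x. \<theta> n (\<phi> n x))"
proof -
 interpret graded_central_map G p u H q v \<phi> by fact
 note fc = hom_in_carrier[OF \<phi>]
 show ?thesis
 proof (rule graded_central_map.intro, goal_cases)
  case 1 then show ?case
   by (rule graded_product_image[where G = G and p = p and \<theta> = \<theta>]) (rule graded_product_axioms G' \<theta> surj mult, assumption?)+
 next
  case 2 then show ?case
  proof (rule graded_central_map_axioms.intro)
  fix m n z y assume z: "z \<in> carrier (H m)"
  {
   assume "y \<in> carrier (G' n)"
   then obtain x where x: "x \<in> carrier (G n)" "y = \<theta> n x" using surj[of n] by auto
   have e: "G (n + m) = G (m + n)" "\<theta> (n + m) = \<theta> (m + n)" by (simp_all add: add.commute)
   have c: "p n m x (\<phi> m z) \<in> carrier (G (m + n))" using p_closed[OF x(1) fc[OF z]] by (simp add: e)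
   have inv: "\<theta> (m + n) (inv\<^bsub>G (m + n)\<^esub> w) = inv\<^bsub>G' (m + n)\<^esub> \<theta> (m + n) w" if "w \<in> carrier (G (m + n))" for w
    by (rule group_hom.hom_inv[OF _ that])
     (simp add: group_hom_def group_hom_axioms_def G_group comm_group.axioms(2)[OF G'] \<theta>)
   have r: "p' n m y (\<theta> m (\<phi> m z)) = \<theta> (m + n) (p n m x (\<phi> m z))"
    unfolding x(2) mult[OF x(1) fc[OF z], symmetric] e ..
   show "p' m n (\<theta> m (\<phi> m z)) y =
     (if even (m * n) then p' n m y (\<theta> m (\<phi> m z)) else inv\<^bsub>G' (m + n)\<^esub> p' n m y (\<theta> m (\<phi> m z)))"
    unfolding r inv[OF c, symmetric] unfolding x(2) mult[OF fc[OF z] x(1), symmetric] \<phi>_comm[OF z x(1)] by (rule if_distrib)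
  next
   assume y: "y \<in> carrier (H n)"
   show "q m n z y \<in> carrier (H (m + n))" by (rule q_closed[OF z y])
   show "\<theta> (m + n) (\<phi> (m + n) (q m n z y)) = p' m n (\<theta> m (\<phi> m z)) (\<theta> n (\<phi> n y))"
    by (simp only: \<phi>_mult[OF z y] mult[OF fc[OF z] fc[OF y]])
  }
  qed (simp_all add: H \<phi>_one hom_compose[OF \<phi> \<theta>])
 qed
qed

locale module_resolution = bimodule_resolution K A P d \<epsilon>
 for K :: "'k ring" (structure) and A :: "('k, 'a) module" (structure)
  and P :: "nat \<Rightarrow> (('a, 'a) tensor, 'p) module" and d and \<epsilon> :: "'p \<Rightarrow> 'a" +
 fixes M :: "('a, 'm) module" and Q :: "nat \<Rightarrow> ('a, 'q) module" and e :: "nat \<Rightarrow> 'q \<Rightarrow> 'q" and \<pi> :: "'q \<Rightarrow> 'm"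
 assumes M_fd: "fd_module K A M" and Q_res: "projective_resolution A Q e \<pi> M"
begin

lemma M: "left_module A M"
 using M_fd by (simp add: fd_module_def)

lemma Q_exact: "aug_exact A Q e \<pi> M"
 by (rule projective_resolution_aug_exact[OF Q_res M])

sublocale QC: proj_complex A Q e
 using Q_res by (intro proj_complex.intro mod_complex.intro proj_complex_axioms.intro)
  (rule aug_exactD[OF Q_exact] aug_exact_dd[OF Q_exact], assumption?, simp add: projective_resolution_def)+

abbreviation "onQ n f \<equiv> restrict f (carrier (Q n))"
abbreviation "End \<equiv> HM M M"

definition composition :: "('m \<Rightarrow> 'm, 'm \<Rightarrow> 'm) tensor \<Rightarrow> 'm \<Rightarrow> 'm" where
 "composition = (\<lambda>t\<in>carrier (bten End End). tensor_lift (add_monoid End) (%f g. \<lambda>v\<in>carrier M. f (g v)) t)"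

definition action :: "'a \<Rightarrow> 'm \<Rightarrow> 'm" where
 "action = (\<lambda>a\<in>carrier A. \<lambda>v\<in>carrier M. a \<odot>\<^bsub>M\<^esub> v)"

lemma End_module: "bimod End"
 by (rule HM_module(1)[OF M M])

lemma action_lin: "(%a. \<lambda>v\<in>carrier M. a \<odot>\<^bsub>M\<^esub> v) \<in> lin Ae (regular_bimodule A) End"
proof -
 interpret M: left_module A M by (rule M)
 have c: "(\<lambda>v\<in>carrier M. a \<odot>\<^bsub>M\<^esub> v) \<in> carrier End" if "a \<in> carrier A" for a
  by (rule HM_I[OF M]) (use that in \<open>simp_all add: M.smult_closed M.smult_r_distr scal_central(1)[OF M]\<close>)
 show ?thesis
 proof (rule env_linI[OF regular_left_module End_module]; unfold regular_simps)
  fix a b assume a: "a \<in> carrier A" and b: "b \<in> carrier A"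
  show "(\<lambda>v\<in>carrier M. a \<odot>\<^bsub>M\<^esub> v) \<in> carrier End" by (rule c[OF a])
  show "(\<lambda>v\<in>carrier M. (a \<oplus>\<^bsub>A\<^esub> b) \<odot>\<^bsub>M\<^esub> v) = (\<lambda>v\<in>carrier M. a \<odot>\<^bsub>M\<^esub> v) \<oplus>\<^bsub>End\<^esub> (\<lambda>v\<in>carrier M. b \<odot>\<^bsub>M\<^esub> v)"
   unfolding HM_simps by (rule restrict_ext) (simp add: a b M.smult_l_distr)
  show "(\<lambda>v\<in>carrier M. la (regular_bimodule A) a b \<odot>\<^bsub>M\<^esub> v) = la End a (\<lambda>v\<in>carrier M. b \<odot>\<^bsub>M\<^esub> v)"
   unfolding HM_lact[OF M M a c[OF b]] by (rule restrict_ext) (simp add: a b regular_lact M.smult_assoc1)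
  show "(\<lambda>v\<in>carrier M. ra (regular_bimodule A) b a \<odot>\<^bsub>M\<^esub> v) = ra End (\<lambda>v\<in>carrier M. b \<odot>\<^bsub>M\<^esub> v) a"
   unfolding HM_ract[OF M M a c[OF b]] by (rule restrict_ext) (simp add: a b regular_ract M.smult_assoc1 M.smult_closed)
 qed
qed

lemma action_simp: "a \<in> carrier A ==> v \<in> carrier M ==> action a v = a \<odot>\<^bsub>M\<^esub> v"
 by (simp add: action_def)

lemma comp_closed: "f \<in> carrier End ==> g \<in> carrier End ==> (\<lambda>v\<in>carrier M. f (g v)) \<in> carrier End"
 by (rule HM_I[OF M]) (simp_all add: HM_D[of f] HM_D[of g])

lemma composition:
 shows "composition \<in> module_hom Ae (bten End End) End"
  and "f \<in> carrier End ==> g \<in> carrier End ==> composition (bt End End f g) = (\<lambda>v\<in>carrier M. f (g v))"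
proof -
 note E = End_module
 interpret M: left_module A M by (rule M)
 interpret E: left_module Ae End by (rule E)
 have "balanced (carrier A) End (ra End) End (la End) (add_monoid End) (%f g. \<lambda>v\<in>carrier M. f (g v))"
 proof (rule balancedI)
  fix f f' g assume h: "f \<in> carrier End" "f' \<in> carrier End" "g \<in> carrier End"
  show "(\<lambda>v\<in>carrier M. (f \<oplus>\<^bsub>End\<^esub> f') (g v)) = (\<lambda>v\<in>carrier M. f (g v)) \<otimes>\<^bsub>add_monoid End\<^esub> (\<lambda>v\<in>carrier M. f' (g v))"
   unfolding monoid.simps HM_simps by (rule restrict_ext) (simp add: HM_D(1)[OF h(3)])
  show "(\<lambda>v\<in>carrier M. g ((f \<oplus>\<^bsub>End\<^esub> f') v)) = (\<lambda>v\<in>carrier M. g (f v)) \<otimes>\<^bsub>add_monoid End\<^esub> (\<lambda>v\<in>carrier M. g (f' v))"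
   unfolding monoid.simps HM_simps by (rule restrict_ext) (simp add: HM_D(2)[OF h(3)] HM_D(1)[OF h(1)] HM_D(1)[OF h(2)])
 next
  fix f a g assume h: "f \<in> carrier End" "a \<in> carrier A" "g \<in> carrier End"
  show "(\<lambda>v\<in>carrier M. ra End f a (g v)) = (\<lambda>v\<in>carrier M. f (la End a g v))"
   unfolding HM_lact[OF M M h(2,3)] HM_ract[OF M M h(2,1)] by (rule restrict_ext) (simp add: HM_D(1)[OF h(3)])
 qed (simp add: comp_closed)
 note B = btensor_lift[OF E E E.M.a_comm_group this]
 have "tensor_lift (add_monoid End) (%f g. \<lambda>v\<in>carrier M. f (g v)) \<in> lin Ae (bten End End) End"
 proof (rule btensor_linI[OF E E E B(1)])
  fix a f g assume h: "a \<in> carrier A" "f \<in> carrier End" "g \<in> carrier End"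
  note c = comp_closed[OF h(2,3)]
  show "tensor_lift (add_monoid End) (%f g. \<lambda>v\<in>carrier M. f (g v)) (bt End End (la End a f) g) =
    la End a (tensor_lift (add_monoid End) (%f g. \<lambda>v\<in>carrier M. f (g v)) (bt End End f g))"
   unfolding B(2)[OF h(2,3)] B(2)[OF lact_closed[OF E h(1,2)] h(3)] HM_lact[OF M M h(1) c]
   unfolding HM_lact[OF M M h(1,2)]
   by (rule restrict_ext) (simp add: HM_D(1)[OF h(3)])
  show "tensor_lift (add_monoid End) (%f g. \<lambda>v\<in>carrier M. f (g v)) (bt End End f (ra End g a)) =
    ra End (tensor_lift (add_monoid End) (%f g. \<lambda>v\<in>carrier M. f (g v)) (bt End End f g)) a"
   unfolding B(2)[OF h(2,3)] B(2)[OF h(2) ract_closed[OF E h(1,3)]] HM_ract[OF M M h(1) c]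
   unfolding HM_ract[OF M M h(1,3)]
   by (rule restrict_ext) (simp add: h M.smult_closed)
 qed
 from lin_restrict[OF btensor_left_module[OF E E] this]
 show "composition \<in> module_hom Ae (bten End End) End" by (simp only: composition_def)
 show "f \<in> carrier End ==> g \<in> carrier End ==> composition (bt End End f g) = (\<lambda>v\<in>carrier M. f (g v))"
  by (simp add: composition_def B(2) btensor_simps btensor_pure_closed[OF E E])
qed

lemma End_algebra: "bimodule_algebra K A End composition action"
proof -
 interpret M: left_module A M by (rule M)
 have a: "action \<in> module_hom Ae (regular_bimodule A) End"
  using lin_restrict[OF regular_left_module action_lin] by (simp add: action_def regular_simps)
 have ac: "action x \<in> carrier End" if "x \<in> carrier A" for x
  using module_hom_closed[OF a] that by (simp add: regular_simps)
 have assoc: "composition (bt End End (composition (bt End End f g)) h) = composition (bt End End f (composition (bt End End g h)))"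
  if c: "f \<in> carrier End" "g \<in> carrier End" "h \<in> carrier End" for f g h
  unfolding composition(2)[OF c(1,2)] composition(2)[OF c(2,3)] composition(2)[OF comp_closed[OF c(1,2)] c(3)]
   composition(2)[OF c(1) comp_closed[OF c(2,3)]]
  by (rule restrict_ext) (simp add: HM_D(1)[OF c(3)])
 have l: "composition (bt End End (action x) f) = la End x f" if c: "x \<in> carrier A" "f \<in> carrier End" for x f
  unfolding composition(2)[OF ac[OF c(1)] c(2)] HM_lact[OF M M c] by (rule restrict_ext) (simp add: action_simp c HM_D(1)[OF c(2)])
 have r: "composition (bt End End f (action x)) = ra End f x" if c: "x \<in> carrier A" "f \<in> carrier End" for x f
  unfolding composition(2)[OF c(2) ac[OF c(1)]] HM_ract[OF M M c] by (rule restrict_ext) (simp add: action_simp c)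
 show ?thesis unfolding bimodule_algebra_def Let_def
  by (intro conjI ballI End_module composition(1) a assoc l r)
qed

sublocale RA: bimodule_algebra_resolution K A P d \<epsilon> End composition action
 by (intro bimodule_algebra_resolution.intro bimodule_resolution_axioms bimodule_algebra_resolution_axioms.intro End_algebra)

end

context module_resolution
begin

abbreviation "ev \<equiv> tensor_lift (add_monoid M)"
abbreviation "MT i \<equiv> mten (P i) M"
abbreviation "dM i \<equiv> tensor_map (mgrp (P i) M) (d i) (%y. y)"
abbreviation "eM \<equiv> ev (%p y. \<epsilon> p \<odot>\<^bsub>M\<^esub> y)"
abbreviation "CM \<equiv> comparison_maps K A P d \<epsilon> M Q e \<pi>"
abbreviation "EM \<equiv> Ext_class A Q e M"
abbreviation "ExtM \<equiv> Ext_group A Q e M"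

lemma MT_exact: "aug_exact A MT dM eM M"
 by (rule mtensor_resolution[OF exact P_projective M])

lemmas MT_module = aug_exactD(2)[OF MT_exact] and dM_lin = aug_exactD(3)[OF MT_exact] and eM_lin = aug_exactD(4)[OF MT_exact]

lemma MT_pure:
 "x \<in> carrier (P (Suc i)) ==> v \<in> carrier M ==> dM i (mt (P (Suc i)) M x v) = mt (P i) M (d i x) v"
 "x' \<in> carrier (P 0) ==> v \<in> carrier M ==> eM (mt (P 0) M x' v) = \<epsilon> x' \<odot>\<^bsub>M\<^esub> v"
 using tensor_resolution(3,4)[OF exact P_projective left_action_smult[OF M], folded mtensor_group_def] by simp_all

lemma CM_iff: "u \<in> CM \<longleftrightarrow> u \<in> chain_lifts A Q e MT dM eM 0 \<pi>"
 by (simp add: comparison_maps_def)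

lemma CM_exists: "\<exists>u. u \<in> CM"
 unfolding CM_iff
 by (rule QC.lift_exists[OF MT_exact aug_exactD(4)[OF Q_exact] aug_exact_eps[OF Q_exact]])

lemma CM_D:
 assumes "u \<in> CM"
 shows "u n \<in> module_hom A (Q n) (MT n)" "x \<in> carrier (Q n) ==> u n x \<in> carrier (MT n)"
  "y \<in> carrier (Q 0) ==> eM (u 0 y) = \<pi> y"
  "z \<in> carrier (Q (Suc n)) ==> dM n (u (Suc n) z) = u n (e n z)"
proof -
 note D = chain_liftsD[OF assms[unfolded CM_iff], simplified]
 show "u n \<in> module_hom A (Q n) (MT n)" by (rule D(1))
 then show "x \<in> carrier (Q n) ==> u n x \<in> carrier (MT n)" by (rule module_hom_closed)
qed (use chain_liftsD(2,3)[OF assms[unfolded CM_iff]] in simp_all)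

lemma ev_unique:
 assumes F: "F \<in> lin Ae (P n) End" and g: "g \<in> lin A (MT n) M"
  and eq: "!!p v. p \<in> carrier (P n) ==> v \<in> carrier M ==> g (mt (P n) M p v) = F p v" and t: "t \<in> carrier (MT n)"
 shows "ev F t = g t"
 by (rule mtensor_lin_unique[OF PM M M mtensor_eval(1)[OF PM M M F refl] g _ t]) (simp add: eq mtensor_eval(2)[OF PM M M F refl])

lemma ev_lin: "F \<in> lin Ae (P n) End ==> ev F \<in> lin A (MT n) M"
 by (rule mtensor_eval(1)[OF PM M M _ refl])

lemma ev_pure: "F \<in> lin Ae (P n) End ==> p \<in> carrier (P n) ==> v \<in> carrier M ==> ev F (mt (P n) M p v) = F p v"
 by (rule mtensor_eval(2)[OF PM M M _ refl])

lemma ev_d: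
 assumes F: "F \<in> lin Ae (P n) End" and t: "t \<in> carrier (MT (Suc n))"
 shows "ev (%x. F (d n x)) t = ev F (dM n t)"
 by (rule ev_unique[OF lin_comp[OF d_lin F] lin_comp[OF dM_lin ev_lin[OF F]] _ t]) (simp add: MT_pure ev_pure[OF F] d_closed)

lemma ev_cocycle:
 assumes F: "F \<in> RA.CR n" and t: "t \<in> carrier (MT (Suc n))"
 shows "ev F (dM n t) = \<zero>\<^bsub>M\<^esub>"
 by (rule mtensor_lin_unique[OF PM M M lin_comp[OF dM_lin ev_lin[OF PC.cocycle_lin[OF F]]] lin_null[OF MT_module M] _ t])
  (simp add: MT_pure ev_pure[OF PC.cocycle_lin[OF F]] d_closed PC.cocycle_d[OF F] HM_simps)

lemma ev_add:
 assumes F: "F \<in> lin Ae (P n) End" and G: "G \<in> lin Ae (P n) End"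
  and h: "!!x. x \<in> carrier (P n) ==> H x = F x \<oplus>\<^bsub>End\<^esub> G x" and t: "t \<in> carrier (MT n)"
 shows "ev H t = ev F t \<oplus>\<^bsub>M\<^esub> ev G t"
proof (rule ev_unique[OF _ lin_plus[OF MT_module M ev_lin[OF F] ev_lin[OF G]] _ t])
 show "H \<in> lin Ae (P n) End" by (rule lin_cong[OF PM lin_plus[OF PM End_module F G] h])
qed (simp add: ev_pure F G h HM_simps)

abbreviation "pull u n F \<equiv> \<lambda>x\<in>carrier (Q n). ev F (u n x)"

lemma pull_cocycle:
 assumes F: "F \<in> RA.CR n" and u: "u \<in> CM"
 shows "pull u n F \<in> cocycles A Q e M n"
 using QC.lift_pairing_cocycle[OF MT_exact u[unfolded CM_iff] M ev_lin[OF PC.cocycle_lin[OF F]] ev_cocycle[OF F]] by simp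

lemma pull_coboundary:
 assumes b: "b \<in> coboundaries Ae P d End n" and u: "u \<in> CM"
 shows "pull u n b \<in> coboundaries A Q e M n"
 using b unfolding PC.coboundaries_iff[of b]
proof (elim disjE exE conjE)
 assume h: "n = 0" "b = (onP 0 (%x. \<zero>\<^bsub>End\<^esub>))"
 have b0: "b \<in> lin Ae (P 0) End"
  using module_hom_lin[OF PC.coboundary_hom[OF End_module b]] h(1) by simp
 have "ev b t = \<zero>\<^bsub>M\<^esub>" if "t \<in> carrier (MT 0)" for t
  by (rule ev_unique[OF b0 lin_null[OF MT_module M] _ that]) (simp add: h(2) HM_simps)
 then have "pull u n b = (onQ n (%x. \<zero>\<^bsub>M\<^esub>))" using CM_D(2)[OF u] h(1) by (intro restrict_ext) simp
 then show ?thesis using QC.coboundary_zero[OF M] by simp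
next
 fix j \<gamma> assume h: "n = Suc j" "\<gamma> \<in> module_hom Ae (P j) End" "b = (onP n (%x. \<gamma> (d j x)))"
 note \<gamma> = module_hom_lin[OF h(2)]
 have "ev b t = ev \<gamma> (dM j t)" if "t \<in> carrier (MT (Suc j))" for t
  by (rule ev_unique[OF lin_cong[OF PM lin_comp[OF d_lin \<gamma>]] lin_comp[OF dM_lin ev_lin[OF \<gamma>]] _ that])
   (simp_all add: h(1,3) MT_pure ev_pure[OF \<gamma>] d_closed)
 then have "pull u n b = (onQ (Suc j + 0) (%x. ev \<gamma> (dM j (u (Suc j) x))))"
  using CM_D(2)[OF u] h(1) by (auto intro!: restrict_ext)
 then show ?thesis using QC.lift_pairing_coboundary[OF u[unfolded CM_iff] ev_lin[OF \<gamma>]] h(1) by simp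
qed

lemma pull_add:
 assumes F: "F \<in> RA.CR n" and G: "G \<in> RA.CR n" and u: "u \<in> CM"
 shows "pull u n (onP n (%x. F x \<oplus>\<^bsub>End\<^esub> G x)) = (onQ n (%x. pull u n F x \<oplus>\<^bsub>M\<^esub> pull u n G x))"
 by (rule restrict_ext) (simp add: ev_add[OF PC.cocycle_lin[OF F] PC.cocycle_lin[OF G] _ CM_D(2)[OF u]])

lemma \<pi>_cocycle: "\<pi> \<in> cocycles A Q e M 0"
proof -
 have "\<pi> \<in> module_hom A (Q 0) M" using Q_res by (simp add: projective_resolution_def)
 then show ?thesis using QC.aug_cocycle[OF Q_exact] by (simp add: module_hom_restrict)
qed

lemma pull_class_unique:
 assumes F: "F \<in> RA.CR n" and F': "F' \<in> RA.CR n" and eq: "RA.ER n F = RA.ER n F'" and u: "u \<in> CM" and u': "u' \<in> CM"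
 shows "EM n (pull u n F) = EM n (pull u' n F')"
proof -
 obtain b where b: "b \<in> coboundaries Ae P d End n" "!!x. x \<in> carrier (P n) ==> F x = b x \<oplus>\<^bsub>End\<^esub> F' x"
  using PC.Ext_class_eqD[OF End_module F eq] by auto
 have "EM n (pull u n F) = EM n (pull u n F')"
  by (rule QC.Ext_class_eqI[OF M QC.cocycle_hom[OF pull_cocycle[OF F u]] QC.cocycle_hom[OF pull_cocycle[OF F' u]]
     pull_coboundary[OF b(1) u]])
   (simp add: ev_add[OF module_hom_lin[OF PC.coboundary_hom[OF End_module b(1)]] PC.cocycle_lin[OF F'] b(2) CM_D(2)[OF u]])
 also have "\<dots> = EM n (pull u' n F')"
  using QC.lift_pairing_unique[OF MT_exact u[unfolded CM_iff] u'[unfolded CM_iff] \<pi>_cocycle \<pi>_cocycle refl M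
    ev_lin[OF PC.cocycle_lin[OF F']] ev_cocycle[OF F']] by simp
 finally show ?thesis .
qed

definition Theta :: "nat \<Rightarrow> ('p \<Rightarrow> 'm \<Rightarrow> 'm) set \<Rightarrow> ('q \<Rightarrow> 'm) set" where
 "Theta n \<alpha> = (\<Union>F\<in>\<alpha>. \<Union>u\<in>CM. EM n (pull u n F))"

lemma Theta_class:
 assumes F: "F \<in> RA.CR n" and u: "u \<in> CM"
 shows "Theta n (RA.ER n F) = EM n (pull u n F)"
proof -
 have *: "EM n (pull u' n F') = EM n (pull u n F)" if "F' \<in> RA.ER n F" "u' \<in> CM" for F' u'
  by (rule pull_class_unique[OF PC.Ext_class_memD(1)[OF End_module F that(1)] F PC.Ext_class_memD(2)[OF End_module F that(1)] that(2) u])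
 show ?thesis unfolding Theta_def
 proof (intro equalityI subsetI)
  fix x assume "x \<in> (\<Union>F\<in>RA.ER n F. \<Union>u\<in>CM. EM n (pull u n F))"
  then show "x \<in> EM n (pull u n F)" by (elim UN_E) (simp only: *)
 next
  fix x assume x: "x \<in> EM n (pull u n F)"
  show "x \<in> (\<Union>F\<in>RA.ER n F. \<Union>u\<in>CM. EM n (pull u n F))"
   by (rule UN_I[OF PC.Ext_class_self[OF End_module F]], rule UN_I[OF u], rule x)
 qed
qed

lemma Theta_hom: "Theta n \<in> hom (RA.HHR n) (ExtM n)"
proof (rule hom_addI)
 obtain u where u: "u \<in> CM" by (rule exE[OF CM_exists])
 fix x assume "x \<in> carrier (RA.HHR n)"
 then obtain F where F: "F \<in> RA.CR n" "x = RA.ER n F" using RA.HHR_cases by auto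
 show "Theta n x \<in> carrier (ExtM n)"
  unfolding F(2) Theta_class[OF F(1) u] by (rule QC.Ext_class_closed[OF pull_cocycle[OF F(1) u]])
 fix y assume "y \<in> carrier (RA.HHR n)"
 then obtain G where G: "G \<in> RA.CR n" "y = RA.ER n G" using RA.HHR_cases by auto
 have s: "(onP n (%x. F x \<oplus>\<^bsub>End\<^esub> G x)) \<in> RA.CR n"
  using subgroup.m_closed[OF PC.cocycles_subgroup[OF End_module] F(1) G(1)] by (simp add: PC.cochain_simps)
 show "Theta n (x \<otimes>\<^bsub>RA.HHR n\<^esub> y) = Theta n x \<otimes>\<^bsub>ExtM n\<^esub> Theta n y"
  unfolding F(2) G(2) PC.Ext_class_mult[OF End_module F(1) G(1)] Theta_class[OF s u] Theta_class[OF F(1) u] Theta_class[OF G(1) u]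
   QC.Ext_class_mult[OF M pull_cocycle[OF F(1) u] pull_cocycle[OF G(1) u]] pull_add[OF F(1) G(1) u] ..
qed

lemma Theta_one: "Theta 0 (RA.ER 0 (onP 0 (%x. action (\<epsilon> x)))) = EM 0 \<pi>"
proof -
 obtain u where u: "u \<in> CM" by (rule exE[OF CM_exists])
 note c = RA.etf_cocycle[OF eps_cocycle]
 have "ev (onP 0 (%x. action (\<epsilon> x))) t = eM t" if "t \<in> carrier (MT 0)" for t
  by (rule ev_unique[OF PC.cocycle_lin[OF c] eM_lin _ that]) (simp add: MT_pure action_simp eps_closed)
 then have "pull u 0 (onP 0 (%x. action (\<epsilon> x))) = (onQ 0 (%x. \<pi> x))"
  by (intro restrict_ext) (simp add: CM_D[OF u])
 then show ?thesis unfolding Theta_class[OF c u] using QC.cocycle_hom[OF \<pi>_cocycle] by (simp add: module_hom_restrict)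
qed

text \<open>Surjectivity: the identity of \<open>M\<close> lifts to a chain map from \<open>P\<close> to \<open>Hom(M, Q)\<close>, and \<open>M\<close>-valued cocycles are composed
 with it.\<close>

lemma Theta_surj: "carrier (ExtM n) \<subseteq> Theta n ` carrier (RA.HHR n)"
proof
 obtain u where u: "u \<in> CM" by (rule exE[OF CM_exists])
 fix y assume "y \<in> carrier (ExtM n)"
 then obtain g where g: "g \<in> cocycles A Q e M n" "y = EM n g" by (auto simp: QC.Ext_carrier)
 obtain V where V: "V \<in> chain_lifts Ae P d (%i. HM M (Q i)) (%i f. \<lambda>v\<in>carrier M. e i (f v)) (%f. \<lambda>v\<in>carrier M. \<pi> (f v)) 0
   (onP 0 (%x. action (\<epsilon> x)))"
  by (rule exE[OF PC.lift_exists_cocycle[OF HM_resolution[OF M_fd Q_exact] RA.etf_cocycle[OF eps_cocycle]]])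
 note VD = chain_liftsD[OF V, unfolded add_0]
 have Vl: "V i \<in> lin Ae (P i) (HM M (Q i))" for i by (rule module_hom_lin[OF VD(1)])
 have Vc: "V i p \<in> carrier (HM M (Q i))" if "p \<in> carrier (P i)" for i p by (rule lin_closed[OF Vl that])
 have V0: "\<pi> (V 0 p v) = \<epsilon> p \<odot>\<^bsub>M\<^esub> v" if "p \<in> carrier (P 0)" "v \<in> carrier M" for p v
  using fun_cong[OF VD(2)[OF that(1)], of v] that by (simp add: action_simp[OF eps_closed])
 have VS: "e i (V (Suc i) p v) = V i (d i p) v" if "p \<in> carrier (P (Suc i))" "v \<in> carrier M" for i p v
  using fun_cong[OF VD(3)[OF that(1)], of v] that by simp
 have Q: "left_module A (Q i)" for i by (rule QC.P_mod)
 let ?W = "%i. tensor_lift (add_monoid (Q i)) (V i)"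
 note W = mtensor_eval[OF PM M Q Vl refl]
 have \<tau>: "(%i. \<lambda>x\<in>carrier (Q i). ?W i (u i x)) \<in> chain_lifts A Q e Q e \<pi> 0 \<pi>"
  unfolding chain_lifts_def
 proof (intro CollectI conjI allI ballI; (unfold add_0)?)
  show "(onQ i (%x. ?W i (u i x))) \<in> module_hom A (Q i) (Q i)" for i
   by (rule lin_restrict[OF Q lin_comp[OF module_hom_lin[OF CM_D(1)[OF u]] W(1)]])
  have "\<pi> (?W 0 t) = eM t" if "t \<in> carrier (MT 0)" for t
   by (rule mtensor_lin_unique[OF PM M M lin_comp[OF W(1) aug_exactD(4)[OF Q_exact]] eM_lin _ that])
    (simp add: W(2) MT_pure V0)
  then show "\<pi> ((onQ 0 (%x. ?W 0 (u 0 x))) x) = \<pi> x" if "x \<in> carrier (Q 0)" for x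
   using that by (simp add: CM_D[OF u])
  fix i x assume x: "x \<in> carrier (Q (Suc i))"
  have "e i (?W (Suc i) t) = ?W i (dM i t)" if "t \<in> carrier (MT (Suc i))" for t
   by (rule mtensor_lin_unique[OF PM M Q lin_comp[OF W(1) QC.d_lin] lin_comp[OF dM_lin W(1)] _ that])
    (simp add: W(2) MT_pure VS d_closed)
  then show "e i ((onQ (Suc i) (%x. ?W (Suc i) (u (Suc i) x))) x) = (onQ i (%x. ?W i (u i x))) (e i x)"
   using x by (simp add: CM_D[OF u] QC.d_closed)
 qed
 let ?F = "\<lambda>p\<in>carrier (P n). \<lambda>v\<in>carrier M. g (V n p v)"
 note gl = QC.cocycle_lin[OF g(1)]
 have Fl: "(%p. \<lambda>v\<in>carrier M. g (V n p v)) \<in> lin Ae (P n) End" by (rule lin_comp[OF Vl HM_map[OF M Q M gl]])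
 have F: "?F \<in> RA.CR n"
 proof (rule PC.cocycleI[OF Fl])
  fix p assume p: "p \<in> carrier (P (Suc n))"
  show "(\<lambda>v\<in>carrier M. g (V n (d n p) v)) = \<zero>\<^bsub>End\<^esub>"
   unfolding HM_simps by (rule restrict_ext) (simp add: p VS[symmetric] QC.cocycle_d[OF g(1)] HM_D(1)[OF Vc[OF p]])
 qed
 have "ev ?F t = g (?W n t)" if "t \<in> carrier (MT n)" for t
  by (rule ev_unique[OF PC.cocycle_lin[OF F] lin_comp[OF W(1) gl] _ that]) (simp add: W(2))
 then have "pull u n ?F = (onQ n (%x. g ((onQ n (%x. ?W n (u n x))) x)))"
  by (intro restrict_ext) (simp add: CM_D[OF u])
 then have "Theta n (RA.ER n ?F) = EM n g"
  unfolding Theta_class[OF F u] using QC.Ext_class_comp_chain_map(2)[OF Q_exact \<tau> M g(1)] by simp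
 then show "y \<in> Theta n ` carrier (RA.HHR n)"
  unfolding g(2) by (intro image_eqI[OF _ PC.Ext_class_closed[OF F]]) simp
qed

lemma Theta_cup:
 assumes "x \<in> carrier (RA.HHR m)" "y \<in> carrier (RA.HHR n)"
 shows "Theta (m + n) (cup K A P d \<epsilon> End composition m n x y) = yoneda A Q e \<pi> M m n (Theta m x) (Theta n y)"
proof -
 obtain u where u: "u \<in> CM" by (rule exE[OF CM_exists])
 note uD = CM_D[OF u]
 obtain F where F: "F \<in> RA.CR m" "x = RA.ER m F" using RA.HHR_cases[OF assms(1)] by auto
 obtain G where G: "G \<in> RA.CR n" "y = RA.ER n G" using RA.HHR_cases[OF assms(2)] by auto
 note Fl = PC.cocycle_lin[OF F(1)] and Gl = PC.cocycle_lin[OF G(1)] and pG = pull_cocycle[OF G(1) u]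
 obtain h where h: "h \<in> RA.lifts n G" by (rule exE[OF PC.lift_exists_cocycle[OF left_res[OF End_module] G(1)]])
 note hD = chain_liftsD[OF h]
 obtain k where k: "k \<in> chain_lifts A Q e Q e \<pi> n (pull u n G)" by (rule exE[OF QC.lift_exists_cocycle[OF Q_exact pG]])
 note kD = chain_liftsD[OF k]
 have kc: "k i z \<in> carrier (Q i)" if "z \<in> carrier (Q (n + i))" for i z by (rule module_hom_closed[OF kD(1) that])
 have uk: "(%i. \<lambda>z\<in>carrier (Q (n + i)). u i (k i z)) \<in> chain_lifts A Q e MT dM eM n (pull u n G)"
  unfolding chain_lifts_def
 proof (intro CollectI conjI allI ballI)
  show "(onQ (n + i) (%z. u i (k i z))) \<in> module_hom A (Q (n + i)) (MT i)" for i
   by (rule lin_restrict[OF QC.P_mod lin_comp[OF module_hom_lin[OF kD(1)] module_hom_lin[OF uD(1)]]])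
  show "eM ((onQ (n + 0) (%z. u 0 (k 0 z))) z) = pull u n G z" if z: "z \<in> carrier (Q n)" for z
   using kc[of z 0] kD(2)[OF z] z by (simp add: uD)
  show "dM i ((onQ (n + Suc i) (%z. u (Suc i) (k (Suc i) z))) z) = (onQ (n + i) (%z. u i (k i z))) (e (n + i) z)"
   if z: "z \<in> carrier (Q (Suc (n + i)))" for i z
   using kc[of z "Suc i"] kD(3)[OF z] z by (simp add: uD QC.d_closed)
 qed
 let ?A = "%i. act_right (P i) M"
 note A = act_right[OF PM M]
 have Hl: "(%p. ?A i (h i p)) \<in> lin Ae (P (n + i)) (HM M (MT i))" for i
  by (rule lin_comp[OF module_hom_lin[OF hD(1)] A(1)])
 let ?L = "%i. tensor_lift (add_monoid (MT i)) (%p. ?A i (h i p))"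
 note L = mtensor_eval[OF PM M MT_module Hl refl]
 have hc: "h i p \<in> carrier (bten (P i) End)" if "p \<in> carrier (P (n + i))" for i p by (rule module_hom_closed[OF hD(1) that])
 have A_e: "(\<lambda>v\<in>carrier M. eM (?A 0 t v)) = eL End t" if t: "t \<in> carrier (bten (P 0) End)" for t
  by (rule btensor_lin_unique[OF PM End_module End_module lin_comp[OF A(1) HM_map[OF M MT_module M eM_lin]] eL_lin[OF End_module] _ t])
   (auto simp: A(2) eL_pure[OF End_module] HM_lact[OF M M] eps_closed MT_pure HM_D(1) intro!: restrict_ext)
 have A_d: "(\<lambda>v\<in>carrier M. dM i (?A (Suc i) t v)) = ?A i (dL End i t)" if t: "t \<in> carrier (bten (P (Suc i)) End)" for i t
  by (rule btensor_lin_unique[OF PM End_module HM_module(1)[OF M MT_module] lin_comp[OF A(1) HM_map[OF M MT_module MT_module dM_lin]]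
     lin_comp[OF dL_lin[OF End_module] A(1)] _ t])
   (auto simp: A(2) dL_pure[OF End_module] MT_pure HM_D(1) d_closed intro!: restrict_ext)
 have A_F: "(\<lambda>v\<in>carrier M. ev F (?A m t v)) = RA.rext F t" if t: "t \<in> carrier (bten (P m) End)" for t
  by (rule btensor_lin_unique[OF PM End_module End_module lin_comp[OF A(1) HM_map[OF M MT_module M ev_lin[OF Fl]]] RA.rext_lin[OF PM Fl] _ t])
   (auto simp: A(2) RA.rext_pure[OF PM Fl] RA.mul_def composition(2) lin_closed[OF Fl] ev_pure[OF Fl] HM_D(1) intro!: restrict_ext)
 have Le: "eM (?L 0 t) = ev G t" if t: "t \<in> carrier (MT n)" for t
 proof (rule ev_unique[OF Gl lin_comp[OF L(1)[of 0, simplified] eM_lin] _ t, symmetric])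
  fix p v assume p: "p \<in> carrier (P n)" and v: "v \<in> carrier M"
  show "eM (?L 0 (mt (P n) M p v)) = G p v"
   using fun_cong[OF A_e[OF hc[of p 0]], of v] hD(2)[OF p] L(2)[of p 0 v] p v by simp
 qed
 have Ld: "dM i (?L (Suc i) t) = ?L i (dM (n + i) t)" if t: "t \<in> carrier (MT (Suc (n + i)))" for i t
 proof (rule mtensor_lin_unique[OF PM M MT_module lin_comp[OF L(1)[of "Suc i", simplified] dM_lin] lin_comp[OF dM_lin L(1)] _ t])
  fix p v assume p: "p \<in> carrier (P (Suc (n + i)))" and v: "v \<in> carrier M"
  show "dM i (?L (Suc i) (mt (P (Suc (n + i))) M p v)) = ?L i (dM (n + i) (mt (P (Suc (n + i))) M p v))"
   using fun_cong[OF A_d[OF hc[of p "Suc i"]], of v] hD(3)[OF p] L(2)[of p "Suc i" v] p v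
   by (simp add: MT_pure L(2) d_closed)
 qed
 have uL: "(%i. \<lambda>z\<in>carrier (Q (n + i)). ?L i (u (n + i) z)) \<in> chain_lifts A Q e MT dM eM n (pull u n G)"
  unfolding chain_lifts_def
 proof (intro CollectI conjI allI ballI)
  show "(onQ (n + i) (%z. ?L i (u (n + i) z))) \<in> module_hom A (Q (n + i)) (MT i)" for i
   by (rule lin_restrict[OF QC.P_mod lin_comp[OF module_hom_lin[OF uD(1)] L(1)]])
  show "eM ((onQ (n + 0) (%z. ?L 0 (u (n + 0) z))) z) = pull u n G z" if z: "z \<in> carrier (Q n)" for z
   using z Le[OF uD(2)[OF z]] by simp
  show "dM i ((onQ (n + Suc i) (%z. ?L (Suc i) (u (n + Suc i) z))) z) =
    (onQ (n + i) (%z. ?L i (u (n + i) z))) (e (n + i) z)" if z: "z \<in> carrier (Q (Suc (n + i)))" for i z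
   using z Ld[OF uD(2)[OF z]] by (simp add: uD QC.d_closed)
 qed
 let ?c = "\<lambda>x\<in>carrier (P (m + n)). RA.rext F (h m x)"
 note c = RA.rext_lift_cocycle[OF F(1) h]
 have nm: "n + m = m + n" by simp
 have "ev ?c t = ev F (?L m t)" if t: "t \<in> carrier (MT (m + n))" for t
 proof (rule ev_unique[OF PC.cocycle_lin[OF c] lin_comp[OF L(1)[of m, unfolded nm] ev_lin[OF Fl]] _ t])
  fix p v assume p: "p \<in> carrier (P (m + n))" and v: "v \<in> carrier M"
  show "ev F (?L m (mt (P (m + n)) M p v)) = ?c p v"
   using fun_cong[OF A_F[OF hc[of p m]], of v] L(2)[of p m v] p v by (simp add: nm)
 qed
 then have "pull u (m + n) ?c = (onQ (m + n) (%z. ev F ((onQ (n + m) (%z. ?L m (u (n + m) z))) z)))"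
  by (intro restrict_ext) (simp add: uD nm)
 then have "Theta (m + n) (cup K A P d \<epsilon> End composition m n x y) =
   EM (m + n) (onQ (m + n) (%z. ev F ((onQ (n + m) (%z. ?L m (u (n + m) z))) z)))"
  unfolding F(2) G(2) RA.cup_Ext_class[OF F(1) G(1) h] Theta_class[OF c u] by simp
 also have "\<dots> = EM (m + n) (onQ (m + n) (%z. ev F ((onQ (n + m) (%z. u m (k m z))) z)))"
  by (rule QC.lift_pairing_unique[OF MT_exact uL uk pG pG refl M ev_lin[OF Fl] ev_cocycle[OF F(1)]])
 also have "(onQ (m + n) (%z. ev F ((onQ (n + m) (%z. u m (k m z))) z))) =
   (onQ (m + n) (%z. pull u m F (k m z)))"
  by (rule restrict_ext) (use kc[of _ m] in \<open>simp add: nm\<close>)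
 also have "EM (m + n) \<dots> = yoneda A Q e \<pi> M m n (Theta m x) (Theta n y)"
  unfolding F(2) G(2) Theta_class[OF F(1) u] Theta_class[OF G(1) u]
  by (rule QC.yoneda_Ext_class[OF Q_exact M pull_cocycle[OF F(1) u] pG k, symmetric])
 finally show ?thesis .
qed

end

context module_resolution
begin

text \<open>Endomorphisms of \<open>M\<close> are sums of maps of rank one, \<open>v \<mapsto> \<kappa> v x w\<close> with a coordinate function \<open>\<kappa>\<close>.\<close>

lemma End_fd: "fd_bimodule K A End"
proof -
 note E = End_module
 interpret M: left_module A M by (rule M)
 interpret E: left_module Ae End by (rule E)
 interpret V: vec K "scal M" by (intro vec.intro scal_left_module[OF M] vec_axioms.intro field)
 have gen: "fin_generated (carrier K) (%c m. (sc c) \<odot>\<^bsub>M\<^esub> m) (add_monoid M) (carrier M)"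
  using M_fd by (simp add: fd_module_def)
 have e: "(\<oplus>\<^bsub>scal M\<^esub>) = (\<oplus>\<^bsub>M\<^esub>)" "(\<odot>\<^bsub>scal M\<^esub>) = (%c x. (sc c) \<odot>\<^bsub>M\<^esub> x)"
  by (simp_all add: scal_def with_smult_def)
 have "fin_generated (carrier K) (%c x. c \<odot>\<^bsub>scal M\<^esub> x) (add_monoid (scal M)) (carrier (scal M))"
  by (subst fin_generated_cong[of "add_monoid (scal M)" "add_monoid M"]) (use gen e in simp_all)
 then obtain F \<kappa> where db: "V.dual_basis F \<kappa>" using V.dual_basis_exists by auto
 note F = V.dual_basisD(1,2)[OF db] and \<kappa> = V.dual_basisD(3,5,6)[OF db, simplified] and rep = V.dual_basisD(4)[OF db, simplified]
 have FM: "x \<in> carrier M" if "x \<in> F" for x using F(2) that by auto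
 define T where "T = (%x w. \<lambda>v\<in>carrier M. (\<kappa> v x \<odot>\<^bsub>A\<^esub> uA) \<odot>\<^bsub>M\<^esub> w)"
 have Tc: "T x w \<in> carrier End" if x: "x \<in> F" and w: "w \<in> carrier M" for x w unfolding T_def
  by (rule HM_I[OF M]) (use w in \<open>simp_all add: \<kappa>[OF x] unit_scalar(1,4,5) M.smult_closed M.smult_l_distr M.smult_assoc1\<close>)
 obtain F0 where "finite F0 \<and> F0 \<subseteq> carrier M \<and> (\<forall>L. stable_subgroup (carrier K) (%c m. (sc c) \<odot>\<^bsub>M\<^esub> m) (add_monoid M) L \<and>
   F0 \<subseteq> L \<longrightarrow> carrier M \<subseteq> L)"
  using gen unfolding fin_generated_def by (rule exE)
 then have F0: "finite F0" "F0 \<subseteq> carrier M"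
  "!!L. stable_subgroup (carrier K) (%c m. (sc c) \<odot>\<^bsub>M\<^esub> m) (add_monoid M) L ==> F0 \<subseteq> L ==> carrier M \<subseteq> L"
  by simp_all
 have ev: "(%f. f v) \<in> hom (add_monoid End) (add_monoid M)" if v: "v \<in> carrier M" for v
 proof (rule hom_addI)
  show "f v \<in> carrier (add_monoid M)" if "f \<in> carrier (add_monoid End)" for f
   using that HM_D(1)[of f M M, OF _ v] by simp
 qed (simp add: v HM_simps(3))
 have fin: "finsum (scal M) g I = finsum M g I" for g I
  by (simp add: finsum_def finprod_def scal_def with_smult_def foldD_def)
 have "fin_generated (carrier K) (%c x. la End (sc c) x) (add_monoid End) (carrier End)"
  unfolding fin_generated_def
 proof (intro exI[of _ "(%(x, w). T x w) ` (F \<times> F0)"] conjI allI impI)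
  show "finite ((%(x, w). T x w) ` (F \<times> F0))" using F(1) F0(1) by simp
  show "(%(x, w). T x w) ` (F \<times> F0) \<subseteq> carrier End" using Tc F0(2) by auto
  fix L assume L: "stable_subgroup (carrier K) (%c x. la End (sc c) x) (add_monoid End) L \<and> (%(x, w). T x w) ` (F \<times> F0) \<subseteq> L"
  then have L': "subgroup L (add_monoid End)" by (simp only: stable_subgroup_def)
  have TL: "T x w \<in> L" if x: "x \<in> F" and w: "w \<in> carrier M" for x w
  proof -
   have "stable_subgroup (carrier K) (%c m. (sc c) \<odot>\<^bsub>M\<^esub> m) (add_monoid M) {w \<in> carrier (add_monoid M). T x w \<in> L}"
   proof (rule preimage_stable[OF conjunct1[OF L] M.M.a_group E.M.a_group])
    show "T x \<in> hom (add_monoid M) (add_monoid End)"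
    proof (rule hom_addI)
     fix w w' assume w: "w \<in> carrier (add_monoid M)" and w': "w' \<in> carrier (add_monoid M)"
     show "T x (w \<otimes>\<^bsub>add_monoid M\<^esub> w') = T x w \<otimes>\<^bsub>add_monoid End\<^esub> T x w'"
      unfolding T_def monoid.simps HM_simps
      by (rule restrict_ext) (use w w' in \<open>simp add: \<kappa>[OF x] unit_scalar(1) M.smult_r_distr\<close>)
    qed (simp add: Tc[OF x])
    fix c w assume c: "c \<in> carrier K" and w: "w \<in> carrier (add_monoid M)"
    then have wM: "w \<in> carrier M" by simp
    then show "(sc c) \<odot>\<^bsub>M\<^esub> w \<in> carrier (add_monoid M)" by (simp add: M.smult_closed unit_scalar(1)[OF c])
    have "T x ((sc c) \<odot>\<^bsub>M\<^esub> w) = la End (sc c) (T x w)"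
     unfolding HM_lact[OF M M unit_scalar(1)[OF c] Tc[OF x wM]] unfolding T_def
     by (rule restrict_ext) (use wM c in \<open>simp add: \<kappa>[OF x] unit_scalar(1) scal_central(1)[OF M c _ wM]\<close>)
    then show "\<exists>s'\<in>carrier K. T x ((sc c) \<odot>\<^bsub>M\<^esub> w) = la End (sc s') (T x w)" using c by (rule bexI)
   qed
   moreover have "F0 \<subseteq> {w \<in> carrier (add_monoid M). T x w \<in> L}" using L F0(2) x by auto
   ultimately have "carrier M \<subseteq> {w \<in> carrier (add_monoid M). T x w \<in> L}" by (rule F0(3))
   then show ?thesis using w by auto
  qed
  show "carrier End \<subseteq> L"
  proof
   fix f assume f: "f \<in> carrier End"
   note fM = HM_D(1)[OF f FM]
   let ?s = "finsum End (%x. T x (f x)) F"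
   have Tf: "(%x. T x (f x)) \<in> F \<rightarrow> carrier (add_monoid End)" using Tc fM by auto
   have sM: "(%x. (sc (\<kappa> v x)) \<odot>\<^bsub>M\<^esub> x) \<in> F \<rightarrow> carrier (add_monoid M)" if "v \<in> carrier M" for v
    using \<kappa>(1)[OF _ that] FM by (auto intro!: M.smult_closed unit_scalar(1))
   have fh: "f \<in> hom (add_monoid M) (add_monoid M)" by (rule hom_addI) (simp_all add: HM_D[OF f])
   have "f v = ?s v" if v: "v \<in> carrier M" for v
   proof -
    have "f v = f (finsum M (%x. (sc (\<kappa> v x)) \<odot>\<^bsub>M\<^esub> x) F)" using rep[OF v] by (simp add: lincomb_def fin)
    also have "\<dots> = finsum M (%x. f ((sc (\<kappa> v x)) \<odot>\<^bsub>M\<^esub> x)) F"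
     unfolding finsum_def by (rule hom_finprod[OF M.M.a_comm_group M.M.a_comm_group fh sM[OF v]])
    also have "\<dots> = finsum M (%x. T x (f x) v) F"
    proof (rule M.M.finsum_cong'[OF refl])
     have T: "f ((sc (\<kappa> v x)) \<odot>\<^bsub>M\<^esub> x) = T x (f x) v" if "x \<in> F" for x
      using HM_D(3)[OF f \<kappa>(1)[OF that v] FM[OF that]] v by (simp add: T_def)
     then show "f ((sc (\<kappa> v x)) \<odot>\<^bsub>M\<^esub> x) = T x (f x) v" if "x \<in> F" for x using that .
     show "(%x. T x (f x) v) \<in> F \<rightarrow> carrier M" using HM_D(1)[OF Tc[OF _ fM] v] by blast
    qed
    also have "\<dots> = ?s v"
     unfolding finsum_def by (rule hom_finprod[OF E.M.a_comm_group M.M.a_comm_group ev[OF v] Tf, symmetric])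
    finally show ?thesis .
   qed
   then have "(\<lambda>v\<in>carrier M. f v) = (\<lambda>v\<in>carrier M. ?s v)" by (rule restrict_ext)
   moreover have "?s \<in> carrier End" by (rule E.M.finsum_closed) (use Tf in simp)
   ultimately have "f = ?s" using HM_D(4)[OF f] HM_D(4)[of ?s M M] by argo
   moreover have "?s \<in> L"
    by (rule subgroup_finsum_closed[OF E.M.abelian_group_axioms L'])
     (intro Pi_I TL fM)
   ultimately show "f \<in> L" by simp
  qed
 qed
 then show ?thesis using E by (simp add: fd_bimodule_def)
qed

lemma tensor_functor_map_eq:
 assumes "!!n. x n \<in> carrier (RA.HHA n)"
 shows "tensor_functor_map K A P d \<epsilon> M Q e \<pi> x = (%n. Theta n (PC.Ext_map End action n (x n)))"
proof
 fix n
 obtain f where f: "f \<in> RA.CA n" "x n = RA.EA n f" using RA.HHA_cases[OF assms] by auto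
 have "EM n (onQ n (%y. ev (%p m. f' p \<odot>\<^bsub>M\<^esub> m) (u n y))) = Theta n (PC.Ext_map End action n (x n))"
  if f': "f' \<in> RA.EA n f" and u: "u \<in> CM" for f' u
 proof -
  note c = PC.Ext_class_memD[OF regular_left_module f(1) f']
  note ec = RA.etf_cocycle[OF c(1)]
  have p: "f' p \<odot>\<^bsub>M\<^esub> v = (onP n (%x. action (f' x))) p v" if "p \<in> carrier (P n)" "v \<in> carrier M" for p v
   using lin_closed[OF PC.cocycle_lin[OF c(1)] that(1)] that by (simp add: action_simp regular_simps)
  note b = mtensor_eval[OF PM M M PC.cocycle_lin[OF ec], of "%p m. f' p \<odot>\<^bsub>M\<^esub> m", OF p]
  have "ev (onP n (%x. action (f' x))) t = ev (%p m. f' p \<odot>\<^bsub>M\<^esub> m) t" if "t \<in> carrier (MT n)" for t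
   by (rule ev_unique[OF PC.cocycle_lin[OF ec] b(1) b(2) that])
  then have "(onQ n (%y. ev (%p m. f' p \<odot>\<^bsub>M\<^esub> m) (u n y))) = pull u n (onP n (%x. action (f' x)))"
   by (intro restrict_ext) (simp add: CM_D(2)[OF u])
  then show ?thesis
   by (simp only: Theta_class[OF ec u, symmetric] f(2) c(2)[symmetric] RA.Ext_map_eta[OF c(1)])
 qed
 note * = this
 obtain u where u: "u \<in> CM" by (rule exE[OF CM_exists])
 show "tensor_functor_map K A P d \<epsilon> M Q e \<pi> x n = Theta n (PC.Ext_map End action n (x n))"
  unfolding tensor_functor_map_def f(2)
 proof (intro equalityI subsetI)
  fix y assume "y \<in> (\<Union>f\<in>RA.EA n f. \<Union>u\<in>CM. EM n (onQ n (%y. ev (%p m. f p \<odot>\<^bsub>M\<^esub> m) (u n y))))"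
  then show "y \<in> Theta n (PC.Ext_map End action n (RA.EA n f))" by (elim UN_E) (simp only: * f(2)[symmetric])
 next
  fix y assume y: "y \<in> Theta n (PC.Ext_map End action n (RA.EA n f))"
  show "y \<in> (\<Union>f\<in>RA.EA n f. \<Union>u\<in>CM. EM n (onQ n (%y. ev (%p m. f p \<odot>\<^bsub>M\<^esub> m) (u n y))))"
   by (rule UN_I[OF PC.Ext_class_self[OF regular_left_module f(1)]], rule UN_I[OF u])
    (use y in \<open>simp only: *[OF PC.Ext_class_self[OF regular_left_module f(1)] u] f(2)\<close>)
 qed
qed

lemma module_graded_central_map:
 "graded_central_map ExtM (yoneda A Q e \<pi> M) (EM 0 \<pi>) RA.HHA
  (yoneda Ae P d \<epsilon> (regular_bimodule A)) (RA.EA 0 \<epsilon>) (%n x. Theta n (PC.Ext_map End action n x))"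
 unfolding Theta_one[symmetric]
 by (rule graded_central_map_image[OF RA.unit_graded_central_map])
  (rule QC.Ext_comm_group[OF M] Theta_hom Theta_surj Theta_cup, assumption?)+

lemma module_result:
 defines "E \<equiv> Ext_ring A Q e \<pi> M" and "\<psi> \<equiv> tensor_functor_map K A P d \<epsilon> M Q e \<pi>"
 shows "\<psi> \<in> ring_hom (HH_ring K A P d \<epsilon>) E" "\<psi> ` carrier (HH_ring K A P d \<epsilon>) \<subseteq> graded_center E"
  "condition_fg K A P d \<epsilon> ==> lr_noetherian_ring E \<and> finite_over_graded_center E"
proof -
 interpret C: graded_central_map ExtM "yoneda A Q e \<pi> M" "EM 0 \<pi>" RA.HHA
  "yoneda Ae P d \<epsilon> (regular_bimodule A)" "RA.EA 0 \<epsilon>" "%n x. Theta n (PC.Ext_map End action n x)"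
  by (rule module_graded_central_map)
 have E: "E = graded_ring ExtM (yoneda A Q e \<pi> M) (EM 0 \<pi>)" by (simp add: E_def Ext_ring_def)
 have H: "HH_ring K A P d \<epsilon> = C.HH" by (simp add: HH_ring_def Ext_ring_def)
 have eq: "\<psi> x = C.F x" if "!!n. x n \<in> carrier (RA.HHA n)" for x
  unfolding \<psi>_def by (rule tensor_functor_map_eq[OF that])
 have eqH: "\<psi> x = C.F x" if "x \<in> carrier C.HH" for x
  by (rule eq) (use that in \<open>simp add: C.HH_mem\<close>)
 show "\<psi> ` carrier (HH_ring K A P d \<epsilon>) \<subseteq> graded_center E"
  unfolding E H using C.F_central eqH by auto
 show "\<psi> \<in> ring_hom (HH_ring K A P d \<epsilon>) E"
  unfolding H E
 proof (rule ring_hom_memI)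
  note h = C.F_ring_hom
  fix x y assume x: "x \<in> carrier C.HH" and y: "y \<in> carrier C.HH"
  have xc: "x n \<in> carrier (RA.HHA n)" and yc: "y n \<in> carrier (RA.HHA n)" for n using x y by (simp_all add: C.HH_mem)
  show "\<psi> x \<in> carrier C.E" unfolding eqH[OF x] by (rule ring_hom_closed[OF h x])
  have "(x \<otimes>\<^bsub>C.HH\<^esub> y) n \<in> carrier (RA.HHA n)" for n
   unfolding graded_ring_def ring.simps monoid.simps graded_prod_def
   by (rule comm_monoid.finprod_closed[OF comm_group.axioms(1)[OF C.H]])
    (rule graded_terms[where N = RA.HHA and H = RA.HHA], rule C.q_closed, assumption, assumption, rule xc, rule yc)
  from eq[OF this] show "\<psi> (x \<otimes>\<^bsub>C.HH\<^esub> y) = \<psi> x \<otimes>\<^bsub>C.E\<^esub> \<psi> y"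
   unfolding eqH[OF x] eqH[OF y] using ring_hom_mult[OF h x y] by simp
  have "(x \<oplus>\<^bsub>C.HH\<^esub> y) n \<in> carrier (RA.HHA n)" for n
   using monoid.m_closed[OF group.is_monoid[OF C.H_group] xc yc] by (simp add: graded_ring_def restrict_UNIV)
  from eq[OF this] show "\<psi> (x \<oplus>\<^bsub>C.HH\<^esub> y) = \<psi> x \<oplus>\<^bsub>C.E\<^esub> \<psi> y"
   unfolding eqH[OF x] eqH[OF y] using ring_hom_add[OF h x y] by simp
 next
  have "\<one>\<^bsub>C.HH\<^esub> n \<in> carrier (RA.HHA n)" for n
   using monoid.one_closed[OF group.is_monoid[OF C.H_group]] PC.Ext_class_closed[OF eps_cocycle] by (simp add: graded_ring_def)
  from eq[OF this] show "\<psi> \<one>\<^bsub>C.HH\<^esub> = \<one>\<^bsub>C.E\<^esub>" using ring_hom_one[OF C.F_ring_hom] by simp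
 qed
 assume fg: "condition_fg K A P d \<epsilon>"
 show "lr_noetherian_ring E \<and> finite_over_graded_center E"
  unfolding E
  by (rule C.noetherian_over_center[where \<theta> = Theta,
     OF PC.yoneda_pairing[OF exact End_module] Theta_hom Theta_surj _ RA.HHR_noetherian[OF End_fd fg, unfolded H]])
   (subst RA.cup_Ext_map_eta[symmetric], assumption, assumption, rule Theta_cup[OF _ RA.Ext_map_eta_closed])
qed

end

theorem proposition4p7:
  fixes K :: "'k ring"
    and A :: "('k, 'a) module"
    and M :: "('a, 'm) module"
    and R :: "(('a, 'a) tensor, 'r) module"
    and \<mu> :: "('r, 'r) tensor \<Rightarrow> 'r"
    and \<eta> :: "'a \<Rightarrow> 'r"
    and P :: "nat \<Rightarrow> (('a, 'a) tensor, 'p) module"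
    and d :: "nat \<Rightarrow> 'p \<Rightarrow> 'p"
    and \<epsilon> :: "'p \<Rightarrow> 'a"
    and Q :: "nat \<Rightarrow> ('a, 'q) module"
    and e :: "nat \<Rightarrow> 'q \<Rightarrow> 'q"
    and \<pi> :: "'q \<Rightarrow> 'm"
  assumes "fd_algebra K A"
    and "fd_module K A M"
    and "fd_bimodule K A R"
    and "bimodule_algebra K A R \<mu> \<eta>"
    and "projective_resolution (env K A) P d \<epsilon> (regular_bimodule A)"
    and "projective_resolution A Q e \<pi> M"
  shows
    "(let HH = HH_ring K A P d \<epsilon>;
          E = Ext_ring A Q e \<pi> M;
          \<phi> = tensor_functor_map K A P d \<epsilon> M Q e \<pi>
      in \<phi> \<in> ring_hom HH E \<and> \<phi> ` carrier HH \<subseteq> graded_center E \<and>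
         (condition_fg K A P d \<epsilon> \<longrightarrow> lr_noetherian_ring E \<and> finite_over_graded_center E)) \<and>
     (let HH = HH_ring K A P d \<epsilon>;
          E = HH_algebra K A P d \<epsilon> R \<mu> \<eta>;
          \<phi> = unit_map K A P d R \<eta>
      in \<phi> \<in> ring_hom HH E \<and> \<phi> ` carrier HH \<subseteq> graded_center E \<and>
         (condition_fg K A P d \<epsilon> \<longrightarrow> lr_noetherian_ring E \<and> finite_over_graded_center E))"
proof -
  have res: "bimodule_resolution K A P d \<epsilon>"
    using assms(1,5) by (intro bimodule_resolution.intro bimodule_resolution_axioms.intro)
  interpret M: module_resolution K A P d \<epsilon> M Q e \<pi>
    using assms(2,6) by (intro module_resolution.intro res module_resolution_axioms.intro)
  interpret R: bimodule_algebra_resolution K A P d \<epsilon> R \<mu> \<eta>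
    using assms(4) by (intro bimodule_algebra_resolution.intro res bimodule_algebra_resolution_axioms.intro)
  show ?thesis unfolding Let_def
    by (intro conjI impI M.module_result R.coefficient_algebra_result assms(3))
qed

end
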